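(* Let $(E^2,\kappa^2)$ be a skew higher algebroid of order two, $A=E^1$, $C=\widehat{E^2}$, $\Theta^2:A^{[2]}\to E^2$ the canonical map and $\partial=\widehat{\Theta^2}:A\to C$ the core of $\Theta^2$. (i) There is a canonical isomorphism of graded bundles $$E^2\simeq (A^{[2]}\times_M C_{[2]})/\mathrm{graph}(-\partial),$$ namely the one induced by $(a,c)\mapsto\Theta^2(a)\dotplus c$. (ii) A choice of local frames $(e_i)$ of $\Gamma(A)$ and $(c_\mu)$ of $\Gamma(C)$ gives rise to a graded coordinate system $(x^a,y^i,w^\mu)$ for $E^2$ (considered as the quotient of $A^{[2]}\times_MC_{[2]}$), defined by $w^\mu=c^*_\mu+Q^\mu_i\dot y^i$, where $\partial(e_i)=Q^\mu_ic_\mu$. The composition $A^{[2]}\hookrightarrow A^{[2]}\times_MC_{[2]}\to (A^{[2]}\times_MC_{[2]})/\mathrm{graph}(-\partial)$ coincides with the map $\Theta^2$, which in the coordinates $(x^a,y^i,w^\mu)$ reads $$(\Theta^2)^*(x^a)=x^a,\quad(\Theta^2)^*(y^i)=y^i,\quad(\Theta^2)^*(w^\mu)=Q^\mu_i\dot y^i.$$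
   Context: **Graded bundles.** A graded bundle of order $k$ is a smooth fibre bundle $\sigma^k:E^k\to M$ with an atlas of coordinates $(x^a,y^i_w)$, where $x^a$ (weight $0$) are coordinates on $M$ and each fibre coordinate $y^i_w$ (ranging over $\mathbb R$) has a weight $w\in\{1,\dots,k\}$, such that fibre coordinates of weight $w$ transform by polynomials homogeneous of weight $w$ in the fibre coordinates with coefficients smooth on $M$. The weight vector field is $\Delta=\sum w\,y^i_w\partial_{y^i_w}$; it corresponds to the action $h_t$ ($t\in\mathbb R$) multiplying $y^i_w$ by $t^w$. Morphisms are smooth maps commuting with $h_t$. Removing coordinates of weight $>j$ gives the order-$j$ reduction $E^j$ and a projection $E^k\to E^j$; $\sigma^1:E^1\to M$ is a vector bundle. The core $\widehat{E^k}\subset E^k$ is given by vanishing of all fibre coordinates of weight $<k$; it is a vector bundle over $M$, and $E^k\to E^{k-1}$ is an affine bundle modelled on the pullback of the core, with addition $a\dotplus v$. A morphism $\phi$ of graded bundles restricts to a VB morphism $\widehat\phi$ of cores. For a vector bundle $F$, $F_{[k]}$ denotes $F$ with linear coordinates of weight $k$. **Higher tangent bundles and comorphisms.** $[\gamma]_k\in\mathrm T^kM$ is the $k$-th order tangency class at $0$ of a curve $\gamma$; $\mathrm T^kM$ is a graded bundle of order $k$, $h_s[\gamma]_k=[t\mapsto\gamma(st)]_k$. For a vector bundle $\sigma:E\to M$, $\mathrm T^k\sigma:\mathrm T^kE\to\mathrm T^kM$ is a vector bundle and $\mathrm T^kE$ is a graded bundle over $E$; $\mathrm TE^k$ is a vector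 bundle $\tau_{E^k}$ over $E^k$ and a graded bundle with action $\mathrm Th_t$. A VB comorphism from $\sigma_1:E_1\to M_1$ to $\sigma_2:E_2\to M_2$ covering $\underline r:M_2\to M_1$ is a relation $r\subset E_1\times E_2$ that is the union of graphs of linear maps $r_y:(E_1)_{\underline r(y)}\to(E_2)_y$, $y\in M_2$, depending smoothly on $y$. **Higher algebroids.** A higher algebroid (HA) of order $k$ is a graded bundle $E^k$ of order $k$ with a VB comorphism $\kappa^k\subset\mathrm T^kE^1\times\mathrm TE^k$ from $\mathrm T^k\sigma^1$ to $\tau_{E^k}$ that is a graded subbundle of the product, covering a graded bundle morphism $\sharp^k:E^k\to\mathrm T^kM$ over $\mathrm{id}_M$ (the anchor), whose order-one reduction $\kappa^1\subset\mathrm TE^1\times\mathrm TE^1$ is an algebroid structure on $E^1$ (it is the identity between the cores $\cong E^1$). It is skew if $\kappa^1$ is a symmetric relation (equivalently $\kappa^1$ encodes a skew algebroid on $A=E^1$, with anchor $\sharp=\sharp^1:A\to\mathrm TM$). **Second prolongation.** $A^{[2]}=\{X\in\mathrm TA:\mathrm T\sigma(X)=\sharp(\tau_A(X))\}$, i.e. the set of $1$-velocities $[a]_1$ of curves $a$ in $A$ with $\frac d{dt}(\sigma\circ a)=\sharp\circ a$. It is a graded bundle of order 2 over $M$ with coordinates $(x^a,y^i,\dot y^i)$ of weights $0,1,2$ induced from linear coordinates $(x^a,y^i)$ on $A$ dual to $(e_i)$; its core is identified with $A$ by $v\mapsto[t\mapsto tv]_1$. **The map $\Theta^2$.** For a skew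 HA of order two, $\Theta^2:A^{[2]}\to E^2$ is the graded bundle morphism over $\mathrm{id}_M$, inducing $\mathrm{id}_A$ in order one, such that $\Theta^2([a]_1)=V$ iff $[\sigma\circ a]_1$ is the image of $\sharp^2(V)$ in $\mathrm TM$ and $\kappa^2_V([t\mapsto t\,b(t)]_2)=\Delta(V)$ for any curve $b$ in $A$ with $[b]_1=[a]_1$ and $[\sigma\circ b]_2=\sharp^2(V)$. **Quotient.** The quotient by $\mathrm{graph}(-\partial)\subset A\times_MC$ (a subbundle of the core of $A^{[2]}\times_MC_{[2]}$) is by the relation $(a,c)\sim(a\dotplus b,c-\partial b)$, $b\in A$. $(c^*_\mu)$ is the coframe dual to $(c_\mu)$, regarded as linear coordinates on $C$. *)

theory Defs
  imports "HOL-Analysis.Analysis"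
begin

section \<open>Smooth functions of finitely many real variables\<close>

text \<open>
  A point of the coordinate space with (finite) label set \<open>I\<close> is a function \<open>'i \<Rightarrow> real\<close> vanishing
  off \<open>I\<close>.  Working with label sets instead of index types allows rank \<open>0\<close> and needs no relation
  between the dimensions of the various bundles at the level of types.
\<close>

definition crd :: "'i set \<Rightarrow> ('i \<Rightarrow> real) set" where
  "crd I = {z. \<forall>i. i \<notin> I \<longrightarrow> z i = 0}"

definition restr :: "'i set \<Rightarrow> ('i \<Rightarrow> real) \<Rightarrow> 'i \<Rightarrow> real" where
  "restr J z = (\<lambda>i. if i \<in> J then z i else 0)"

definition open_crd :: "'i set \<Rightarrow> ('i \<Rightarrow> real) set \<Rightarrow> bool" where
  "open_crd I U \<longleftrightarrow> openin (top_of_set (crd I)) U"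

text \<open>Class \<open>C\<^sup>n\<close> on a set \<open>U\<close> that is open in \<open>crd I\<close>: all iterated partial derivatives up to
  order \<open>n\<close> exist and are continuous.\<close>

primrec C_diff :: "nat \<Rightarrow> 'i set \<Rightarrow> ('i \<Rightarrow> real) set \<Rightarrow> (('i \<Rightarrow> real) \<Rightarrow> real) \<Rightarrow> bool" where
  "C_diff 0 I U f \<longleftrightarrow> continuous_on U f"
| "C_diff (Suc n) I U f \<longleftrightarrow> continuous_on U f \<and>
     (\<forall>i\<in>I. (\<forall>x\<in>U. (\<lambda>t. f (x(i := t))) field_differentiable (at (x i))) \<and>
            C_diff n I U (\<lambda>x. deriv (\<lambda>t. f (x(i := t))) (x i)))"

definition smooth_crd :: "'i set \<Rightarrow> ('i \<Rightarrow> real) set \<Rightarrow> (('i \<Rightarrow> real) \<Rightarrow> real) \<Rightarrow> bool" where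
  "smooth_crd I U f \<longleftrightarrow> (\<forall>n. C_diff n I U f)"


section \<open>Manifolds\<close>

text \<open>The atlas need not be maximal.\<close>

record ('p, 'i) mfd =
  pts :: "'p set"
  idx :: "'i set"
  atlas :: "('p set \<times> ('p \<Rightarrow> 'i \<Rightarrow> real)) set"

definition mopen :: "('p, 'i, 'z) mfd_scheme \<Rightarrow> 'p set \<Rightarrow> bool" where
  "mopen N W \<longleftrightarrow> W \<subseteq> pts N \<and> (\<forall>(U, \<phi>)\<in>atlas N. open_crd (idx N) (\<phi> ` (U \<inter> W)))"

definition manifold :: "('p, 'i, 'z) mfd_scheme \<Rightarrow> bool" where
  "manifold N \<longleftrightarrow>
     finite (idx N) \<and>
     (\<Union>(U, \<phi>)\<in>atlas N. U) = pts N \<and>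
     (\<forall>(U, \<phi>)\<in>atlas N. inj_on \<phi> U \<and> open_crd (idx N) (\<phi> ` U)) \<and>
     (\<forall>(U, \<phi>)\<in>atlas N. \<forall>(V, \<psi>)\<in>atlas N.
        open_crd (idx N) (\<phi> ` (U \<inter> V)) \<and>
        (\<forall>i\<in>idx N. smooth_crd (idx N) (\<phi> ` (U \<inter> V)) (\<lambda>z. \<psi> (inv_into U \<phi> z) i))) \<and>
     Hausdorff_space (topology (mopen N)) \<and>
     second_countable (topology (mopen N))"

definition smooth_real_on :: "('p, 'i, 'z) mfd_scheme \<Rightarrow> 'p set \<Rightarrow> ('p \<Rightarrow> real) \<Rightarrow> bool" where
  "smooth_real_on N W f \<longleftrightarrow> mopen N W \<and>
     (\<forall>(U, \<phi>)\<in>atlas N. smooth_crd (idx N) (\<phi> ` (U \<inter> W)) (\<lambda>z. f (inv_into U \<phi> z)))"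

definition smooth_map_on ::
  "('p, 'i, 'z) mfd_scheme \<Rightarrow> 'p set \<Rightarrow> ('q, 'j, 'y) mfd_scheme \<Rightarrow> ('p \<Rightarrow> 'q) \<Rightarrow> bool" where
  "smooth_map_on N W P f \<longleftrightarrow> mopen N W \<and> f ` W \<subseteq> pts P \<and>
     (\<forall>(U, \<phi>)\<in>atlas N. \<forall>(V, \<psi>)\<in>atlas P.
        open_crd (idx N) (\<phi> ` (U \<inter> W \<inter> f -` V)) \<and>
        (\<forall>i\<in>idx P. smooth_crd (idx N) (\<phi> ` (U \<inter> W \<inter> f -` V)) (\<lambda>z. \<psi> (f (inv_into U \<phi> z)) i)))"

abbreviation smooth_map ::
  "('p, 'i, 'z) mfd_scheme \<Rightarrow> ('q, 'j, 'y) mfd_scheme \<Rightarrow> ('p \<Rightarrow> 'q) \<Rightarrow> bool" where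
  "smooth_map N P f \<equiv> smooth_map_on N (pts N) P f"

text \<open>\<open>(U, \<xi>)\<close> is a chart of the maximal atlas of \<open>N\<close>, possibly with a different set \<open>J\<close> of
  coordinate labels.\<close>

definition coord_sys ::
  "('p, 'i, 'z) mfd_scheme \<Rightarrow> 'j set \<Rightarrow> 'p set \<times> ('p \<Rightarrow> 'j \<Rightarrow> real) \<Rightarrow> bool" where
  "coord_sys N J = (\<lambda>(U, \<xi>). mopen N U \<and> inj_on \<xi> U \<and> open_crd J (\<xi> ` U) \<and>
     (\<forall>j\<in>J. smooth_real_on N U (\<lambda>p. \<xi> p j)) \<and>
     (\<forall>(V, \<eta>)\<in>atlas N. open_crd J (\<xi> ` (U \<inter> V)) \<and>
        (\<forall>i\<in>idx N. smooth_crd J (\<xi> ` (U \<inter> V)) (\<lambda>z. \<eta> (inv_into U \<xi> z) i))))"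

definition mprod ::
  "('p, 'i, 'z) mfd_scheme \<Rightarrow> ('q, 'j, 'y) mfd_scheme \<Rightarrow> ('p \<times> 'q, 'i + 'j) mfd" where
  "mprod N P = \<lparr>
     pts = pts N \<times> pts P,
     idx = idx N <+> idx P,
     atlas = {(U \<times> V, \<lambda>(p, q). case_sum (\<phi> p) (\<psi> q)) |U \<phi> V \<psi>. (U, \<phi>) \<in> atlas N \<and> (V, \<psi>) \<in> atlas P}\<rparr>"


section \<open>Graded bundles\<close>

text \<open>The coordinates of weight \<open>0\<close> are those of the base; \<open>wt\<close> is the weight of a coordinate label.\<close>

record ('e, 'i, 'm) gbundle = "('e, 'i) mfd" +
  bproj :: "'e \<Rightarrow> 'm"
  wt :: "'i \<Rightarrow> nat"

text \<open>Exponents of the monomials of weight \<open>w\<close> in the fibre coordinates.\<close>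

definition monomials :: "'i set \<Rightarrow> ('i \<Rightarrow> nat) \<Rightarrow> nat \<Rightarrow> ('i \<Rightarrow> nat) set" where
  "monomials I w d = {\<alpha>. (\<forall>i. i \<notin> I \<or> w i = 0 \<longrightarrow> \<alpha> i = 0) \<and> (\<Sum>i\<in>I. \<alpha> i * w i) = d}"

text \<open>A chart \<open>(D, \<phi>)\<close> over the base chart \<open>(U, \<xi>)\<close>; the fibre coordinates range over all reals.\<close>

definition adapted_chart ::
  "('m, 'b, 'z) mfd_scheme \<Rightarrow> ('e, 'i, 'm) gbundle \<Rightarrow> 'e set \<times> ('e \<Rightarrow> 'i \<Rightarrow> real) \<Rightarrow> bool" where
  "adapted_chart M E = (\<lambda>(D, \<phi>). \<exists>U \<xi>.
     coord_sys M {i\<in>idx E. wt E i = 0} (U, \<xi>) \<and>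
     D = {e\<in>pts E. bproj E e \<in> U} \<and>
     inj_on \<phi> D \<and>
     (\<forall>e\<in>D. restr {i\<in>idx E. wt E i = 0} (\<phi> e) = \<xi> (bproj E e)) \<and>
     \<phi> ` D = {z\<in>crd (idx E). restr {i\<in>idx E. wt E i = 0} z \<in> \<xi> ` U})"

definition polynomial_transition ::
  "('m, 'b, 'z) mfd_scheme \<Rightarrow> ('e, 'i, 'm) gbundle \<Rightarrow>
     'e set \<times> ('e \<Rightarrow> 'i \<Rightarrow> real) \<Rightarrow> 'e set \<times> ('e \<Rightarrow> 'i \<Rightarrow> real) \<Rightarrow> bool" where
  "polynomial_transition M E = (\<lambda>(D, \<phi>) (D', \<psi>).
     \<forall>i\<in>idx E. wt E i > 0 \<longrightarrow> (\<exists>c.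
       (\<forall>\<alpha>\<in>monomials (idx E) (wt E) (wt E i). smooth_real_on M (bproj E ` (D \<inter> D')) (c \<alpha>)) \<and>
       (\<forall>e\<in>D \<inter> D'. \<psi> e i =
          (\<Sum>\<alpha>\<in>monomials (idx E) (wt E) (wt E i). c \<alpha> (bproj E e) * (\<Prod>j\<in>idx E. \<phi> e j ^ \<alpha> j)))))"

definition graded_bundle :: "nat \<Rightarrow> ('m, 'b, 'z) mfd_scheme \<Rightarrow> ('e, 'i, 'm) gbundle \<Rightarrow> bool" where
  "graded_bundle k M E \<longleftrightarrow> manifold M \<and> manifold E \<and>
     bproj E ` pts E = pts M \<and>
     (\<forall>i\<in>idx E. wt E i \<le> k) \<and>
     (\<forall>c\<in>atlas E. adapted_chart M E c) \<and>
     (\<forall>c\<in>atlas E. \<forall>c'\<in>atlas E. polynomial_transition M E c c')"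

text \<open>Graded coordinate systems: the charts of the maximal graded atlas.\<close>

definition graded_coords ::
  "('m, 'b, 'z) mfd_scheme \<Rightarrow> ('e, 'i, 'm) gbundle \<Rightarrow> 'e set \<times> ('e \<Rightarrow> 'i \<Rightarrow> real) \<Rightarrow> bool" where
  "graded_coords M E c \<longleftrightarrow> adapted_chart M E c \<and>
     (\<forall>c'\<in>atlas E. polynomial_transition M E c c' \<and> polynomial_transition M E c' c)"

text \<open>The action \<open>h\<^sub>t\<close>.  For a vector bundle (weights \<open>0\<close>, \<open>1\<close>) it is scalar multiplication.\<close>

definition hact :: "('e, 'i, 'm) gbundle \<Rightarrow> real \<Rightarrow> 'e \<Rightarrow> 'e" where
  "hact E t e = (THE e'. e' \<in> pts E \<and>
     (\<forall>(D, \<phi>)\<in>atlas E. e \<in> D \<longrightarrow> e' \<in> D \<and> (\<forall>i\<in>idx E. \<phi> e' i = t ^ wt E i * \<phi> e i)))"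

definition gb_morphism :: "('e, 'i, 'm) gbundle \<Rightarrow> ('f, 'j, 'n) gbundle \<Rightarrow> ('e \<Rightarrow> 'f) \<Rightarrow> bool" where
  "gb_morphism E F f \<longleftrightarrow> smooth_map E F f \<and> (\<forall>t. \<forall>e\<in>pts E. f (hact E t e) = hact F t (f e))"

definition over_id :: "('e, 'i, 'm) gbundle \<Rightarrow> ('f, 'j, 'm) gbundle \<Rightarrow> ('e \<Rightarrow> 'f) \<Rightarrow> bool" where
  "over_id E F f \<longleftrightarrow> (\<forall>e\<in>pts E. bproj F (f e) = bproj E e)"

definition gb_isomorphism :: "('e, 'i, 'm) gbundle \<Rightarrow> ('f, 'j, 'n) gbundle \<Rightarrow> ('e \<Rightarrow> 'f) \<Rightarrow> bool" where
  "gb_isomorphism E F f \<longleftrightarrow> bij_betw f (pts E) (pts F) \<and>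
     gb_morphism E F f \<and> gb_morphism F E (inv_into (pts E) f)"

text \<open>The projection to the reduction \<open>E\<^sup>j\<close>; its points are the fibres of \<open>E\<^sup>k \<rightarrow> E\<^sup>j\<close>.\<close>

definition red :: "nat \<Rightarrow> ('e, 'i, 'm) gbundle \<Rightarrow> 'e \<Rightarrow> 'e set" where
  "red j E e = {e'. \<exists>(D, \<phi>)\<in>atlas E. e \<in> D \<and> e' \<in> D \<and> (\<forall>i\<in>idx E. wt E i \<le> j \<longrightarrow> \<phi> e' i = \<phi> e i)}"

definition reduct :: "nat \<Rightarrow> ('e, 'i, 'm) gbundle \<Rightarrow> ('e set, 'i, 'm) gbundle" where
  "reduct j E = \<lparr>
     pts = red j E ` pts E,
     idx = {i\<in>idx E. wt E i \<le> j},
     atlas = {(red j E ` D, \<lambda>a. restr {i\<in>idx E. wt E i \<le> j} (\<phi> (SOME e. e \<in> a))) |D \<phi>. (D, \<phi>) \<in> atlas E},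
     bproj = (\<lambda>a. bproj E (SOME e. e \<in> a)),
     wt = wt E\<rparr>"

text \<open>The core as a vector bundle, hence with linear coordinates of weight \<open>1\<close>.\<close>

definition core :: "nat \<Rightarrow> ('e, 'i, 'm) gbundle \<Rightarrow> ('e, 'i, 'm) gbundle" where
  "core k E = (
     let P = {e\<in>pts E. \<forall>(D, \<phi>)\<in>atlas E. e \<in> D \<longrightarrow> (\<forall>i\<in>idx E. 0 < wt E i \<and> wt E i < k \<longrightarrow> \<phi> e i = 0)};
         J = {i\<in>idx E. wt E i = 0 \<or> wt E i = k}
     in \<lparr>
       pts = P,
       idx = J,
       atlas = {(D \<inter> P, \<lambda>e. restr J (\<phi> e)) |D \<phi>. (D, \<phi>) \<in> atlas E},
       bproj = bproj E,
       wt = (\<lambda>i. if wt E i = 0 then 0 else 1)\<rparr>)"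

text \<open>\<open>F\<^bsub>[k]\<^esub>\<close> for a vector bundle \<open>F\<close>.\<close>

definition reweight :: "nat \<Rightarrow> ('f, 'i, 'm) gbundle \<Rightarrow> ('f, 'i, 'm) gbundle" where
  "reweight k F = F\<lparr>wt := \<lambda>i. k * wt F i\<rparr>"

text \<open>\<open>V \<dotplus> v\<close> for \<open>v\<close> in the core of the order \<open>k\<close> bundle \<open>E\<close>, over the same base point.
  For \<open>k = 1\<close> this is the addition of the vector bundle \<open>E\<close>.\<close>

definition dotplus :: "nat \<Rightarrow> ('e, 'i, 'm) gbundle \<Rightarrow> 'e \<Rightarrow> 'e \<Rightarrow> 'e" where
  "dotplus k E V v = (THE V'. V' \<in> pts E \<and>
     (\<forall>(D, \<phi>)\<in>atlas E. V \<in> D \<longrightarrow> V' \<in> D \<and>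
        (\<forall>i\<in>idx E. \<phi> V' i = \<phi> V i + (if wt E i = k then \<phi> v i else 0))))"

definition zero_vec :: "('f, 'i, 'm) gbundle \<Rightarrow> 'm \<Rightarrow> 'f" where
  "zero_vec F p = (THE v. v \<in> pts F \<and> bproj F v = p \<and> hact F 0 v = v)"

definition gprod ::
  "('e, 'i, 'm) gbundle \<Rightarrow> ('f, 'j, 'n) gbundle \<Rightarrow> ('e \<times> 'f, 'i + 'j, 'm \<times> 'n) gbundle" where
  "gprod E F = \<lparr>
     pts = pts (mprod E F),
     idx = idx (mprod E F),
     atlas = atlas (mprod E F),
     bproj = map_prod (bproj E) (bproj F),
     wt = case_sum (wt E) (wt F)\<rparr>"

text \<open>The fibre product over the common base; the base coordinates are taken from \<open>E\<close>.\<close>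

definition fibre_prod ::
  "('e, 'i, 'm) gbundle \<Rightarrow> ('f, 'j, 'm) gbundle \<Rightarrow> ('e \<times> 'f, 'i + 'j, 'm) gbundle" where
  "fibre_prod E F = (
     let P = {(e, f). e \<in> pts E \<and> f \<in> pts F \<and> bproj E e = bproj F f};
         J = idx E <+> {j\<in>idx F. wt F j > 0}
     in \<lparr>
       pts = P,
       idx = J,
       atlas = {((D \<times> D') \<inter> P, \<lambda>(e, f). restr J (case_sum (\<phi> e) (\<psi> f))) |D \<phi> D' \<psi>.
                  (D, \<phi>) \<in> atlas E \<and> (D', \<psi>) \<in> atlas F},
       bproj = (\<lambda>(e, f). bproj E e),
       wt = case_sum (wt E) (wt F)\<rparr>)"

text \<open>A subset given, near each of its points, by the vanishing of some coordinates of a graded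
  coordinate system.\<close>

definition graded_subbundle :: "('m, 'b, 'z) mfd_scheme \<Rightarrow> ('e, 'i, 'm) gbundle \<Rightarrow> 'e set \<Rightarrow> bool" where
  "graded_subbundle M E S \<longleftrightarrow> S \<subseteq> pts E \<and>
     (\<exists>J\<subseteq>idx E. \<forall>e\<in>S. \<exists>D \<phi>. graded_coords M E (D, \<phi>) \<and> e \<in> D \<and>
        S \<inter> D = {e'\<in>D. \<forall>j\<in>J. \<phi> e' j = 0})"


section \<open>Vector bundles: frames and comorphisms\<close>

text \<open>The linear combination \<open>\<Sum>j\<in>J. a j \<cdot> u j\<close> in the fibre over \<open>p\<close> of a vector bundle \<open>F\<close>.\<close>

definition lincomb :: "('f, 'i, 'm) gbundle \<Rightarrow> 'm \<Rightarrow> 'j set \<Rightarrow> ('j \<Rightarrow> real) \<Rightarrow> ('j \<Rightarrow> 'f) \<Rightarrow> 'f" where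
  "lincomb F p J a u = (THE v. v \<in> pts F \<and> bproj F v = p \<and>
     (\<forall>(D, \<phi>)\<in>atlas F. v \<in> D \<longrightarrow>
        (\<forall>i\<in>idx F. wt F i = 1 \<longrightarrow> \<phi> v i = (\<Sum>j\<in>J. a j * \<phi> (u j) i))))"

definition local_frame ::
  "('m, 'b, 'z) mfd_scheme \<Rightarrow> ('f, 'i, 'm) gbundle \<Rightarrow> 'j set \<Rightarrow> 'm set \<Rightarrow> ('j \<Rightarrow> 'm \<Rightarrow> 'f) \<Rightarrow> bool" where
  "local_frame M F J U s \<longleftrightarrow> mopen M U \<and> finite J \<and>
     (\<forall>j\<in>J. smooth_map_on M U F (s j) \<and> (\<forall>p\<in>U. bproj F (s j p) = p)) \<and>
     (\<forall>v\<in>pts F. bproj F v \<in> U \<longrightarrow>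
        (\<exists>!a. a \<in> crd J \<and> v = lincomb F (bproj F v) J a (\<lambda>j. s j (bproj F v))))"

definition coframe :: "('f, 'i, 'm) gbundle \<Rightarrow> 'j set \<Rightarrow> ('j \<Rightarrow> 'm \<Rightarrow> 'f) \<Rightarrow> 'f \<Rightarrow> 'j \<Rightarrow> real" where
  "coframe F J s v = (THE a. a \<in> crd J \<and> v = lincomb F (bproj F v) J a (\<lambda>j. s j (bproj F v)))"

text \<open>A comorphism \<open>r\<close> from \<open>E1 \<rightarrow> M1\<close> to \<open>E2 \<rightarrow> M2\<close> covering \<open>rb : M2 \<rightarrow> M1\<close>: over each point
  \<open>y\<close> of \<open>M2\<close> the relation is the graph of a map on the whole fibre of \<open>E1\<close> over \<open>rb y\<close>, which in
  linear coordinates is given by a matrix depending smoothly on \<open>y\<close>.\<close>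

definition vb_comorphism ::
  "('m, 'b, 'z) mfd_scheme \<Rightarrow> ('e, 'i, 'm) gbundle \<Rightarrow> ('n, 'c, 'y) mfd_scheme \<Rightarrow> ('f, 'j, 'n) gbundle \<Rightarrow>
     ('n \<Rightarrow> 'm) \<Rightarrow> ('e \<times> 'f) set \<Rightarrow> bool" where
  "vb_comorphism M1 E1 M2 E2 rb r \<longleftrightarrow>
     smooth_map M2 M1 rb \<and>
     r \<subseteq> pts E1 \<times> pts E2 \<and>
     (\<forall>(u, v)\<in>r. bproj E1 u = rb (bproj E2 v)) \<and>
     (\<forall>y\<in>pts M2. \<forall>u\<in>pts E1. bproj E1 u = rb y \<longrightarrow> (\<exists>!v. (u, v) \<in> r \<and> bproj E2 v = y)) \<and>
     (\<forall>(D, \<phi>)\<in>atlas E1. \<forall>(D', \<psi>)\<in>atlas E2. \<exists>A.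
        (\<forall>i j. smooth_real_on M2 {y\<in>bproj E2 ` D'. rb y \<in> bproj E1 ` D} (A i j)) \<and>
        (\<forall>(u, v)\<in>r. u \<in> D \<longrightarrow> v \<in> D' \<longrightarrow>
           (\<forall>i\<in>{i\<in>idx E2. wt E2 i = 1}.
              \<psi> v i = (\<Sum>j\<in>{j\<in>idx E1. wt E1 j = 1}. A i j (bproj E2 v) * \<phi> u j))))"


section \<open>Higher tangent bundles\<close>

text \<open>Curves are considered near \<open>0\<close> only; their values away from \<open>0\<close> are arbitrary.\<close>

definition curve :: "('p, 'i, 'z) mfd_scheme \<Rightarrow> (real \<Rightarrow> 'p) \<Rightarrow> bool" where
  "curve N \<gamma> \<longleftrightarrow> \<gamma> 0 \<in> pts N \<and>
     (\<forall>(U, \<phi>)\<in>atlas N. \<gamma> 0 \<in> U \<longrightarrow>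
        (\<exists>\<epsilon>>0. \<forall>t\<in>{-\<epsilon><..<\<epsilon>}. \<gamma> t \<in> U \<and>
           (\<forall>i\<in>idx N. \<forall>n. (deriv ^^ n) (\<lambda>s. \<phi> (\<gamma> s) i) field_differentiable (at t))))"

text \<open>The tangency class \<open>[\<gamma>]\<^sub>k\<close>, and the map \<open>T\<^sup>kf\<close> for a smooth map \<open>f\<close> into \<open>N\<close>;
  \<open>Tmap j N id\<close> is the projection \<open>T\<^sup>kN \<rightarrow> T\<^sup>jN\<close>.\<close>

definition jet :: "nat \<Rightarrow> ('p, 'i, 'z) mfd_scheme \<Rightarrow> (real \<Rightarrow> 'p) \<Rightarrow> (real \<Rightarrow> 'p) set" where
  "jet k N \<gamma> = {\<delta>. curve N \<delta> \<and> \<delta> 0 = \<gamma> 0 \<and>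
     (\<forall>(U, \<phi>)\<in>atlas N. \<gamma> 0 \<in> U \<longrightarrow>
        (\<forall>i\<in>idx N. \<forall>j\<le>k. (deriv ^^ j) (\<lambda>t. \<phi> (\<delta> t) i) 0 = (deriv ^^ j) (\<lambda>t. \<phi> (\<gamma> t) i) 0))}"

definition repr :: "(real \<Rightarrow> 'p) set \<Rightarrow> real \<Rightarrow> 'p" where
  "repr X = (SOME \<gamma>. \<gamma> \<in> X)"

definition base_pt :: "(real \<Rightarrow> 'p) set \<Rightarrow> 'p" where
  "base_pt X = repr X 0"

definition Tmap :: "nat \<Rightarrow> ('q, 'j, 'y) mfd_scheme \<Rightarrow> ('p \<Rightarrow> 'q) \<Rightarrow> (real \<Rightarrow> 'p) set \<Rightarrow> (real \<Rightarrow> 'q) set" where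
  "Tmap k N f X = jet k N (\<lambda>t. f (repr X t))"

text \<open>\<open>T\<^sup>kN\<close> as a graded bundle over \<open>N\<close>; the label \<open>(i, j)\<close> stands for the \<open>j\<close>-th derivative of
  the \<open>i\<close>-th coordinate.  For \<open>k = 1\<close> this is the vector bundle \<open>TN \<rightarrow> N\<close>.\<close>

definition Tan :: "nat \<Rightarrow> ('p, 'i, 'z) mfd_scheme \<Rightarrow> ((real \<Rightarrow> 'p) set, 'i \<times> nat, 'p) gbundle" where
  "Tan k N = \<lparr>
     pts = jet k N ` {\<gamma>. curve N \<gamma>},
     idx = idx N \<times> {..k},
     atlas = {({X \<in> jet k N ` {\<gamma>. curve N \<gamma>}. base_pt X \<in> U},
               \<lambda>X. restr (idx N \<times> {..k}) (\<lambda>(i, j). (deriv ^^ j) (\<lambda>t. \<phi> (repr X t) i) 0)) |U \<phi>.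
              (U, \<phi>) \<in> atlas N},
     bproj = base_pt,
     wt = snd\<rparr>"

text \<open>The other fibration \<open>T\<^sup>k\<sigma> : T\<^sup>kE \<rightarrow> T\<^sup>kM\<close>, whose action is \<open>T\<^sup>kh\<^sub>t\<close>: for a vector bundle \<open>E\<close> it
  is a vector bundle, and for \<open>k = 1\<close> it is \<open>TE\<close> as a graded bundle over \<open>TM\<close>.\<close>

definition Tan_lift ::
  "nat \<Rightarrow> ('m, 'b, 'z) mfd_scheme \<Rightarrow> ('e, 'i, 'm) gbundle \<Rightarrow>
     ((real \<Rightarrow> 'e) set, 'i \<times> nat, (real \<Rightarrow> 'm) set) gbundle" where
  "Tan_lift k M E = \<lparr>
     pts = pts (Tan k E),
     idx = idx (Tan k E),
     atlas = atlas (Tan k E),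
     bproj = Tmap k M (bproj E),
     wt = wt E \<circ> fst\<rparr>"

text \<open>The vertical vector \<open>[t \<mapsto> t v]\<^sub>1\<close>, which identifies a vector bundle \<open>A\<close> with the core of
  \<open>TA\<close> and with the core of its second prolongation.\<close>

definition vlift :: "('a, 'i, 'm) gbundle \<Rightarrow> 'a \<Rightarrow> (real \<Rightarrow> 'a) set" where
  "vlift A v = jet 1 A (\<lambda>t. hact A t v)"

text \<open>The weight vector field \<open>\<Delta>\<close>, whose flow is \<open>s \<mapsto> h\<^bsub>exp s\<^esub>\<close>.\<close>

definition weight_vf :: "('e, 'i, 'm) gbundle \<Rightarrow> 'e \<Rightarrow> (real \<Rightarrow> 'e) set" where
  "weight_vf E V = jet 1 E (\<lambda>s. hact E (exp s) V)"


section \<open>Higher algebroids\<close>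

text \<open>The part of the definition common to all orders, with \<open>A\<close> in the role of \<open>E\<^sup>1\<close>.  The grading
  of \<open>T\<^sup>kA \<times> TE\<close> is that of \<open>T\<^sup>kA \<rightarrow> A\<close> and of \<open>TE \<rightarrow> TM\<close>.\<close>

definition graded_comorphism ::
  "nat \<Rightarrow> ('m, 'b, 'z) mfd_scheme \<Rightarrow> ('a, 'i, 'm) gbundle \<Rightarrow> ('e, 'j, 'm) gbundle \<Rightarrow>
     ((real \<Rightarrow> 'a) set \<times> (real \<Rightarrow> 'e) set) set \<Rightarrow> ('e \<Rightarrow> (real \<Rightarrow> 'm) set) \<Rightarrow> bool" where
  "graded_comorphism k M A E \<kappa> sharp \<longleftrightarrow>
     gb_morphism E (Tan k M) sharp \<and> over_id E (Tan k M) sharp \<and>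
     vb_comorphism (Tan k M) (Tan_lift k M A) E (Tan 1 E) sharp \<kappa> \<and>
     graded_subbundle (mprod A (Tan 1 M)) (gprod (Tan k A) (Tan_lift 1 M E)) \<kappa>"

text \<open>A (general) algebroid structure on a vector bundle: \<open>\<kappa>\<close> induces the identity on the cores.\<close>

definition algebroid ::
  "('m, 'b, 'z) mfd_scheme \<Rightarrow> ('a, 'i, 'm) gbundle \<Rightarrow>
     ((real \<Rightarrow> 'a) set \<times> (real \<Rightarrow> 'a) set) set \<Rightarrow> ('a \<Rightarrow> (real \<Rightarrow> 'm) set) \<Rightarrow> bool" where
  "algebroid M A \<kappa> sharp \<longleftrightarrow> graded_bundle 1 M A \<and> graded_comorphism 1 M A A \<kappa> sharp \<and>
     (\<forall>a\<in>pts A. \<forall>b\<in>pts A. (vlift A a, vlift A b) \<in> \<kappa> \<longleftrightarrow> a = b)"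

definition reduced_kappa ::
  "('e, 'i, 'm) gbundle \<Rightarrow> ((real \<Rightarrow> 'e set) set \<times> (real \<Rightarrow> 'e) set) set \<Rightarrow>
     ((real \<Rightarrow> 'e set) set \<times> (real \<Rightarrow> 'e set) set) set" where
  "reduced_kappa E \<kappa> =
     (\<lambda>(u, v). (Tmap 1 (reduct 1 E) id u, Tmap 1 (reduct 1 E) (red 1 E) v)) ` \<kappa>"

definition reduced_anchor ::
  "('m, 'b, 'z) mfd_scheme \<Rightarrow> ('e \<Rightarrow> (real \<Rightarrow> 'm) set) \<Rightarrow> 'e set \<Rightarrow> (real \<Rightarrow> 'm) set" where
  "reduced_anchor M sharp a = Tmap 1 M id (sharp (SOME V. V \<in> a))"

definition higher_algebroid ::
  "nat \<Rightarrow> ('m, 'b, 'z) mfd_scheme \<Rightarrow> ('e, 'i, 'm) gbundle \<Rightarrow>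
     ((real \<Rightarrow> 'e set) set \<times> (real \<Rightarrow> 'e) set) set \<Rightarrow> ('e \<Rightarrow> (real \<Rightarrow> 'm) set) \<Rightarrow> bool" where
  "higher_algebroid k M E \<kappa> sharp \<longleftrightarrow> 1 \<le> k \<and> graded_bundle k M E \<and>
     graded_comorphism k M (reduct 1 E) E \<kappa> sharp \<and>
     algebroid M (reduct 1 E) (reduced_kappa E \<kappa>) (reduced_anchor M sharp)"

definition skew_higher_algebroid ::
  "nat \<Rightarrow> ('m, 'b, 'z) mfd_scheme \<Rightarrow> ('e, 'i, 'm) gbundle \<Rightarrow>
     ((real \<Rightarrow> 'e set) set \<times> (real \<Rightarrow> 'e) set) set \<Rightarrow> ('e \<Rightarrow> (real \<Rightarrow> 'm) set) \<Rightarrow> bool" where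
  "skew_higher_algebroid k M E \<kappa> sharp \<longleftrightarrow>
     higher_algebroid k M E \<kappa> sharp \<and> sym (reduced_kappa E \<kappa>)"


section \<open>The second prolongation, the canonical map and the quotient\<close>

text \<open>\<open>A\<^bsup>[2]\<^esup>\<close>; the coordinates \<open>(a, 1)\<close> of \<open>TA\<close> with \<open>wt A a = 0\<close> are dropped, being determined
  by the others.\<close>

definition second_prolongation ::
  "('m, 'b, 'z) mfd_scheme \<Rightarrow> ('a, 'i, 'm) gbundle \<Rightarrow> ('a \<Rightarrow> (real \<Rightarrow> 'm) set) \<Rightarrow>
     ((real \<Rightarrow> 'a) set, 'i \<times> nat, 'm) gbundle" where
  "second_prolongation M A sharp = (
     let P = {X\<in>pts (Tan 1 A). Tmap 1 M (bproj A) X = sharp (base_pt X)};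
         J = {(i, j). i \<in> idx A \<and> (j = 0 \<or> j = 1 \<and> wt A i = 1)}
     in \<lparr>
       pts = P,
       idx = J,
       atlas = {(D \<inter> P, \<lambda>X. restr J (\<phi> X)) |D \<phi>. (D, \<phi>) \<in> atlas (Tan 1 A)},
       bproj = bproj A \<circ> base_pt,
       wt = (\<lambda>(i, j). wt A i + j)\<rparr>)"

text \<open>\<open>\<Theta>\<close> is the canonical map \<open>\<Theta>\<^sup>2\<close> of the skew higher algebroid \<open>(E, \<kappa>)\<close> of order two.\<close>

definition canonical_Theta ::
  "('m, 'b, 'z) mfd_scheme \<Rightarrow> ('e, 'i, 'm) gbundle \<Rightarrow>
     ((real \<Rightarrow> 'e set) set \<times> (real \<Rightarrow> 'e) set) set \<Rightarrow> ('e \<Rightarrow> (real \<Rightarrow> 'm) set) \<Rightarrow>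
     ((real \<Rightarrow> 'e set) set \<Rightarrow> 'e) \<Rightarrow> bool" where
  "canonical_Theta M E \<kappa> sharp \<Theta> \<longleftrightarrow> (
     let A = reduct 1 E;
         A2 = second_prolongation M A (reduced_anchor M sharp)
     in gb_morphism A2 E \<Theta> \<and> over_id A2 E \<Theta> \<and>
        (\<forall>X\<in>pts A2. red 1 E (\<Theta> X) = base_pt X) \<and>
        (\<forall>X\<in>pts A2. \<forall>V\<in>pts E. \<Theta> X = V \<longleftrightarrow>
           Tmap 1 M (bproj A) X = Tmap 1 M id (sharp V) \<and>
           (\<forall>b. curve A b \<longrightarrow> jet 1 A b = X \<longrightarrow> jet 2 M (\<lambda>t. bproj A (b t)) = sharp V \<longrightarrow>
              (jet 2 A (\<lambda>t. hact A t (b t)), weight_vf E V) \<in> \<kappa>)))"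

text \<open>The relation \<open>(a, c) \<sim> (a \<dotplus> b, c - bd b)\<close> on \<open>A\<^bsup>[2]\<^esup> \<times>\<^sub>M C\<close>, for \<open>bd : A \<rightarrow> C\<close>.\<close>

definition graph_rel ::
  "('a, 'i, 'm) gbundle \<Rightarrow> ((real \<Rightarrow> 'a) set, 'i \<times> nat, 'm) gbundle \<Rightarrow> ('c, 'j, 'm) gbundle \<Rightarrow>
     ('a \<Rightarrow> 'c) \<Rightarrow> (((real \<Rightarrow> 'a) set \<times> 'c) \<times> ((real \<Rightarrow> 'a) set \<times> 'c)) set" where
  "graph_rel A A2 C bd =
     {((X, c), (dotplus 2 A2 X (vlift A b), dotplus 1 C c (hact C (-1) (bd b)))) |X c b.
        X \<in> pts A2 \<and> c \<in> pts C \<and> b \<in> pts A \<and> bproj A2 X = bproj C c \<and> bproj A b = bproj C c}"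

text \<open>The quotient of a graded bundle \<open>F\<close> by a fibre-preserving equivalence relation \<open>R\<close>.  The
  coordinate systems of the quotient are obtained from those graded coordinate systems of \<open>F\<close> in
  which \<open>R\<close> is the equality of a part of the coordinates, namely those with labels \<open>lab ` J\<close>;
  the function \<open>lab\<close> serves to label them by \<open>J\<close>.\<close>

definition quotient_bundle ::
  "('m, 'b, 'z) mfd_scheme \<Rightarrow> ('f, 'k, 'm) gbundle \<Rightarrow> ('f \<times> 'f) set \<Rightarrow> 'i set \<Rightarrow> ('i \<Rightarrow> 'k) \<Rightarrow>
     ('f set, 'i, 'm) gbundle" where
  "quotient_bundle M F R J lab = \<lparr>
     pts = pts F // R,
     idx = J,
     atlas = {((\<lambda>f. R `` {f}) ` D, \<lambda>X. restr J (\<lambda>j. \<phi> (SOME f. f \<in> X) (lab j))) |D \<phi>.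
                graded_coords M F (D, \<phi>) \<and>
                (\<forall>f\<in>D. \<forall>f'\<in>D. (f, f') \<in> R \<longleftrightarrow> (\<forall>j\<in>J. \<phi> f (lab j) = \<phi> f' (lab j)))},
     bproj = (\<lambda>X. bproj F (SOME f. f \<in> X)),
     wt = wt F \<circ> lab\<rparr>"

text \<open>The coordinates of \<open>A\<^bsup>[2]\<^esup>\<close> of weight \<open>2\<close> induced by the linear coordinates dual to \<open>s\<close>.\<close>

definition coframe_dot ::
  "('a, 'i, 'm) gbundle \<Rightarrow> 'j set \<Rightarrow> ('j \<Rightarrow> 'm \<Rightarrow> 'a) \<Rightarrow> (real \<Rightarrow> 'a) set \<Rightarrow> 'j \<Rightarrow> real" where
  "coframe_dot A J s X i = deriv (\<lambda>t. coframe A J s (repr X t) i) 0"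

end

theory Submission
 imports Defs
begin

text \<open>Let \<open>A = E\<^sup>1\<close> and let \<open>\<partial>\<close> be the core of the canonical map \<open>\<Theta>\<close>; write \<open>\<oplus>\<close> for the action of the core of
  a graded bundle.  The proof rests on two facts, that the anchor and \<open>\<Theta>\<close> are morphisms of graded
  bundles over the identity and that \<open>\<Theta>\<close> induces the identity in order one, and on one principle: a
  smooth function that is homogeneous of degree \<open>d\<close> under the action of \<open>\<real>\<close> on a graded bundle is a
  polynomial in the fibre coordinates (\<open>homog_polynomial\<close>), and along the coordinates of weight \<open>d\<close> it is
  affine with coefficients depending on the base point only (\<open>homog_add_top\<close>, \<open>gfun_top_linear\<close>).

  Applied to the coordinates of weight two composed with \<open>\<Theta>\<close> this gives \<open>\<Theta> (X \<oplus> b) = \<Theta> X \<oplus> \<partial> b\<close> for \<open>b\<close> in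
  the core \<open>A\<close> of \<open>A\<^bsup>[2]\<^esup>\<close> (\<open>\<Theta>_additive\<close>).  So the map \<open>(X, v) \<mapsto> \<Theta> X \<oplus> v\<close> is constant on the classes of the
  relation.  It separates them: if \<open>\<Theta> X \<oplus> v = \<Theta> X' \<oplus> v'\<close>, then \<open>X\<close> and \<open>X'\<close> lie over the same element of
  \<open>A\<close>, so \<open>X' = X \<oplus> b\<close> for some \<open>b\<close>, and cancelling leaves \<open>v' = v - \<partial> b\<close>.  It is surjective because every
  element of \<open>A\<close> is the base point of some \<open>X\<close>, and the core acts transitively on the fibres of
  \<open>E \<rightarrow> A\<close>.

  To see that the bijection is an isomorphism of graded bundles, a chart of \<open>E\<close> is pulled back to the
  product: the coordinates of \<open>X\<close> are kept, and the coordinates \<open>v\<^sup>\<mu>\<close> of \<open>v\<close> are replaced by \<open>v\<^sup>\<mu> + S\<^sup>\<mu> X\<close>, where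
  \<open>S\<^sup>\<mu> X\<close> are the coordinates of weight two of \<open>\<Theta> X\<close>.  Such a sheared product chart is again a graded
  chart (\<open>shear_gcoords\<close>), and in it the relation says that all coordinates except the velocities in
  \<open>X\<close> agree (\<open>RR_shear\<close>).  It therefore induces a chart of the quotient, which is the pull-back of the
  given chart of \<open>E\<close>.  Since the atlas of the quotient contains the pull-backs of all charts of \<open>E\<close> and
  all its charts are compatible, the structure of a graded bundle can be transported from \<open>E\<close>
  (\<open>graded_bundle_transport\<close>, \<open>isomorphism_transport\<close>).

  For the coordinates given by frames one shears with \<open>S\<^sup>\<mu> = Q\<^sup>\<mu>\<^sub>i u\<^sup>i\<close> instead, where \<open>u\<^sup>i\<close> are the velocity
  coordinates of \<open>A\<^bsup>[2]\<^esup>\<close>.  This function has degree two and the same linear part \<open>\<partial>\<close> along the core, so the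
  same two lemmas produce the chart \<open>(x, y, w)\<close>.  That \<open>Q\<close> is smooth comes down to the smoothness of the
  inverse of a smooth matrix (\<open>smooth_crd_inverse_matrix\<close>).\<close>

section \<open>Calculus on coordinate spaces\<close>

lemma continuous_on_coord: "continuous_on U (\<lambda>z::'i \<Rightarrow> real. z j)"
 by (rule continuous_on_subset[OF continuous_on_product_coordinates]) simp

lemma open_crd_iff:
 assumes "finite I"
 shows "open_crd I U \<longleftrightarrow> U \<subseteq> crd I \<and>
  (\<forall>x\<in>U. \<exists>\<epsilon>>0. \<forall>y\<in>crd I. (\<forall>i\<in>I. \<bar>y i - x i\<bar> < \<epsilon>) \<longrightarrow> y \<in> U)"
proof
 assume "open_crd I U"
 then obtain T where T: "open T" "U = crd I \<inter> T"
  unfolding open_crd_def openin_open by auto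
 show "U \<subseteq> crd I \<and> (\<forall>x\<in>U. \<exists>\<epsilon>>0. \<forall>y\<in>crd I. (\<forall>i\<in>I. \<bar>y i - x i\<bar> < \<epsilon>) \<longrightarrow> y \<in> U)"
 proof (intro conjI ballI)
  fix x assume x: "x \<in> U"
  have "openin (product_topology (\<lambda>i. euclidean) UNIV) T"
   using T(1) by (simp add: open_fun_def)
  from product_topology_open_contains_basis[OF this, of x] x T(2)
  obtain X where X: "x \<in> Pi\<^sub>E UNIV X" "\<And>i. open (X i)" "Pi\<^sub>E UNIV X \<subseteq> T"
   by auto
  have "\<exists>e>0. \<forall>t. \<bar>t - x i\<bar> < e \<longrightarrow> t \<in> X i" for i
  proof -
   have "x i \<in> X i" using X(1) by (auto simp: PiE_def Pi_def)
   with X(2)[of i] show ?thesis by (auto simp: open_dist dist_real_def)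
  qed
  then obtain e where e: "\<And>i. e i > 0" "\<And>i t. \<bar>t - x i\<bar> < e i \<Longrightarrow> t \<in> X i" by metis
  define d where "d = Min (insert 1 (e ` I))"
  have d: "d > 0" "\<And>i. i \<in> I \<Longrightarrow> d \<le> e i"
   unfolding d_def using assms e(1) by (auto simp: Min_gr_iff)
  have "y \<in> U" if y: "y \<in> crd I" "\<forall>i\<in>I. \<bar>y i - x i\<bar> < d" for y
  proof -
   have "y i \<in> X i" for i
   proof (cases "i \<in> I")
    case True
    then show ?thesis using y(2) d(2)[of i] e(2)[of "y i" i] by force
   next
    case False
    then have "y i = 0" "x i = 0" using y(1) x T(2) by (auto simp: crd_def)
    then show ?thesis using e(2)[of "y i" i] e(1)[of i] by simp
   qed
   then have "y \<in> Pi\<^sub>E UNIV X" by (auto simp: PiE_def)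
   then show ?thesis using X(3) T(2) y(1) by auto
  qed
  then show "\<exists>\<epsilon>>0. \<forall>y\<in>crd I. (\<forall>i\<in>I. \<bar>y i - x i\<bar> < \<epsilon>) \<longrightarrow> y \<in> U" using d(1) by blast
 qed (use T in auto)
next
 assume *: "U \<subseteq> crd I \<and> (\<forall>x\<in>U. \<exists>\<epsilon>>0. \<forall>y\<in>crd I. (\<forall>i\<in>I. \<bar>y i - x i\<bar> < \<epsilon>) \<longrightarrow> y \<in> U)"
 show "open_crd I U"
  unfolding open_crd_def
 proof (subst openin_subopen, intro ballI)
  fix x assume x: "x \<in> U"
  with * obtain e where e: "e > 0" "\<forall>y\<in>crd I. (\<forall>i\<in>I. \<bar>y i - x i\<bar> < e) \<longrightarrow> y \<in> U" by blast
  define T where "T = (\<Inter>i\<in>I. {y::'a \<Rightarrow> real. \<bar>y i - x i\<bar> < e})"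
  have "open {y::'a \<Rightarrow> real. \<bar>y i - x i\<bar> < e}" for i
   by (intro open_Collect_less continuous_intros continuous_on_coord)
  then have "open T" unfolding T_def using assms by auto
  then have "openin (top_of_set (crd I)) (crd I \<inter> T)" by (auto simp: openin_open)
  moreover have "x \<in> crd I \<inter> T" using x * e(1) by (auto simp: T_def)
  moreover have "crd I \<inter> T \<subseteq> U" using e(2) by (auto simp: T_def)
  ultimately show "\<exists>T. openin (top_of_set (crd I)) T \<and> x \<in> T \<and> T \<subseteq> U" by blast
 qed
qed

lemma open_crd_subset: "open_crd I U \<Longrightarrow> U \<subseteq> crd I"
 unfolding open_crd_def by (metis openin_imp_subset)

lemma open_crd_Int: "open_crd I U \<Longrightarrow> open_crd I V \<Longrightarrow> open_crd I (U \<inter> V)"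
 unfolding open_crd_def by auto

lemma open_crd_Union: "(\<And>U. U \<in> \<A> \<Longrightarrow> open_crd I U) \<Longrightarrow> open_crd I (\<Union>\<A>)"
 unfolding open_crd_def by auto

lemma open_crd_empty [simp]: "open_crd I {}"
 unfolding open_crd_def by auto

lemma open_crd_local:
 assumes "\<And>x. x \<in> U \<Longrightarrow> \<exists>V. open_crd I V \<and> x \<in> V \<and> V \<subseteq> U"
 shows "open_crd I U"
 unfolding open_crd_def by (subst openin_subopen) (use assms in \<open>auto simp: open_crd_def\<close>)

lemma open_crd_upd:
 assumes "finite I" "open_crd I U" "x \<in> U" "i \<in> I"
 shows "\<forall>\<^sub>F t in nhds (x i). x(i := t) \<in> U"
proof -
 from assms obtain e where e: "e > 0" "\<forall>y\<in>crd I. (\<forall>j\<in>I. \<bar>y j - x j\<bar> < e) \<longrightarrow> y \<in> U"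
  unfolding open_crd_iff[OF assms(1)] by blast
 have "x \<in> crd I" using assms open_crd_subset by blast
 then have "x(i := t) \<in> U" if "\<bar>t - x i\<bar> < e" for t
  using that e assms(4) by (auto simp: crd_def)
 then show ?thesis
  unfolding eventually_nhds_metric using e(1) by (auto simp: dist_real_def)
qed

definition pdv :: "'i \<Rightarrow> (('i \<Rightarrow> real) \<Rightarrow> real) \<Rightarrow> ('i \<Rightarrow> real) \<Rightarrow> real" where
 "pdv i f x = deriv (\<lambda>t. f (x(i := t))) (x i)"

lemma C_diff_Suc_pdv:
 "C_diff (Suc n) I U f \<longleftrightarrow> continuous_on U f \<and>
   (\<forall>i\<in>I. (\<forall>x\<in>U. (\<lambda>t. f (x(i := t))) field_differentiable (at (x i))) \<and> C_diff n I U (pdv i f))"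
 by (simp add: pdv_def [abs_def])

declare C_diff.simps(2) [simp del]

lemma C_diff_imp_cont: "C_diff n I U f \<Longrightarrow> continuous_on U f"
 by (cases n) (auto simp: C_diff_Suc_pdv)

lemma pdv_cong:
 assumes "finite I" "open_crd I U" "x \<in> U" "i \<in> I" "\<And>y. y \<in> U \<Longrightarrow> f y = g y"
 shows "pdv i f x = pdv i g x"
  and "(\<lambda>t. f (x(i := t))) field_differentiable (at (x i)) \<longleftrightarrow>
   (\<lambda>t. g (x(i := t))) field_differentiable (at (x i))"
proof -
 have ev: "\<forall>\<^sub>F t in nhds (x i). f (x(i := t)) = g (x(i := t))"
  using open_crd_upd[OF assms(1-4)] by eventually_elim (use assms(5) in auto)
 then show "pdv i f x = pdv i g x" unfolding pdv_def by (rule deriv_cong_ev) simp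
 from ev have *: "((\<lambda>t. f (x(i := t))) has_field_derivative D) (at (x i)) \<longleftrightarrow>
   ((\<lambda>t. g (x(i := t))) has_field_derivative D) (at (x i))" for D
  by (intro DERIV_cong_ev) auto
 then show "(\<lambda>t. f (x(i := t))) field_differentiable (at (x i)) \<longleftrightarrow>
   (\<lambda>t. g (x(i := t))) field_differentiable (at (x i))"
  unfolding field_differentiable_def by simp
qed

lemma C_diff_cong:
 assumes "finite I" "open_crd I U" "\<And>y. y \<in> U \<Longrightarrow> f y = g y"
 shows "C_diff n I U f \<longleftrightarrow> C_diff n I U g"
 using assms(3)
proof (induction n arbitrary: f g)
 case 0
 then show ?case by (auto intro: continuous_on_cong[THEN iffD1])
next
 case (Suc n)
 have "C_diff n I U (pdv i f) \<longleftrightarrow> C_diff n I U (pdv i g)" if "i \<in> I" for i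
  by (rule Suc.IH) (use pdv_cong(1)[OF assms(1,2) _ that] Suc.prems in blast)
 moreover have "continuous_on U f \<longleftrightarrow> continuous_on U g"
  using Suc.prems by (intro continuous_on_cong) auto
 moreover have "(\<forall>x\<in>U. (\<lambda>t. f (x(i := t))) field_differentiable (at (x i))) \<longleftrightarrow>
   (\<forall>x\<in>U. (\<lambda>t. g (x(i := t))) field_differentiable (at (x i)))" if "i \<in> I" for i
  using pdv_cong(2)[OF assms(1,2) _ that] Suc.prems by blast
 ultimately show ?case unfolding C_diff_Suc_pdv by auto
qed

lemma C_diff_cong_imp:
 assumes "finite I" "open_crd I U" "C_diff n I U f" "\<And>y. y \<in> U \<Longrightarrow> g y = f y"
 shows "C_diff n I U g"
 using C_diff_cong[OF assms(1,2), of g f] assms(3,4) by simp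

lemma C_diff_Suc_imp: "C_diff (Suc n) I U f \<Longrightarrow> C_diff n I U f"
 by (induction n arbitrary: f) (auto simp: C_diff_Suc_pdv)

lemma C_diff_subset:
 assumes "C_diff n I U f" "V \<subseteq> U"
 shows "C_diff n I V f"
 using assms
 by (induction n arbitrary: f) (auto simp: C_diff_Suc_pdv intro: continuous_on_subset)

lemma continuous_on_open_crd_local:
 assumes "\<And>x. x \<in> U \<Longrightarrow> \<exists>V. open_crd I V \<and> x \<in> V \<and> V \<subseteq> U \<and> continuous_on V f"
 shows "continuous_on U f"
 unfolding continuous_on_def
proof
 fix x assume "x \<in> U"
 with assms obtain V where V: "open_crd I V" "x \<in> V" "V \<subseteq> U" "continuous_on V f" by blast
 then obtain T where T: "open T" "V = crd I \<inter> T" by (auto simp: open_crd_def openin_open)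
 have U: "U \<subseteq> crd I" using assms open_crd_subset by blast
 have "(f \<longlongrightarrow> f x) (at x within V)" using V by (simp add: continuous_on_def)
 moreover have "at x within U = at x within V"
  by (rule at_within_nhd[of x T]) (use V T U in auto)
 ultimately show "(f \<longlongrightarrow> f x) (at x within U)" by simp
qed

lemma C_diff_local:
 assumes "\<And>x. x \<in> U \<Longrightarrow> \<exists>V. open_crd I V \<and> x \<in> V \<and> V \<subseteq> U \<and> C_diff n I V f"
 shows "C_diff n I U f"
 using assms
proof (induction n arbitrary: f)
 case 0
 show ?case unfolding C_diff.simps(1)
  by (rule continuous_on_open_crd_local) (use 0 in auto)
next
 case (Suc n)
 show ?case unfolding C_diff_Suc_pdv
 proof (intro conjI ballI)
  show "continuous_on U f"
   by (rule continuous_on_open_crd_local) (use Suc.prems C_diff_imp_cont in blast)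
  fix i assume i: "i \<in> I"
  show "C_diff n I U (pdv i f)"
   by (rule Suc.IH) (use Suc.prems i in \<open>unfold C_diff_Suc_pdv, blast\<close>)
  fix x assume "x \<in> U"
  with Suc.prems i show "(\<lambda>t. f (x(i := t))) field_differentiable (at (x i))"
   unfolding C_diff_Suc_pdv by blast
 qed
qed

lemma C_diff_const: "C_diff n I U (\<lambda>_. c)"
 by (induction n arbitrary: c)
  (auto simp: C_diff_Suc_pdv pdv_def [abs_def] intro: field_differentiable_const)

lemma C_diff_coord: "C_diff n I U (\<lambda>z. z j)"
proof (cases n)
 case (Suc m)
 have "pdv i (\<lambda>z. z j) = (\<lambda>_. if i = j then 1 else 0)" for i
  unfolding pdv_def by (auto simp: fun_eq_iff)
 moreover have "(\<lambda>t. (x(i := t)) j) field_differentiable (at (x i))" for x :: "'a \<Rightarrow> real" and i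
  by (cases "i = j") (auto intro: field_differentiable_const field_differentiable_ident)
 moreover have "continuous_on U (\<lambda>z. z j)"
  by (rule continuous_on_coord)
 ultimately show ?thesis unfolding Suc C_diff_Suc_pdv using C_diff_const by auto
qed (auto intro!: continuous_on_coord)

lemma C_diff_add:
 assumes "finite I" "open_crd I U" "C_diff n I U f" "C_diff n I U g"
 shows "C_diff n I U (\<lambda>z. f z + g z)"
 using assms(3,4)
proof (induction n arbitrary: f g)
 case 0
 then show ?case by (auto intro: continuous_intros)
next
 case (Suc n)
 have pd: "pdv i (\<lambda>z. f z + g z) x = pdv i f x + pdv i g x" if "x \<in> U" "i \<in> I" for x i
  unfolding pdv_def by (rule deriv_add) (use Suc.prems that in \<open>auto simp: C_diff_Suc_pdv\<close>)
 show ?case unfolding C_diff_Suc_pdv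
 proof (intro conjI ballI)
  show "continuous_on U (\<lambda>z. f z + g z)"
   using Suc.prems by (auto simp: C_diff_Suc_pdv intro!: continuous_on_add continuous_on_mult)
  fix i assume i: "i \<in> I"
  have "C_diff n I U (\<lambda>z. pdv i f z + pdv i g z)"
   using Suc i by (auto simp: C_diff_Suc_pdv)
  then show "C_diff n I U (pdv i (\<lambda>z. f z + g z))"
   by (rule C_diff_cong_imp[OF assms(1,2)]) (simp add: pd i)
  fix x assume x: "x \<in> U"
  have "(\<lambda>t. f (x(i := t))) field_differentiable (at (x i))"
   "(\<lambda>t. g (x(i := t))) field_differentiable (at (x i))"
   using Suc.prems i x unfolding C_diff_Suc_pdv by blast+
  then show "(\<lambda>t. f (x(i := t)) + g (x(i := t))) field_differentiable (at (x i))"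
   by (fact field_differentiable_add)
 qed
qed

lemma C_diff_mult:
 assumes "finite I" "open_crd I U" "C_diff n I U f" "C_diff n I U g"
 shows "C_diff n I U (\<lambda>z. f z * g z)"
 using assms(3,4)
proof (induction n arbitrary: f g)
 case 0
 then show ?case by (auto intro: continuous_intros)
next
 case (Suc n)
 have pd: "pdv i (\<lambda>z. f z * g z) x = f x * pdv i g x + pdv i f x * g x" if "x \<in> U" "i \<in> I" for x i
 proof -
  have "deriv (\<lambda>t. f (x(i := t)) * g (x(i := t))) (x i) =
    f (x(i := x i)) * deriv (\<lambda>t. g (x(i := t))) (x i) + deriv (\<lambda>t. f (x(i := t))) (x i) * g (x(i := x i))"
   by (rule deriv_mult) (use Suc.prems that in \<open>auto simp: C_diff_Suc_pdv\<close>)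
  then show ?thesis unfolding pdv_def by simp
 qed
 show ?case unfolding C_diff_Suc_pdv
 proof (intro conjI ballI)
  show "continuous_on U (\<lambda>z. f z * g z)"
   using Suc.prems by (auto simp: C_diff_Suc_pdv intro!: continuous_on_add continuous_on_mult)
  fix i assume i: "i \<in> I"
  have "C_diff n I U (\<lambda>z. f z * pdv i g z + pdv i f z * g z)"
   using Suc.prems i C_diff_Suc_imp[of n I U f] C_diff_Suc_imp[of n I U g]
   by (intro C_diff_add[OF assms(1,2)] Suc.IH) (auto simp: C_diff_Suc_pdv)
  then show "C_diff n I U (pdv i (\<lambda>z. f z * g z))"
   by (rule C_diff_cong_imp[OF assms(1,2)]) (simp add: pd i)
  fix x assume x: "x \<in> U"
  have "(\<lambda>t. f (x(i := t))) field_differentiable (at (x i))"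
   "(\<lambda>t. g (x(i := t))) field_differentiable (at (x i))"
   using Suc.prems i x unfolding C_diff_Suc_pdv by blast+
  then show "(\<lambda>t. f (x(i := t)) * g (x(i := t))) field_differentiable (at (x i))"
   by (fact field_differentiable_mult)
 qed
qed

lemma C_diff_sum:
 assumes "finite I" "open_crd I U" "\<And>k. k \<in> K \<Longrightarrow> C_diff n I U (f k)"
 shows "C_diff n I U (\<lambda>z. \<Sum>k\<in>K. f k z)"
 using assms(3)
proof (induction K rule: infinite_finite_induct)
 case (insert k K)
 then show ?case using C_diff_add[OF assms(1,2)] by simp
qed (simp_all add: C_diff_const)

lemma C_diff_prod:
 assumes "finite I" "open_crd I U" "\<And>k. k \<in> K \<Longrightarrow> C_diff n I U (f k)"
 shows "C_diff n I U (\<lambda>z. \<Prod>k\<in>K. f k z)"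
 using assms(3)
proof (induction K rule: infinite_finite_induct)
 case (insert k K)
 then show ?case using C_diff_mult[OF assms(1,2)] by simp
qed (simp_all add: C_diff_const)

lemma pdv_has_derivative:
 assumes "C_diff (Suc n) I U f" "i \<in> I" "x \<in> U"
 shows "((\<lambda>t. f (x(i := t))) has_field_derivative pdv i f x) (at (x i))"
 using assms unfolding C_diff_Suc_pdv pdv_def DERIV_deriv_iff_field_differentiable by blast

lemma open_crd_close:
 assumes "finite I" "open_crd I U" "continuous_on U g" "x \<in> U" "e > (0::real)"
 shows "\<exists>d>0. \<forall>y\<in>crd I. (\<forall>i\<in>I. \<bar>y i - x i\<bar> < d) \<longrightarrow> y \<in> U \<and> \<bar>g y - g x\<bar> < e"
proof -
 have "openin (top_of_set U) (U \<inter> g -` ball (g x) e)"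
  by (rule continuous_openin_preimage_gen[OF assms(3)]) simp
 then have "open_crd I (U \<inter> g -` ball (g x) e)"
  using assms(2) unfolding open_crd_def by (rule openin_trans)
 moreover have "x \<in> U \<inter> g -` ball (g x) e" using assms(4,5) by simp
 ultimately obtain d where d: "d > 0"
  "\<forall>y\<in>crd I. (\<forall>i\<in>I. \<bar>y i - x i\<bar> < d) \<longrightarrow> y \<in> U \<inter> g -` ball (g x) e"
  unfolding open_crd_iff[OF assms(1)] by meson
 have "y \<in> U \<and> \<bar>g y - g x\<bar> < e" if "y \<in> crd I" "\<forall>i\<in>I. \<bar>y i - x i\<bar> < d" for y
  using bspec[OF d(2) that(1)] that(2) by (simp add: dist_real_def abs_minus_commute)
 then show ?thesis using d(1) by blast
qed

text \<open>The coordinates of the curve are switched on one at a time.  Passing from the labels \<open>K\<close> to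
  \<open>insert k K\<close> changes the value by a difference quotient in the direction \<open>k\<close> times the increment of
  the \<open>k\<close>-th coordinate, and by the mean value theorem that quotient tends to the partial derivative,
  because the partial derivatives are continuous.\<close>

lemma chain_rule_curve:
 fixes c :: "real \<Rightarrow> 'j \<Rightarrow> real"
 assumes J: "finite J" and V: "open_crd J V" and f: "C_diff (Suc 0) J V f"
  and c0: "c t0 \<in> V" and cJ: "\<And>t. c t \<in> crd J"
  and c': "\<And>j. j \<in> J \<Longrightarrow> ((\<lambda>t. c t j) has_field_derivative c' j) (at t0)"
 shows "((\<lambda>t. f (c t)) has_field_derivative (\<Sum>j\<in>J. pdv j f (c t0) * c' j)) (at t0)"
proof -
 define p where "p K t = (\<lambda>i. if i \<in> K then c t i else c t0 i)" for K t
 have "((\<lambda>t. f (p K t)) has_field_derivative (\<Sum>j\<in>K. pdv j f (c t0) * c' j)) (at t0)"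
  if "K \<subseteq> J" for K
  using finite_subset[OF that J] that
 proof (induction K rule: finite_induct)
  case empty
  then show ?case by (simp add: p_def)
 next
  case (insert k K)
  have k: "k \<in> J" "k \<notin> K" using insert by auto
  define r0 where "r0 = pdv k f (c t0)"
  \<comment> \<open>The difference quotient in the direction \<open>k\<close>, completed by its limit where the increment vanishes.\<close>
  define r where "r t = (if c t k = c t0 k then r0
   else (f (p (insert k K) t) - f (p K t)) / (c t k - c t0 k))" for t
  have split: "f (p (insert k K) t) = f (p K t) + r t * (c t k - c t0 k)" for t
  proof (cases "c t k = c t0 k")
   case True
   then have "p (insert k K) t = p K t" unfolding p_def by auto
   then show ?thesis using True by simp
  qed (simp add: r_def)
  have cont: "continuous_on V (pdv k f)"
   using f k(1) unfolding C_diff_Suc_pdv by simp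
  have r_lim: "(r \<longlongrightarrow> r0) (at t0)"
  proof (rule tendstoI)
   fix e :: real assume "e > 0"
   obtain d where d: "d > 0"
    "\<And>y. y \<in> crd J \<Longrightarrow> (\<And>i. i \<in> J \<Longrightarrow> \<bar>y i - c t0 i\<bar> < d) \<Longrightarrow>
     y \<in> V \<and> \<bar>pdv k f y - r0\<bar> < e"
    using open_crd_close[OF J V cont c0 \<open>e > 0\<close>] unfolding r0_def by blast
   have "\<forall>\<^sub>F t in at t0. \<bar>c t i - c t0 i\<bar> < d" if "i \<in> J" for i
   proof -
    have "((\<lambda>t. c t i) \<longlongrightarrow> c t0 i) (at t0)"
     using DERIV_isCont[OF c'[OF that]] by (simp add: isCont_def)
    from tendstoD[OF this d(1)] show ?thesis by (simp add: dist_real_def)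
   qed
   then have "\<forall>\<^sub>F t in at t0. \<forall>i\<in>J. \<bar>c t i - c t0 i\<bar> < d"
    using J by (simp add: eventually_ball_finite_distrib)
   then show "\<forall>\<^sub>F t in at t0. dist (r t) r0 < e"
   proof eventually_elim
    case (elim t)
    show ?case
    proof (cases "c t k = c t0 k")
     case True
     then show ?thesis using \<open>e > 0\<close> by (simp add: r_def)
    next
     case False
     define g where "g s = f ((p K t)(k := s))" for s
     define lo hi where "lo = min (c t k) (c t0 k)" and "hi = max (c t k) (c t0 k)"
     have near: "(p K t)(k := s) \<in> V \<and> \<bar>pdv k f ((p K t)(k := s)) - r0\<bar> < e"
      if "lo \<le> s" "s \<le> hi" for s
     proof (rule d(2))
      show "(p K t)(k := s) \<in> crd J"
       using cJ[of t] cJ[of t0] k by (auto simp: crd_def p_def)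
      fix i assume "i \<in> J"
      then show "\<bar>((p K t)(k := s)) i - c t0 i\<bar> < d"
       using bspec[OF elim k(1)] bspec[OF elim \<open>i \<in> J\<close>] that d(1)
       unfolding p_def lo_def hi_def by auto
     qed
     have der: "(g has_field_derivative pdv k f ((p K t)(k := s))) (at s)"
      if "lo \<le> s" "s \<le> hi" for s
      using pdv_has_derivative[OF f k(1) conjunct1[OF near[OF that]]]
      unfolding g_def by simp
     have "lo < hi" using False by (auto simp: lo_def hi_def)
     from MVT2[OF this der] obtain z where z: "lo < z" "z < hi"
      "g hi - g lo = (hi - lo) * pdv k f ((p K t)(k := z))" by blast
     have gk: "g (c t k) = f (p (insert k K) t)" "g (c t0 k) = f (p K t)"
      using k(2) unfolding g_def p_def by (auto intro!: arg_cong[of _ _ f])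
     have "f (p (insert k K) t) - f (p K t) = (c t k - c t0 k) * pdv k f ((p K t)(k := z))"
      using z(3) gk unfolding lo_def hi_def
      by (cases "c t k \<le> c t0 k") (auto simp: min_def max_def algebra_simps)
     then have "r t = pdv k f ((p K t)(k := z))" using False by (simp add: r_def)
     then show ?thesis using near[of z] z by (simp add: dist_real_def)
    qed
   qed
  qed
  have "((\<lambda>t. r t * (c t k - c t0 k)) has_field_derivative r0 * c' k) (at t0)"
  proof -
   have "((\<lambda>t. (c t k - c t0 k) / (t - t0)) \<longlongrightarrow> c' k) (at t0)"
    using c'[OF k(1)] by (simp add: has_field_derivative_iff)
   from tendsto_mult[OF r_lim this]
   have "((\<lambda>t. (r t * (c t k - c t0 k) - r t0 * (c t0 k - c t0 k)) / (t - t0)) \<longlongrightarrow> r0 * c' k) (at t0)"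
    by simp
   then show ?thesis by (simp add: has_field_derivative_iff)
  qed
  moreover have "((\<lambda>t. f (p K t)) has_field_derivative (\<Sum>j\<in>K. pdv j f (c t0) * c' j)) (at t0)"
   using insert by simp
  ultimately have "((\<lambda>t. f (p K t) + r t * (c t k - c t0 k)) has_field_derivative
    (\<Sum>j\<in>K. pdv j f (c t0) * c' j) + r0 * c' k) (at t0)"
   by (rule DERIV_add[rotated])
  then show ?case
   using insert(1,2) by (simp add: split r0_def add.commute)
 qed
 from this[of J] have "((\<lambda>t. f (p J t)) has_field_derivative (\<Sum>j\<in>J. pdv j f (c t0) * c' j)) (at t0)"
  by simp
 moreover have "p J t = c t" for t
  using cJ[of t] cJ[of t0] by (auto simp: p_def crd_def)
 ultimately show ?thesis by simp
qed

lemma C_diff_mono: "C_diff n I U f \<Longrightarrow> m \<le> n \<Longrightarrow> C_diff m I U f"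
 by (induction n) (auto simp: le_Suc_eq dest: C_diff_Suc_imp)

lemma C_diff_comp:
 assumes I: "finite I" "open_crd I U" and J: "finite J" "open_crd J V"
  and g: "\<And>z. z \<in> U \<Longrightarrow> g z \<in> V"
  and "\<And>j. j \<in> J \<Longrightarrow> C_diff n I U (\<lambda>z. g z j)" and "C_diff n J V f"
 shows "C_diff n I U (\<lambda>z. f (g z))"
 using assms(6,7)
proof (induction n arbitrary: f)
 case 0
 have "continuous_on U g"
 proof (rule continuous_on_coordinatewise_then_product)
  fix j
  show "continuous_on U (\<lambda>z. g z j)"
  proof (cases "j \<in> J")
   case False
   then have "g z j = 0" if "z \<in> U" for z
    using g[OF that] open_crd_subset[OF J(2)] by (auto simp: crd_def)
   then show ?thesis by (metis continuous_on_cong continuous_on_const)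
  qed (use 0 in simp)
 qed
 then show ?case using 0(2) g
  by (auto intro: continuous_on_compose2[of V f U g])
next
 case (Suc n)
 have g1: "C_diff n I U (\<lambda>z. g z j)" if "j \<in> J" for j
  using Suc.prems(1)[OF that] by (rule C_diff_Suc_imp)
 have f1: "C_diff (Suc 0) J V f"
  by (rule C_diff_mono[OF Suc.prems(2)]) simp
 have der: "((\<lambda>t. f (g (x(i := t)))) has_field_derivative
   (\<Sum>j\<in>J. pdv j f (g x) * pdv i (\<lambda>z. g z j) x)) (at (x i))" if "x \<in> U" "i \<in> I" for x i
 proof -
  define c where "c t = (if x(i := t) \<in> U then g (x(i := t)) else (\<lambda>_. 0))" for t
  have ev: "\<forall>\<^sub>F t in nhds (x i). x(i := t) \<in> U"
   by (rule open_crd_upd[OF I that])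
  have cx: "c (x i) = g x" using that by (simp add: c_def)
  have "((\<lambda>t. f (c t)) has_field_derivative
   (\<Sum>j\<in>J. pdv j f (c (x i)) * pdv i (\<lambda>z. g z j) x)) (at (x i))"
  proof (rule chain_rule_curve[OF J f1])
   show "c (x i) \<in> V" using cx g that by simp
   show "c t \<in> crd J" for t
    using g open_crd_subset[OF J(2)] by (auto simp: c_def crd_def)
   fix j assume "j \<in> J"
   have "((\<lambda>t. g (x(i := t)) j) has_field_derivative pdv i (\<lambda>z. g z j) x) (at (x i))"
    by (rule pdv_has_derivative[OF Suc.prems(1)[OF \<open>j \<in> J\<close>] that(2,1)])
   moreover have "\<forall>\<^sub>F t in nhds (x i). c t j = g (x(i := t)) j"
    using ev by eventually_elim (simp add: c_def)
   ultimately show "((\<lambda>t. c t j) has_field_derivative pdv i (\<lambda>z. g z j) x) (at (x i))"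
    by (subst DERIV_cong_ev) auto
  qed
  moreover have "\<forall>\<^sub>F t in nhds (x i). f (c t) = f (g (x(i := t)))"
   using ev by eventually_elim (simp add: c_def)
  ultimately show ?thesis by (subst (asm) DERIV_cong_ev) (auto simp: cx)
 qed
 show ?case unfolding C_diff_Suc_pdv
 proof (intro conjI ballI)
  have "C_diff n I U (\<lambda>z. f (g z))"
   by (rule Suc.IH) (use g1 C_diff_Suc_imp[OF Suc.prems(2)] in auto)
  then show "continuous_on U (\<lambda>z. f (g z))" by (rule C_diff_imp_cont)
  fix i assume i: "i \<in> I"
  have "C_diff n I U (\<lambda>x. \<Sum>j\<in>J. pdv j f (g x) * pdv i (\<lambda>z. g z j) x)"
  proof (rule C_diff_sum[OF I], rule C_diff_mult[OF I])
   fix j assume j: "j \<in> J"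
   show "C_diff n I U (\<lambda>x. pdv j f (g x))"
    by (rule Suc.IH) (use g1 Suc.prems(2) j in \<open>auto simp: C_diff_Suc_pdv\<close>)
   show "C_diff n I U (pdv i (\<lambda>z. g z j))"
    using Suc.prems(1)[OF j] i by (auto simp: C_diff_Suc_pdv)
  qed
  then show "C_diff n I U (pdv i (\<lambda>z. f (g z)))"
  proof (rule C_diff_cong_imp[OF I])
   fix x assume "x \<in> U"
   from DERIV_imp_deriv[OF der[OF this i]]
   show "pdv i (\<lambda>z. f (g z)) x = (\<Sum>j\<in>J. pdv j f (g x) * pdv i (\<lambda>z. g z j) x)"
    unfolding pdv_def .
  qed
  fix x assume "x \<in> U"
  from der[OF this i] show "(\<lambda>t. f (g (x(i := t)))) field_differentiable at (x i)"
   unfolding field_differentiable_def by blast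
 qed
qed

lemma smooth_crdD: "smooth_crd I U f \<Longrightarrow> C_diff n I U f"
 by (simp add: smooth_crd_def)

lemma smooth_crd_cong_imp:
 assumes "finite I" "open_crd I U" "smooth_crd I U f" "\<And>y. y \<in> U \<Longrightarrow> g y = f y"
 shows "smooth_crd I U g"
 using assms C_diff_cong_imp[OF assms(1,2)] unfolding smooth_crd_def by blast

lemma smooth_crd_subset: "smooth_crd I U f \<Longrightarrow> V \<subseteq> U \<Longrightarrow> smooth_crd I V f"
 unfolding smooth_crd_def using C_diff_subset by blast

lemma smooth_crd_local:
 assumes "\<And>x. x \<in> U \<Longrightarrow> \<exists>V. open_crd I V \<and> x \<in> V \<and> V \<subseteq> U \<and> smooth_crd I V f"
 shows "smooth_crd I U f"
 unfolding smooth_crd_def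
proof (intro allI C_diff_local)
 fix n x assume "x \<in> U"
 from assms[OF this] show "\<exists>V. open_crd I V \<and> x \<in> V \<and> V \<subseteq> U \<and> C_diff n I V f"
  unfolding smooth_crd_def by blast
qed

lemma smooth_crd_const: "smooth_crd I U (\<lambda>_. c)"
 by (simp add: smooth_crd_def C_diff_const)

lemma smooth_crd_coord: "smooth_crd I U (\<lambda>z. z j)"
 by (simp add: smooth_crd_def C_diff_coord)

lemma smooth_crd_add:
 "finite I \<Longrightarrow> open_crd I U \<Longrightarrow> smooth_crd I U f \<Longrightarrow> smooth_crd I U g \<Longrightarrow> smooth_crd I U (\<lambda>z. f z + g z)"
 by (simp add: smooth_crd_def C_diff_add)

lemma smooth_crd_mult:
 "finite I \<Longrightarrow> open_crd I U \<Longrightarrow> smooth_crd I U f \<Longrightarrow> smooth_crd I U g \<Longrightarrow> smooth_crd I U (\<lambda>z. f z * g z)"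
 by (simp add: smooth_crd_def C_diff_mult)

lemma smooth_crd_diff:
 assumes "finite I" "open_crd I U" "smooth_crd I U f" "smooth_crd I U g"
 shows "smooth_crd I U (\<lambda>z. f z - g z)"
proof -
 have "smooth_crd I U (\<lambda>z. f z + (- 1) * g z)"
  by (intro smooth_crd_add smooth_crd_mult smooth_crd_const assms)
 then show ?thesis by simp
qed

lemma smooth_crd_sum:
 "finite I \<Longrightarrow> open_crd I U \<Longrightarrow> (\<And>k. k \<in> K \<Longrightarrow> smooth_crd I U (f k)) \<Longrightarrow>
   smooth_crd I U (\<lambda>z. \<Sum>k\<in>K. f k z)"
 by (simp add: smooth_crd_def C_diff_sum)

lemma smooth_crd_prod:
 "finite I \<Longrightarrow> open_crd I U \<Longrightarrow> (\<And>k. k \<in> K \<Longrightarrow> smooth_crd I U (f k)) \<Longrightarrow>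
   smooth_crd I U (\<lambda>z. \<Prod>k\<in>K. f k z)"
 by (simp add: smooth_crd_def C_diff_prod)

lemma smooth_crd_power:
 assumes "finite I" "open_crd I U" "smooth_crd I U f"
 shows "smooth_crd I U (\<lambda>z. f z ^ n)"
 by (induction n) (simp_all add: smooth_crd_const smooth_crd_mult assms)

lemma smooth_crd_comp:
 assumes "finite I" "open_crd I U" "finite J" "open_crd J V"
  and "\<And>z. z \<in> U \<Longrightarrow> g z \<in> V"
  and "\<And>j. j \<in> J \<Longrightarrow> smooth_crd I U (\<lambda>z. g z j)" and "smooth_crd J V f"
 shows "smooth_crd I U (\<lambda>z. f (g z))"
 unfolding smooth_crd_def
proof
 fix n
 show "C_diff n I U (\<lambda>z. f (g z))"
  by (rule C_diff_comp[OF assms(1-5)]) (auto intro: smooth_crdD assms(6,7))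
qed

lemma smooth_crd_pdv:
 assumes "smooth_crd I U f" "i \<in> I"
 shows "smooth_crd I U (pdv i f)"
 unfolding smooth_crd_def
proof
 fix n
 from smooth_crdD[OF assms(1), of "Suc n"] assms(2) show "C_diff n I U (pdv i f)"
  unfolding C_diff_Suc_pdv by simp
qed

lemma smooth_crd_Union:
 assumes "\<And>W. W \<in> \<W> \<Longrightarrow> open_crd I W \<and> smooth_crd I W f"
 shows "smooth_crd I (\<Union>\<W>) f"
proof (rule smooth_crd_local)
 fix x assume "x \<in> \<Union>\<W>"
 then obtain W where "W \<in> \<W>" "x \<in> W" by blast
 with assms[OF this(1)] show "\<exists>V. open_crd I V \<and> x \<in> V \<and> V \<subseteq> \<Union>\<W> \<and> smooth_crd I V f" by blast
qed

lemma open_crd_preimage: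
 assumes I: "finite I" "open_crd I U" and J: "finite J" "open_crd J V"
  and g: "\<And>z. z \<in> U \<Longrightarrow> g z \<in> crd J"
  and s: "\<And>j. j \<in> J \<Longrightarrow> smooth_crd I U (\<lambda>z. g z j)"
 shows "open_crd I {z \<in> U. g z \<in> V}"
proof -
 have "continuous_on U g"
 proof (rule continuous_on_coordinatewise_then_product)
  fix j
  show "continuous_on U (\<lambda>z. g z j)"
  proof (cases "j \<in> J")
   case False
   then have "g z j = 0" if "z \<in> U" for z
    using g[OF that] by (auto simp: crd_def)
   then show ?thesis by (metis continuous_on_cong continuous_on_const)
  next
   case True
   show ?thesis by (rule C_diff_imp_cont[OF smooth_crdD[OF s[OF True]]])
  qed
 qed
 moreover obtain T where T: "open T" "V = crd J \<inter> T"
  using J(2) unfolding open_crd_def openin_open by auto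
 ultimately have "openin (top_of_set U) (U \<inter> g -` T)"
  using continuous_openin_preimage_gen by blast
 then have "open_crd I (U \<inter> g -` T)"
  using I(2) unfolding open_crd_def by (rule openin_trans)
 moreover have "U \<inter> g -` T = {z \<in> U. g z \<in> V}" using T(2) g by auto
 ultimately show ?thesis by simp
qed

subsection \<open>Inverse matrices\<close>

text \<open>The identity \<open>N - N' = - N (B - B') N'\<close> for inverse matrices: it bounds the increment of the inverse
  by that of the matrix, and after division by the increment of the parameter it gives the derivative
  of the inverse.\<close>

lemma resolvent_identity:
 fixes N N' B B' :: "'k \<Rightarrow> 'k \<Rightarrow> real"
 assumes K: "finite K"
  and l: "\<And>i k. i \<in> K \<Longrightarrow> k \<in> K \<Longrightarrow> (\<Sum>j\<in>K. N i j * B j k) = (if i = k then 1 else 0)"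
  and r: "\<And>j l. j \<in> K \<Longrightarrow> l \<in> K \<Longrightarrow> (\<Sum>k\<in>K. B' j k * N' k l) = (if j = l then 1 else 0)"
  and il: "i \<in> K" "l \<in> K"
 shows "N i l - N' i l = - (\<Sum>j\<in>K. \<Sum>k\<in>K. N i j * (B j k - B' j k) * N' k l)"
proof -
 have "(\<Sum>j\<in>K. \<Sum>k\<in>K. N i j * B j k * N' k l) = (\<Sum>k\<in>K. (\<Sum>j\<in>K. N i j * B j k) * N' k l)"
  by (subst sum.swap) (simp add: sum_distrib_right)
 also have "\<dots> = (\<Sum>k\<in>K. (if i = k then 1 else 0) * N' k l)"
  using il by (intro sum.cong) (auto simp: l)
 also have "\<dots> = N' i l" using K il by (simp add: if_distrib[of "\<lambda>x. x * _"] cong: if_cong)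
 finally have 1: "(\<Sum>j\<in>K. \<Sum>k\<in>K. N i j * B j k * N' k l) = N' i l" .
 have "(\<Sum>j\<in>K. \<Sum>k\<in>K. N i j * B' j k * N' k l) = (\<Sum>j\<in>K. N i j * (\<Sum>k\<in>K. B' j k * N' k l))"
  by (simp add: sum_distrib_left mult.assoc)
 also have "\<dots> = (\<Sum>j\<in>K. N i j * (if j = l then 1 else 0))"
  using il by (intro sum.cong) (auto simp: r)
 also have "\<dots> = N i l" using K il by (simp add: if_distrib[of "\<lambda>x. _ * x"] cong: if_cong)
 finally have 2: "(\<Sum>j\<in>K. \<Sum>k\<in>K. N i j * B' j k * N' k l) = N i l" .
 have "(\<Sum>j\<in>K. \<Sum>k\<in>K. N i j * (B j k - B' j k) * N' k l) =
   (\<Sum>j\<in>K. \<Sum>k\<in>K. N i j * B j k * N' k l) - (\<Sum>j\<in>K. \<Sum>k\<in>K. N i j * B' j k * N' k l)"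
  by (simp add: algebra_simps sum_subtractf)
 then show ?thesis using 1 2 by simp
qed

text \<open>Continuity of the inverse needs a bound on \<open>N\<close> near \<open>x\<close> that is not available in advance.  With
  \<open>S\<close> the sum of the absolute values of the entries, the resolvent identity gives
  \<open>S y \<le> S x + d \<cdot> S y \<cdot> S x\<close>, hence \<open>S y \<le> 2 \<cdot> S x\<close> as soon as \<open>d \<cdot> S x \<le> 1/2\<close>.\<close>

lemma tendsto_inverse_matrix:
 fixes N B :: "'x \<Rightarrow> 'k \<Rightarrow> 'k \<Rightarrow> real"
 assumes K: "finite K"
  and l: "\<And>x i k. x \<in> U \<Longrightarrow> i \<in> K \<Longrightarrow> k \<in> K \<Longrightarrow> (\<Sum>j\<in>K. N x i j * B x j k) = (if i = k then 1 else 0)"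
  and r: "\<And>x i k. x \<in> U \<Longrightarrow> i \<in> K \<Longrightarrow> k \<in> K \<Longrightarrow> (\<Sum>j\<in>K. B x i j * N x j k) = (if i = k then 1 else 0)"
  and \<phi>: "\<forall>\<^sub>F t in F. \<phi> t \<in> U" and x: "x \<in> U"
  and B: "\<And>j k. j \<in> K \<Longrightarrow> k \<in> K \<Longrightarrow> ((\<lambda>t. B (\<phi> t) j k) \<longlongrightarrow> B x j k) F"
  and il: "i \<in> K" "l \<in> K"
 shows "((\<lambda>t. N (\<phi> t) i l) \<longlongrightarrow> N x i l) F"
proof (rule tendstoI)
 fix e :: real assume e: "e > 0"
 define S where "S y = (\<Sum>i\<in>K. \<Sum>l\<in>K. \<bar>N y i l\<bar>)" for y
 have S0: "S y \<ge> 0" for y by (simp add: S_def sum_nonneg)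
 \<comment> \<open>The first bound absorbs \<open>S y\<close>; the second makes \<open>d \<cdot> (2 \<cdot> S x) \<cdot> S x\<close> smaller than \<open>e\<close>.\<close>
 define d where "d = min (1 / (2 * (S x + 1))) (e / (2 * (S x + 1) ^ 2))"
 have d: "d > 0" unfolding d_def using S0[of x] e by (simp add: add_nonneg_pos)
 have "\<forall>\<^sub>F t in F. \<forall>j\<in>K. \<forall>k\<in>K. \<bar>B (\<phi> t) j k - B x j k\<bar> < d"
  using tendstoD[OF B d] K by (simp add: eventually_ball_finite_distrib dist_real_def)
 with \<phi> show "\<forall>\<^sub>F t in F. dist (N (\<phi> t) i l) (N x i l) < e"
 proof eventually_elim
  case (elim t)
  define y where "y = \<phi> t"
  have res: "N y i l - N x i l = - (\<Sum>j\<in>K. \<Sum>k\<in>K. N y i j * (B y j k - B x j k) * N x k l)"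
   if "i \<in> K" "l \<in> K" for i l
   by (rule resolvent_identity[OF K]) (use l r elim(1) x that in \<open>auto simp: y_def\<close>)
  have bd: "\<bar>N y i l - N x i l\<bar> \<le> (\<Sum>j\<in>K. \<Sum>k\<in>K. \<bar>N y i j\<bar> * d * \<bar>N x k l\<bar>)"
   if "i \<in> K" "l \<in> K" for i l
  proof -
   have "\<bar>N y i j * (B y j k - B x j k) * N x k l\<bar> \<le> \<bar>N y i j\<bar> * d * \<bar>N x k l\<bar>"
    if "j \<in> K" "k \<in> K" for j k
    unfolding abs_mult using elim(2) that
    by (intro mult_mono) (use d in \<open>auto simp: y_def less_imp_le\<close>)
   then show ?thesis unfolding res[OF that] abs_minus_cancel
    by (intro order_trans[OF sum_abs] sum_mono)
  qed
  have SS: "(\<Sum>i\<in>K. \<Sum>l\<in>K. \<bar>N y i l - N x i l\<bar>) \<le> d * S y * S x"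
  proof -
   have "(\<Sum>i\<in>K. \<Sum>l\<in>K. \<bar>N y i l - N x i l\<bar>) \<le>
     (\<Sum>i\<in>K. \<Sum>l\<in>K. \<Sum>j\<in>K. \<Sum>k\<in>K. \<bar>N y i j\<bar> * d * \<bar>N x k l\<bar>)"
    by (intro sum_mono bd)
   also have "\<dots> = (\<Sum>i\<in>K. \<Sum>j\<in>K. \<Sum>l\<in>K. \<Sum>k\<in>K. \<bar>N y i j\<bar> * d * \<bar>N x k l\<bar>)"
    by (intro sum.cong refl sum.swap)
   also have "\<dots> = (\<Sum>i\<in>K. \<Sum>j\<in>K. \<Sum>k\<in>K. \<Sum>l\<in>K. \<bar>N y i j\<bar> * d * \<bar>N x k l\<bar>)"
    by (intro sum.cong refl sum.swap)
   also have "\<dots> = (\<Sum>i\<in>K. \<Sum>j\<in>K. \<bar>N y i j\<bar> * d * S x)"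
    by (simp add: S_def sum_distrib_left)
   also have "\<dots> = (\<Sum>i\<in>K. \<Sum>j\<in>K. \<bar>N y i j\<bar>) * d * S x"
    by (simp add: sum_distrib_right)
   also have "\<dots> = d * S y * S x" by (simp add: S_def)
   finally show ?thesis .
  qed
  have "S y \<le> S x + d * S y * S x"
  proof -
   have "S y \<le> (\<Sum>i\<in>K. \<Sum>l\<in>K. \<bar>N x i l\<bar> + \<bar>N y i l - N x i l\<bar>)"
    unfolding S_def by (intro sum_mono) linarith
   then show ?thesis using SS by (simp add: S_def sum.distrib)
  qed
  moreover have "d * S x \<le> 1 / 2"
  proof -
   have "d * S x \<le> 1 / (2 * (S x + 1)) * S x"
    unfolding d_def using S0 by (intro mult_right_mono) auto
   also have "\<dots> \<le> 1 / 2" using S0[of x] by (simp add: field_simps add_nonneg_pos)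
   finally show ?thesis .
  qed
  then have "d * S y * S x \<le> S y / 2"
   using mult_left_mono[of "d * S x" "1 / 2" "S y"] S0[of y] by (simp add: mult_ac)
  ultimately have Sy: "S y \<le> 2 * S x" by linarith
  have "\<bar>N y i l - N x i l\<bar> \<le> (\<Sum>l\<in>K. \<bar>N y i l - N x i l\<bar>)"
   using il K by (intro member_le_sum) auto
  also have "\<dots> \<le> (\<Sum>i\<in>K. \<Sum>l\<in>K. \<bar>N y i l - N x i l\<bar>)"
   using il K by (intro member_le_sum[where f = "\<lambda>i. \<Sum>l\<in>K. \<bar>N y i l - N x i l\<bar>"])
    (auto intro: sum_nonneg)
  also have "\<dots> \<le> d * S y * S x" by (rule SS)
  also have "\<dots> \<le> d * (2 * S x) * S x"
   using Sy d S0 by (intro mult_right_mono mult_left_mono) auto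
  also have "\<dots> < d * (2 * (S x + 1) ^ 2)"
  proof -
   have "2 * S x * S x < 2 * (S x + 1) ^ 2"
    using S0[of x] by (simp add: power2_eq_square algebra_simps)
   from mult_strict_left_mono[OF this d] show ?thesis by (simp add: mult_ac)
  qed
  also have "\<dots> \<le> e / (2 * (S x + 1) ^ 2) * (2 * (S x + 1) ^ 2)"
   unfolding d_def by (intro mult_right_mono) auto
  also have "\<dots> = e" using S0[of x] by simp
  finally show ?case by (simp add: y_def dist_real_def)
 qed
qed

lemma smooth_crd_inverse_matrix:
 fixes N B :: "('i \<Rightarrow> real) \<Rightarrow> 'k \<Rightarrow> 'k \<Rightarrow> real"
 assumes K: "finite K" and I: "finite I" "open_crd I U"
  and l: "\<And>x i k. x \<in> U \<Longrightarrow> i \<in> K \<Longrightarrow> k \<in> K \<Longrightarrow> (\<Sum>j\<in>K. N x i j * B x j k) = (if i = k then 1 else 0)"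
  and r: "\<And>x i k. x \<in> U \<Longrightarrow> i \<in> K \<Longrightarrow> k \<in> K \<Longrightarrow> (\<Sum>j\<in>K. B x i j * N x j k) = (if i = k then 1 else 0)"
  and B: "\<And>j k. j \<in> K \<Longrightarrow> k \<in> K \<Longrightarrow> smooth_crd I U (\<lambda>x. B x j k)"
  and il: "i \<in> K" "l \<in> K"
 shows "smooth_crd I U (\<lambda>x. N x i l)"
proof -
 have der: "((\<lambda>t. N (x(a := t)) i l) has_field_derivative
   - (\<Sum>j\<in>K. \<Sum>k\<in>K. N x i j * pdv a (\<lambda>z. B z j k) x * N x k l)) (at (x a))"
  if x: "x \<in> U" and a: "a \<in> I" and il: "i \<in> K" "l \<in> K" for x a i l
 proof -
  have ev: "\<forall>\<^sub>F t in at (x a). x(a := t) \<in> U"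
   using open_crd_upd[OF I x a] by (simp add: eventually_at_filter eventually_mono)
  have Bd: "((\<lambda>t. B (x(a := t)) j k) has_field_derivative pdv a (\<lambda>z. B z j k) x) (at (x a))"
   if "j \<in> K" "k \<in> K" for j k
   by (rule pdv_has_derivative[OF smooth_crdD[OF B[OF that]] a x])
  have Bt: "((\<lambda>t. B (x(a := t)) j k) \<longlongrightarrow> B x j k) (at (x a))" if "j \<in> K" "k \<in> K" for j k
   using DERIV_isCont[OF Bd[OF that]] by (simp add: isCont_def)
  have Nt: "((\<lambda>t. N (x(a := t)) i j) \<longlongrightarrow> N x i j) (at (x a))" if "i \<in> K" "j \<in> K" for i j
   by (rule tendsto_inverse_matrix[where B = B and U = U and \<phi> = "\<lambda>t. x(a := t)"])
    (use K l r ev x Bt that in auto)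
  have "((\<lambda>t. - (\<Sum>j\<in>K. \<Sum>k\<in>K. N (x(a := t)) i j *
     ((B (x(a := t)) j k - B x j k) / (t - x a)) * N x k l)) \<longlongrightarrow>
    - (\<Sum>j\<in>K. \<Sum>k\<in>K. N x i j * pdv a (\<lambda>z. B z j k) x * N x k l)) (at (x a))"
   using Bd il unfolding has_field_derivative_iff
   by (intro tendsto_intros Nt) auto
  moreover have "\<forall>\<^sub>F t in at (x a). - (\<Sum>j\<in>K. \<Sum>k\<in>K. N (x(a := t)) i j *
     ((B (x(a := t)) j k - B x j k) / (t - x a)) * N x k l) =
    (N (x(a := t)) i l - N x i l) / (t - x a)"
   using ev
  proof eventually_elim
   case (elim t)
   have "N (x(a := t)) i l - N x i l =
     - (\<Sum>j\<in>K. \<Sum>k\<in>K. N (x(a := t)) i j * (B (x(a := t)) j k - B x j k) * N x k l)"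
    by (rule resolvent_identity[OF K l[OF elim] r[OF x] il])
   then show ?case by (simp add: sum_divide_distrib)
  qed
  ultimately show ?thesis
   unfolding has_field_derivative_iff by (simp add: filterlim_cong)
 qed
 have "C_diff n I U (\<lambda>x. N x i l)" if "i \<in> K" "l \<in> K" for n i l
  using that
 proof (induction n arbitrary: i l)
  case 0
  have "((\<lambda>z. N z i l) \<longlongrightarrow> N x i l) (at x within U)" if x: "x \<in> U" for x
  proof (rule tendsto_inverse_matrix[where B = B and U = U and \<phi> = "\<lambda>z. z"])
   show "\<forall>\<^sub>F t in at x within U. t \<in> U" by (simp add: eventually_at_filter)
   show "((\<lambda>t. B t j k) \<longlongrightarrow> B x j k) (at x within U)" if "j \<in> K" "k \<in> K" for j k
    using C_diff_imp_cont[OF smooth_crdD[OF B[OF that]]] x by (simp add: continuous_on_def)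
  qed (use K l r x 0 in auto)
  then show ?case by (simp add: continuous_on_def)
 next
  case (Suc n)
  show ?case unfolding C_diff_Suc_pdv
  proof (intro conjI ballI)
   show "continuous_on U (\<lambda>x. N x i l)" by (rule C_diff_imp_cont[OF Suc.IH[OF Suc.prems]])
   fix a assume a: "a \<in> I"
   have "C_diff n I U (\<lambda>x. (-1) * (\<Sum>j\<in>K. \<Sum>k\<in>K. N x i j * pdv a (\<lambda>z. B z j k) x * N x k l))"
    by (intro C_diff_mult[OF I] C_diff_sum[OF I] C_diff_const Suc.IH smooth_crdD[OF smooth_crd_pdv]
      B a Suc.prems)
   then show "C_diff n I U (pdv a (\<lambda>x. N x i l))"
   proof (rule C_diff_cong_imp[OF I])
    fix x assume "x \<in> U"
    from DERIV_imp_deriv[OF der[OF this a Suc.prems]]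
    show "pdv a (\<lambda>x. N x i l) x = (-1) * (\<Sum>j\<in>K. \<Sum>k\<in>K. N x i j * pdv a (\<lambda>z. B z j k) x * N x k l)"
     by (simp add: pdv_def)
   qed
   fix x assume "x \<in> U"
   from der[OF this a Suc.prems] show "(\<lambda>t. N (x(a := t)) i l) field_differentiable at (x a)"
    unfolding field_differentiable_def by blast
  qed
 qed
 then show ?thesis using il unfolding smooth_crd_def by blast
qed

subsection \<open>Homogeneous functions\<close>

text \<open>The action of the real numbers in coordinates.\<close>

definition scl :: "('i \<Rightarrow> nat) \<Rightarrow> real \<Rightarrow> ('i \<Rightarrow> real) \<Rightarrow> 'i \<Rightarrow> real" where
 "scl w t z = (\<lambda>i. t ^ w i * z i)"

definition base_of :: "'i set \<Rightarrow> ('i \<Rightarrow> nat) \<Rightarrow> 'i set" where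
 "base_of I w = {i\<in>I. w i = 0}"

text \<open>The coordinate domain of a bundle chart over the base domain \<open>B\<close>: the fibre coordinates are free.\<close>

definition cyl :: "'i set \<Rightarrow> ('i \<Rightarrow> nat) \<Rightarrow> ('i \<Rightarrow> real) set \<Rightarrow> ('i \<Rightarrow> real) set" where
 "cyl I w B = {z \<in> crd I. restr (base_of I w) z \<in> B}"

lemma base_of_subset: "base_of I w \<subseteq> I"
 by (auto simp: base_of_def)

lemma restr_crd: "restr J z \<in> crd J"
 by (simp add: restr_def crd_def)

lemma restr_apply: "restr J z i = (if i \<in> J then z i else 0)"
 by (simp add: restr_def)

lemma open_cyl:
 assumes "finite I" "open_crd (base_of I w) B"
 shows "open_crd I (cyl I w B)"
proof -
 have "open_crd I {z \<in> crd I. restr (base_of I w) z \<in> B}"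
 proof (rule open_crd_preimage[OF assms(1)])
  show "open_crd I (crd I)" by (simp add: open_crd_def)
  show "finite (base_of I w)" using assms(1) by (simp add: base_of_def)
  show "smooth_crd I (crd I) (\<lambda>z. restr (base_of I w) z j)" if "j \<in> base_of I w" for j
   using that smooth_crd_coord by (simp add: restr_apply)
 qed (use assms restr_crd in auto)
 then show ?thesis by (simp add: cyl_def)
qed

lemma scl_cyl: "z \<in> cyl I w B \<Longrightarrow> scl w t z \<in> cyl I w B"
proof -
 have "restr (base_of I w) (scl w t z) = restr (base_of I w) z"
  by (auto simp: restr_def scl_def base_of_def)
 then show "z \<in> cyl I w B \<Longrightarrow> scl w t z \<in> cyl I w B"
  by (auto simp: cyl_def crd_def scl_def)
qed

lemma cyl_add_fibre:
 assumes "z \<in> cyl I w B" "v \<in> crd I" "\<And>i. w i = 0 \<Longrightarrow> v i = 0"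
 shows "(\<lambda>i. z i + v i) \<in> cyl I w B"
proof -
 have "restr (base_of I w) (\<lambda>i. z i + v i) = restr (base_of I w) z"
  using assms(3) by (auto simp: restr_def base_of_def)
 then show ?thesis using assms by (auto simp: cyl_def crd_def)
qed

definition homog_on :: "('i \<Rightarrow> nat) \<Rightarrow> nat \<Rightarrow> ('i \<Rightarrow> real) set \<Rightarrow> (('i \<Rightarrow> real) \<Rightarrow> real) \<Rightarrow> bool" where
 "homog_on w d U f \<longleftrightarrow> (\<forall>z\<in>U. \<forall>t. f (scl w t z) = t ^ d * f z)"

lemma scl_one [simp]: "scl w 1 z = z"
 by (simp add: scl_def)

lemma scl_has_derivative:
 "((\<lambda>t. scl w t z i) has_field_derivative (real (w i) * t ^ (w i - 1) * z i)) (at t)"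
proof -
 have "((\<lambda>t. t ^ n * c) has_field_derivative (real n * t ^ (n - 1) * c)) (at t)" for n c
  by (auto intro!: derivative_eq_intros)
 then show ?thesis by (simp add: scl_def)
qed

context
 fixes I :: "'i set" and w :: "'i \<Rightarrow> nat" and B :: "('i \<Rightarrow> real) set"
 assumes I: "finite I" and B: "open_crd (base_of I w) B"
begin

lemma pdv_homog:
 assumes f: "smooth_crd I (cyl I w B) f" "homog_on w d (cyl I w B) f"
  and z: "z \<in> cyl I w B" and i: "i \<in> I"
 shows "t ^ w i * pdv i f (scl w t z) = t ^ d * pdv i f z"
proof -
 let ?O = "cyl I w B"
 have O: "open_crd I ?O" by (rule open_cyl[OF I B])
 have "((\<lambda>s. f (z(i := s))) has_field_derivative pdv i f z) (at (z i))"
  by (rule pdv_has_derivative[OF smooth_crdD[OF f(1)] i z])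
 then have 1: "((\<lambda>s. t ^ d * f (z(i := s))) has_field_derivative t ^ d * pdv i f z) (at (z i))"
  by (rule DERIV_cmult)
 have "((\<lambda>s. f ((scl w t z)(i := s))) has_field_derivative pdv i f (scl w t z)) (at (t ^ w i * z i))"
  using pdv_has_derivative[OF smooth_crdD[OF f(1)] i scl_cyl[OF z]] by (simp add: scl_def)
 moreover have "((\<lambda>s. t ^ w i * s) has_field_derivative t ^ w i) (at (z i))"
  using DERIV_cmult_Id by blast
 ultimately have 2: "((\<lambda>s. f ((scl w t z)(i := t ^ w i * s))) has_field_derivative
   pdv i f (scl w t z) * t ^ w i) (at (z i))"
  by (rule DERIV_chain2)
 have "\<forall>\<^sub>F s in nhds (z i). f ((scl w t z)(i := t ^ w i * s)) = t ^ d * f (z(i := s))"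
  using open_crd_upd[OF I O z i]
 proof eventually_elim
  case (elim s)
  have "(scl w t z)(i := t ^ w i * s) = scl w t (z(i := s))" by (auto simp: scl_def)
  then show ?case using f(2) elim by (simp add: homog_on_def)
 qed
 then have "((\<lambda>s. t ^ d * f (z(i := s))) has_field_derivative
   pdv i f (scl w t z) * t ^ w i) (at (z i))"
  using 2 by (subst (asm) DERIV_cong_ev) auto
 from DERIV_unique[OF this 1] show ?thesis by (simp add: mult.commute)
qed

lemma continuous_scl:
 assumes "smooth_crd I (cyl I w B) f" "z \<in> cyl I w B"
 shows "((\<lambda>t. f (scl w t z)) \<longlongrightarrow> f (scl w 0 z)) (at 0)"
proof -
 have "continuous_on UNIV (\<lambda>t. scl w t z)"
  unfolding scl_def by (intro continuous_on_coordinatewise_then_product continuous_intros)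
 then have "continuous_on UNIV (\<lambda>t. f (scl w t z))"
  by (rule continuous_on_compose2[OF C_diff_imp_cont[OF smooth_crdD[OF assms(1)]]])
   (use scl_cyl[OF assms(2)] in auto)
 then show ?thesis by (simp add: continuous_on_def)
qed

text \<open>For \<open>t \<noteq> 0\<close> a power of \<open>t\<close> cancels in \<open>pdv_homog\<close>; the value at \<open>t = 0\<close> is reached by continuity.\<close>

lemma pdv_homog_le:
 assumes f: "smooth_crd I (cyl I w B) f" "homog_on w d (cyl I w B) f" and i: "i \<in> I" "w i \<le> d"
 shows "homog_on w (d - w i) (cyl I w B) (pdv i f)"
 unfolding homog_on_def
proof (intro ballI allI)
 fix z t assume z: "z \<in> cyl I w B"
 have nz: "pdv i f (scl w t z) = t ^ (d - w i) * pdv i f z" if "t \<noteq> 0" for t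
 proof -
  have "t ^ w i * pdv i f (scl w t z) = t ^ w i * (t ^ (d - w i) * pdv i f z)"
   using pdv_homog[OF f z i(1), of t] i(2) by (simp add: power_add [symmetric] mult.assoc [symmetric])
  then show ?thesis using that by simp
 qed
 show "pdv i f (scl w t z) = t ^ (d - w i) * pdv i f z"
 proof (cases "t = 0")
  case True
  have "((\<lambda>t. pdv i f (scl w t z)) \<longlongrightarrow> pdv i f (scl w 0 z)) (at 0)"
   by (rule continuous_scl[OF smooth_crd_pdv[OF f(1) i(1)] z])
  moreover have lim0: "((\<lambda>t. t ^ (d - w i) * pdv i f z) \<longlongrightarrow> 0 ^ (d - w i) * pdv i f z) (at 0)"
   by (intro tendsto_intros)
  moreover have "\<forall>\<^sub>F t in at 0. pdv i f (scl w t z) = t ^ (d - w i) * pdv i f z"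
   using nz by (simp add: eventually_at_filter)
  ultimately have "((\<lambda>t. t ^ (d - w i) * pdv i f z) \<longlongrightarrow> pdv i f (scl w 0 z)) (at 0)"
   by (simp add: filterlim_cong)
  from LIM_unique[OF this lim0] show ?thesis using True by simp
 qed (use nz in auto)
qed

text \<open>A homogeneous function does not depend on coordinates of weight above its degree: for \<open>t \<rightarrow> 0\<close> the
  scaling relation has a positive power of \<open>t\<close> on one side only.\<close>

lemma pdv_homog_gt:
 assumes f: "smooth_crd I (cyl I w B) f" "homog_on w d (cyl I w B) f" and i: "i \<in> I" "d < w i"
  and z: "z \<in> cyl I w B"
 shows "pdv i f z = 0"
proof -
 have nz: "pdv i f z = t ^ (w i - d) * pdv i f (scl w t z)" if "t \<noteq> 0" for t
 proof -
  have "t ^ d * pdv i f z = t ^ d * (t ^ (w i - d) * pdv i f (scl w t z))"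
   using pdv_homog[OF f z i(1), of t] i(2) by (simp add: power_add [symmetric] mult.assoc [symmetric])
  then show ?thesis using that by simp
 qed
 have "((\<lambda>t. t ^ (w i - d) * pdv i f (scl w t z)) \<longlongrightarrow> 0 ^ (w i - d) * pdv i f (scl w 0 z)) (at 0)"
  by (intro tendsto_intros continuous_scl[OF smooth_crd_pdv[OF f(1) i(1)] z])
 moreover have "\<forall>\<^sub>F t in at 0. t ^ (w i - d) * pdv i f (scl w t z) = pdv i f z"
  using nz by (simp add: eventually_at_filter)
 ultimately have "((\<lambda>t::real. pdv i f z) \<longlongrightarrow> 0 ^ (w i - d) * pdv i f (scl w 0 z)) (at 0)"
  by (rule Lim_transform_eventually)
 then have "pdv i f z = 0 ^ (w i - d) * pdv i f (scl w 0 z)"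
  by (simp add: LIM_const_eq)
 then show ?thesis using i(2) by simp
qed

lemma euler_homog:
 assumes f: "smooth_crd I (cyl I w B) f" "homog_on w d (cyl I w B) f" and z: "z \<in> cyl I w B"
 shows "real d * f z = (\<Sum>i\<in>{i\<in>I. 0 < w i \<and> w i \<le> d}. real (w i) * z i * pdv i f z)"
proof -
 have O: "open_crd I (cyl I w B)" by (rule open_cyl[OF I B])
 have "((\<lambda>t. f (scl w t z)) has_field_derivative
   (\<Sum>i\<in>I. pdv i f (scl w 1 z) * (real (w i) * 1 ^ (w i - 1) * z i))) (at 1)"
 proof (rule chain_rule_curve[OF I O smooth_crdD[OF f(1)]])
  show "scl w 1 z \<in> cyl I w B" by (rule scl_cyl[OF z])
  show "scl w t z \<in> crd I" for t using scl_cyl[OF z, of t] by (simp add: cyl_def)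
 qed (rule scl_has_derivative)
 moreover have "((\<lambda>t. f (scl w t z)) has_field_derivative real d * f z) (at 1)"
 proof -
  have "((\<lambda>t. t ^ d * f z) has_field_derivative real d * f z) (at 1)"
   by (auto intro!: derivative_eq_intros)
  then show ?thesis using f(2) z by (simp add: homog_on_def)
 qed
 ultimately have "real d * f z = (\<Sum>i\<in>I. pdv i f z * (real (w i) * z i))"
  using DERIV_unique by fastforce
 also have "\<dots> = (\<Sum>i\<in>{i\<in>I. 0 < w i \<and> w i \<le> d}. real (w i) * z i * pdv i f z)"
 proof (intro sum.mono_neutral_cong_right ballI)
  fix i assume "i \<in> I - {i\<in>I. 0 < w i \<and> w i \<le> d}"
  then have "w i = 0 \<or> pdv i f z = 0" using pdv_homog_gt[OF f _ _ z, of i] by force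
  then show "pdv i f z * (real (w i) * z i) = 0" by auto
 qed (use I in auto)
 finally show ?thesis .
qed

end

subsection \<open>Curves\<close>

definition smooth_curve_on :: "real set \<Rightarrow> (real \<Rightarrow> real) \<Rightarrow> bool" where
 "smooth_curve_on S u \<longleftrightarrow> (\<forall>t\<in>S. \<forall>n. (deriv ^^ n) u field_differentiable (at t))"

lemma finite_unit: "finite (UNIV :: unit set)"
 by simp

lemma open_crd_unit: "open_crd (UNIV :: unit set) {z. z () \<in> S} \<longleftrightarrow> open S"
proof -
 have [simp]: "crd (UNIV :: unit set) = UNIV" by (auto simp: crd_def)
 show ?thesis
  unfolding open_crd_iff[OF finite_unit] open_dist
 proof (intro iffI ballI conjI)
  fix x assume *: "{z. z () \<in> S} \<subseteq> crd UNIV \<and> (\<forall>x\<in>{z. z () \<in> S}. \<exists>\<epsilon>>0. \<forall>y\<in>crd UNIV.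
    (\<forall>i\<in>UNIV. \<bar>y i - x i\<bar> < \<epsilon>) \<longrightarrow> y \<in> {z. z () \<in> S})" and "x \<in> S"
  then have "(\<lambda>_::unit. x) \<in> {z. z () \<in> S}" by simp
  with * obtain e where e: "e > 0"
   "\<forall>y\<in>crd UNIV. (\<forall>i\<in>UNIV. \<bar>y i - x\<bar> < e) \<longrightarrow> y \<in> {z::unit \<Rightarrow> real. z () \<in> S}"
   by meson
  have "\<forall>y. \<bar>y - x\<bar> < e \<longrightarrow> y \<in> S"
  proof (intro allI impI)
   fix y assume "\<bar>y - x\<bar> < e"
   then show "y \<in> S" using bspec[OF e(2), of "\<lambda>_::unit. y"] by simp
  qed
  with e(1) show "\<exists>e>0. \<forall>y. dist y x < e \<longrightarrow> y \<in> S" by (auto simp: dist_real_def)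
 next
  fix x :: "unit \<Rightarrow> real"
  assume "\<forall>x\<in>S. \<exists>e>0. \<forall>y. dist y x < e \<longrightarrow> y \<in> S" "x \<in> {z. z () \<in> S}"
  then obtain e where "e > 0" "\<forall>y. dist y (x ()) < e \<longrightarrow> y \<in> S" by blast
  then show "\<exists>\<epsilon>>0. \<forall>y\<in>crd UNIV. (\<forall>i\<in>UNIV. \<bar>y i - x i\<bar> < \<epsilon>) \<longrightarrow> y \<in> {z. z () \<in> S}"
   by (intro exI[of _ e]) (simp add: dist_real_def)
 qed simp
qed

lemma smooth_curve_on_iff:
 assumes "open S"
 shows "smooth_curve_on S u \<longleftrightarrow> smooth_crd (UNIV :: unit set) {z. z () \<in> S} (\<lambda>z. u (z ()))"
proof -
 have pd: "pdv () (\<lambda>z. u (z ())) = (\<lambda>z. deriv u (z ()))" for u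
  by (auto simp: pdv_def fun_eq_iff)
 have cont: "continuous_on {z::unit \<Rightarrow> real. z () \<in> S} (\<lambda>z. u (z ()))"
  if "\<forall>t\<in>S. u field_differentiable (at t)" for u
 proof -
  have "continuous_on S u"
   using that by (auto intro!: continuous_at_imp_continuous_on field_differentiable_imp_continuous_at)
  then show ?thesis by (rule continuous_on_compose2) (auto intro: continuous_on_coord)
 qed
 have "(\<forall>n. C_diff n (UNIV :: unit set) {z. z () \<in> S} (\<lambda>z. u (z ()))) \<longleftrightarrow> smooth_curve_on S u"
 proof
  assume a: "\<forall>n. C_diff n (UNIV :: unit set) {z. z () \<in> S} (\<lambda>z. u (z ()))"
  have b: "\<forall>k. C_diff k (UNIV :: unit set) {z. z () \<in> S} (\<lambda>z. (deriv ^^ n) u (z ()))" for n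
  proof (induction n)
   case (Suc n)
   show ?case
   proof
    fix k
    from spec[OF Suc, of "Suc k"] show "C_diff k UNIV {z. z () \<in> S} (\<lambda>z. (deriv ^^ Suc n) u (z ()))"
     unfolding C_diff_Suc_pdv by (simp add: pd)
   qed
  qed (use a in simp)
  have "(deriv ^^ n) u field_differentiable (at t)" if "t \<in> S" for n t
   using spec[OF b[of n], of "Suc 0"] that unfolding C_diff_Suc_pdv by auto
  then show "smooth_curve_on S u" by (auto simp: smooth_curve_on_def)
 next
  have "C_diff k (UNIV :: unit set) {z. z () \<in> S} (\<lambda>z. u (z ()))"
   if "\<forall>t\<in>S. \<forall>n. (deriv ^^ n) u field_differentiable (at t)" for k u
   using that
  proof (induction k arbitrary: u)
   case 0
   then have "\<forall>t\<in>S. u field_differentiable (at t)" by (metis funpow_0)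
   then show ?case using cont by simp
  next
   case (Suc k)
   have u: "\<forall>t\<in>S. u field_differentiable (at t)" using Suc.prems by (metis funpow_0)
   have "\<forall>t\<in>S. \<forall>n. (deriv ^^ n) (deriv u) field_differentiable (at t)"
    using Suc.prems by (metis funpow_Suc_right o_apply)
   from Suc.IH[OF this] show ?case
    unfolding C_diff_Suc_pdv using cont[OF u] u by (auto simp: pd)
  qed
  then show "\<forall>n. C_diff n (UNIV :: unit set) {z. z () \<in> S} (\<lambda>z. u (z ()))" if "smooth_curve_on S u"
   using that by (auto simp: smooth_curve_on_def)
 qed
 then show ?thesis by (simp add: smooth_crd_def)
qed

lemma smooth_curve_on_comp:
 assumes "open S" "finite J" "open_crd J V" "smooth_crd J V f"
  and "\<And>t. t \<in> S \<Longrightarrow> c t \<in> V" "\<And>j. j \<in> J \<Longrightarrow> smooth_curve_on S (\<lambda>t. c t j)"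
 shows "smooth_curve_on S (\<lambda>t. f (c t))"
 unfolding smooth_curve_on_iff[OF assms(1)]
 by (rule smooth_crd_comp[OF finite_unit _ assms(2,3) _ _ assms(4), where g = "\<lambda>z. c (z ())"])
  (use assms in \<open>auto simp: open_crd_unit smooth_curve_on_iff[OF assms(1)]\<close>)

lemma smooth_curve_on_cong:
 assumes "open S" "smooth_curve_on S u" "\<And>t. t \<in> S \<Longrightarrow> v t = u t"
 shows "smooth_curve_on S v"
 using assms(2) unfolding smooth_curve_on_iff[OF assms(1)]
 by (rule smooth_crd_cong_imp[OF finite_unit, rotated]) (use assms open_crd_unit in auto)

lemma smooth_curve_on_subset: "smooth_curve_on S u \<Longrightarrow> T \<subseteq> S \<Longrightarrow> smooth_curve_on T u"
 by (auto simp: smooth_curve_on_def)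

lemma smooth_curve_on_deriv:
 "smooth_curve_on S u \<Longrightarrow> t \<in> S \<Longrightarrow> (u has_field_derivative deriv u t) (at t)"
 unfolding smooth_curve_on_def DERIV_deriv_iff_field_differentiable by (metis funpow_0)

lemma smooth_curve_on_affine: "smooth_curve_on S (\<lambda>t. a + b * t)"
proof -
 have "deriv (\<lambda>t. a + b * t) = (\<lambda>t. b)" for a b :: real
  by (auto simp: fun_eq_iff intro!: DERIV_imp_deriv derivative_eq_intros)
 from this[of a b] this[of _ 0]
 have "(deriv ^^ n) (\<lambda>t. a + b * t) \<in> {\<lambda>t. a + b * t, \<lambda>t. b, \<lambda>t. 0}" for n
 proof (induction n)
  case (Suc n)
  have "deriv (\<lambda>t::real. c) = (\<lambda>t. 0)" for c :: real by (auto simp: fun_eq_iff)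
  then show ?case using Suc by auto
 qed simp
 moreover have "(\<lambda>t. a + b * t) field_differentiable (at t)" for t
  by (auto intro!: derivative_intros)
 moreover have "(\<lambda>t. c) field_differentiable (at t)" for c t :: real
  by (rule field_differentiable_const)
 ultimately have "(deriv ^^ n) (\<lambda>t. a + b * t) field_differentiable (at t)" for n t
  by (metis empty_iff insert_iff)
 then show ?thesis by (simp add: smooth_curve_on_def)
qed

lemma scl_zero:
 assumes "z \<in> crd I"
 shows "scl w 0 z = restr (base_of I w) z"
 using assms by (auto simp: scl_def restr_def base_of_def crd_def fun_eq_iff power_0_left)

lemma restr_base_idem [simp]: "restr J (restr J z) = restr J z"
 by (auto simp: restr_def)

lemma restr_id: "z \<in> crd J \<Longrightarrow> restr J z = z"
 by (auto simp: restr_def crd_def)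

lemma finite_monomials:
 assumes "finite I"
 shows "finite (monomials I w d)"
proof (rule finite_subset)
 show "monomials I w d \<subseteq> {\<alpha>. \<forall>i. (i \<in> I \<longrightarrow> \<alpha> i \<in> {..d}) \<and> (i \<notin> I \<longrightarrow> \<alpha> i = 0)}"
 proof (intro subsetI CollectI allI conjI impI)
  fix \<alpha> i assume \<alpha>: "\<alpha> \<in> monomials I w d"
  show "\<alpha> i \<in> {..d}" if i: "i \<in> I"
  proof (cases "w i = 0")
   case True
   then show ?thesis using \<alpha> by (simp add: monomials_def)
  next
   case False
   have "\<alpha> i \<le> \<alpha> i * w i" using False by simp
   also have "\<dots> \<le> (\<Sum>i\<in>I. \<alpha> i * w i)" using assms i by (intro member_le_sum) auto
   finally show ?thesis using \<alpha> by (simp add: monomials_def)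
  qed
  show "\<alpha> i = 0" if "i \<notin> I" using that \<alpha> by (simp add: monomials_def)
 qed
 show "finite {\<alpha>. \<forall>i. (i \<in> I \<longrightarrow> \<alpha> i \<in> {..d}) \<and> (i \<notin> I \<longrightarrow> \<alpha> i = 0)}"
  by (rule finite_set_of_finite_funs) (use assms in auto)
qed

lemma monomials_zero: "finite I \<Longrightarrow> monomials I w 0 = {\<lambda>_. 0}"
 by (auto simp: monomials_def fun_eq_iff)

lemma monomials_incr:
 assumes I: "finite I" and i: "i \<in> I" "0 < w i" "w i \<le> d"
 shows "bij_betw (\<lambda>\<beta>. \<beta>(i := Suc (\<beta> i))) (monomials I w (d - w i)) {\<alpha> \<in> monomials I w d. 0 < \<alpha> i}"
proof (rule bij_betwI[where g = "\<lambda>\<alpha>. \<alpha>(i := \<alpha> i - 1)"])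
 have S: "(\<Sum>j\<in>I. (\<beta>(i := n)) j * w j) + \<beta> i * w i = (\<Sum>j\<in>I. \<beta> j * w j) + n * w i" for \<beta> n
 proof -
  have "(\<Sum>j\<in>I. (\<beta>(i := n)) j * w j) = n * w i + (\<Sum>j\<in>I - {i}. (\<beta>(i := n)) j * w j)"
   by (subst sum.remove[OF I i(1)]) simp
  moreover have "(\<Sum>j\<in>I - {i}. (\<beta>(i := n)) j * w j) = (\<Sum>j\<in>I - {i}. \<beta> j * w j)"
   by (rule sum.cong) auto
  moreover have "(\<Sum>j\<in>I. \<beta> j * w j) = \<beta> i * w i + (\<Sum>j\<in>I - {i}. \<beta> j * w j)"
   by (rule sum.remove[OF I i(1)])
  ultimately show ?thesis by simp
 qed
 show "(\<lambda>\<beta>. \<beta>(i := Suc (\<beta> i))) \<in> monomials I w (d - w i) \<rightarrow> {\<alpha> \<in> monomials I w d. 0 < \<alpha> i}"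
 proof (rule funcsetI)
  fix \<beta> assume \<beta>: "\<beta> \<in> monomials I w (d - w i)"
  have "(\<Sum>j\<in>I. (\<beta>(i := Suc (\<beta> i))) j * w j) = d"
   using S[of \<beta> "Suc (\<beta> i)"] \<beta> i(3) by (simp add: monomials_def)
  then show "\<beta>(i := Suc (\<beta> i)) \<in> {\<alpha> \<in> monomials I w d. 0 < \<alpha> i}"
   using \<beta> i unfolding monomials_def by auto
 qed
 show "(\<lambda>\<alpha>. \<alpha>(i := \<alpha> i - 1)) \<in> {\<alpha> \<in> monomials I w d. 0 < \<alpha> i} \<rightarrow> monomials I w (d - w i)"
 proof (rule funcsetI)
  fix \<alpha> assume \<alpha>: "\<alpha> \<in> {\<alpha> \<in> monomials I w d. 0 < \<alpha> i}"
  obtain m where m: "\<alpha> i = Suc m" using \<alpha> by (auto simp: gr0_conv_Suc)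
  have "(\<Sum>j\<in>I. (\<alpha>(i := \<alpha> i - 1)) j * w j) = d - w i"
   using S[of \<alpha> "\<alpha> i - 1"] \<alpha> by (simp add: monomials_def m)
  then show "\<alpha>(i := \<alpha> i - 1) \<in> monomials I w (d - w i)"
   using \<alpha> i unfolding monomials_def by auto
 qed
qed auto

lemma prod_power_incr:
 fixes z :: "'i \<Rightarrow> real"
 assumes "finite I" "i \<in> I"
 shows "(\<Prod>j\<in>I. z j ^ (\<beta>(i := Suc (\<beta> i))) j) = z i * (\<Prod>j\<in>I. z j ^ \<beta> j)"
proof -
 have "(\<Prod>j\<in>I - {i}. z j ^ (\<beta>(i := Suc (\<beta> i))) j) = (\<Prod>j\<in>I - {i}. z j ^ \<beta> j)"
  by (rule prod.cong) auto
 then show ?thesis by (simp add: prod.remove[OF assms] mult.assoc)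
qed

lemma prod_monomial_scl:
 fixes z :: "'i \<Rightarrow> real"
 assumes "\<alpha> \<in> monomials I w d"
 shows "(\<Prod>j\<in>I. scl w t z j ^ \<alpha> j) = t ^ d * (\<Prod>j\<in>I. z j ^ \<alpha> j)"
proof -
 have "(\<Prod>j\<in>I. scl w t z j ^ \<alpha> j) = (\<Prod>j\<in>I. t ^ (\<alpha> j * w j)) * (\<Prod>j\<in>I. z j ^ \<alpha> j)"
  by (simp add: scl_def power_mult_distrib prod.distrib power_mult [symmetric] mult.commute)
 also have "(\<Prod>j\<in>I. t ^ (\<alpha> j * w j)) = t ^ d"
  using assms by (simp add: monomials_def power_sum [symmetric])
 finally show ?thesis .
qed

context
 fixes I :: "'i set" and w :: "'i \<Rightarrow> nat" and B :: "('i \<Rightarrow> real) set"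
 assumes I: "finite I" and B: "open_crd (base_of I w) B"
begin

lemma smooth_crd_to_base:
 assumes "smooth_crd I (cyl I w B) f"
 shows "smooth_crd (base_of I w) B f"
proof -
 have "smooth_crd (base_of I w) B (\<lambda>z. f (id z))"
 proof (rule smooth_crd_comp[OF _ B I open_cyl[OF I B] _ _ assms])
  show "finite (base_of I w)" using I by (simp add: base_of_def)
  fix z assume z: "z \<in> B"
  then have "z \<in> crd (base_of I w)" using open_crd_subset[OF B] by blast
  then show "id z \<in> cyl I w B" using z by (auto simp: cyl_def restr_id crd_def base_of_def)
 qed (simp add: smooth_crd_coord)
 then show ?thesis by simp
qed

lemma smooth_crd_from_base:
 assumes "smooth_crd (base_of I w) B g"
 shows "smooth_crd I (cyl I w B) (\<lambda>z. g (restr (base_of I w) z))"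
proof (rule smooth_crd_comp[OF I open_cyl[OF I B] _ B _ _ assms])
 show "finite (base_of I w)" using I by (simp add: base_of_def)
 show "smooth_crd I (cyl I w B) (\<lambda>z. restr (base_of I w) z j)" if "j \<in> base_of I w" for j
  using that by (simp add: restr_apply smooth_crd_coord)
qed (simp add: cyl_def)

lemma homog_0_base:
 assumes "homog_on w 0 (cyl I w B) f" "z \<in> cyl I w B"
 shows "f z = f (restr (base_of I w) z)"
proof -
 have "f (scl w 0 z) = 0 ^ 0 * f z" using assms by (simp only: homog_on_def)
 then show ?thesis using assms(2) by (simp add: scl_zero[where I = I] cyl_def)
qed

text \<open>By Euler's identity \<open>d \<cdot> f = \<Sum>\<^sub>i w i \<cdot> z i \<cdot> \<partial>\<^sub>i f\<close>, and the derivatives that occur are homogeneous of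
  smaller degree \<open>d - w i\<close>, so induction on the degree applies.  In degree zero \<open>f\<close> is determined by its
  values on the zero section.\<close>

lemma homog_polynomial:
 assumes "smooth_crd I (cyl I w B) f" "homog_on w d (cyl I w B) f"
 shows "\<exists>c. (\<forall>\<alpha>. smooth_crd (base_of I w) B (c \<alpha>)) \<and>
  (\<forall>z\<in>cyl I w B. f z = (\<Sum>\<alpha>\<in>monomials I w d. c \<alpha> (restr (base_of I w) z) * (\<Prod>j\<in>I. z j ^ \<alpha> j)))"
 using assms
proof (induction d arbitrary: f rule: less_induct)
 case (less d)
 show ?case
 proof (cases "d = 0")
  case True
  have "f z = f (restr (base_of I w) z)" if "z \<in> cyl I w B" for z
   using homog_0_base less.prems(2) that True by simp
  then show ?thesis using True smooth_crd_to_base[OF less.prems(1)]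
   by (intro exI[of _ "\<lambda>\<alpha>. f"]) (simp add: monomials_zero[OF I])
 next
  case False
  define L where "L = {i\<in>I. 0 < w i \<and> w i \<le> d}"
  have L: "finite L" "L \<subseteq> I" using I by (auto simp: L_def)
  define P where "P i c \<longleftrightarrow> (\<forall>\<alpha>. smooth_crd (base_of I w) B (c \<alpha>)) \<and>
   (\<forall>z\<in>cyl I w B. pdv i f z = (\<Sum>\<alpha>\<in>monomials I w (d - w i). c \<alpha> (restr (base_of I w) z) * (\<Prod>j\<in>I. z j ^ \<alpha> j)))"
   for i c
  have "\<exists>c. P i c" if "i \<in> L" for i
   unfolding P_def
  proof (rule less.IH)
   have i: "i \<in> I" "0 < w i" "w i \<le> d" using that by (auto simp: L_def)
   show "d - w i < d" using i by simp
   show "smooth_crd I (cyl I w B) (pdv i f)" by (rule smooth_crd_pdv[OF less.prems(1) i(1)])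
   show "homog_on w (d - w i) (cyl I w B) (pdv i f)" by (rule pdv_homog_le[OF I B less.prems i(1,3)])
  qed
  then obtain k where kP: "\<And>i. i \<in> L \<Longrightarrow> P i (k i)" by metis
  have k: "\<And>i \<alpha>. i \<in> L \<Longrightarrow> smooth_crd (base_of I w) B (k i \<alpha>)"
   "\<And>i z. i \<in> L \<Longrightarrow> z \<in> cyl I w B \<Longrightarrow>
    pdv i f z = (\<Sum>\<alpha>\<in>monomials I w (d - w i). k i \<alpha> (restr (base_of I w) z) * (\<Prod>j\<in>I. z j ^ \<alpha> j))"
   using kP unfolding P_def by simp_all
  \<comment> \<open>The coefficient of the monomial \<open>\<alpha>\<close> on the right-hand side of the Euler identity.\<close>
  define c where "c \<alpha> b = (1 / real d) * (\<Sum>i\<in>{i\<in>L. 0 < \<alpha> i}. real (w i) * k i (\<alpha>(i := \<alpha> i - 1)) b)" for \<alpha> b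
  have "smooth_crd (base_of I w) B (c \<alpha>)" for \<alpha>
  proof -
   have "finite (base_of I w)" using I by (simp add: base_of_def)
   then have "smooth_crd (base_of I w) B
     (\<lambda>b. (1 / real d) * (\<Sum>i\<in>{i\<in>L. 0 < \<alpha> i}. real (w i) * k i (\<alpha>(i := \<alpha> i - 1)) b))"
    by (intro smooth_crd_mult smooth_crd_sum smooth_crd_const k B) auto
   then show ?thesis by (simp add: c_def [abs_def])
  qed
  moreover have "f z = (\<Sum>\<alpha>\<in>monomials I w d. c \<alpha> (restr (base_of I w) z) * (\<Prod>j\<in>I. z j ^ \<alpha> j))"
   if z: "z \<in> cyl I w B" for z
  proof -
   define b where "b = restr (base_of I w) z"
   define P where "P \<alpha> = (\<Prod>j\<in>I. z j ^ \<alpha> j)" for \<alpha>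
   have "(\<Sum>\<alpha>\<in>monomials I w d. c \<alpha> b * P \<alpha>) = (1 / real d) *
     (\<Sum>\<alpha>\<in>monomials I w d. \<Sum>i\<in>{i\<in>L. 0 < \<alpha> i}. real (w i) * k i (\<alpha>(i := \<alpha> i - 1)) b * P \<alpha>)"
    by (simp add: c_def sum_distrib_left sum_distrib_right mult.assoc)
   also have "(\<Sum>\<alpha>\<in>monomials I w d. \<Sum>i\<in>{i\<in>L. 0 < \<alpha> i}. real (w i) * k i (\<alpha>(i := \<alpha> i - 1)) b * P \<alpha>)
     = (\<Sum>i\<in>L. \<Sum>\<alpha>\<in>{\<alpha>\<in>monomials I w d. 0 < \<alpha> i}. real (w i) * k i (\<alpha>(i := \<alpha> i - 1)) b * P \<alpha>)"
    by (rule sum.swap_restrict[OF finite_monomials[OF I] L(1)])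
   also have "\<dots> = (\<Sum>i\<in>L. real (w i) * z i * pdv i f z)"
   proof (rule sum.cong[OF refl])
    fix i assume i: "i \<in> L"
    then have i': "i \<in> I" "0 < w i" "w i \<le> d" by (auto simp: L_def)
    have "(\<Sum>\<alpha>\<in>{\<alpha>\<in>monomials I w d. 0 < \<alpha> i}. real (w i) * k i (\<alpha>(i := \<alpha> i - 1)) b * P \<alpha>) =
     (\<Sum>\<beta>\<in>monomials I w (d - w i). real (w i) * k i \<beta> b * (z i * P \<beta>))"
     by (subst sum.reindex_bij_betw[OF monomials_incr[OF I i'(1), of w d, OF i'(2,3)], symmetric])
      (simp add: P_def prod_power_incr[OF I i'(1)] del: fun_upd_apply, simp)
    also have "\<dots> = real (w i) * z i * pdv i f z"
     by (simp add: k(2)[OF i z] b_def P_def sum_distrib_left mult_ac)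
    finally show "(\<Sum>\<alpha>\<in>{\<alpha>\<in>monomials I w d. 0 < \<alpha> i}. real (w i) * k i (\<alpha>(i := \<alpha> i - 1)) b * P \<alpha>) =
     real (w i) * z i * pdv i f z" .
   qed
   also have "\<dots> = real d * f z"
    using euler_homog[OF I B less.prems z] by (simp add: L_def)
   finally show ?thesis using False by (simp add: b_def P_def)
  qed
  ultimately show ?thesis by blast
 qed
qed

text \<open>Along a direction \<open>v\<close> of weight \<open>k\<close> the derivative of \<open>f\<close> only involves \<open>\<partial>\<^sub>i f\<close> with \<open>w i = k\<close>, which
  vanishes if \<open>d < k\<close> and is homogeneous of degree zero, hence constant on fibres, if \<open>d = k\<close>.  So \<open>f\<close> is
  affine along the line.\<close>

lemma homog_add_top:
 assumes f: "smooth_crd I (cyl I w B) f" "homog_on w d (cyl I w B) f"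
  and z: "z \<in> cyl I w B" and v: "v \<in> crd I" "\<And>i. w i \<noteq> k \<Longrightarrow> v i = 0" and k: "0 < k" "d \<le> k"
 shows "f (\<lambda>i. z i + v i) = f z +
  (if d = k then \<Sum>i\<in>{i\<in>I. w i = k}. pdv i f (restr (base_of I w) z) * v i else 0)"
  (is "_ = _ + ?K")
proof -
 have O: "open_crd I (cyl I w B)" by (rule open_cyl[OF I B])
 define c where "c t = (\<lambda>i. z i + t * v i)" for t
 have c: "c t \<in> cyl I w B" for t
  unfolding c_def by (rule cyl_add_fibre[OF z]) (use v k in \<open>auto simp: crd_def\<close>)
 have base: "restr (base_of I w) (c t) = restr (base_of I w) z" for t
  using v(2) k by (auto simp: c_def restr_def base_of_def)
 have K: "(\<Sum>i\<in>I. pdv i f (c t) * v i) = ?K" for t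
 proof (cases "d = k")
  case True
  have "(\<Sum>i\<in>I. pdv i f (c t) * v i) = (\<Sum>i\<in>{i\<in>I. w i = k}. pdv i f (c t) * v i)"
   using I v(2) by (intro sum.mono_neutral_right) auto
  also have "\<dots> = ?K"
  proof -
   have "pdv i f (c t) = pdv i f (restr (base_of I w) z)" if "i \<in> I" "w i = k" for i
   proof -
    have "homog_on w 0 (cyl I w B) (pdv i f)"
     using pdv_homog_le[OF I B f that(1)] that(2) True by simp
    from homog_0_base[OF this c[of t]] show ?thesis by (simp add: base)
   qed
   then show ?thesis using True by simp
  qed
  finally show ?thesis .
 next
  case False
  have "pdv i f (c t) * v i = 0" if "i \<in> I" for i
   using pdv_homog_gt[OF I B f that _ c[of t]] v(2)[of i] False k by (cases "w i = k") auto
  then show ?thesis using False by (simp add: sum.neutral)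
 qed
 have "((\<lambda>t. f (c t)) has_field_derivative (\<Sum>i\<in>I. pdv i f (c t) * v i)) (at t)" for t
 proof (rule chain_rule_curve[OF I O smooth_crdD[OF f(1)] c])
  show "c s \<in> crd I" for s using c[of s] by (simp add: cyl_def)
  show "((\<lambda>t. c t j) has_field_derivative v j) (at t)" for j
   unfolding c_def by (auto intro!: derivative_eq_intros)
 qed
 then have "((\<lambda>t. f (c t)) has_field_derivative ?K) (at t)" for t by (simp only: K)
 from MVT2[of 0 1 "\<lambda>t. f (c t)" "\<lambda>_. ?K", OF _ this] have "f (c 1) - f (c 0) = ?K" by auto
 then show ?thesis by (simp add: c_def)
qed

end

section \<open>Manifolds and their coordinate systems\<close>

lemma manifold_finite: "manifold N \<Longrightarrow> finite (idx N)"
 and manifold_cover: "manifold N \<Longrightarrow> p \<in> pts N \<Longrightarrow> \<exists>U \<phi>. (U, \<phi>) \<in> atlas N \<and> p \<in> U"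
 and manifold_chart: "manifold N \<Longrightarrow> (U, \<phi>) \<in> atlas N \<Longrightarrow>
  U \<subseteq> pts N \<and> inj_on \<phi> U \<and> open_crd (idx N) (\<phi> ` U)"
 and manifold_trans: "manifold N \<Longrightarrow> (U, \<phi>) \<in> atlas N \<Longrightarrow> (V, \<psi>) \<in> atlas N \<Longrightarrow>
  open_crd (idx N) (\<phi> ` (U \<inter> V)) \<and>
  (\<forall>i\<in>idx N. smooth_crd (idx N) (\<phi> ` (U \<inter> V)) (\<lambda>z. \<psi> (inv_into U \<phi> z) i))"
 unfolding manifold_def by (blast, force, force, force)

lemma mopen_subset: "mopen N W \<Longrightarrow> W \<subseteq> pts N"
 by (simp add: mopen_def)

lemma mopen_open: "mopen N W \<Longrightarrow> (U, \<phi>) \<in> atlas N \<Longrightarrow> open_crd (idx N) (\<phi> ` (U \<inter> W))"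
 unfolding mopen_def by blast

lemma mopen_Int:
 assumes N: "\<And>U \<phi>. (U, \<phi>) \<in> atlas N \<Longrightarrow> inj_on \<phi> U" and W: "mopen N W" "mopen N W'"
 shows "mopen N (W \<inter> W')"
proof -
 have "open_crd (idx N) (\<phi> ` (U \<inter> (W \<inter> W')))" if c: "(U, \<phi>) \<in> atlas N" for U \<phi>
 proof -
  have "\<phi> ` (U \<inter> (W \<inter> W')) = \<phi> ` (U \<inter> W) \<inter> \<phi> ` (U \<inter> W')"
   using inj_on_image_Int[OF N[OF c], of "U \<inter> W" "U \<inter> W'"] by (simp add: Int_assoc Int_left_commute)
  then show ?thesis using open_crd_Int mopen_open[OF W(1) c] mopen_open[OF W(2) c] by metis
 qed
 then show ?thesis using W unfolding mopen_def by blast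
qed

lemma mopen_Union:
 assumes "\<And>W. W \<in> \<W> \<Longrightarrow> mopen N W"
 shows "mopen N (\<Union>\<W>)"
proof -
 have "open_crd (idx N) (\<phi> ` (U \<inter> \<Union>\<W>))" if c: "(U, \<phi>) \<in> atlas N" for U \<phi>
 proof -
  have "\<phi> ` (U \<inter> \<Union>\<W>) = \<Union>((\<lambda>W. \<phi> ` (U \<inter> W)) ` \<W>)" by auto
  also have "open_crd (idx N) \<dots>"
   by (rule open_crd_Union) (use mopen_open[OF assms c] in blast)
  finally show ?thesis .
 qed
 then show ?thesis using assms mopen_subset[OF assms] unfolding mopen_def by blast
qed

lemma istopology_mopen:
 assumes "\<And>U \<phi>. (U, \<phi>) \<in> atlas N \<Longrightarrow> inj_on \<phi> U"
 shows "istopology (mopen N)"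
 unfolding istopology_def using mopen_Int[OF assms] mopen_Union by blast

lemma mopen_chart: "manifold N \<Longrightarrow> (U, \<phi>) \<in> atlas N \<Longrightarrow> mopen N U"
 unfolding mopen_def using manifold_chart[of N] manifold_trans[of N] by blast

lemma mopen_pts:
 assumes "manifold N"
 shows "mopen N (pts N)"
proof -
 have "U \<inter> pts N = U" if "(U, \<phi>) \<in> atlas N" for U \<phi>
  using manifold_chart[OF assms that] by auto
 then show ?thesis unfolding mopen_def using manifold_chart[OF assms] by fastforce
qed

lemma manifold_mopen_Int: "manifold N \<Longrightarrow> mopen N W \<Longrightarrow> mopen N W' \<Longrightarrow> mopen N (W \<inter> W')"
 using mopen_Int manifold_chart by metis

lemma coord_sysD:
 assumes "coord_sys N J (U, \<xi>)"
 shows "mopen N U" "inj_on \<xi> U" "open_crd J (\<xi> ` U)"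
  "\<And>j. j \<in> J \<Longrightarrow> smooth_real_on N U (\<lambda>p. \<xi> p j)"
  "\<And>V \<eta>. (V, \<eta>) \<in> atlas N \<Longrightarrow> open_crd J (\<xi> ` (U \<inter> V))"
  "\<And>V \<eta> i. (V, \<eta>) \<in> atlas N \<Longrightarrow> i \<in> idx N \<Longrightarrow> smooth_crd J (\<xi> ` (U \<inter> V)) (\<lambda>z. \<eta> (inv_into U \<xi> z) i)"
 using assms unfolding coord_sys_def by auto

lemma coord_sys_atlas:
 assumes N: "manifold N" and c: "(U, \<phi>) \<in> atlas N"
 shows "coord_sys N (idx N) (U, \<phi>)"
proof -
 have "smooth_real_on N U (\<lambda>p. \<phi> p j)" if "j \<in> idx N" for j
  unfolding smooth_real_on_def using mopen_chart[OF N c] manifold_trans[OF N _ c] that by auto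
 then show ?thesis unfolding coord_sys_def
  using mopen_chart[OF N c] manifold_chart[OF N c] manifold_trans[OF N c] by auto
qed

lemma smooth_real_onD:
 "smooth_real_on N W f \<Longrightarrow> (U, \<phi>) \<in> atlas N \<Longrightarrow>
   smooth_crd (idx N) (\<phi> ` (U \<inter> W)) (\<lambda>z. f (inv_into U \<phi> z))"
 unfolding smooth_real_on_def by blast

context
 fixes N :: "('p, 'i, 'z) mfd_scheme" and J :: "'j set" and U :: "'p set" and \<xi> :: "'p \<Rightarrow> 'j \<Rightarrow> real"
 assumes N: "manifold N" and J: "finite J" and cs: "coord_sys N J (U, \<xi>)"
begin

lemma coord_sys_open_image:
 assumes "mopen N W"
 shows "open_crd J (\<xi> ` (U \<inter> W))"
proof (rule open_crd_local)
 fix x assume "x \<in> \<xi> ` (U \<inter> W)"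
 then obtain p where p: "p \<in> U" "p \<in> W" "x = \<xi> p" by auto
 then obtain V \<eta> where V: "(V, \<eta>) \<in> atlas N" "p \<in> V"
  using manifold_cover[OF N, of p] mopen_subset[OF assms] by blast
 note \<eta> = manifold_chart[OF N V(1)]
 let ?g = "\<lambda>z. \<eta> (inv_into U \<xi> z)"
 have "open_crd J {z \<in> \<xi> ` (U \<inter> V). ?g z \<in> \<eta> ` (V \<inter> W)}"
 proof (rule open_crd_preimage[OF J coord_sysD(5)[OF cs V(1)] manifold_finite[OF N] mopen_open[OF assms V(1)]])
  fix z assume "z \<in> \<xi> ` (U \<inter> V)"
  then have "?g z \<in> \<eta> ` V" using coord_sysD(2)[OF cs] by (auto simp: inv_into_f_f)
  then show "?g z \<in> crd (idx N)" using open_crd_subset \<eta> by blast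
 qed (rule coord_sysD(6)[OF cs V(1)])
 moreover have "x \<in> {z \<in> \<xi> ` (U \<inter> V). ?g z \<in> \<eta> ` (V \<inter> W)}"
  using p V coord_sysD(2)[OF cs] by (auto simp: inv_into_f_f)
 moreover have "{z \<in> \<xi> ` (U \<inter> V). ?g z \<in> \<eta> ` (V \<inter> W)} \<subseteq> \<xi> ` (U \<inter> W)"
 proof
  fix y assume y: "y \<in> {z \<in> \<xi> ` (U \<inter> V). ?g z \<in> \<eta> ` (V \<inter> W)}"
  then obtain q where q: "q \<in> U" "q \<in> V" "y = \<xi> q" by auto
  with y have "\<eta> q \<in> \<eta> ` (V \<inter> W)" using coord_sysD(2)[OF cs] by (simp add: inv_into_f_f)
  then have "q \<in> W" using q \<eta> by (auto dest: inj_onD)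
  then show "y \<in> \<xi> ` (U \<inter> W)" using q by blast
 qed
 ultimately show "\<exists>V. open_crd J V \<and> x \<in> V \<and> V \<subseteq> \<xi> ` (U \<inter> W)" by blast
qed

lemma smooth_real_on_coords:
 assumes "smooth_real_on N W f"
 shows "smooth_crd J (\<xi> ` (U \<inter> W)) (\<lambda>z. f (inv_into U \<xi> z))"
proof (rule smooth_crd_local)
 fix x assume "x \<in> \<xi> ` (U \<inter> W)"
 then obtain p where p: "p \<in> U" "p \<in> W" "x = \<xi> p" by auto
 have W: "mopen N W" using assms by (simp add: smooth_real_on_def)
 obtain V \<eta> where V: "(V, \<eta>) \<in> atlas N" "p \<in> V"
  using p manifold_cover[OF N, of p] mopen_subset[OF W] by blast
 note \<eta> = manifold_chart[OF N V(1)]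
 let ?O = "\<xi> ` (U \<inter> (V \<inter> W))"
 have O: "open_crd J ?O"
  by (rule coord_sys_open_image[OF manifold_mopen_Int[OF N mopen_chart[OF N V(1)] W]])
 have "smooth_crd J ?O (\<lambda>z. f (inv_into V \<eta> (\<eta> (inv_into U \<xi> z))))"
 proof (rule smooth_crd_comp[OF J O manifold_finite[OF N] mopen_open[OF W V(1)] _ _ smooth_real_onD[OF assms V(1)]])
  show "\<eta> (inv_into U \<xi> z) \<in> \<eta> ` (V \<inter> W)" if "z \<in> ?O" for z
   using that coord_sysD(2)[OF cs] by (auto simp: inv_into_f_f)
  show "smooth_crd J ?O (\<lambda>z. \<eta> (inv_into U \<xi> z) j)" if "j \<in> idx N" for j
   by (rule smooth_crd_subset[OF coord_sysD(6)[OF cs V(1) that]]) auto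
 qed
 then have "smooth_crd J ?O (\<lambda>z. f (inv_into U \<xi> z))"
  by (rule smooth_crd_cong_imp[OF J O]) (use coord_sysD(2)[OF cs] \<eta> in \<open>auto simp: inv_into_f_f\<close>)
 moreover have "x \<in> ?O" "?O \<subseteq> \<xi> ` (U \<inter> W)" using p V by auto
 ultimately show "\<exists>V. open_crd J V \<and> x \<in> V \<and> V \<subseteq> \<xi> ` (U \<inter> W) \<and> smooth_crd J V (\<lambda>z. f (inv_into U \<xi> z))"
  using O by blast
qed

lemma smooth_real_on_from_coords:
 assumes W: "mopen N W" "W \<subseteq> U" and f: "smooth_crd J (\<xi> ` W) (\<lambda>z. f (inv_into U \<xi> z))"
 shows "smooth_real_on N W f"
 unfolding smooth_real_on_def
proof (intro conjI W(1) ballI, clarify)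
 fix V \<eta> assume V: "(V, \<eta>) \<in> atlas N"
 note \<eta> = manifold_chart[OF N V(1)]
 have O: "open_crd (idx N) (\<eta> ` (V \<inter> W))" by (rule mopen_open[OF W(1) V])
 have UW: "U \<inter> W = W" using W(2) by blast
 have "smooth_crd (idx N) (\<eta> ` (V \<inter> W)) (\<lambda>z. f (inv_into U \<xi> (\<xi> (inv_into V \<eta> z))))"
 proof (rule smooth_crd_comp[OF manifold_finite[OF N] O J _ _ _ f])
  show "open_crd J (\<xi> ` W)" using coord_sys_open_image[OF W(1)] by (simp add: UW)
  show "\<xi> (inv_into V \<eta> z) \<in> \<xi> ` W" if "z \<in> \<eta> ` (V \<inter> W)" for z
   using that \<eta> by (auto simp: inv_into_f_f)
  show "smooth_crd (idx N) (\<eta> ` (V \<inter> W)) (\<lambda>z. \<xi> (inv_into V \<eta> z) j)" if "j \<in> J" for j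
   by (rule smooth_crd_subset[OF smooth_real_onD[OF coord_sysD(4)[OF cs that] V]]) (use W(2) in auto)
 qed
 then show "smooth_crd (idx N) (\<eta> ` (V \<inter> W)) (\<lambda>z. f (inv_into V \<eta> z))"
  by (rule smooth_crd_cong_imp[OF manifold_finite[OF N] O])
   (use coord_sysD(2)[OF cs] \<eta> W(2) in \<open>auto simp: inv_into_f_f subset_iff\<close>)
qed

text \<open>The base charts of the core, of products and of prolongations are those of the original
  bundle under different labels.\<close>

lemma coord_sys_relabel:
 fixes K :: "'k set"
 assumes h: "bij_betw h K J"
 shows "coord_sys N K (U, \<lambda>p k. if k \<in> K then \<xi> p (h k) else 0)" (is "coord_sys N K (U, ?\<xi>')")
proof -
 have K: "finite K" using h J bij_betw_finite by blast
 define \<rho> :: "('j \<Rightarrow> real) \<Rightarrow> 'k \<Rightarrow> real" where "\<rho> z = (\<lambda>k. if k \<in> K then z (h k) else 0)" for z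
 define \<rho>' :: "('k \<Rightarrow> real) \<Rightarrow> 'j \<Rightarrow> real" where "\<rho>' z = (\<lambda>j. if j \<in> J then z (inv_into K h j) else 0)" for z
 have \<rho>'\<rho>: "\<rho>' (\<rho> z) = z" if "z \<in> crd J" for z
 proof
  fix j show "\<rho>' (\<rho> z) j = z j"
   using that h by (cases "j \<in> J") (auto simp: \<rho>_def \<rho>'_def crd_def bij_betw_def inv_into_into f_inv_into_f)
 qed
 have \<rho>\<rho>': "\<rho> (\<rho>' z) = z" if "z \<in> crd K" for z
 proof
  fix k show "\<rho> (\<rho>' z) k = z k"
   using that h by (cases "k \<in> K") (auto simp: \<rho>_def \<rho>'_def crd_def bij_betw_def)
 qed
 have \<rho>_crd: "\<rho> z \<in> crd K" "\<rho>' y \<in> crd J" for z y by (auto simp: \<rho>_def \<rho>'_def crd_def)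
 have \<rho>'_sm: "smooth_crd K Z (\<lambda>z. \<rho>' z j)" for Z j
  by (cases "j \<in> J") (simp_all add: \<rho>'_def smooth_crd_coord smooth_crd_const)
 have im: "\<rho> ` V = {z \<in> crd K. \<rho>' z \<in> V}" if "V \<subseteq> crd J" for V
 proof -
  have "\<rho>' (\<rho> z) \<in> V" if "z \<in> V" for z using that \<open>V \<subseteq> crd J\<close> \<rho>'\<rho> by fastforce
  moreover have "z \<in> \<rho> ` V" if "z \<in> crd K" "\<rho>' z \<in> V" for z
   using \<rho>\<rho>'[OF that(1)] that(2) by (metis imageI)
  ultimately show ?thesis using \<rho>_crd(1) by auto
 qed
 have opn: "open_crd K (\<rho> ` V)" if V: "open_crd J V" for V
  unfolding im[OF open_crd_subset[OF V]]
  by (rule open_crd_preimage[OF K _ J V]) (use \<rho>_crd \<rho>'_sm in \<open>auto simp: open_crd_def\<close>)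
 have \<xi>': "?\<xi>' = (\<lambda>p. \<rho> (\<xi> p))" by (simp add: \<rho>_def)
 have \<xi>_crd: "\<xi> p \<in> crd J" if "p \<in> U" for p
  using that open_crd_subset[OF coord_sysD(3)[OF cs]] by blast
 have inj: "inj_on ?\<xi>' U"
 proof (rule inj_onI)
  fix p q assume "p \<in> U" "q \<in> U" "?\<xi>' p = ?\<xi>' q"
  then have "\<rho>' (\<rho> (\<xi> p)) = \<rho>' (\<rho> (\<xi> q))" by (simp only: \<rho>_def)
  then show "p = q" using \<rho>'\<rho> \<xi>_crd \<open>p \<in> U\<close> \<open>q \<in> U\<close> coord_sysD(2)[OF cs] by (simp add: inj_onD)
 qed
 have image: "?\<xi>' ` W = \<rho> ` (\<xi> ` W)" for W unfolding \<xi>' by (simp add: image_image)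
 have "smooth_real_on N U (\<lambda>p. ?\<xi>' p k)" if "k \<in> K" for k
  using coord_sysD(4)[OF cs, of "h k"] that h by (auto simp: bij_betw_def)
 moreover have "smooth_crd K (?\<xi>' ` (U \<inter> V)) (\<lambda>z. \<eta> (inv_into U ?\<xi>' z) i)"
  if V: "(V, \<eta>) \<in> atlas N" and i: "i \<in> idx N" for V \<eta> i
 proof -
  have O: "open_crd K (?\<xi>' ` (U \<inter> V))" unfolding image by (rule opn[OF coord_sysD(5)[OF cs V]])
  have "smooth_crd K (?\<xi>' ` (U \<inter> V)) (\<lambda>z. \<eta> (inv_into U \<xi> (\<rho>' z)) i)"
  proof (rule smooth_crd_comp[OF K O J coord_sysD(5)[OF cs V] _ _ coord_sysD(6)[OF cs V i]])
   fix z assume "z \<in> ?\<xi>' ` (U \<inter> V)"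
   then show "\<rho>' z \<in> \<xi> ` (U \<inter> V)" unfolding \<xi>' using \<rho>'\<rho> \<xi>_crd by auto
  qed (rule \<rho>'_sm)
  then show ?thesis
  proof (rule smooth_crd_cong_imp[OF K O])
   fix y assume "y \<in> ?\<xi>' ` (U \<inter> V)"
   then obtain p where p: "p \<in> U" "p \<in> V" "y = ?\<xi>' p" by auto
   have "inv_into U ?\<xi>' y = p" unfolding p(3) by (rule inv_into_f_f[OF inj p(1)])
   moreover have "y = \<rho> (\<xi> p)" by (simp add: p(3) \<rho>_def)
   then have "\<rho>' y = \<xi> p" using p(1) \<rho>'\<rho> \<xi>_crd by simp
   ultimately show "\<eta> (inv_into U ?\<xi>' y) i = \<eta> (inv_into U \<xi> (\<rho>' y)) i"
    using coord_sysD(2)[OF cs] p by (simp add: inv_into_f_f)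
  qed
 qed
 moreover have "open_crd K (?\<xi>' ` U)" "\<And>V \<eta>. (V, \<eta>) \<in> atlas N \<Longrightarrow> open_crd K (?\<xi>' ` (U \<inter> V))"
  unfolding image using opn coord_sysD(3,5)[OF cs] by blast+
 ultimately show ?thesis unfolding coord_sys_def using coord_sysD(1)[OF cs] inj by auto
qed

lemma coord_sys_restrict:
 assumes W: "mopen N W"
 shows "coord_sys N J (U \<inter> W, \<xi>)"
proof -
 have inj: "inj_on \<xi> (U \<inter> W)" using coord_sysD(2)[OF cs] inj_on_subset by blast
 have UW: "mopen N (U \<inter> W)" by (rule manifold_mopen_Int[OF N coord_sysD(1)[OF cs] W])
 have inv: "inv_into (U \<inter> W) \<xi> z = inv_into U \<xi> z" if "z \<in> \<xi> ` (U \<inter> W)" for z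
  using that inj coord_sysD(2)[OF cs] by (auto simp: inv_into_f_f)
 have op: "open_crd J (\<xi> ` (U \<inter> W \<inter> V))" if V: "(V, \<eta>) \<in> atlas N" for V \<eta>
  using coord_sys_open_image[OF manifold_mopen_Int[OF N W mopen_chart[OF N V]]] by (simp add: Int_assoc)
 have "smooth_crd J (\<xi> ` (U \<inter> W \<inter> V)) (\<lambda>z. \<eta> (inv_into (U \<inter> W) \<xi> z) i)"
  if V: "(V, \<eta>) \<in> atlas N" and i: "i \<in> idx N" for V \<eta> i
 proof (rule smooth_crd_cong_imp[OF J op[OF V]])
  show "smooth_crd J (\<xi> ` (U \<inter> W \<inter> V)) (\<lambda>z. \<eta> (inv_into U \<xi> z) i)"
   by (rule smooth_crd_subset[OF coord_sysD(6)[OF cs V i]]) auto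
  show "\<eta> (inv_into (U \<inter> W) \<xi> y) i = \<eta> (inv_into U \<xi> y) i" if "y \<in> \<xi> ` (U \<inter> W \<inter> V)" for y
   using inv[of y] that by fastforce
 qed
 moreover have "smooth_real_on N (U \<inter> W) (\<lambda>p. \<xi> p j)" if "j \<in> J" for j
  unfolding smooth_real_on_def
 proof (intro conjI UW ballI, clarify)
  fix V \<eta> assume V: "(V, \<eta>) \<in> atlas N"
  show "smooth_crd (idx N) (\<eta> ` (V \<inter> (U \<inter> W))) (\<lambda>z. \<xi> (inv_into V \<eta> z) j)"
   by (rule smooth_crd_subset[OF smooth_real_onD[OF coord_sysD(4)[OF cs that] V]]) auto
 qed
 ultimately show ?thesis unfolding coord_sys_def
  using UW inj op coord_sys_open_image[OF W] by auto
qed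

end

section \<open>Graded functions and graded coordinate systems\<close>

abbreviation (input) bidx :: "('e, 'i, 'm) gbundle \<Rightarrow> 'i set" where
 "bidx E \<equiv> base_of (idx E) (wt E)"

definition over :: "('e, 'i, 'm) gbundle \<Rightarrow> 'm set \<Rightarrow> 'e set" where
 "over E W = {e \<in> pts E. bproj E e \<in> W}"

definition saturated :: "('m, 'b, 'z) mfd_scheme \<Rightarrow> ('e, 'i, 'm) gbundle \<Rightarrow> 'e set \<Rightarrow> bool" where
 "saturated M E W \<longleftrightarrow> (\<exists>W0. mopen M W0 \<and> W = over E W0)"

text \<open>The function \<open>h\<close> on \<open>W\<close> is smooth and homogeneous of degree \<open>d\<close>, read off in the chart \<open>(D, \<phi>)\<close>.  The
  whole development speaks about such functions instead of polynomials, because smoothness and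
  homogeneity are inherited by compositions and derivatives without any bookkeeping of coefficients.\<close>

definition gfun :: "('e, 'i, 'm) gbundle \<Rightarrow> 'e set \<Rightarrow> ('e \<Rightarrow> 'i \<Rightarrow> real) \<Rightarrow> 'e set \<Rightarrow> nat \<Rightarrow> ('e \<Rightarrow> real) \<Rightarrow> bool"
 where "gfun E D \<phi> W d h \<longleftrightarrow> smooth_crd (idx E) (\<phi> ` W) (\<lambda>z. h (inv_into D \<phi> z)) \<and>
   homog_on (wt E) d (\<phi> ` W) (\<lambda>z. h (inv_into D \<phi> z))"

definition gcompat ::
 "('e, 'i, 'm) gbundle \<Rightarrow> 'e set \<times> ('e \<Rightarrow> 'i \<Rightarrow> real) \<Rightarrow> 'e set \<times> ('e \<Rightarrow> 'i \<Rightarrow> real) \<Rightarrow> bool" where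
 "gcompat E = (\<lambda>(D, \<phi>) (D', \<psi>). \<forall>i\<in>idx E. gfun E D \<phi> (D \<inter> D') (wt E i) (\<lambda>e. \<psi> e i))"

text \<open>The part of the definition of a graded bundle that concerns its charts.  The topological axioms are
  separated from it because for the quotient they are not accessible directly: they come from \<open>E\<close> by
  transport, and for this the charts must be compatible already.\<close>

definition pre_graded :: "('m, 'b, 'z) mfd_scheme \<Rightarrow> ('e, 'i, 'm) gbundle \<Rightarrow> bool" where
 "pre_graded M E \<longleftrightarrow> manifold M \<and> finite (idx E) \<and> (\<Union>(D, \<phi>)\<in>atlas E. D) = pts E \<and>
   (\<forall>c\<in>atlas E. adapted_chart M E c) \<and> (\<forall>c\<in>atlas E. \<forall>c'\<in>atlas E. gcompat E c c')"

definition gcoords ::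
 "('m, 'b, 'z) mfd_scheme \<Rightarrow> ('e, 'i, 'm) gbundle \<Rightarrow> 'e set \<times> ('e \<Rightarrow> 'i \<Rightarrow> real) \<Rightarrow> bool" where
 "gcoords M E c \<longleftrightarrow> adapted_chart M E c \<and> (\<forall>c'\<in>atlas E. gcompat E c c' \<and> gcompat E c' c)"

definition bundle_chart ::
 "('m, 'b, 'z) mfd_scheme \<Rightarrow> ('e, 'i, 'm) gbundle \<Rightarrow> 'e set \<Rightarrow> ('e \<Rightarrow> 'i \<Rightarrow> real) \<Rightarrow>
   'm set \<Rightarrow> ('m \<Rightarrow> 'i \<Rightarrow> real) \<Rightarrow> bool" where
 "bundle_chart M E D \<phi> U \<xi> \<longleftrightarrow> coord_sys M (bidx E) (U, \<xi>) \<and> D = over E U \<and> inj_on \<phi> D \<and>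
   (\<forall>e\<in>D. restr (bidx E) (\<phi> e) = \<xi> (bproj E e)) \<and> \<phi> ` D = cyl (idx E) (wt E) (\<xi> ` U)"

lemma bundle_chartD:
 assumes "bundle_chart M E D \<phi> U \<xi>"
 shows "coord_sys M (bidx E) (U, \<xi>)" "D = over E U" "inj_on \<phi> D"
  "\<And>e. e \<in> D \<Longrightarrow> restr (bidx E) (\<phi> e) = \<xi> (bproj E e)"
  "\<phi> ` D = cyl (idx E) (wt E) (\<xi> ` U)"
 using assms unfolding bundle_chart_def by blast+

lemma bundle_chartE:
 assumes "adapted_chart M E (D, \<phi>)"
 obtains U \<xi> where "bundle_chart M E D \<phi> U \<xi>"
 using assms unfolding adapted_chart_def bundle_chart_def over_def cyl_def base_of_def by auto

lemma adapted_chartI: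
 assumes "coord_sys M (bidx E) (U, \<xi>)" "D = over E U" "inj_on \<phi> D"
  "\<And>e. e \<in> D \<Longrightarrow> restr (bidx E) (\<phi> e) = \<xi> (bproj E e)"
  "\<phi> ` D = cyl (idx E) (wt E) (\<xi> ` U)"
 shows "adapted_chart M E (D, \<phi>)"
 using assms unfolding adapted_chart_def over_def cyl_def base_of_def by blast

lemma adapted_chart_by_points:
 assumes "coord_sys M (bidx E) (U, \<xi>)" and D: "D = over E U"
  and b: "\<And>e. e \<in> D \<Longrightarrow> restr (bidx E) (\<phi> e) = \<xi> (bproj E e)"
  and crd: "\<And>e. \<phi> e \<in> crd (idx E)"
  and inj: "\<And>e e'. e \<in> D \<Longrightarrow> e' \<in> D \<Longrightarrow> bproj E e = bproj E e' \<Longrightarrow> \<phi> e = \<phi> e' \<Longrightarrow> e = e'"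
  and surj: "\<And>p z. p \<in> U \<Longrightarrow> z \<in> crd (idx E) \<Longrightarrow> restr (bidx E) z = \<xi> p \<Longrightarrow> \<exists>e\<in>D. \<phi> e = z"
 shows "adapted_chart M E (D, \<phi>)"
proof (rule adapted_chartI[OF assms(1) D _ b])
 have \<xi>: "inj_on \<xi> U" using assms(1) by (simp add: coord_sys_def)
 show "inj_on \<phi> D"
 proof (rule inj_onI)
  fix e e' assume e: "e \<in> D" "e' \<in> D" "\<phi> e = \<phi> e'"
  have "\<xi> (bproj E e) = \<xi> (bproj E e')" using b[OF e(1)] b[OF e(2)] e(3) by simp
  then have "bproj E e = bproj E e'" using \<xi> e(1,2) D by (auto simp: over_def dest: inj_onD)
  then show "e = e'" by (rule inj[OF e(1,2) _ e(3)])
 qed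
 show "\<phi> ` D = cyl (idx E) (wt E) (\<xi> ` U)"
 proof (intro subset_antisym subsetI)
  fix z assume "z \<in> \<phi> ` D"
  then show "z \<in> cyl (idx E) (wt E) (\<xi> ` U)" using crd b D by (auto simp: cyl_def over_def)
 next
  fix z assume "z \<in> cyl (idx E) (wt E) (\<xi> ` U)"
  then show "z \<in> \<phi> ` D" using surj by (force simp: cyl_def)
 qed
qed

lemma finite_bidx: "finite (idx E) \<Longrightarrow> finite (bidx E)"
 by (simp add: base_of_def)

lemma over_Int: "over E U \<inter> over E V = over E (U \<inter> V)"
 by (auto simp: over_def)

lemma saturated_Int:
 assumes "manifold M" "saturated M E W" "saturated M E W'"
 shows "saturated M E (W \<inter> W')"
 using assms manifold_mopen_Int[OF assms(1)] over_Int unfolding saturated_def by metis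

lemma adapted_saturated: "adapted_chart M E (D, \<phi>) \<Longrightarrow> saturated M E D"
 by (erule bundle_chartE) (auto simp: bundle_chart_def saturated_def coord_sys_def)

lemma saturated_over: "mopen M W \<Longrightarrow> saturated M E (over E W)"
 by (auto simp: saturated_def)

lemma saturatedD: "saturated M E W \<Longrightarrow> e \<in> W \<Longrightarrow> e' \<in> pts E \<Longrightarrow> bproj E e' = bproj E e \<Longrightarrow> e' \<in> W"
 by (auto simp: saturated_def over_def)

lemma saturated_pts: "saturated M E W \<Longrightarrow> W \<subseteq> pts E"
 by (auto simp: saturated_def over_def)

lemma adapted_inj: "adapted_chart M E (D, \<phi>) \<Longrightarrow> inj_on \<phi> D"
 by (erule bundle_chartE) (rule bundle_chartD(3))

lemma adapted_crd: "adapted_chart M E (D, \<phi>) \<Longrightarrow> e \<in> D \<Longrightarrow> \<phi> e \<in> crd (idx E)"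
 by (erule bundle_chartE) (auto simp: bundle_chart_def cyl_def)

lemma adapted_inv: "adapted_chart M E (D, \<phi>) \<Longrightarrow> e \<in> D \<Longrightarrow> inv_into D \<phi> (\<phi> e) = e"
 using adapted_inj inv_into_f_f by metis

lemma adapted_eq:
 assumes "adapted_chart M E (D, \<phi>)" "e \<in> D" "e' \<in> D" "\<And>i. i \<in> idx E \<Longrightarrow> \<phi> e i = \<phi> e' i"
 shows "e = e'"
proof -
 have "\<phi> e = \<phi> e'"
  using adapted_crd[OF assms(1,2)] adapted_crd[OF assms(1,3)] assms(4)
  by (intro ext) (metis (mono_tags, lifting) crd_def mem_Collect_eq)
 then show ?thesis using adapted_inj[OF assms(1)] assms(2,3) by (auto dest: inj_onD)
qed

lemma adapted_base_eq:
 assumes "adapted_chart M E (D, \<phi>)" "e \<in> D" "e' \<in> D"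
 shows "bproj E e = bproj E e' \<longleftrightarrow> (\<forall>i\<in>bidx E. \<phi> e i = \<phi> e' i)"
proof -
 obtain U \<xi> where "bundle_chart M E D \<phi> U \<xi>" using bundle_chartE[OF assms(1)] by blast
 note c = bundle_chartD[OF this]
 have "bproj E e = bproj E e' \<longleftrightarrow> \<xi> (bproj E e) = \<xi> (bproj E e')"
  using coord_sysD(2)[OF c(1)] assms(2,3) c(2) by (auto simp: over_def dest: inj_onD)
 also have "\<dots> \<longleftrightarrow> restr (bidx E) (\<phi> e) = restr (bidx E) (\<phi> e')"
  using c(4) assms(2,3) by simp
 also have "\<dots> \<longleftrightarrow> (\<forall>i\<in>bidx E. \<phi> e i = \<phi> e' i)"
  unfolding restr_def fun_eq_iff by metis
 finally show ?thesis .
qed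

lemma adapted_point:
 assumes a: "adapted_chart M E (D, \<phi>)" and e: "e \<in> D" and z: "z \<in> crd (idx E)"
  and b: "\<And>i. i \<in> bidx E \<Longrightarrow> z i = \<phi> e i"
 shows "\<exists>e'\<in>D. \<phi> e' = z \<and> bproj E e' = bproj E e"
proof -
 obtain U \<xi> where "bundle_chart M E D \<phi> U \<xi>" using bundle_chartE[OF a] by blast
 note c = bundle_chartD(5,2,4)[OF this]
 have "restr (bidx E) z = restr (bidx E) (\<phi> e)" using b by (auto simp: restr_def)
 then have "z \<in> \<phi> ` D" using c z e by (auto simp: cyl_def over_def)
 then obtain e' where e': "e' \<in> D" "\<phi> e' = z" by auto
 then have "bproj E e' = bproj E e" using adapted_base_eq[OF a e'(1) e] b by simp
 then show ?thesis using e' by blast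
qed

lemma adapted_image:
 assumes M: "manifold M" and fin: "finite (idx E)" and c: "coord_sys M (bidx E) (U, \<xi>)" "D = over E U"
  "\<And>e. e \<in> D \<Longrightarrow> restr (bidx E) (\<phi> e) = \<xi> (bproj E e)"
  "\<phi> ` D = cyl (idx E) (wt E) (\<xi> ` U)" and W: "mopen M W"
 shows "\<phi> ` (D \<inter> over E W) = cyl (idx E) (wt E) (\<xi> ` (U \<inter> W))"
  and "open_crd (bidx E) (\<xi> ` (U \<inter> W))"
  and "bproj E ` (D \<inter> over E W) = U \<inter> W"
proof -
 show "open_crd (bidx E) (\<xi> ` (U \<inter> W))"
  by (rule coord_sys_open_image[OF M finite_bidx[OF fin] c(1) W])
 show 1: "\<phi> ` (D \<inter> over E W) = cyl (idx E) (wt E) (\<xi> ` (U \<inter> W))"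
 proof (intro subset_antisym subsetI)
  fix z assume "z \<in> \<phi> ` (D \<inter> over E W)"
  then obtain e where e: "e \<in> D" "e \<in> over E W" "z = \<phi> e" by auto
  then have "\<phi> e \<in> cyl (idx E) (wt E) (\<xi> ` U)" using c(4) by blast
  then show "z \<in> cyl (idx E) (wt E) (\<xi> ` (U \<inter> W))"
   using e c(2) c(3)[OF e(1)] by (auto simp: cyl_def over_def)
 next
  fix z assume z: "z \<in> cyl (idx E) (wt E) (\<xi> ` (U \<inter> W))"
  then have "z \<in> \<phi> ` D" using c(4) by (auto simp: cyl_def)
  then obtain e where e: "e \<in> D" "z = \<phi> e" by auto
  have "\<xi> (bproj E e) \<in> \<xi> ` (U \<inter> W)" using z c(3)[OF e(1)] e by (simp add: cyl_def)
  then have "bproj E e \<in> W"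
   using coord_sysD(2)[OF c(1)] e c(2) by (auto simp: over_def dest: inj_onD)
  then show "z \<in> \<phi> ` (D \<inter> over E W)" using e c(2) by (auto simp: over_def)
 qed
 show "bproj E ` (D \<inter> over E W) = U \<inter> W"
 proof (intro subset_antisym subsetI)
  fix p assume p: "p \<in> U \<inter> W"
  then have "\<xi> p \<in> crd (bidx E)" using coord_sysD(3)[OF c(1)] open_crd_subset by blast
  then have "\<xi> p \<in> cyl (idx E) (wt E) (\<xi> ` (U \<inter> W))"
   using p by (auto simp: cyl_def restr_id crd_def base_of_def)
  then obtain e where e: "e \<in> D" "e \<in> over E W" "\<phi> e = \<xi> p"
   unfolding 1 [symmetric] by auto
  then have "\<xi> (bproj E e) = \<xi> p" using c(3)[OF e(1)] \<open>\<xi> p \<in> crd (bidx E)\<close> by (simp add: restr_id)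
  then have "bproj E e = p" using coord_sysD(2)[OF c(1)] e c(2) p by (auto simp: over_def dest: inj_onD)
  then show "p \<in> bproj E ` (D \<inter> over E W)" using e by blast
 qed (auto simp: c(2) over_def)
qed

lemma adapted_saturated_image:
 assumes M: "manifold M" and fin: "finite (idx E)" and a: "adapted_chart M E (D, \<phi>)"
  and W: "saturated M E W" "W \<subseteq> D"
 obtains B where "open_crd (bidx E) B" "\<phi> ` W = cyl (idx E) (wt E) B"
proof -
 obtain U \<xi> where "bundle_chart M E D \<phi> U \<xi>" using bundle_chartE[OF a] by blast
 note c = bundle_chartD[OF this]
 obtain W0 where W0: "mopen M W0" "W = over E W0" using W(1) by (auto simp: saturated_def)
 have "W = D \<inter> over E W0" using W(2) W0(2) by auto
 with adapted_image(1,2)[OF M fin c(1,2,4,5) W0(1)] that show ?thesis by simp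
qed

lemma adapted_saturated_open:
 assumes "manifold M" "finite (idx E)" "adapted_chart M E (D, \<phi>)" "saturated M E W" "W \<subseteq> D"
 shows "open_crd (idx E) (\<phi> ` W)"
 using adapted_saturated_image[OF assms] open_cyl[OF assms(2)] by metis

lemma gfun_smooth: "gfun E D \<phi> W d h \<Longrightarrow> smooth_crd (idx E) (\<phi> ` W) (\<lambda>z. h (inv_into D \<phi> z))"
 and gfun_homog: "gfun E D \<phi> W d h \<Longrightarrow> homog_on (wt E) d (\<phi> ` W) (\<lambda>z. h (inv_into D \<phi> z))"
 by (auto simp: gfun_def)

lemma gfun_mono: "gfun E D \<phi> W d h \<Longrightarrow> W' \<subseteq> W \<Longrightarrow> gfun E D \<phi> W' d h"
 unfolding gfun_def homog_on_def using smooth_crd_subset by (metis (no_types, lifting) image_mono subsetD)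

lemma gcompatD: "gcompat E (D, \<phi>) (D', \<psi>) \<Longrightarrow> i \<in> idx E \<Longrightarrow> gfun E D \<phi> (D \<inter> D') (wt E i) (\<lambda>e. \<psi> e i)"
 by (simp add: gcompat_def)

context
 fixes M :: "('m, 'b, 'z) mfd_scheme" and E :: "('e, 'i, 'm) gbundle"
  and D :: "'e set" and \<phi> :: "'e \<Rightarrow> 'i \<Rightarrow> real"
 assumes M: "manifold M" and fin: "finite (idx E)" and a: "adapted_chart M E (D, \<phi>)"
begin

lemma adapted_scl:
 assumes "saturated M E W" "W \<subseteq> D" "e \<in> W"
 shows "\<exists>e'\<in>W. \<phi> e' = scl (wt E) t (\<phi> e) \<and> bproj E e' = bproj E e"
proof -
 have e: "e \<in> D" using assms by blast
 have "scl (wt E) t (\<phi> e) \<in> crd (idx E)" using adapted_crd[OF a e] by (auto simp: scl_def crd_def)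
 from adapted_point[OF a e this] obtain e' where "e' \<in> D" "\<phi> e' = scl (wt E) t (\<phi> e)" "bproj E e' = bproj E e"
  by (auto simp: scl_def base_of_def)
 then show ?thesis
  using saturatedD[OF assms(1,3)] saturated_pts[OF adapted_saturated[OF a]] by blast
qed

lemma gfun_eval:
 assumes "gfun E D \<phi> W d h" "W \<subseteq> D" "e \<in> W" "e' \<in> D" "\<And>i. i \<in> idx E \<Longrightarrow> \<phi> e' i = t ^ wt E i * \<phi> e i"
 shows "h e' = t ^ d * h e"
proof -
 have e: "e \<in> D" using assms by blast
 have "\<phi> e' = scl (wt E) t (\<phi> e)"
 proof
  fix i
  show "\<phi> e' i = scl (wt E) t (\<phi> e) i"
   using adapted_crd[OF a e] adapted_crd[OF a assms(4)] assms(5)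
   by (cases "i \<in> idx E") (auto simp: scl_def crd_def)
 qed
 moreover have "h (inv_into D \<phi> (scl (wt E) t (\<phi> e))) = t ^ d * h (inv_into D \<phi> (\<phi> e))"
  using gfun_homog[OF assms(1)] assms(3) unfolding homog_on_def by blast
 ultimately show ?thesis using adapted_inv[OF a assms(4)] adapted_inv[OF a e] by simp
qed

lemma gfunI:
 assumes W: "saturated M E W" "W \<subseteq> D"
  and s: "smooth_crd (idx E) (\<phi> ` W) (\<lambda>z. h (inv_into D \<phi> z))"
  and h: "\<And>e e' t. e \<in> W \<Longrightarrow> e' \<in> W \<Longrightarrow> bproj E e' = bproj E e \<Longrightarrow>
   \<phi> e' = scl (wt E) t (\<phi> e) \<Longrightarrow> h e' = t ^ d * h e"
 shows "gfun E D \<phi> W d h"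
 unfolding gfun_def homog_on_def
proof (intro conjI s ballI allI)
 fix z t assume "z \<in> \<phi> ` W"
 then obtain e where e: "e \<in> W" "z = \<phi> e" by auto
 obtain e' where e': "e' \<in> W" "\<phi> e' = scl (wt E) t (\<phi> e)" "bproj E e' = bproj E e"
  using adapted_scl[OF W e(1)] by blast
 have "inv_into D \<phi> (\<phi> e) = e" "inv_into D \<phi> (\<phi> e') = e'"
  using adapted_inv[OF a] e e' W(2) by blast+
 then show "h (inv_into D \<phi> (scl (wt E) t z)) = t ^ d * h (inv_into D \<phi> z)"
  using h[OF e(1) e'(1) e'(3) e'(2)] e(2) e'(2) by simp
qed

lemma gfun_cong:
 assumes "saturated M E W" "W \<subseteq> D" "gfun E D \<phi> W d h" "\<And>e. e \<in> W \<Longrightarrow> h' e = h e"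
 shows "gfun E D \<phi> W d h'"
proof (rule gfunI[OF assms(1,2)])
 show "smooth_crd (idx E) (\<phi> ` W) (\<lambda>z. h' (inv_into D \<phi> z))"
  by (rule smooth_crd_cong_imp[OF fin adapted_saturated_open[OF M fin a assms(1,2)] gfun_smooth[OF assms(3)]])
   (use adapted_inv[OF a] assms(2,4) in auto)
 show "h' e' = t ^ d * h' e" if "e \<in> W" "e' \<in> W" "\<phi> e' = scl (wt E) t (\<phi> e)" for e e' t
  using gfun_eval[OF assms(3,2) that(1), of e' t] that assms(2,4) by (auto simp: scl_def)
qed

lemma gfun_Union:
 assumes "\<And>W. W \<in> \<W> \<Longrightarrow> saturated M E W \<and> W \<subseteq> D \<and> gfun E D \<phi> W d h"
 shows "gfun E D \<phi> (\<Union>\<W>) d h"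
proof -
 have "smooth_crd (idx E) (\<Union>((`) \<phi> ` \<W>)) (\<lambda>z. h (inv_into D \<phi> z))"
 proof (rule smooth_crd_Union)
  fix V assume "V \<in> (`) \<phi> ` \<W>"
  then obtain W where "W \<in> \<W>" "V = \<phi> ` W" by blast
  with assms[OF this(1)] show "open_crd (idx E) V \<and> smooth_crd (idx E) V (\<lambda>z. h (inv_into D \<phi> z))"
   using adapted_saturated_open[OF M fin a] gfun_smooth by blast
 qed
 moreover have "homog_on (wt E) d (\<phi> ` \<Union>\<W>) (\<lambda>z. h (inv_into D \<phi> z))"
  using gfun_homog assms unfolding homog_on_def by blast
 ultimately show ?thesis unfolding gfun_def by (simp add: image_Union)
qed

lemma gfun_coord: "saturated M E W \<Longrightarrow> W \<subseteq> D \<Longrightarrow> gfun E D \<phi> W (wt E i) (\<lambda>e. \<phi> e i)"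
proof (rule gfunI)
 assume W: "saturated M E W" "W \<subseteq> D"
 show "smooth_crd (idx E) (\<phi> ` W) (\<lambda>z. \<phi> (inv_into D \<phi> z) i)"
  by (rule smooth_crd_cong_imp[OF fin adapted_saturated_open[OF M fin a W] smooth_crd_coord[of _ _ i]])
   (use adapted_inv[OF a] W(2) in auto)
qed (auto simp: scl_def)

lemma gfun_mult:
 assumes W: "saturated M E W" "W \<subseteq> D" and "gfun E D \<phi> W d f" "gfun E D \<phi> W d' g"
 shows "gfun E D \<phi> W (d + d') (\<lambda>e. f e * g e)"
 using assms(3,4) smooth_crd_mult[OF fin adapted_saturated_open[OF M fin a W]]
 unfolding gfun_def homog_on_def by (simp add: power_add mult_ac)

lemma gfun_zero: "saturated M E W \<Longrightarrow> W \<subseteq> D \<Longrightarrow> gfun E D \<phi> W d (\<lambda>e. 0)"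
 by (simp add: gfun_def homog_on_def smooth_crd_const)

lemma gfun_add:
 assumes W: "saturated M E W" "W \<subseteq> D" and "gfun E D \<phi> W d f" "gfun E D \<phi> W d g"
 shows "gfun E D \<phi> W d (\<lambda>e. f e + g e)"
 using assms(3,4) smooth_crd_add[OF fin adapted_saturated_open[OF M fin a W]]
 unfolding gfun_def homog_on_def by (simp add: distrib_left)

lemma gfun_diff:
 assumes W: "saturated M E W" "W \<subseteq> D" and "gfun E D \<phi> W d f" "gfun E D \<phi> W d g"
 shows "gfun E D \<phi> W d (\<lambda>e. f e - g e)"
 using assms(3,4) smooth_crd_diff[OF fin adapted_saturated_open[OF M fin a W]]
 unfolding gfun_def homog_on_def by (simp add: right_diff_distrib)

lemma gfun_sum:
 assumes W: "saturated M E W" "W \<subseteq> D" and "\<And>k. k \<in> K \<Longrightarrow> gfun E D \<phi> W d (f k)"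
 shows "gfun E D \<phi> W d (\<lambda>e. \<Sum>k\<in>K. f k e)"
 using assms(3) smooth_crd_sum[OF fin adapted_saturated_open[OF M fin a W], of K]
 unfolding gfun_def homog_on_def by (simp add: sum_distrib_left)

lemma gfun_monomial:
 assumes W: "saturated M E W" "W \<subseteq> D" and \<alpha>: "\<alpha> \<in> monomials (idx E) (wt E) d"
 shows "gfun E D \<phi> W d (\<lambda>e. \<Prod>j\<in>idx E. \<phi> e j ^ \<alpha> j)"
proof (rule gfunI[OF W])
 have "smooth_crd (idx E) (\<phi> ` W) (\<lambda>z. \<Prod>j\<in>idx E. \<phi> (inv_into D \<phi> z) j ^ \<alpha> j)"
  by (intro smooth_crd_prod smooth_crd_power gfun_smooth[OF gfun_coord[OF W]]
    fin adapted_saturated_open[OF M fin a W])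
 then show "smooth_crd (idx E) (\<phi> ` W) (\<lambda>z. \<Prod>j\<in>idx E. \<phi> (inv_into D \<phi> z) j ^ \<alpha> j)" .
qed (simp add: prod_monomial_scl[OF \<alpha>])

lemma gfun_base:
 assumes f: "smooth_real_on M W0 f" and W: "saturated M E W" "W \<subseteq> D" "W \<subseteq> over E W0"
 shows "gfun E D \<phi> W 0 (\<lambda>e. f (bproj E e))"
proof -
 obtain U \<xi> where "bundle_chart M E D \<phi> U \<xi>" using bundle_chartE[OF a] by blast
 note c = bundle_chartD[OF this]
 have W0: "mopen M W0" using f by (simp add: smooth_real_on_def)
 note im = adapted_image[OF M fin c(1,2,4,5) W0]
 let ?W1 = "D \<inter> over E W0"
 have W1: "saturated M E ?W1"
  by (rule saturated_Int[OF M adapted_saturated[OF a] saturated_over[OF W0]])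
 have "gfun E D \<phi> ?W1 0 (\<lambda>e. f (bproj E e))"
 proof (rule gfunI[OF W1])
  have "smooth_crd (bidx E) (\<xi> ` (U \<inter> W0)) (\<lambda>x. f (inv_into U \<xi> x))"
   by (rule smooth_real_on_coords[OF M finite_bidx[OF fin] c(1) f])
  from smooth_crd_from_base[OF fin im(2) this]
  have "smooth_crd (idx E) (\<phi> ` ?W1) (\<lambda>z. f (inv_into U \<xi> (restr (bidx E) z)))"
   by (simp add: im(1))
  then show "smooth_crd (idx E) (\<phi> ` ?W1) (\<lambda>z. f (bproj E (inv_into D \<phi> z)))"
  proof (rule smooth_crd_cong_imp[OF fin adapted_saturated_open[OF M fin a W1 Int_lower1]])
   fix y assume "y \<in> \<phi> ` ?W1"
   then obtain e where e: "e \<in> D" "e \<in> over E W0" "y = \<phi> e" by auto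
   have "inv_into U \<xi> (restr (bidx E) y) = bproj E e"
    using c(4)[OF e(1)] coord_sysD(2)[OF c(1)] e c(2) by (simp add: over_def inv_into_f_f)
   then show "f (bproj E (inv_into D \<phi> y)) = f (inv_into U \<xi> (restr (bidx E) y))"
    using adapted_inv[OF a e(1)] e(3) by simp
  qed
 qed auto
 then show ?thesis by (rule gfun_mono) (use W in auto)
qed

text \<open>A map whose coordinates are homogeneous of the right degrees commutes with the actions, so it pulls
  homogeneous functions back to homogeneous functions.\<close>

lemma gfun_pullback:
 assumes fin': "finite (idx E')" and a': "adapted_chart M' E' (D', \<psi>)" and M': "manifold M'"
  and W: "saturated M E W" "W \<subseteq> D" and W': "saturated M' E' W'" "W' \<subseteq> D'"
  and \<pi>: "\<And>e. e \<in> W \<Longrightarrow> \<pi> e \<in> W'"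
  and c: "\<And>i. i \<in> idx E' \<Longrightarrow> gfun E D \<phi> W (wt E' i) (\<lambda>e. \<psi> (\<pi> e) i)"
  and h: "gfun E' D' \<psi> W' d h"
 shows "gfun E D \<phi> W d (\<lambda>e. h (\<pi> e))"
proof (rule gfunI[OF W])
 have O: "open_crd (idx E) (\<phi> ` W)" by (rule adapted_saturated_open[OF M fin a W])
 have \<pi>D: "\<pi> e \<in> D'" if "e \<in> W" for e using \<pi>[OF that] W'(2) by blast
 have "smooth_crd (idx E) (\<phi> ` W) (\<lambda>z. h (inv_into D' \<psi> (\<psi> (\<pi> (inv_into D \<phi> z)))))"
 proof (rule smooth_crd_comp[OF fin O fin' adapted_saturated_open[OF M' fin' a' W'] _ _ gfun_smooth[OF h]])
  show "\<psi> (\<pi> (inv_into D \<phi> z)) \<in> \<psi> ` W'" if "z \<in> \<phi> ` W" for z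
   using that adapted_inv[OF a] W(2) \<pi> by auto
 qed (rule gfun_smooth[OF c])
 then show "smooth_crd (idx E) (\<phi> ` W) (\<lambda>z. h (\<pi> (inv_into D \<phi> z)))"
 proof (rule smooth_crd_cong_imp[OF fin O])
  fix y assume "y \<in> \<phi> ` W"
  then obtain e where e: "e \<in> W" "y = \<phi> e" by auto
  then have "e \<in> D" using W by auto
  then show "h (\<pi> (inv_into D \<phi> y)) = h (inv_into D' \<psi> (\<psi> (\<pi> (inv_into D \<phi> y))))"
   using adapted_inv[OF a] adapted_inv[OF a' \<pi>D[OF e(1)]] e(2) by simp
 qed
next
 fix e e' t assume e: "e \<in> W" "e' \<in> W" "\<phi> e' = scl (wt E) t (\<phi> e)"
 have D: "e \<in> D" "e' \<in> D" "\<pi> e \<in> D'" "\<pi> e' \<in> D'" using e \<pi> W(2) W'(2) by auto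
 have "\<psi> (\<pi> e') i = t ^ wt E' i * \<psi> (\<pi> e) i" if "i \<in> idx E'" for i
  by (rule gfun_eval[OF c[OF that] W(2) e(1) D(2)]) (simp add: e(3) scl_def)
 then show "h (\<pi> e') = t ^ d * h (\<pi> e)"
 proof -
  assume *: "\<And>i. i \<in> idx E' \<Longrightarrow> \<psi> (\<pi> e') i = t ^ wt E' i * \<psi> (\<pi> e) i"
  have "\<psi> (\<pi> e') = scl (wt E') t (\<psi> (\<pi> e))"
  proof
   fix i
   show "\<psi> (\<pi> e') i = scl (wt E') t (\<psi> (\<pi> e)) i"
    using adapted_crd[OF a' D(3)] adapted_crd[OF a' D(4)] *[of i]
    by (cases "i \<in> idx E'") (auto simp: scl_def crd_def)
  qed
  moreover have "h (inv_into D' \<psi> (scl (wt E') t (\<psi> (\<pi> e)))) = t ^ d * h (inv_into D' \<psi> (\<psi> (\<pi> e)))"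
   using gfun_homog[OF h] \<pi>[OF e(1)] unfolding homog_on_def by blast
  ultimately show ?thesis using adapted_inv[OF a'] D by metis
 qed
qed

lemma gfun_change:
 assumes a': "adapted_chart M E (D', \<psi>)" and c: "gcompat E (D, \<phi>) (D', \<psi>)"
  and W: "saturated M E W" "W \<subseteq> D" "W \<subseteq> D'" and h: "gfun E D' \<psi> W d h"
 shows "gfun E D \<phi> W d h"
 by (rule gfun_pullback[where \<pi> = "\<lambda>e. e", OF fin a' M W(1,2) W(1,3) _ _ h])
  (use gfun_mono[OF gcompatD[OF c]] W in auto)

lemma gfun_pdv:
 assumes W: "saturated M E W" "W \<subseteq> D" and h: "gfun E D \<phi> W d h" and l: "l \<in> idx E"
 shows "wt E l \<le> d \<Longrightarrow> gfun E D \<phi> W (d - wt E l) (\<lambda>e. pdv l (\<lambda>z. h (inv_into D \<phi> z)) (\<phi> e))"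
  and "d < wt E l \<Longrightarrow> e \<in> W \<Longrightarrow> pdv l (\<lambda>z. h (inv_into D \<phi> z)) (\<phi> e) = 0"
proof -
 obtain B where B: "open_crd (bidx E) B" "\<phi> ` W = cyl (idx E) (wt E) B"
  using adapted_saturated_image[OF M fin a W] by blast
 let ?f = "\<lambda>z. h (inv_into D \<phi> z)"
 have f: "smooth_crd (idx E) (cyl (idx E) (wt E) B) ?f" "homog_on (wt E) d (cyl (idx E) (wt E) B) ?f"
  using h unfolding gfun_def B(2) by auto
 have inv: "\<phi> (inv_into D \<phi> z) = z" if "z \<in> \<phi> ` W" for z
  using that adapted_inv[OF a] W(2) by auto
 show "gfun E D \<phi> W (d - wt E l) (\<lambda>e. pdv l ?f (\<phi> e))" if "wt E l \<le> d"
  unfolding gfun_def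
 proof
  have "smooth_crd (idx E) (\<phi> ` W) (pdv l ?f)"
   using smooth_crd_pdv[OF f(1) l] by (simp add: B(2))
  then show "smooth_crd (idx E) (\<phi> ` W) (\<lambda>z. pdv l ?f (\<phi> (inv_into D \<phi> z)))"
   by (rule smooth_crd_cong_imp[OF fin adapted_saturated_open[OF M fin a W]]) (simp only: inv)
  have "homog_on (wt E) (d - wt E l) (\<phi> ` W) (pdv l ?f)"
   using pdv_homog_le[OF fin B(1) f l that] by (simp add: B(2))
  then show "homog_on (wt E) (d - wt E l) (\<phi> ` W) (\<lambda>z. pdv l ?f (\<phi> (inv_into D \<phi> z)))"
   unfolding homog_on_def using inv scl_cyl[where B = B and I = "idx E" and w = "wt E"] B(2) by auto
 qed
 show "pdv l ?f (\<phi> e) = 0" if "d < wt E l" "e \<in> W"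
  by (rule pdv_homog_gt[OF fin B(1) f l that(1)]) (use that B(2) in blast)
qed

text \<open>The coordinate expression of \<open>V' = V \<oplus> v\<close> with \<open>v\<close> in the core: homogeneous functions of top degree are
  additive under it and are linear on the core, with the same coefficients \<open>g\<close>.\<close>

lemma gfun_top_linear:
 assumes W: "saturated M E W" "W \<subseteq> D" and h: "gfun E D \<phi> W k h" and k: "0 < k"
 obtains g where "\<And>V v V'. V \<in> W \<Longrightarrow> v \<in> W \<Longrightarrow> V' \<in> W \<Longrightarrow> bproj E v = bproj E V \<Longrightarrow> bproj E V' = bproj E V \<Longrightarrow>
   (\<And>i. i \<in> idx E \<Longrightarrow> \<phi> V' i = \<phi> V i + (if wt E i = k then \<phi> v i else 0)) \<Longrightarrow>
   h V' = h V + (\<Sum>i\<in>{i\<in>idx E. wt E i = k}. g i (bproj E V) * \<phi> v i)"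
  and "\<And>v. v \<in> W \<Longrightarrow> (\<And>i. i \<in> idx E \<Longrightarrow> wt E i \<noteq> 0 \<Longrightarrow> wt E i \<noteq> k \<Longrightarrow> \<phi> v i = 0) \<Longrightarrow>
   h v = (\<Sum>i\<in>{i\<in>idx E. wt E i = k}. g i (bproj E v) * \<phi> v i)"
proof -
 obtain B where B: "open_crd (bidx E) B" "\<phi> ` W = cyl (idx E) (wt E) B"
  using adapted_saturated_image[OF M fin a W] by blast
 obtain U \<xi> where "bundle_chart M E D \<phi> U \<xi>" using bundle_chartE[OF a] by blast
 note c = bundle_chartD(4)[OF this]
 define f where "f z = h (inv_into D \<phi> z)" for z
 have f: "smooth_crd (idx E) (cyl (idx E) (wt E) B) f" "homog_on (wt E) k (cyl (idx E) (wt E) B) f"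
  using h unfolding gfun_def B(2) f_def [abs_def] by auto
 define g where "g i p = pdv i f (\<xi> p)" for i p
 have fe: "f (\<phi> e) = h e" if "e \<in> W" for e
  unfolding f_def using adapted_inv[OF a] that W(2) by auto
 have 1: "h V' = h V + (\<Sum>i\<in>{i\<in>idx E. wt E i = k}. g i (bproj E V) * \<phi> v i)"
  if V: "V \<in> W" "v \<in> W" "V' \<in> W" "bproj E v = bproj E V" "bproj E V' = bproj E V"
   and add: "\<And>i. i \<in> idx E \<Longrightarrow> \<phi> V' i = \<phi> V i + (if wt E i = k then \<phi> v i else 0)" for V v V'
 proof -
  have D: "V \<in> D" "v \<in> D" "V' \<in> D" using V W(2) by auto
  define u where "u = (\<lambda>i. if wt E i = k then \<phi> v i else 0)"
  have z: "\<phi> V \<in> cyl (idx E) (wt E) B" using V(1) B(2) by blast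
  have u: "u \<in> crd (idx E)" using adapted_crd[OF a D(2)] by (auto simp: u_def crd_def)
  have "\<phi> V' = (\<lambda>i. \<phi> V i + u i)"
  proof
   fix i show "\<phi> V' i = \<phi> V i + u i"
    using add[of i] adapted_crd[OF a D(1)] adapted_crd[OF a D(3)] u
    by (cases "i \<in> idx E") (auto simp: u_def crd_def)
  qed
  moreover have "f (\<lambda>i. \<phi> V i + u i) = f (\<phi> V) +
    (\<Sum>i\<in>{i\<in>idx E. wt E i = k}. pdv i f (restr (bidx E) (\<phi> V)) * u i)"
   using homog_add_top[OF fin B(1) f z u _ k] by (simp add: u_def)
  ultimately show ?thesis
   using fe[OF V(1)] fe[OF V(3)] c[OF D(1)] by (simp add: u_def g_def)
 qed
 have 2: "h v = (\<Sum>i\<in>{i\<in>idx E. wt E i = k}. g i (bproj E v) * \<phi> v i)"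
  if v: "v \<in> W" "\<And>i. i \<in> idx E \<Longrightarrow> wt E i \<noteq> 0 \<Longrightarrow> wt E i \<noteq> k \<Longrightarrow> \<phi> v i = 0" for v
 proof -
  obtain v0 where v0: "v0 \<in> W" "\<phi> v0 = scl (wt E) 0 (\<phi> v)" "bproj E v0 = bproj E v"
   using adapted_scl[OF W v(1)] by blast
  have "h v0 = 0 ^ k * h v"
   by (rule gfun_eval[OF h W(2) v(1)]) (use v0 W(2) in \<open>auto simp: scl_def\<close>)
  moreover have "h v = h v0 + (\<Sum>i\<in>{i\<in>idx E. wt E i = k}. g i (bproj E v0) * \<phi> v i)"
   by (rule 1) (use v0 v k in \<open>auto simp: scl_def power_0_left\<close>)
  moreover have "(0::real) ^ k = 0" using k by simp
  ultimately show ?thesis using v0(3) by simp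
 qed
 show ?thesis
 proof (rule that[of g])
  show "h V' = h V + (\<Sum>i\<in>{i\<in>idx E. wt E i = k}. g i (bproj E V) * \<phi> v i)"
   if "V \<in> W" "v \<in> W" "V' \<in> W" "bproj E v = bproj E V" "bproj E V' = bproj E V"
    "\<And>i. i \<in> idx E \<Longrightarrow> \<phi> V' i = \<phi> V i + (if wt E i = k then \<phi> v i else 0)" for V v V'
   by (rule 1[OF that])
  show "h v = (\<Sum>i\<in>{i\<in>idx E. wt E i = k}. g i (bproj E v) * \<phi> v i)"
   if "v \<in> W" "\<And>i. i \<in> idx E \<Longrightarrow> wt E i \<noteq> 0 \<Longrightarrow> wt E i \<noteq> k \<Longrightarrow> \<phi> v i = 0" for v
   by (rule 2[OF that])
 qed
qed

lemma gfun_core_linear: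
 assumes W: "saturated M E W" "W \<subseteq> D" and h: "gfun E D \<phi> W k h" and k: "0 < k"
 shows "\<exists>g. \<forall>v\<in>W. (\<forall>i\<in>idx E. wt E i \<noteq> 0 \<longrightarrow> wt E i \<noteq> k \<longrightarrow> \<phi> v i = 0) \<longrightarrow>
   h v = (\<Sum>i\<in>{i\<in>idx E. wt E i = k}. g i (bproj E v) * \<phi> v i)"
 by (rule gfun_top_linear[OF W h k]) blast

lemma gfun_below_top:
 assumes W: "saturated M E W" "W \<subseteq> D" and h: "gfun E D \<phi> W d h" and k: "d < k"
  and V: "V \<in> W" "V' \<in> W"
  and eq: "\<And>i. i \<in> idx E \<Longrightarrow> wt E i \<noteq> k \<Longrightarrow> \<phi> V' i = \<phi> V i"
 shows "h V' = h V"
proof -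
 obtain B where B: "open_crd (bidx E) B" "\<phi> ` W = cyl (idx E) (wt E) B"
  using adapted_saturated_image[OF M fin a W] by blast
 define f where "f z = h (inv_into D \<phi> z)" for z
 have f: "smooth_crd (idx E) (cyl (idx E) (wt E) B) f" "homog_on (wt E) d (cyl (idx E) (wt E) B) f"
  using h unfolding gfun_def B(2) f_def [abs_def] by auto
 have D: "V \<in> D" "V' \<in> D" using V W(2) by auto
 define u where "u = (\<lambda>i. \<phi> V' i - \<phi> V i)"
 have crd: "\<phi> V \<in> crd (idx E)" "\<phi> V' \<in> crd (idx E)" using adapted_crd[OF a] D by auto
 have u: "u \<in> crd (idx E)" using crd by (auto simp: u_def crd_def)
 have u0: "u i = 0" if "wt E i \<noteq> k" for i
  using that eq crd by (cases "i \<in> idx E") (auto simp: u_def crd_def)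
 have z: "\<phi> V \<in> cyl (idx E) (wt E) B" using V(1) B(2) by blast
 have "f (\<lambda>i. \<phi> V i + u i) = f (\<phi> V)"
  using homog_add_top[OF fin B(1) f z u u0] k by simp
 moreover have "(\<lambda>i. \<phi> V i + u i) = \<phi> V'" by (simp add: u_def)
 ultimately show ?thesis unfolding f_def using adapted_inv[OF a] D by simp
qed

end

lemma pre_gradedD:
 assumes "pre_graded M E"
 shows "manifold M" "finite (idx E)" "(\<Union>(D, \<phi>)\<in>atlas E. D) = pts E"
  "\<And>c. c \<in> atlas E \<Longrightarrow> adapted_chart M E c"
  "\<And>c c'. c \<in> atlas E \<Longrightarrow> c' \<in> atlas E \<Longrightarrow> gcompat E c c'"
 using assms unfolding pre_graded_def by blast+

lemma pre_graded_cover: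
 assumes "pre_graded M E" "e \<in> pts E"
 obtains D \<phi> where "(D, \<phi>) \<in> atlas E" "e \<in> D"
 using pre_gradedD(3)[OF assms(1)] assms(2) by blast

lemma gcoordsD:
 assumes "gcoords M E c"
 shows "adapted_chart M E c" "\<And>c'. c' \<in> atlas E \<Longrightarrow> gcompat E c c'" "\<And>c'. c' \<in> atlas E \<Longrightarrow> gcompat E c' c"
 using assms unfolding gcoords_def by blast+

lemma gcoords_atlas: "pre_graded M E \<Longrightarrow> c \<in> atlas E \<Longrightarrow> gcoords M E c"
 unfolding gcoords_def pre_graded_def by simp

lemma gfun_cover:
 assumes E: "pre_graded M E" and a: "adapted_chart M E (D, \<phi>)" and W: "saturated M E W" "W \<subseteq> D"
  and loc: "\<And>D' \<psi>. (D', \<psi>) \<in> atlas E \<Longrightarrow> gfun E D \<phi> (W \<inter> D') d h"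
 shows "gfun E D \<phi> W d h"
proof -
 note M = pre_gradedD(1)[OF E] and fin = pre_gradedD(2)[OF E]
 have "gfun E D \<phi> (\<Union>((\<lambda>(D', \<psi>). W \<inter> D') ` atlas E)) d h"
 proof (rule gfun_Union[OF M fin a])
  fix X assume "X \<in> (\<lambda>(D', \<psi>). W \<inter> D') ` atlas E"
  then obtain D' \<psi> where X: "(D', \<psi>) \<in> atlas E" "X = W \<inter> D'" by auto
  show "saturated M E X \<and> X \<subseteq> D \<and> gfun E D \<phi> X d h"
   using saturated_Int[OF M W(1) adapted_saturated[OF pre_gradedD(4)[OF E X(1)]]] loc[OF X(1)] W(2) X(2)
   by auto
 qed
 moreover have "\<Union>((\<lambda>(D', \<psi>). W \<inter> D') ` atlas E) = W"
  using pre_gradedD(3)[OF E] saturated_pts[OF W(1)] by auto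
 ultimately show ?thesis by simp
qed

lemma gcoords_compat:
 assumes E: "pre_graded M E" and c: "gcoords M E (D, \<phi>)" "gcoords M E (D', \<psi>)"
 shows "gcompat E (D, \<phi>) (D', \<psi>)"
 unfolding gcompat_def prod.case
proof
 note M = pre_gradedD(1)[OF E] and fin = pre_gradedD(2)[OF E]
 fix i assume i: "i \<in> idx E"
 note a = gcoordsD(1)[OF c(1)] and a' = gcoordsD(1)[OF c(2)]
 have W: "saturated M E (D \<inter> D')"
  by (rule saturated_Int[OF M adapted_saturated[OF a] adapted_saturated[OF a']])
 show "gfun E D \<phi> (D \<inter> D') (wt E i) (\<lambda>e. \<psi> e i)"
 proof (rule gfun_cover[OF E a W])
  fix D0 \<eta> assume c0: "(D0, \<eta>) \<in> atlas E"
  note a0 = pre_gradedD(4)[OF E c0]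
  show "gfun E D \<phi> (D \<inter> D' \<inter> D0) (wt E i) (\<lambda>e. \<psi> e i)"
  proof (rule gfun_change[OF M fin a a0 gcoordsD(2)[OF c(1) c0]])
   show "saturated M E (D \<inter> D' \<inter> D0)" by (rule saturated_Int[OF M W adapted_saturated[OF a0]])
   show "gfun E D0 \<eta> (D \<inter> D' \<inter> D0) (wt E i) (\<lambda>e. \<psi> e i)"
    by (rule gfun_mono[OF gcompatD[OF gcoordsD(3)[OF c(2) c0] i]]) auto
  qed auto
 qed auto
qed

lemma gfun_change_gcoords:
 assumes E: "pre_graded M E" and c: "gcoords M E (D, \<phi>)" "gcoords M E (D', \<psi>)"
  and W: "saturated M E W" "W \<subseteq> D" "W \<subseteq> D'" and h: "gfun E D' \<psi> W d h"
 shows "gfun E D \<phi> W d h"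
 by (rule gfun_change[OF pre_gradedD(1,2)[OF E] gcoordsD(1)[OF c(1)] gcoordsD(1)[OF c(2)]
    gcoords_compat[OF E c] W h])

lemma polynomial_imp_gcompat:
 assumes M: "manifold M" and fin: "finite (idx E)"
  and a: "adapted_chart M E (D, \<phi>)" and a': "adapted_chart M E (D', \<psi>)"
  and p: "polynomial_transition M E (D, \<phi>) (D', \<psi>)"
 shows "gcompat E (D, \<phi>) (D', \<psi>)"
 unfolding gcompat_def prod.case
proof
 fix i assume i: "i \<in> idx E"
 have W: "saturated M E (D \<inter> D')" "D \<inter> D' \<subseteq> D"
  by (simp_all add: saturated_Int[OF M adapted_saturated[OF a] adapted_saturated[OF a']])
 show "gfun E D \<phi> (D \<inter> D') (wt E i) (\<lambda>e. \<psi> e i)"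
 proof (cases "wt E i = 0")
  case True
  obtain U \<xi> where "bundle_chart M E D' \<psi> U \<xi>" using bundle_chartE[OF a'] by blast
  note c = bundle_chartD(1,2,4)[OF this]
  have b: "i \<in> bidx E" using i True by (simp add: base_of_def)
  have "gfun E D \<phi> (D \<inter> D') 0 (\<lambda>e. \<xi> (bproj E e) i)"
   by (rule gfun_base[OF M fin a coord_sysD(4)[OF c(1) b] W]) (simp add: c(2))
  then have "gfun E D \<phi> (D \<inter> D') 0 (\<lambda>e. \<psi> e i)"
  proof (rule gfun_cong[OF M fin a W])
   fix e assume "e \<in> D \<inter> D'"
   then have "restr (bidx E) (\<psi> e) i = \<xi> (bproj E e) i" using c(3) by simp
   then show "\<psi> e i = \<xi> (bproj E e) i" using b by (simp add: restr_apply)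
  qed
  then show ?thesis using True by simp
 next
  case False
  then obtain c where c:
   "\<And>\<alpha>. \<alpha>\<in>monomials (idx E) (wt E) (wt E i) \<Longrightarrow> smooth_real_on M (bproj E ` (D \<inter> D')) (c \<alpha>)"
   "\<And>e. e\<in>D \<inter> D' \<Longrightarrow> \<psi> e i =
    (\<Sum>\<alpha>\<in>monomials (idx E) (wt E) (wt E i). c \<alpha> (bproj E e) * (\<Prod>j\<in>idx E. \<phi> e j ^ \<alpha> j))"
   using bspec[OF p[unfolded polynomial_transition_def prod.case] i] by auto
  have "D \<inter> D' \<subseteq> over E (bproj E ` (D \<inter> D'))"
   using saturated_pts[OF W(1)] by (auto simp: over_def)
  then have "gfun E D \<phi> (D \<inter> D') (0 + wt E i)
   (\<lambda>e. c \<alpha> (bproj E e) * (\<Prod>j\<in>idx E. \<phi> e j ^ \<alpha> j))"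
   if "\<alpha> \<in> monomials (idx E) (wt E) (wt E i)" for \<alpha>
   by (intro gfun_mult[OF M fin a W] gfun_base[OF M fin a c(1) W] gfun_monomial[OF M fin a W] that)
  then have "gfun E D \<phi> (D \<inter> D') (wt E i) (\<lambda>e. \<Sum>\<alpha>\<in>monomials (idx E) (wt E) (wt E i).
    c \<alpha> (bproj E e) * (\<Prod>j\<in>idx E. \<phi> e j ^ \<alpha> j))"
   by (intro gfun_sum[OF M fin a W]) simp
  then show ?thesis by (rule gfun_cong[OF M fin a W]) (simp add: c(2))
 qed
qed

text \<open>Homogeneous smooth transition functions are polynomial, so the compatibility used here is that of
  the definition of graded bundles.\<close>

lemma gcompat_imp_polynomial:
 assumes M: "manifold M" and fin: "finite (idx E)"
  and a: "adapted_chart M E (D, \<phi>)" and a': "adapted_chart M E (D', \<psi>)"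
  and g: "gcompat E (D, \<phi>) (D', \<psi>)"
 shows "polynomial_transition M E (D, \<phi>) (D', \<psi>)"
 unfolding polynomial_transition_def prod.case
proof (intro ballI impI)
 fix i assume i: "i \<in> idx E" "0 < wt E i"
 obtain U \<xi> where "bundle_chart M E D \<phi> U \<xi>" using bundle_chartE[OF a] by blast
 note c = bundle_chartD[OF this]
 obtain U' where U': "mopen M U'" "D' = over E U'"
  using adapted_saturated[OF a'] by (auto simp: saturated_def)
 note im0 = adapted_image[OF M fin c(1,2,4,5) U'(1)]
 have im: "\<phi> ` (D \<inter> D') = cyl (idx E) (wt E) (\<xi> ` (U \<inter> U'))"
  "open_crd (bidx E) (\<xi> ` (U \<inter> U'))" "bproj E ` (D \<inter> D') = U \<inter> U'"
  using im0 by (simp_all only: U'(2))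
 define f where "f z = \<psi> (inv_into D \<phi> z) i" for z
 have "gfun E D \<phi> (D \<inter> D') (wt E i) (\<lambda>e. \<psi> e i)" by (rule gcompatD[OF g i(1)])
 then have "smooth_crd (idx E) (cyl (idx E) (wt E) (\<xi> ` (U \<inter> U'))) f"
  "homog_on (wt E) (wt E i) (cyl (idx E) (wt E) (\<xi> ` (U \<inter> U'))) f"
  unfolding gfun_def im(1) f_def [abs_def] by auto
 from homog_polynomial[OF fin im(2) this] obtain k where k:
  "\<And>\<alpha>. smooth_crd (bidx E) (\<xi> ` (U \<inter> U')) (k \<alpha>)"
  "\<And>z. z \<in> cyl (idx E) (wt E) (\<xi> ` (U \<inter> U')) \<Longrightarrow>
   f z = (\<Sum>\<alpha>\<in>monomials (idx E) (wt E) (wt E i). k \<alpha> (restr (bidx E) z) * (\<Prod>j\<in>idx E. z j ^ \<alpha> j))"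
  by blast
 have UU': "mopen M (U \<inter> U')" by (rule manifold_mopen_Int[OF M coord_sysD(1)[OF c(1)] U'(1)])
 have "smooth_real_on M (U \<inter> U') (\<lambda>p. k \<alpha> (\<xi> p))" for \<alpha>
 proof (rule smooth_real_on_from_coords[OF M finite_bidx[OF fin] c(1) UU'])
  show "smooth_crd (bidx E) (\<xi> ` (U \<inter> U')) (\<lambda>z. k \<alpha> (\<xi> (inv_into U \<xi> z)))"
   by (rule smooth_crd_cong_imp[OF finite_bidx[OF fin] im(2) k(1)])
    (use coord_sysD(2)[OF c(1)] in \<open>auto simp: inv_into_f_f\<close>)
 qed simp
 moreover have "\<psi> e i = (\<Sum>\<alpha>\<in>monomials (idx E) (wt E) (wt E i).
   k \<alpha> (\<xi> (bproj E e)) * (\<Prod>j\<in>idx E. \<phi> e j ^ \<alpha> j))" if e: "e \<in> D \<inter> D'" for e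
 proof -
  have "\<phi> e \<in> cyl (idx E) (wt E) (\<xi> ` (U \<inter> U'))" using e im(1) by blast
  from k(2)[OF this] show ?thesis
   using c(4)[of e] e adapted_inv[OF a, of e] by (simp add: f_def)
 qed
 ultimately show "\<exists>c. (\<forall>\<alpha>\<in>monomials (idx E) (wt E) (wt E i).
    smooth_real_on M (bproj E ` (D \<inter> D')) (c \<alpha>)) \<and>
   (\<forall>e\<in>D \<inter> D'. \<psi> e i = (\<Sum>\<alpha>\<in>monomials (idx E) (wt E) (wt E i).
    c \<alpha> (bproj E e) * (\<Prod>j\<in>idx E. \<phi> e j ^ \<alpha> j)))"
  unfolding im(3) by (intro exI[of _ "\<lambda>\<alpha> p. k \<alpha> (\<xi> p)"]) simp
qed

lemma graded_bundle_pre_graded: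
 assumes "graded_bundle k M E"
 shows "pre_graded M E"
proof -
 have E: "manifold M" "manifold E" "\<And>c. c \<in> atlas E \<Longrightarrow> adapted_chart M E c"
  "\<And>c c'. c \<in> atlas E \<Longrightarrow> c' \<in> atlas E \<Longrightarrow> polynomial_transition M E c c'"
  using assms unfolding graded_bundle_def by blast+
 have "gcompat E c c'" if "c \<in> atlas E" "c' \<in> atlas E" for c c'
  using polynomial_imp_gcompat[OF E(1) manifold_finite[OF E(2)], of "fst c" "snd c" "fst c'" "snd c'"]
   E(3,4) that by simp
 then show ?thesis unfolding pre_graded_def
  using E(1,3) manifold_finite[OF E(2)] E(2) by (simp add: manifold_def)
qed

lemma gcoords_iff_graded_coords:
 assumes "pre_graded M E"
 shows "gcoords M E c \<longleftrightarrow> graded_coords M E c"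
proof -
 note E = pre_gradedD[OF assms]
 have *: "gcompat E c1 c2 \<longleftrightarrow> polynomial_transition M E c1 c2"
  if "adapted_chart M E c1" "adapted_chart M E c2" for c1 c2
  using polynomial_imp_gcompat[OF E(1,2), of "fst c1" "snd c1" "fst c2" "snd c2"]
   gcompat_imp_polynomial[OF E(1,2), of "fst c1" "snd c1" "fst c2" "snd c2"] that by auto
 show ?thesis unfolding gcoords_def graded_coords_def
  using *[of c] *[of _ c] E(4) by meson
qed

section \<open>The action, the affine structure and linear combinations in coordinates\<close>

text \<open>The point with scaled coordinates in one chart has scaled coordinates in every chart, since
  transition functions are homogeneous; so the defining description has exactly one solution.\<close>

lemma hact_coords:
 assumes E: "pre_graded M E" and e: "e \<in> pts E"
 shows "hact E t e \<in> pts E" "bproj E (hact E t e) = bproj E e"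
  "\<And>D \<phi> i. gcoords M E (D, \<phi>) \<Longrightarrow> e \<in> D \<Longrightarrow> i \<in> idx E \<Longrightarrow> \<phi> (hact E t e) i = t ^ wt E i * \<phi> e i"
proof -
 note M = pre_gradedD(1)[OF E] and fin = pre_gradedD(2)[OF E]
 obtain D0 \<phi>0 where c0: "(D0, \<phi>0) \<in> atlas E" "e \<in> D0" using pre_graded_cover[OF E e] by blast
 note g0 = gcoords_atlas[OF E c0(1)]
 note a0 = gcoordsD(1)[OF g0]
 obtain e' where e': "e' \<in> D0" "\<phi>0 e' = scl (wt E) t (\<phi>0 e)" "bproj E e' = bproj E e"
  using adapted_scl[OF M fin a0 adapted_saturated[OF a0] order_refl c0(2)] by blast
 have e'p: "e' \<in> pts E" using e'(1) saturated_pts[OF adapted_saturated[OF a0]] by blast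
 have co: "e' \<in> D \<and> (\<forall>i\<in>idx E. \<phi> e' i = t ^ wt E i * \<phi> e i)" if c: "gcoords M E (D, \<phi>)" "e \<in> D" for D \<phi>
 proof
  show e'D: "e' \<in> D"
   by (rule saturatedD[OF adapted_saturated[OF gcoordsD(1)[OF c(1)]] c(2) e'p e'(3)])
  show "\<forall>i\<in>idx E. \<phi> e' i = t ^ wt E i * \<phi> e i"
  proof
   fix i assume i: "i \<in> idx E"
   show "\<phi> e' i = t ^ wt E i * \<phi> e i"
    by (rule gfun_eval[OF M fin a0 gcompatD[OF gcoords_compat[OF E g0 c(1)] i]])
     (use e' c0 c e'D in \<open>auto simp: scl_def\<close>)
  qed
 qed
 have "hact E t e = e'" unfolding hact_def
 proof (rule the_equality)
  show "e' \<in> pts E \<and> (\<forall>(D, \<phi>)\<in>atlas E. e \<in> D \<longrightarrow> e' \<in> D \<and> (\<forall>i\<in>idx E. \<phi> e' i = t ^ wt E i * \<phi> e i))"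
   using e'p co gcoords_atlas[OF E] by blast
  fix y assume "y \<in> pts E \<and> (\<forall>(D, \<phi>)\<in>atlas E. e \<in> D \<longrightarrow> y \<in> D \<and> (\<forall>i\<in>idx E. \<phi> y i = t ^ wt E i * \<phi> e i))"
  then have "y \<in> D0" "\<forall>i\<in>idx E. \<phi>0 y i = t ^ wt E i * \<phi>0 e i" using c0 by auto
  then show "y = e'" using adapted_eq[OF a0 _ e'(1)] e'(2) by (simp add: scl_def)
 qed
 then show "hact E t e \<in> pts E" "bproj E (hact E t e) = bproj E e"
  "\<And>D \<phi> i. gcoords M E (D, \<phi>) \<Longrightarrow> e \<in> D \<Longrightarrow> i \<in> idx E \<Longrightarrow> \<phi> (hact E t e) i = t ^ wt E i * \<phi> e i"
  using e'p e'(3) co by auto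
qed

lemma saturated_gcoords: "gcoords M E (D, \<phi>) \<Longrightarrow> saturated M E D"
 using gcoordsD(1) adapted_saturated by blast

text \<open>The sum formed in one chart is the sum in every chart: transition functions of weight below \<open>k\<close> do not
  see the core, those of weight \<open>k\<close> are additive along it.\<close>

lemma dotplus_coords:
 assumes E: "pre_graded M E" and k: "0 < k" "\<And>i. i \<in> idx E \<Longrightarrow> wt E i \<le> k"
  and V: "V \<in> pts E" "v \<in> pts E" "bproj E v = bproj E V"
  and c1: "gcoords M E (D1, \<phi>1)" "v \<in> D1" and v: "\<And>i. i \<in> idx E \<Longrightarrow> 0 < wt E i \<Longrightarrow> wt E i < k \<Longrightarrow> \<phi>1 v i = 0"
 shows "dotplus k E V v \<in> pts E" "bproj E (dotplus k E V v) = bproj E V"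
  "\<And>D \<phi> i. gcoords M E (D, \<phi>) \<Longrightarrow> V \<in> D \<Longrightarrow> i \<in> idx E \<Longrightarrow>
    \<phi> (dotplus k E V v) i = \<phi> V i + (if wt E i = k then \<phi> v i else 0)"
proof -
 note M = pre_gradedD(1)[OF E] and fin = pre_gradedD(2)[OF E]
 note a1 = gcoordsD(1)[OF c1(1)]
 have V1: "V \<in> D1"
  using saturatedD[OF saturated_gcoords[OF c1(1)] c1(2) V(1)] V(3) by simp
 define z where "z = (\<lambda>i. \<phi>1 V i + (if wt E i = k then \<phi>1 v i else 0))"
 have "z \<in> crd (idx E)"
  using adapted_crd[OF a1 V1] adapted_crd[OF a1 c1(2)] by (auto simp: z_def crd_def)
 moreover have "z i = \<phi>1 V i" if "i \<in> bidx E" for i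
  using that k by (auto simp: z_def base_of_def)
 ultimately obtain V' where V': "V' \<in> D1" "\<phi>1 V' = z" "bproj E V' = bproj E V"
  using adapted_point[OF a1 V1] by blast
 have V'p: "V' \<in> pts E" using V'(1) saturated_pts[OF saturated_gcoords[OF c1(1)]] by blast
 have co: "V' \<in> D \<and> (\<forall>i\<in>idx E. \<phi> V' i = \<phi> V i + (if wt E i = k then \<phi> v i else 0))"
  if c: "gcoords M E (D, \<phi>)" "V \<in> D" for D \<phi>
 proof
  note sat = saturated_gcoords[OF c(1)]
  show V'D: "V' \<in> D" by (rule saturatedD[OF sat c(2) V'p V'(3)])
  have vD: "v \<in> D" by (rule saturatedD[OF sat c(2) V(2,3)])
  have W: "saturated M E (D1 \<inter> D)" "D1 \<inter> D \<subseteq> D1"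
   by (simp_all add: saturated_Int[OF M saturated_gcoords[OF c1(1)] sat])
  show "\<forall>i\<in>idx E. \<phi> V' i = \<phi> V i + (if wt E i = k then \<phi> v i else 0)"
  proof
   fix i assume i: "i \<in> idx E"
   note gi = gcompatD[OF gcoords_compat[OF E c1(1) c(1)] i]
   show "\<phi> V' i = \<phi> V i + (if wt E i = k then \<phi> v i else 0)"
   proof (cases "wt E i = k")
    case True
    obtain g where g: "\<And>V v V'. V \<in> D1 \<inter> D \<Longrightarrow> v \<in> D1 \<inter> D \<Longrightarrow> V' \<in> D1 \<inter> D \<Longrightarrow> bproj E v = bproj E V \<Longrightarrow> bproj E V' = bproj E V \<Longrightarrow>
      (\<And>i. i \<in> idx E \<Longrightarrow> \<phi>1 V' i = \<phi>1 V i + (if wt E i = k then \<phi>1 v i else 0)) \<Longrightarrow>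
      \<phi> V' i = \<phi> V i + (\<Sum>i\<in>{i\<in>idx E. wt E i = k}. g i (bproj E V) * \<phi>1 v i)"
     "\<And>v. v \<in> D1 \<inter> D \<Longrightarrow> (\<And>i. i \<in> idx E \<Longrightarrow> wt E i \<noteq> 0 \<Longrightarrow> wt E i \<noteq> k \<Longrightarrow> \<phi>1 v i = 0) \<Longrightarrow>
      \<phi> v i = (\<Sum>i\<in>{i\<in>idx E. wt E i = k}. g i (bproj E v) * \<phi>1 v i)"
     using gfun_top_linear[OF M fin a1 W gi[unfolded True] k(1)] by blast
    have "\<phi> V' i = \<phi> V i + (\<Sum>i\<in>{i\<in>idx E. wt E i = k}. g i (bproj E V) * \<phi>1 v i)"
     by (rule g(1)) (use V1 c1 c V' V'D vD V in \<open>auto simp: z_def\<close>)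
    moreover have "\<phi> v i = (\<Sum>i\<in>{i\<in>idx E. wt E i = k}. g i (bproj E v) * \<phi>1 v i)"
    proof (rule g(2))
     fix i assume "i \<in> idx E" "wt E i \<noteq> 0" "wt E i \<noteq> k"
     then show "\<phi>1 v i = 0" using v[of i] k(2)[of i] by simp
    qed (use c1 vD in auto)
    ultimately show ?thesis using V(3) True by simp
   next
    case False
    have "\<phi> V' i = \<phi> V i"
     by (rule gfun_below_top[OF M fin a1 W gi, of k])
      (use False k(2)[OF i] V1 V' V'D c in \<open>auto simp: z_def\<close>)
    then show ?thesis using False by simp
   qed
  qed
 qed
 have "dotplus k E V v = V'" unfolding dotplus_def
 proof (rule the_equality)
  show "V' \<in> pts E \<and> (\<forall>(D, \<phi>)\<in>atlas E. V \<in> D \<longrightarrow> V' \<in> D \<and>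
    (\<forall>i\<in>idx E. \<phi> V' i = \<phi> V i + (if wt E i = k then \<phi> v i else 0)))"
   using V'p co gcoords_atlas[OF E] by blast
  fix y assume y: "y \<in> pts E \<and> (\<forall>(D, \<phi>)\<in>atlas E. V \<in> D \<longrightarrow> y \<in> D \<and>
    (\<forall>i\<in>idx E. \<phi> y i = \<phi> V i + (if wt E i = k then \<phi> v i else 0)))"
  obtain D0 \<phi>0 where c0: "(D0, \<phi>0) \<in> atlas E" "V \<in> D0" using pre_graded_cover[OF E V(1)] by blast
  then have "y \<in> D0" "\<forall>i\<in>idx E. \<phi>0 y i = \<phi>0 V i + (if wt E i = k then \<phi>0 v i else 0)"
   using y by auto
  then show "y = V'"
   using adapted_eq[OF pre_gradedD(4)[OF E c0(1)]] co[OF gcoords_atlas[OF E c0(1)] c0(2)] by simp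
 qed
 then show "dotplus k E V v \<in> pts E" "bproj E (dotplus k E V v) = bproj E V"
  "\<And>D \<phi> i. gcoords M E (D, \<phi>) \<Longrightarrow> V \<in> D \<Longrightarrow> i \<in> idx E \<Longrightarrow>
    \<phi> (dotplus k E V v) i = \<phi> V i + (if wt E i = k then \<phi> v i else 0)"
  using V'p V'(3) co by auto
qed

text \<open>On a vector bundle all fibre coordinates have weight one, so transition functions are linear.\<close>

lemma lincomb_coords:
 assumes F: "pre_graded M F" and w: "\<And>i. i \<in> idx F \<Longrightarrow> wt F i \<le> 1"
  and p: "v0 \<in> pts F" "bproj F v0 = p" and u: "\<And>j. j \<in> J \<Longrightarrow> u j \<in> pts F \<and> bproj F (u j) = p"
 shows "lincomb F p J a u \<in> pts F" "bproj F (lincomb F p J a u) = p"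
  "\<And>D \<phi> i. gcoords M F (D, \<phi>) \<Longrightarrow> lincomb F p J a u \<in> D \<Longrightarrow> i \<in> idx F \<Longrightarrow> wt F i = 1 \<Longrightarrow>
   \<phi> (lincomb F p J a u) i = (\<Sum>j\<in>J. a j * \<phi> (u j) i)"
proof -
 note M = pre_gradedD(1)[OF F] and fin = pre_gradedD(2)[OF F]
 obtain D0 \<phi>0 where c0: "(D0, \<phi>0) \<in> atlas F" "v0 \<in> D0" using pre_graded_cover[OF F p(1)] by blast
 note g0 = gcoords_atlas[OF F c0(1)]
 note a0 = gcoordsD(1)[OF g0]
 have inD: "x \<in> D" if "gcoords M F (D, \<phi>)" "y \<in> D" "x \<in> pts F" "bproj F x = p" "bproj F y = p" for x y D \<phi>
  using saturatedD[OF saturated_gcoords[OF that(1)] that(2,3)] that(4,5) by simp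
 define z where "z = (\<lambda>i. if i \<in> idx F \<and> wt F i = 1 then \<Sum>j\<in>J. a j * \<phi>0 (u j) i else \<phi>0 v0 i)"
 have "z \<in> crd (idx F)" using adapted_crd[OF a0 c0(2)] by (auto simp: z_def crd_def)
 moreover have "z i = \<phi>0 v0 i" if "i \<in> bidx F" for i
  using that by (simp add: z_def base_of_def)
 ultimately obtain v where v: "v \<in> D0" "\<phi>0 v = z" "bproj F v = bproj F v0"
  using adapted_point[OF a0 c0(2)] by blast
 have vp: "v \<in> pts F" using v(1) saturated_pts[OF saturated_gcoords[OF g0]] by blast
 have co: "\<phi> v i = (\<Sum>j\<in>J. a j * \<phi> (u j) i)"
  if c: "gcoords M F (D, \<phi>)" "v \<in> D" and i: "i \<in> idx F" "wt F i = 1" for D \<phi> i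
 proof -
  have W: "saturated M F (D0 \<inter> D)" "D0 \<inter> D \<subseteq> D0"
   by (simp_all add: saturated_Int[OF M saturated_gcoords[OF g0] saturated_gcoords[OF c(1)]])
  have h: "gfun F D0 \<phi>0 (D0 \<inter> D) 1 (\<lambda>e. \<phi> e i)"
   using gcompatD[OF gcoords_compat[OF F g0 c(1)] i(1)] i(2) by simp
  obtain g where g: "\<And>v. v \<in> D0 \<inter> D \<Longrightarrow> (\<And>i. i \<in> idx F \<Longrightarrow> wt F i \<noteq> 0 \<Longrightarrow> wt F i \<noteq> 1 \<Longrightarrow> \<phi>0 v i = 0) \<Longrightarrow>
    \<phi> v i = (\<Sum>l\<in>{i\<in>idx F. wt F i = 1}. g l (bproj F v) * \<phi>0 v l)"
   using gfun_core_linear[OF M fin a0 W h zero_less_one] by blast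
  have lin: "\<phi> x i = (\<Sum>l\<in>{i\<in>idx F. wt F i = 1}. g l p * \<phi>0 x l)" if "x \<in> pts F" "bproj F x = p" for x
  proof -
   have "x \<in> D0 \<inter> D" using inD[OF g0 c0(2) that p(2)] inD[OF c that] v(3) p(2) by simp
   moreover have "\<phi>0 x i = 0" if "i \<in> idx F" "wt F i \<noteq> 0" "wt F i \<noteq> 1" for i
    using w[OF that(1)] that by simp
   ultimately have "\<phi> x i = (\<Sum>l\<in>{i\<in>idx F. wt F i = 1}. g l (bproj F x) * \<phi>0 x l)" by (rule g)
   then show ?thesis using that(2) by simp
  qed
  have "\<phi> v i = (\<Sum>l\<in>{i\<in>idx F. wt F i = 1}. g l p * (\<Sum>j\<in>J. a j * \<phi>0 (u j) l))"
   using lin[OF vp] v p(2) by (simp add: z_def)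
  also have "\<dots> = (\<Sum>j\<in>J. a j * (\<Sum>l\<in>{i\<in>idx F. wt F i = 1}. g l p * \<phi>0 (u j) l))"
   unfolding sum_distrib_left by (subst sum.swap) (simp add: mult_ac)
  also have "\<dots> = (\<Sum>j\<in>J. a j * \<phi> (u j) i)"
   using lin u by (intro sum.cong) auto
  finally show ?thesis .
 qed
 have "lincomb F p J a u = v" unfolding lincomb_def
 proof (rule the_equality)
  show "v \<in> pts F \<and> bproj F v = p \<and> (\<forall>(D, \<phi>)\<in>atlas F. v \<in> D \<longrightarrow>
    (\<forall>i\<in>idx F. wt F i = 1 \<longrightarrow> \<phi> v i = (\<Sum>j\<in>J. a j * \<phi> (u j) i)))"
  proof (intro conjI ballI, goal_cases)
   case (3 c)
   then show ?case using co[OF gcoords_atlas[OF F]] by (cases c) blast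
  qed (use vp v(3) p(2) in auto)
  fix y assume y: "y \<in> pts F \<and> bproj F y = p \<and> (\<forall>(D, \<phi>)\<in>atlas F. y \<in> D \<longrightarrow>
    (\<forall>i\<in>idx F. wt F i = 1 \<longrightarrow> \<phi> y i = (\<Sum>j\<in>J. a j * \<phi> (u j) i)))"
  then have yD: "y \<in> D0" using inD[OF g0 c0(2)] p(2) by blast
  show "y = v"
  proof (rule adapted_eq[OF a0 yD v(1)])
   fix i assume i: "i \<in> idx F"
   show "\<phi>0 y i = \<phi>0 v i"
   proof (cases "wt F i = 0")
    case True
    then have "i \<in> bidx F" using i by (simp add: base_of_def)
    then show ?thesis using adapted_base_eq[OF a0 yD v(1)] y v(3) p(2) by simp
   next
    case False
    then have "wt F i = 1" using w[OF i] by simp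
    moreover have "\<forall>i\<in>idx F. wt F i = 1 \<longrightarrow> \<phi>0 y i = (\<Sum>j\<in>J. a j * \<phi>0 (u j) i)"
     using y c0(1) yD by blast
    ultimately show ?thesis using i v(2) by (simp add: z_def)
   qed
  qed
 qed
 then show "lincomb F p J a u \<in> pts F" "bproj F (lincomb F p J a u) = p"
  "\<And>D \<phi> i. gcoords M F (D, \<phi>) \<Longrightarrow> lincomb F p J a u \<in> D \<Longrightarrow> i \<in> idx F \<Longrightarrow> wt F i = 1 \<Longrightarrow>
   \<phi> (lincomb F p J a u) i = (\<Sum>j\<in>J. a j * \<phi> (u j) i)"
  using vp v(3) p(2) co by auto
qed

section \<open>Cores, fibre products and frames\<close>

lemma pre_gradedI:
 assumes "manifold M" "finite (idx E)" "(\<Union>(D, \<phi>)\<in>atlas E. D) = pts E"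
  and "\<And>D \<phi>. (D, \<phi>) \<in> atlas E \<Longrightarrow> adapted_chart M E (D, \<phi>)"
  and "\<And>D \<phi> D' \<psi>. (D, \<phi>) \<in> atlas E \<Longrightarrow> (D', \<psi>) \<in> atlas E \<Longrightarrow> gcompat E (D, \<phi>) (D', \<psi>)"
 shows "pre_graded M E"
 unfolding pre_graded_def using assms by fast

lemma smooth_crd_fewer_labels:
 assumes "finite I" "J \<subseteq> I" "open_crd I V" "smooth_crd I V f" "open_crd J U" "U \<subseteq> V"
 shows "smooth_crd J U f"
proof -
 have "smooth_crd J U (\<lambda>z. f (id z))"
  by (rule smooth_crd_comp[OF finite_subset[OF assms(2,1)] assms(5,1,3) _ _ assms(4)])
   (use assms(6) smooth_crd_coord in auto)
 then show ?thesis by simp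
qed

subsection \<open>The core\<close>

lemma core_simps:
 "pts (core k E) = {e\<in>pts E. \<forall>(D, \<phi>)\<in>atlas E. e \<in> D \<longrightarrow> (\<forall>i\<in>idx E. 0 < wt E i \<and> wt E i < k \<longrightarrow> \<phi> e i = 0)}"
 "idx (core k E) = {i\<in>idx E. wt E i = 0 \<or> wt E i = k}"
 "bproj (core k E) = bproj E"
 "wt (core k E) = (\<lambda>i. if wt E i = 0 then 0 else 1)"
 "atlas (core k E) = {(D \<inter> pts (core k E), \<lambda>e. restr {i\<in>idx E. wt E i = 0 \<or> wt E i = k} (\<phi> e)) |D \<phi>.
   (D, \<phi>) \<in> atlas E}"
 by (simp_all add: core_def Let_def)

context
 fixes M :: "('m, 'b, 'z) mfd_scheme" and E :: "('e, 'i, 'm) gbundle" and k :: nat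
 assumes E: "pre_graded M E" and k: "0 < k" "\<And>i. i \<in> idx E \<Longrightarrow> wt E i \<le> k"
begin

text \<open>Compare \<open>e\<close> with its image \<open>e0\<close> on the zero section: below weight \<open>k\<close> they have the same coordinates in
  the first chart, and functions of degree below \<open>k\<close> do not see the rest; on the zero section
  coordinates of positive weight vanish.\<close>

lemma core_coord_zero:
 assumes c: "gcoords M E (D, \<phi>)" "e \<in> D" and v: "\<And>i. i \<in> idx E \<Longrightarrow> 0 < wt E i \<Longrightarrow> wt E i < k \<Longrightarrow> \<phi> e i = 0"
  and c': "gcoords M E (D', \<psi>)" "e \<in> D'" and i: "i \<in> idx E" "0 < wt E i" "wt E i < k"
 shows "\<psi> e i = 0"
proof -
 note M = pre_gradedD(1)[OF E] and fin = pre_gradedD(2)[OF E]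
 note a = gcoordsD(1)[OF c(1)]
 have W: "saturated M E (D \<inter> D')" "D \<inter> D' \<subseteq> D"
  by (simp_all add: saturated_Int[OF M saturated_gcoords[OF c(1)] saturated_gcoords[OF c'(1)]])
 obtain e0 where e0: "e0 \<in> D \<inter> D'" "\<phi> e0 = scl (wt E) 0 (\<phi> e)"
  using adapted_scl[OF M fin a W] c c' by blast
 note g = gcompatD[OF gcoords_compat[OF E c(1) c'(1)] i(1)]
 have "\<psi> e i = \<psi> e0 i"
 proof (rule gfun_below_top[OF M fin a W g i(3)])
  fix j assume "j \<in> idx E" "wt E j \<noteq> k"
  then show "\<phi> e j = \<phi> e0 j" using v[of j] k(2)[of j] e0(2)
   by (cases "wt E j = 0") (auto simp: scl_def power_0_left)
 qed (use e0 c c' in auto)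
 also have "\<psi> e0 i = 0 ^ wt E i * \<psi> e i"
  by (rule gfun_eval[OF M fin a g]) (use c c' e0 in \<open>auto simp: scl_def\<close>)
 finally show ?thesis using i(2) by (simp add: power_0_left)
qed

lemma core_iff:
 assumes c: "gcoords M E (D, \<phi>)" "e \<in> D"
 shows "e \<in> pts (core k E) \<longleftrightarrow> (\<forall>i\<in>idx E. 0 < wt E i \<and> wt E i < k \<longrightarrow> \<phi> e i = 0)"
proof
 have ep: "e \<in> pts E" using c(2) saturated_pts[OF saturated_gcoords[OF c(1)]] by blast
 obtain D0 \<phi>0 where c0: "(D0, \<phi>0) \<in> atlas E" "e \<in> D0" using pre_graded_cover[OF E ep] by blast
 note g0 = gcoords_atlas[OF E c0(1)]
 show "\<forall>i\<in>idx E. 0 < wt E i \<and> wt E i < k \<longrightarrow> \<phi> e i = 0" if "e \<in> pts (core k E)"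
 proof (intro ballI impI)
  fix i assume i: "i \<in> idx E" "0 < wt E i \<and> wt E i < k"
  have z: "\<phi>0 e i = 0" if "i \<in> idx E" "0 < wt E i" "wt E i < k" for i
   using \<open>e \<in> pts (core k E)\<close> c0 that unfolding core_simps(1) by blast
  show "\<phi> e i = 0"
   by (rule core_coord_zero[OF g0 c0(2) z c i(1) conjunct1[OF i(2)] conjunct2[OF i(2)]])
 qed
 assume *: "\<forall>i\<in>idx E. 0 < wt E i \<and> wt E i < k \<longrightarrow> \<phi> e i = 0"
 have "\<psi> e i = 0" if "(D', \<psi>) \<in> atlas E" "e \<in> D'" "i \<in> idx E" "0 < wt E i" "wt E i < k" for D' \<psi> i
  by (rule core_coord_zero[OF c _ gcoords_atlas[OF E that(1)] that(2-5)]) (use * in blast)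
 then show "e \<in> pts (core k E)" using ep by (auto simp: core_simps)
qed

lemma bidx_core: "bidx (core k E) = bidx E"
 unfolding base_of_def core_simps by auto

definition cchart :: "('e \<Rightarrow> 'i \<Rightarrow> real) \<Rightarrow> 'e \<Rightarrow> 'i \<Rightarrow> real" where
 "cchart \<phi> e = restr {i\<in>idx E. wt E i = 0 \<or> wt E i = k} (\<phi> e)"

lemma cchart_eq:
 assumes c: "gcoords M E (D, \<phi>)" "e \<in> D" "e \<in> pts (core k E)"
 shows "cchart \<phi> e = \<phi> e"
proof
 fix i
 show "cchart \<phi> e i = \<phi> e i"
 proof (cases "i \<in> {i\<in>idx E. wt E i = 0 \<or> wt E i = k}")
  case True
  then show ?thesis by (simp add: cchart_def restr_apply)
 next
  case False
  have "\<phi> e i = 0"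
  proof (cases "i \<in> idx E")
   case True
   then have "0 < wt E i \<and> wt E i < k" using False k(2)[OF True] by auto
   then show ?thesis using core_iff[OF c(1,2)] c(3) True by blast
  next
   case False
   then show ?thesis using adapted_crd[OF gcoordsD(1)[OF c(1)] c(2)] by (simp add: crd_def)
  qed
  moreover have "cchart \<phi> e i = 0" using False by (simp only: cchart_def restr_apply if_False)
  ultimately show ?thesis by simp
 qed
qed

lemma core_adapted:
 assumes c: "gcoords M E (D, \<phi>)"
 shows "adapted_chart M (core k E) (D \<inter> pts (core k E), cchart \<phi>)"
proof -
 let ?P = "pts (core k E)"
 note a = gcoordsD(1)[OF c]
 obtain U \<xi> where "bundle_chart M E D \<phi> U \<xi>" using bundle_chartE[OF a] by blast
 note u = bundle_chartD[OF this]
 show ?thesis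
 proof (rule adapted_chart_by_points)
  show "coord_sys M (bidx (core k E)) (U, \<xi>)" using u(1) by (simp add: bidx_core)
  show "D \<inter> ?P = over (core k E) U"
   unfolding u(2) by (auto simp: over_def core_simps)
  show "restr (bidx (core k E)) (cchart \<phi> e) = \<xi> (bproj (core k E) e)" if "e \<in> D \<inter> ?P" for e
   using that u(4)[of e] cchart_eq[OF c, of e] unfolding bidx_core core_simps(3) by simp
  show "cchart \<phi> e \<in> crd (idx (core k E))" for e by (simp add: cchart_def core_simps restr_crd)
  show "e = e'" if "e \<in> D \<inter> ?P" "e' \<in> D \<inter> ?P" "cchart \<phi> e = cchart \<phi> e'" for e e'
   using that u(3) cchart_eq[OF c] by (auto dest: inj_onD)
  fix p z assume p: "p \<in> U" "restr (bidx (core k E)) z = \<xi> p" and z1: "z \<in> crd (idx (core k E))"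
  have z: "z \<in> crd (idx (core k E))" "restr (bidx E) z \<in> \<xi> ` U" using p z1 by (auto simp: bidx_core)
  then have "z \<in> crd (idx E)" by (auto simp: crd_def core_simps)
  then have "z \<in> \<phi> ` D" using z u(5) by (simp add: cyl_def)
  then obtain e where e: "e \<in> D" "z = \<phi> e" by auto
  have "e \<in> ?P" using core_iff[OF c e(1)] z(1) e(2) by (auto simp: crd_def core_simps)
  then show "\<exists>e\<in>D \<inter> ?P. cchart \<phi> e = z" using e cchart_eq[OF c e(1)] by force
 qed
qed

lemma core_gcompat:
 assumes c: "gcoords M E (D, \<phi>)" and c': "gcoords M E (D', \<psi>)"
 shows "gcompat (core k E) (D \<inter> pts (core k E), cchart \<phi>) (D' \<inter> pts (core k E), cchart \<psi>)"
 unfolding gcompat_def prod.case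
proof
 let ?P = "pts (core k E)" and ?C = "core k E"
 note M = pre_gradedD(1)[OF E] and fin = pre_gradedD(2)[OF E]
 note a = gcoordsD(1)[OF c] and ca = core_adapted[OF c] and ca' = core_adapted[OF c']
 have finC: "finite (idx ?C)" using fin by (simp add: core_simps)
 have sub: "idx ?C \<subseteq> idx E" by (auto simp: core_simps)
 have W: "saturated M E (D \<inter> D')" "D \<inter> D' \<subseteq> D"
  by (simp_all add: saturated_Int[OF M saturated_gcoords[OF c] saturated_gcoords[OF c']])
 have WC: "saturated M ?C (D \<inter> ?P \<inter> (D' \<inter> ?P))" "D \<inter> ?P \<inter> (D' \<inter> ?P) \<subseteq> D \<inter> ?P"
  using saturated_Int[OF M adapted_saturated[OF ca] adapted_saturated[OF ca']] by auto
 fix i assume i: "i \<in> idx ?C"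
 then have iE: "i \<in> idx E" using sub by blast
 note g = gcompatD[OF gcoords_compat[OF E c c'] iE]
 show "gfun ?C (D \<inter> ?P) (cchart \<phi>) (D \<inter> ?P \<inter> (D' \<inter> ?P)) (wt ?C i) (\<lambda>e. cchart \<psi> e i)"
 proof (rule gfunI[OF M finC ca WC])
  let ?W = "D \<inter> ?P \<inter> (D' \<inter> ?P)"
  have OC: "open_crd (idx ?C) (cchart \<phi> ` ?W)"
   by (rule adapted_saturated_open[OF M finC ca WC])
  have "smooth_crd (idx ?C) (cchart \<phi> ` ?W) (\<lambda>z. \<psi> (inv_into D \<phi> z) i)"
   by (rule smooth_crd_fewer_labels[OF fin sub adapted_saturated_open[OF M fin a W] gfun_smooth[OF g] OC])
    (use cchart_eq[OF c] in force)
  then show "smooth_crd (idx ?C) (cchart \<phi> ` ?W) (\<lambda>z. cchart \<psi> (inv_into (D \<inter> ?P) (cchart \<phi>) z) i)"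
  proof (rule smooth_crd_cong_imp[OF finC OC])
   fix y assume "y \<in> cchart \<phi> ` ?W"
   then obtain e where e: "e \<in> D" "e \<in> D'" "e \<in> ?P" "y = cchart \<phi> e" by auto
   then show "cchart \<psi> (inv_into (D \<inter> ?P) (cchart \<phi>) y) i = \<psi> (inv_into D \<phi> y) i"
    using adapted_inv[OF ca, of e] adapted_inv[OF a e(1)] cchart_eq[OF c e(1,3)] cchart_eq[OF c' e(2,3)]
    by simp
  qed
 next
  fix e e' t assume e: "e \<in> D \<inter> ?P \<inter> (D' \<inter> ?P)" "e' \<in> D \<inter> ?P \<inter> (D' \<inter> ?P)"
   "bproj ?C e' = bproj ?C e" "cchart \<phi> e' = scl (wt ?C) t (cchart \<phi> e)"
  then have bp: "bproj E e' = bproj E e" by (simp add: core_simps)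
  have \<phi>: "cchart \<phi> e = \<phi> e" "cchart \<phi> e' = \<phi> e'" "cchart \<psi> e = \<psi> e" "cchart \<psi> e' = \<psi> e'"
   using cchart_eq[OF c] cchart_eq[OF c'] e by auto
  show "cchart \<psi> e' i = t ^ wt ?C i * cchart \<psi> e i"
  proof (cases "wt E i = 0")
   case True
   then have "\<psi> e' i = \<psi> e i"
    using adapted_base_eq[OF gcoordsD(1)[OF c'], of e' e] e bp iE by (auto simp: base_of_def)
   then show ?thesis using True \<phi> by (simp add: core_simps)
  next
   case False
   then have ik: "wt E i = k" using i by (auto simp: core_simps)
   obtain h where h: "\<forall>v\<in>D \<inter> D'. (\<forall>i\<in>idx E. wt E i \<noteq> 0 \<longrightarrow> wt E i \<noteq> k \<longrightarrow> \<phi> v i = 0) \<longrightarrow>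
     \<psi> v i = (\<Sum>l\<in>{i\<in>idx E. wt E i = k}. h l (bproj E v) * \<phi> v l)"
    using gfun_core_linear[OF M fin a W g[unfolded ik] k(1)] by blast
   have z: "\<forall>i\<in>idx E. wt E i \<noteq> 0 \<longrightarrow> wt E i \<noteq> k \<longrightarrow> \<phi> v i = 0" if "v \<in> D" "v \<in> ?P" for v
   proof (intro ballI impI)
    fix l assume "l \<in> idx E" "wt E l \<noteq> 0" "wt E l \<noteq> k"
    then show "\<phi> v l = 0" using core_iff[OF c that(1)] that(2) k(2)[of l] by auto
   qed
   have "\<psi> e i = (\<Sum>l\<in>{i\<in>idx E. wt E i = k}. h l (bproj E e) * \<phi> e l)"
    "\<psi> e' i = (\<Sum>l\<in>{i\<in>idx E. wt E i = k}. h l (bproj E e') * \<phi> e' l)"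
    using h z e by auto
   moreover have "\<phi> e' l = t * \<phi> e l" if "wt E l = k" for l
    using e(4) \<phi> that k by (simp add: scl_def core_simps)
   ultimately have "\<psi> e' i = t * \<psi> e i"
    by (simp add: bp sum_distrib_left mult_ac)
   then show ?thesis using ik k \<phi> by (simp add: core_simps)
  qed
 qed
qed

lemma atlas_core: "atlas (core k E) = (\<lambda>(D, \<phi>). (D \<inter> pts (core k E), cchart \<phi>)) ` atlas E"
 unfolding core_simps(5) cchart_def [abs_def] by (auto simp: image_iff)

lemma pre_graded_core: "pre_graded M (core k E)"
proof (rule pre_gradedI)
 show "manifold M" by (rule pre_gradedD(1)[OF E])
 show "finite (idx (core k E))" using pre_gradedD(2)[OF E] by (simp add: core_simps)
 have "pts (core k E) \<subseteq> pts E" by (auto simp: core_simps)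
 then show "(\<Union>(D, \<phi>)\<in>atlas (core k E). D) = pts (core k E)"
  unfolding atlas_core using pre_gradedD(3)[OF E] by auto
 show "adapted_chart M (core k E) (D, \<phi>)" if "(D, \<phi>) \<in> atlas (core k E)" for D \<phi>
  using that core_adapted[OF gcoords_atlas[OF E]] unfolding atlas_core by auto
 show "gcompat (core k E) (D, \<phi>) (D', \<psi>)"
  if "(D, \<phi>) \<in> atlas (core k E)" "(D', \<psi>) \<in> atlas (core k E)" for D \<phi> D' \<psi>
  using that core_gcompat[OF gcoords_atlas[OF E] gcoords_atlas[OF E]] unfolding atlas_core by auto
qed

lemma core_gcoords:
 assumes c: "gcoords M E (D, \<phi>)"
 shows "gcoords M (core k E) (D \<inter> pts (core k E), cchart \<phi>)"
 unfolding gcoords_def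
proof (intro conjI ballI core_adapted[OF c])
 fix x assume "x \<in> atlas (core k E)"
 then obtain D' \<psi> where x: "x = (D' \<inter> pts (core k E), cchart \<psi>)" "(D', \<psi>) \<in> atlas E"
  unfolding atlas_core by auto
 show "gcompat (core k E) (D \<inter> pts (core k E), cchart \<phi>) x"
  "gcompat (core k E) x (D \<inter> pts (core k E), cchart \<phi>)"
  unfolding x(1) using core_gcompat[OF c gcoords_atlas[OF E x(2)]] core_gcompat[OF gcoords_atlas[OF E x(2)] c]
  by auto
qed

end

subsection \<open>Change of weights\<close>

lemma reweight_simps [simp]:
 "pts (reweight m F) = pts F" "idx (reweight m F) = idx F" "atlas (reweight m F) = atlas F"
 "bproj (reweight m F) = bproj F" "wt (reweight m F) i = m * wt F i"
 by (simp_all add: reweight_def)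

lemma scl_reweight: "scl (wt (reweight m F)) t z = scl (wt F) (t ^ m) z"
 by (simp add: scl_def power_mult)

lemma gfun_reweight: "gfun F D \<phi> W d h \<Longrightarrow> gfun (reweight m F) D \<phi> W (m * d) h"
 unfolding gfun_def homog_on_def scl_reweight by (simp add: power_mult)

lemma gcoords_reweight:
 assumes m: "0 < m" and c: "gcoords M F (D, \<phi>)"
 shows "gcoords M (reweight m F) (D, \<phi>)"
proof -
 have "adapted_chart M (reweight m F) (D, \<phi>)"
  using gcoordsD(1)[OF c] m unfolding adapted_chart_def by simp
 moreover have "gcompat (reweight m F) c1 c2" if "gcompat F c1 c2" for c1 c2
  using that gfun_reweight[of F _ _ _ _ _ m]
  by (cases c1; cases c2) (simp only: gcompat_def prod.case reweight_simps, blast)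
 ultimately show ?thesis using gcoordsD(2,3)[OF c] unfolding gcoords_def by simp
qed

lemma pre_graded_reweight:
 assumes m: "0 < m" and F: "pre_graded M F"
 shows "pre_graded M (reweight m F)"
proof (rule pre_gradedI)
 show "manifold M" "finite (idx (reweight m F))" "(\<Union>(D, \<phi>)\<in>atlas (reweight m F). D) = pts (reweight m F)"
  using pre_gradedD(1,2,3)[OF F] by simp_all
 show "adapted_chart M (reweight m F) (D, \<phi>)" if "(D, \<phi>) \<in> atlas (reweight m F)" for D \<phi>
  using gcoordsD(1)[OF gcoords_reweight[OF m gcoords_atlas[OF F]]] that by simp
 show "gcompat (reweight m F) (D, \<phi>) (D', \<psi>)"
  if "(D, \<phi>) \<in> atlas (reweight m F)" "(D', \<psi>) \<in> atlas (reweight m F)" for D \<phi> D' \<psi>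
  using gcoordsD(2)[OF gcoords_reweight[OF m gcoords_atlas[OF F]]] that by simp
qed

subsection \<open>Fibre products\<close>

lemma fibre_prod_simps:
 "pts (fibre_prod G H) = {(e, f). e \<in> pts G \<and> f \<in> pts H \<and> bproj G e = bproj H f}"
 "idx (fibre_prod G H) = idx G <+> {j\<in>idx H. wt H j > 0}"
 "bproj (fibre_prod G H) = (\<lambda>(e, f). bproj G e)"
 "wt (fibre_prod G H) = case_sum (wt G) (wt H)"
 "atlas (fibre_prod G H) = {((D \<times> D') \<inter> pts (fibre_prod G H),
   \<lambda>(e, f). restr (idx G <+> {j\<in>idx H. wt H j > 0}) (case_sum (\<phi> e) (\<psi> f))) |D \<phi> D' \<psi>.
   (D, \<phi>) \<in> atlas G \<and> (D', \<psi>) \<in> atlas H}"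
 by (simp_all add: fibre_prod_def Let_def)

context
 fixes M :: "('m, 'b, 'z) mfd_scheme" and G :: "('e, 'i, 'm) gbundle" and H :: "('f, 'j, 'm) gbundle"
 assumes G: "pre_graded M G" and H: "pre_graded M H"
begin

definition shear_dom :: "'e set \<Rightarrow> 'f set \<Rightarrow> ('e \<times> 'f) set" where
 "shear_dom D D' = (D \<times> D') \<inter> pts (fibre_prod G H)"

text \<open>Product coordinates in which the fibre coordinates of the second factor are translated by a function
  of the first factor.  Base coordinates of the second factor are dropped as labels.\<close>

definition shear :: "('e \<Rightarrow> 'i \<Rightarrow> real) \<Rightarrow> ('f \<Rightarrow> 'j \<Rightarrow> real) \<Rightarrow> ('e \<Rightarrow> 'j \<Rightarrow> real) \<Rightarrow> 'e \<times> 'f \<Rightarrow> 'i + 'j \<Rightarrow> real" where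
 "shear \<phi> \<psi> S = (\<lambda>(e, f). restr (idx (fibre_prod G H)) (case_sum (\<phi> e) (\<lambda>\<mu>. \<psi> f \<mu> + S e \<mu>)))"

lemma shear_apply:
 "i \<in> idx G \<Longrightarrow> shear \<phi> \<psi> S (e, f) (Inl i) = \<phi> e i"
 "\<mu> \<in> idx H \<Longrightarrow> 0 < wt H \<mu> \<Longrightarrow> shear \<phi> \<psi> S (e, f) (Inr \<mu>) = \<psi> f \<mu> + S e \<mu>"
 by (auto simp: shear_def restr_apply fibre_prod_simps)

lemma bidx_fibre_prod: "bidx (fibre_prod G H) = Inl ` bidx G"
 by (auto simp: base_of_def fibre_prod_simps)

lemma finite_idx_fibre_prod: "finite (idx (fibre_prod G H))"
 using pre_gradedD(2)[OF G] pre_gradedD(2)[OF H] by (simp add: fibre_prod_simps)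

lemma shear_dom_eq:
 assumes "D = over G U" "D' = over H U'"
 shows "shear_dom D D' = over (fibre_prod G H) (U \<inter> U')"
 using assms by (auto simp: shear_dom_def over_def fibre_prod_simps)

lemma shear_adapted:
 assumes c: "gcoords M G (D, \<phi>)" and c': "gcoords M H (D', \<psi>)"
 shows "adapted_chart M (fibre_prod G H) (shear_dom D D', shear \<phi> \<psi> S)"
proof -
 let ?F = "fibre_prod G H"
 note M = pre_gradedD(1)[OF G] and finG = pre_gradedD(2)[OF G] and finH = pre_gradedD(2)[OF H]
 note a = gcoordsD(1)[OF c] and a' = gcoordsD(1)[OF c']
 obtain U \<xi> where "bundle_chart M G D \<phi> U \<xi>" using bundle_chartE[OF a] by blast
 note u = bundle_chartD[OF this]
 obtain U' \<xi>' where "bundle_chart M H D' \<psi> U' \<xi>'" using bundle_chartE[OF a'] by blast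
 note u' = bundle_chartD[OF this]
 have UU: "mopen M U" "mopen M U'" using coord_sysD(1) u(1) u'(1) by blast+
 have bp': "bproj H ` D' = U'"
  using adapted_image(3)[OF M finH u'(1,2,4,5) UU(2)] u'(2) by (simp add: Int_absorb)
 define \<zeta> :: "'m \<Rightarrow> 'i + 'j \<Rightarrow> real" where "\<zeta> p k = (if k \<in> Inl ` bidx G then \<xi> p (projl k) else 0)" for p k
 have "bij_betw projl (Inl ` bidx G) (bidx G)"
  by (auto simp: bij_betw_def inj_on_def image_image)
 from coord_sys_relabel[OF M finite_bidx[OF finG] coord_sys_restrict[OF M finite_bidx[OF finG] u(1) UU(2)] this]
 have cs: "coord_sys M (bidx ?F) (U \<inter> U', \<zeta>)"
  by (simp add: bidx_fibre_prod \<zeta>_def [abs_def])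
 have bc: "restr (bidx ?F) (shear \<phi> \<psi> S x) = \<zeta> (bproj ?F x)" if x: "x \<in> shear_dom D D'" for x
 proof
  fix k
  obtain e f where ef: "x = (e, f)" "e \<in> D" using x by (auto simp: shear_dom_def)
  have "restr (bidx G) (\<phi> e) i = \<xi> (bproj G e) i" for i using u(4)[OF ef(2)] by simp
  then have "\<phi> e i = \<xi> (bproj G e) i" if "i \<in> bidx G" for i using that by (metis restr_apply)
  then show "restr (bidx ?F) (shear \<phi> \<psi> S x) k = \<zeta> (bproj ?F x) k"
   using base_of_subset[of "idx G" "wt G"] shear_apply(1)[of _ \<phi> \<psi> S e f]
   by (auto simp only: restr_apply bidx_fibre_prod \<zeta>_def ef(1) fibre_prod_simps(3) prod.case
     sum.sel split: if_split)
 qed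
 show ?thesis
 proof (rule adapted_chart_by_points[OF cs shear_dom_eq[OF u(2) u'(2)] bc])
  show "shear \<phi> \<psi> S x \<in> crd (idx ?F)" for x by (cases x) (simp add: shear_def restr_crd)
  show "x1 = x2" if x: "x1 \<in> shear_dom D D'" "x2 \<in> shear_dom D D'"
   and eq: "shear \<phi> \<psi> S x1 = shear \<phi> \<psi> S x2" for x1 x2
  proof -
   obtain e1 f1 e2 f2 where xs: "x1 = (e1, f1)" "x2 = (e2, f2)" by (cases x1; cases x2)
   note x = x[unfolded xs] and eq = eq[unfolded xs]
   have D: "e1 \<in> D" "f1 \<in> D'" "e2 \<in> D" "f2 \<in> D'" "bproj G e1 = bproj H f1" "bproj G e2 = bproj H f2"
    using x by (auto simp: shear_dom_def fibre_prod_simps)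
   have e: "e1 = e2"
   proof (rule adapted_eq[OF a D(1,3)])
    fix i assume i: "i \<in> idx G"
    from eq have "shear \<phi> \<psi> S (e1, f1) (Inl i) = shear \<phi> \<psi> S (e2, f2) (Inl i)" by simp
    then show "\<phi> e1 i = \<phi> e2 i" using shear_apply(1)[OF i] by metis
   qed
   have "f1 = f2"
   proof (rule adapted_eq[OF a' D(2,4)])
    fix i assume i: "i \<in> idx H"
    show "\<psi> f1 i = \<psi> f2 i"
    proof (cases "wt H i = 0")
     case True
     then show ?thesis using adapted_base_eq[OF a' D(2,4)] D(5,6) e i by (auto simp: base_of_def)
    next
     case False
     from eq have "shear \<phi> \<psi> S (e1, f1) (Inr i) = shear \<phi> \<psi> S (e2, f2) (Inr i)" by simp
     then show ?thesis using shear_apply(2)[OF i] False e by simp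
    qed
   qed
   then show ?thesis using e xs by simp
  qed
  fix p z assume pz: "p \<in> U \<inter> U'" "restr (bidx ?F) z = \<zeta> p" and z: "z \<in> crd (idx ?F)"
  have p: "restr (bidx ?F) z = \<zeta> p" "p \<in> U" "p \<in> U'" using pz by auto
  define y where "y = (\<lambda>i. z (Inl i))"
  have "y \<in> crd (idx G)" using z by (auto simp: y_def crd_def fibre_prod_simps)
  moreover have "restr (bidx G) y = \<xi> p"
  proof
   fix i
   have "restr (bidx ?F) z (Inl i) = \<zeta> p (Inl i)" using p(1) by simp
   moreover have "\<xi> p \<in> crd (bidx G)" using coord_sysD(3)[OF u(1)] open_crd_subset p(2) by blast
   ultimately show "restr (bidx G) y i = \<xi> p i"
    by (auto simp: restr_apply bidx_fibre_prod \<zeta>_def y_def crd_def)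
  qed
  ultimately have "y \<in> \<phi> ` D" using u(5) p(2) by (simp add: cyl_def)
  then obtain e where e: "e \<in> D" "\<phi> e = y" by auto
  have pe: "bproj G e = p"
   using u(4)[OF e(1)] \<open>restr (bidx G) y = \<xi> p\<close> e coord_sysD(2)[OF u(1)] u(2) p(2)
   by (auto simp: over_def dest: inj_onD)
  obtain f0 where f0: "f0 \<in> D'" "bproj H f0 = p" using bp' p(3) by blast
  define y' where "y' = (\<lambda>\<mu>. if \<mu> \<in> bidx H then \<psi> f0 \<mu> else if \<mu> \<in> idx H then z (Inr \<mu>) - S e \<mu> else 0)"
  have "y' \<in> crd (idx H)" using base_of_subset[of "idx H" "wt H"] by (auto simp: y'_def crd_def)
  moreover have "y' \<mu> = \<psi> f0 \<mu>" if "\<mu> \<in> bidx H" for \<mu> using that by (simp add: y'_def)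
  ultimately obtain f where f: "f \<in> D'" "\<psi> f = y'" "bproj H f = p"
   using adapted_point[OF a' f0(1)] f0(2) by blast
  have ef: "(e, f) \<in> shear_dom D D'"
   using e(1) f(1,3) pe saturated_pts[OF saturated_gcoords[OF c]] saturated_pts[OF saturated_gcoords[OF c']]
   by (auto simp: shear_dom_def fibre_prod_simps)
  have "z = shear \<phi> \<psi> S (e, f)"
  proof
   fix k
   show "z k = shear \<phi> \<psi> S (e, f) k"
   proof (cases "k \<in> idx ?F")
    case True
    then show ?thesis
    proof (cases k)
     case (Inl i)
     then show ?thesis using True shear_apply(1)[of i \<phi> \<psi> S e f] e(2) by (auto simp: fibre_prod_simps y_def)
    next
     case (Inr \<mu>)
     then have "\<mu> \<in> idx H" "0 < wt H \<mu>" using True by (auto simp: fibre_prod_simps)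
     then show ?thesis using Inr shear_apply(2)[of \<mu> \<phi> \<psi> S e f] f(2) by (auto simp: y'_def base_of_def)
    qed
   next
    case False
    then show ?thesis using z by (simp add: shear_def restr_apply crd_def)
   qed
  qed
  then show "\<exists>x\<in>shear_dom D D'. shear \<phi> \<psi> S x = z" using ef by blast
 qed
qed

lemma shear_gfun_fst:
 assumes c: "gcoords M G (D, \<phi>)" and c': "gcoords M H (D', \<psi>)"
  and W: "saturated M G W" "W \<subseteq> D" and h: "gfun G D \<phi> W d h"
  and V: "saturated M (fibre_prod G H) V" "V \<subseteq> shear_dom D D'" "fst ` V \<subseteq> W"
 shows "gfun (fibre_prod G H) (shear_dom D D') (shear \<phi> \<psi> S) V d (\<lambda>x. h (fst x))"
proof (rule gfun_pullback[OF pre_gradedD(1)[OF G] finite_idx_fibre_prod shear_adapted[OF c c']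
   pre_gradedD(2)[OF G] gcoordsD(1)[OF c] pre_gradedD(1)[OF G] V(1,2) W _ _ h])
 show "fst x \<in> W" if "x \<in> V" for x using that V(3) by blast
 fix i assume i: "i \<in> idx G"
 have "gfun (fibre_prod G H) (shear_dom D D') (shear \<phi> \<psi> S) V (wt (fibre_prod G H) (Inl i))
   (\<lambda>x. shear \<phi> \<psi> S x (Inl i))"
  by (rule gfun_coord[OF pre_gradedD(1)[OF G] finite_idx_fibre_prod shear_adapted[OF c c'] V(1,2)])
 then show "gfun (fibre_prod G H) (shear_dom D D') (shear \<phi> \<psi> S) V (wt G i) (\<lambda>x. \<phi> (fst x) i)"
  unfolding fibre_prod_simps(4) sum.case
  by (rule gfun_cong[OF pre_gradedD(1)[OF G] finite_idx_fibre_prod shear_adapted[OF c c'] V(1,2)])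
   (metis shear_apply(1)[OF i] prod.collapse)
qed

text \<open>A function on the second factor is a function of \<open>\<psi>\<close>, and \<open>\<psi>\<close> is the difference of a sheared coordinate
  and \<open>S\<close>, both homogeneous of the same degree; base coordinates come from the first factor.\<close>

lemma shear_gfun_snd:
 assumes c: "gcoords M G (D, \<phi>)" and c': "gcoords M H (D', \<psi>)"
  and S: "\<And>\<mu>. \<mu> \<in> idx H \<Longrightarrow> 0 < wt H \<mu> \<Longrightarrow> gfun G D \<phi> D (wt H \<mu>) (\<lambda>e. S e \<mu>)"
  and W: "saturated M H W" "W \<subseteq> D'" and h: "gfun H D' \<psi> W d h"
  and V: "saturated M (fibre_prod G H) V" "V \<subseteq> shear_dom D D'" "snd ` V \<subseteq> W"
 shows "gfun (fibre_prod G H) (shear_dom D D') (shear \<phi> \<psi> S) V d (\<lambda>x. h (snd x))"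
proof (rule gfun_pullback[OF pre_gradedD(1)[OF G] finite_idx_fibre_prod shear_adapted[OF c c']
   pre_gradedD(2)[OF H] gcoordsD(1)[OF c'] pre_gradedD(1)[OF G] V(1,2) W _ _ h])
 let ?F = "fibre_prod G H"
 note M = pre_gradedD(1)[OF G] and aF = shear_adapted[OF c c', of S] and finF = finite_idx_fibre_prod
 show "snd x \<in> W" if "x \<in> V" for x using that V(3) by blast
 have V': "fst ` V \<subseteq> D" "\<And>x. x \<in> V \<Longrightarrow> bproj H (snd x) = bproj ?F x \<and> snd x \<in> D'"
  using V(2) by (auto simp: shear_dom_def fibre_prod_simps)
 fix \<mu> assume \<mu>: "\<mu> \<in> idx H"
 show "gfun ?F (shear_dom D D') (shear \<phi> \<psi> S) V (wt H \<mu>) (\<lambda>x. \<psi> (snd x) \<mu>)"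
 proof (cases "wt H \<mu> = 0")
  case True
  then have b: "\<mu> \<in> bidx H" using \<mu> by (simp add: base_of_def)
  obtain U' \<xi>' where "bundle_chart M H D' \<psi> U' \<xi>'" using bundle_chartE[OF gcoordsD(1)[OF c']] by blast
  note u' = bundle_chartD(1,2,4)[OF this]
  have "V \<subseteq> over ?F U'"
  proof
   fix x assume x: "x \<in> V"
   then have "bproj ?F x \<in> U'" using V'(2)[OF x] unfolding u'(2) over_def by force
   then show "x \<in> over ?F U'" using saturated_pts[OF V(1)] x by (auto simp: over_def)
  qed
  then have "gfun ?F (shear_dom D D') (shear \<phi> \<psi> S) V 0 (\<lambda>x. \<xi>' (bproj ?F x) \<mu>)"
   by (rule gfun_base[OF M finF aF coord_sysD(4)[OF u'(1) b] V(1,2)])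
  then have "gfun ?F (shear_dom D D') (shear \<phi> \<psi> S) V 0 (\<lambda>x. \<psi> (snd x) \<mu>)"
  proof (rule gfun_cong[OF M finF aF V(1,2)])
   fix x assume x: "x \<in> V"
   have "restr (bidx H) (\<psi> (snd x)) \<mu> = \<xi>' (bproj H (snd x)) \<mu>" using u'(3) V'(2)[OF x] by metis
   then show "\<psi> (snd x) \<mu> = \<xi>' (bproj ?F x) \<mu>" using V'(2)[OF x] b by (simp add: restr_apply)
  qed
  then show ?thesis using True by simp
 next
  case False
  have S': "gfun ?F (shear_dom D D') (shear \<phi> \<psi> S) V (wt H \<mu>) (\<lambda>x. S (fst x) \<mu>)"
   by (rule shear_gfun_fst[OF c c' saturated_gcoords[OF c] order_refl S[OF \<mu>] V(1,2) V'(1)]) (use False in simp)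
  have "gfun ?F (shear_dom D D') (shear \<phi> \<psi> S) V (wt ?F (Inr \<mu>)) (\<lambda>x. shear \<phi> \<psi> S x (Inr \<mu>))"
   by (rule gfun_coord[OF M finF aF V(1,2)])
  then have "gfun ?F (shear_dom D D') (shear \<phi> \<psi> S) V (wt H \<mu>) (\<lambda>x. shear \<phi> \<psi> S x (Inr \<mu>))"
   by (simp add: fibre_prod_simps)
  from gfun_diff[OF M finF aF V(1,2) this S'] show ?thesis
  proof (rule gfun_cong[OF M finF aF V(1,2)])
   fix x assume "x \<in> V"
   show "\<psi> (snd x) \<mu> = shear \<phi> \<psi> S x (Inr \<mu>) - S (fst x) \<mu>"
    using shear_apply(2)[OF \<mu>, of \<phi> \<psi> S "fst x" "snd x"] False by simp
  qed
 qed
qed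

lemma shear_gcompat:
 assumes c: "gcoords M G (D1, \<phi>1)" "gcoords M H (D1', \<psi>1)"
  and S1: "\<And>\<mu>. \<mu> \<in> idx H \<Longrightarrow> 0 < wt H \<mu> \<Longrightarrow> gfun G D1 \<phi>1 D1 (wt H \<mu>) (\<lambda>e. S1 e \<mu>)"
  and c2: "gcoords M G (D2, \<phi>2)" "gcoords M H (D2', \<psi>2)"
  and S2: "\<And>\<mu>. \<mu> \<in> idx H \<Longrightarrow> 0 < wt H \<mu> \<Longrightarrow> gfun G D2 \<phi>2 D2 (wt H \<mu>) (\<lambda>e. S2 e \<mu>)"
 shows "gcompat (fibre_prod G H) (shear_dom D1 D1', shear \<phi>1 \<psi>1 S1) (shear_dom D2 D2', shear \<phi>2 \<psi>2 S2)"
 unfolding gcompat_def prod.case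
proof
 let ?F = "fibre_prod G H"
 note M = pre_gradedD(1)[OF G] and finF = finite_idx_fibre_prod
 note aF1 = shear_adapted[OF c, of S1] and aF2 = shear_adapted[OF c2, of S2]
 let ?V = "shear_dom D1 D1' \<inter> shear_dom D2 D2'"
 have V: "saturated M ?F ?V" "?V \<subseteq> shear_dom D1 D1'"
  by (simp_all add: saturated_Int[OF M adapted_saturated[OF aF1] adapted_saturated[OF aF2]])
 have W: "saturated M G (D1 \<inter> D2)" "D1 \<inter> D2 \<subseteq> D1" "D1 \<inter> D2 \<subseteq> D2"
  "saturated M H (D1' \<inter> D2')" "D1' \<inter> D2' \<subseteq> D1'" "D1' \<inter> D2' \<subseteq> D2'"
  using saturated_Int[OF M saturated_gcoords[OF c(1)] saturated_gcoords[OF c2(1)]]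
   saturated_Int[OF M saturated_gcoords[OF c(2)] saturated_gcoords[OF c2(2)]] by auto
 have im: "fst ` ?V \<subseteq> D1 \<inter> D2" "snd ` ?V \<subseteq> D1' \<inter> D2'" by (auto simp: shear_dom_def)
 fix k assume k: "k \<in> idx ?F"
 show "gfun ?F (shear_dom D1 D1') (shear \<phi>1 \<psi>1 S1) ?V (wt ?F k) (\<lambda>x. shear \<phi>2 \<psi>2 S2 x k)"
 proof (cases k)
  case (Inl i)
  then have i: "i \<in> idx G" using k by (auto simp: fibre_prod_simps)
  have "gfun ?F (shear_dom D1 D1') (shear \<phi>1 \<psi>1 S1) ?V (wt G i) (\<lambda>x. \<phi>2 (fst x) i)"
   by (rule shear_gfun_fst[OF c W(1,2) gcompatD[OF gcoords_compat[OF G c(1) c2(1)] i] V im(1)])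
  then have "gfun ?F (shear_dom D1 D1') (shear \<phi>1 \<psi>1 S1) ?V (wt G i) (\<lambda>x. shear \<phi>2 \<psi>2 S2 x (Inl i))"
   by (rule gfun_cong[OF M finF aF1 V])
    (metis shear_apply(1)[OF i] prod.collapse)
  then show ?thesis using Inl by (simp add: fibre_prod_simps)
 next
  case (Inr \<mu>)
  then have \<mu>: "\<mu> \<in> idx H" "0 < wt H \<mu>" using k by (auto simp: fibre_prod_simps)
  have 1: "gfun ?F (shear_dom D1 D1') (shear \<phi>1 \<psi>1 S1) ?V (wt H \<mu>) (\<lambda>x. \<psi>2 (snd x) \<mu>)"
   by (rule shear_gfun_snd[OF c S1 W(4,5) gcompatD[OF gcoords_compat[OF H c(2) c2(2)] \<mu>(1)] V im(2)])
  have "gfun G D1 \<phi>1 (D1 \<inter> D2) (wt H \<mu>) (\<lambda>e. S2 e \<mu>)"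
   by (rule gfun_change_gcoords[OF G c(1) c2(1) W(1,2,3)]) (rule gfun_mono[OF S2[OF \<mu>]], simp)
  then have 2: "gfun ?F (shear_dom D1 D1') (shear \<phi>1 \<psi>1 S1) ?V (wt H \<mu>) (\<lambda>x. S2 (fst x) \<mu>)"
   by (rule shear_gfun_fst[OF c W(1,2) _ V im(1)])
  from gfun_add[OF M finF aF1 V 1 2]
  have "gfun ?F (shear_dom D1 D1') (shear \<phi>1 \<psi>1 S1) ?V (wt H \<mu>) (\<lambda>x. shear \<phi>2 \<psi>2 S2 x (Inr \<mu>))"
   by (rule gfun_cong[OF M finF aF1 V])
    (metis shear_apply(2)[OF \<mu>] prod.collapse)
  then show ?thesis using Inr by (simp add: fibre_prod_simps)
 qed
qed

lemma atlas_fibre_prod: "atlas (fibre_prod G H) =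
 {(shear_dom D D', shear \<phi> \<psi> (\<lambda>e \<mu>. 0)) |D \<phi> D' \<psi>. (D, \<phi>) \<in> atlas G \<and> (D', \<psi>) \<in> atlas H}"
 unfolding fibre_prod_simps(5) shear_dom_def shear_def by (simp add: fibre_prod_simps)

lemma zero_gfun:
 "gcoords M G (D, \<phi>) \<Longrightarrow> gfun G D \<phi> D d (\<lambda>e. 0)"
 using gfun_zero[OF pre_gradedD(1,2)[OF G]] gcoordsD(1) saturated_gcoords by blast

lemma pre_graded_fibre_prod: "pre_graded M (fibre_prod G H)"
proof (rule pre_gradedI)
 show "manifold M" by (rule pre_gradedD(1)[OF G])
 show "finite (idx (fibre_prod G H))" by (rule finite_idx_fibre_prod)
 show "(\<Union>(D, \<phi>)\<in>atlas (fibre_prod G H). D) = pts (fibre_prod G H)"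
 proof (intro subset_antisym subsetI)
  fix x assume x: "x \<in> pts (fibre_prod G H)"
  then have "fst x \<in> pts G" "snd x \<in> pts H" by (auto simp: fibre_prod_simps)
  then obtain D \<phi> D' \<psi> where "(D, \<phi>) \<in> atlas G" "fst x \<in> D" "(D', \<psi>) \<in> atlas H" "snd x \<in> D'"
   using pre_graded_cover[OF G] pre_graded_cover[OF H] by metis
  then have "(shear_dom D D', shear \<phi> \<psi> (\<lambda>e \<mu>. 0)) \<in> atlas (fibre_prod G H)" "x \<in> shear_dom D D'"
   using x by (auto simp: atlas_fibre_prod shear_dom_def mem_Times_iff)
  then show "x \<in> (\<Union>(D, \<phi>)\<in>atlas (fibre_prod G H). D)" by blast
 qed (auto simp: atlas_fibre_prod shear_dom_def)
 show "adapted_chart M (fibre_prod G H) (D, \<phi>)" if "(D, \<phi>) \<in> atlas (fibre_prod G H)" for D \<phi>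
  using that shear_adapted[OF gcoords_atlas[OF G] gcoords_atlas[OF H]] unfolding atlas_fibre_prod by auto
 show "gcompat (fibre_prod G H) (D, \<phi>) (D', \<psi>)"
  if "(D, \<phi>) \<in> atlas (fibre_prod G H)" "(D', \<psi>) \<in> atlas (fibre_prod G H)" for D \<phi> D' \<psi>
  using that shear_gcompat[OF gcoords_atlas[OF G] gcoords_atlas[OF H] _ gcoords_atlas[OF G] gcoords_atlas[OF H]]
   zero_gfun[OF gcoords_atlas[OF G]]
  unfolding atlas_fibre_prod by auto
qed

lemma shear_gcoords:
 assumes c: "gcoords M G (D, \<phi>)" "gcoords M H (D', \<psi>)"
  and S: "\<And>\<mu>. \<mu> \<in> idx H \<Longrightarrow> 0 < wt H \<mu> \<Longrightarrow> gfun G D \<phi> D (wt H \<mu>) (\<lambda>e. S e \<mu>)"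
 shows "gcoords M (fibre_prod G H) (shear_dom D D', shear \<phi> \<psi> S)"
 unfolding gcoords_def
proof (intro conjI ballI shear_adapted[OF c])
 fix x assume "x \<in> atlas (fibre_prod G H)"
 then obtain D0 \<phi>0 D0' \<psi>0 where x: "x = (shear_dom D0 D0', shear \<phi>0 \<psi>0 (\<lambda>e \<mu>. 0))"
  "(D0, \<phi>0) \<in> atlas G" "(D0', \<psi>0) \<in> atlas H"
  unfolding atlas_fibre_prod by auto
 note g = gcoords_atlas[OF G x(2)] gcoords_atlas[OF H x(3)]
 show "gcompat (fibre_prod G H) (shear_dom D D', shear \<phi> \<psi> S) x"
  unfolding x(1) by (rule shear_gcompat[OF c S g zero_gfun[OF g(1)]])
 show "gcompat (fibre_prod G H) x (shear_dom D D', shear \<phi> \<psi> S)"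
  unfolding x(1) by (rule shear_gcompat[OF g zero_gfun[OF g(1)] c S])
qed

end

subsection \<open>Frames of vector bundles\<close>

lemma gfun_base_times_coord:
 assumes F: "pre_graded M F" and a: "adapted_chart M F (D, \<phi>)" and W: "saturated M F W" "W \<subseteq> D" "W \<subseteq> over F W0"
  and f: "\<And>k. k \<in> K \<Longrightarrow> smooth_real_on M W0 (f k)" and K: "\<And>k. k \<in> K \<Longrightarrow> wt F k = d"
 shows "gfun F D \<phi> W d (\<lambda>e. \<Sum>k\<in>K. f k (bproj F e) * \<phi> e k)"
proof (rule gfun_sum[OF pre_gradedD(1,2)[OF F] a W(1,2)])
 fix k assume k: "k \<in> K"
 show "gfun F D \<phi> W d (\<lambda>e. f k (bproj F e) * \<phi> e k)"
  using gfun_mult[OF pre_gradedD(1,2)[OF F] a W(1,2) gfun_base[OF pre_gradedD(1,2)[OF F] a f[OF k] W]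
   gfun_coord[OF pre_gradedD(1,2)[OF F] a W(1,2), of k]] K[OF k] by simp
qed

context
 fixes M :: "('m, 'b, 'z) mfd_scheme" and F :: "('f, 'i, 'm) gbundle"
  and U :: "'m set" and \<xi> :: "'m \<Rightarrow> 'i \<Rightarrow> real" and s :: "'i \<Rightarrow> 'm \<Rightarrow> 'f" and I1 :: "'i set"
 assumes F: "pre_graded M F" and w1: "\<And>i. i \<in> idx F \<Longrightarrow> wt F i \<le> 1" and onto: "bproj F ` pts F = pts M"
  and I1: "I1 = {i\<in>idx F. wt F i = 1}"
  and cs: "coord_sys M (bidx F) (U, \<xi>)" and fr: "local_frame M F I1 U s"
begin

lemma I1_iff: "i \<in> I1 \<longleftrightarrow> i \<in> idx F \<and> wt F i = 1"
 by (simp add: I1)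

lemma frame_pts: "j \<in> I1 \<Longrightarrow> p \<in> U \<Longrightarrow> s j p \<in> pts F \<and> bproj F (s j p) = p"
 using fr unfolding local_frame_def smooth_map_on_def by blast

lemma finite_frame: "finite I1"
 using fr by (simp add: local_frame_def)

lemma frame_U_pts: "p \<in> U \<Longrightarrow> \<exists>v\<in>pts F. bproj F v = p"
 using onto mopen_subset[OF coord_sysD(1)[OF cs]] by (metis (no_types, lifting) imageE subsetD)

lemma frame_coframe:
 assumes "v \<in> pts F" "bproj F v \<in> U"
 shows "coframe F I1 s v \<in> crd I1" "v = lincomb F (bproj F v) I1 (coframe F I1 s v) (\<lambda>j. s j (bproj F v))"
  "\<And>a. a \<in> crd I1 \<Longrightarrow> v = lincomb F (bproj F v) I1 a (\<lambda>j. s j (bproj F v)) \<Longrightarrow> coframe F I1 s v = a"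
proof -
 have ex: "\<exists>!a. a \<in> crd I1 \<and> v = lincomb F (bproj F v) I1 a (\<lambda>j. s j (bproj F v))"
  using fr assms unfolding local_frame_def by blast
 from theI'[OF ex] show "coframe F I1 s v \<in> crd I1" "v = lincomb F (bproj F v) I1 (coframe F I1 s v) (\<lambda>j. s j (bproj F v))"
  unfolding coframe_def by blast+
 show "coframe F I1 s v = a" if "a \<in> crd I1" "v = lincomb F (bproj F v) I1 a (\<lambda>j. s j (bproj F v))" for a
  unfolding coframe_def by (rule the1_equality[OF ex]) (use that in blast)
qed

lemma frame_lincomb:
 assumes p: "p \<in> U"
 shows "lincomb F p I1 a (\<lambda>j. s j p) \<in> pts F" "bproj F (lincomb F p I1 a (\<lambda>j. s j p)) = p"
  "\<And>D \<phi> i. gcoords M F (D, \<phi>) \<Longrightarrow> lincomb F p I1 a (\<lambda>j. s j p) \<in> D \<Longrightarrow> i \<in> I1 \<Longrightarrow>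
   \<phi> (lincomb F p I1 a (\<lambda>j. s j p)) i = (\<Sum>j\<in>I1. a j * \<phi> (s j p) i)"
proof -
 obtain v where v: "v \<in> pts F" "bproj F v = p" using frame_U_pts[OF p] by blast
 have u: "s j p \<in> pts F \<and> bproj F (s j p) = p" if "j \<in> I1" for j by (rule frame_pts[OF that p])
 show "lincomb F p I1 a (\<lambda>j. s j p) \<in> pts F" "bproj F (lincomb F p I1 a (\<lambda>j. s j p)) = p"
  "\<And>D \<phi> i. gcoords M F (D, \<phi>) \<Longrightarrow> lincomb F p I1 a (\<lambda>j. s j p) \<in> D \<Longrightarrow> i \<in> I1 \<Longrightarrow>
   \<phi> (lincomb F p I1 a (\<lambda>j. s j p)) i = (\<Sum>j\<in>I1. a j * \<phi> (s j p) i)"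
  using lincomb_coords[OF F w1 v u, where J = I1 and a = a] unfolding I1 by auto
qed

lemma frame_expand:
 assumes v: "v \<in> pts F" "bproj F v \<in> U" and c: "gcoords M F (D, \<phi>)" "v \<in> D" and i: "i \<in> I1"
 shows "\<phi> v i = (\<Sum>j\<in>I1. coframe F I1 s v j * \<phi> (s j (bproj F v)) i)"
 using frame_lincomb(3)[OF v(2) c(1) _ i, of "coframe F I1 s v"] frame_coframe(2)[OF v] c(2) by metis

lemma coframe_unique:
 assumes v: "v \<in> pts F" "bproj F v \<in> U" and c: "gcoords M F (D, \<phi>)" "v \<in> D"
  and a: "a \<in> crd I1" "\<And>i. i \<in> I1 \<Longrightarrow> \<phi> v i = (\<Sum>j\<in>I1. a j * \<phi> (s j (bproj F v)) i)"
 shows "coframe F I1 s v = a"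
proof (rule frame_coframe(3)[OF v a(1)])
 let ?l = "lincomb F (bproj F v) I1 a (\<lambda>j. s j (bproj F v))"
 note l = frame_lincomb[OF v(2), where a = a]
 have lD: "?l \<in> D" by (rule saturatedD[OF saturated_gcoords[OF c(1)] c(2) l(1) l(2)])
 show "v = ?l"
 proof (rule adapted_eq[OF gcoordsD(1)[OF c(1)] c(2) lD])
  fix i assume i: "i \<in> idx F"
  show "\<phi> v i = \<phi> ?l i"
  proof (cases "wt F i = 0")
   case True
   then show ?thesis
    using adapted_base_eq[OF gcoordsD(1)[OF c(1)] c(2) lD] l(2) i by (simp add: base_of_def)
  next
   case False
   then have "i \<in> I1" using w1[OF i] i I1 by simp
   then show ?thesis using l(3)[OF c(1) lD] a(2) by simp
  qed
 qed
qed

lemma coframe_frame: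
 assumes "j \<in> I1" "p \<in> U"
 shows "coframe F I1 s (s j p) i = (if i = j then 1 else 0)"
proof -
 note sp = frame_pts[OF assms]
 obtain D \<phi> where c: "(D, \<phi>) \<in> atlas F" "s j p \<in> D" using pre_graded_cover[OF F] sp by metis
 have "coframe F I1 s (s j p) = (\<lambda>i. if i = j then 1 else 0)"
 proof (rule coframe_unique[OF _ _ gcoords_atlas[OF F c(1)] c(2)])
  fix i
  have "(\<Sum>l\<in>I1. (if l = j then 1 else 0) * \<phi> (s l p) i) = (\<Sum>l\<in>I1. if l = j then \<phi> (s l p) i else 0)"
   by (rule sum.cong) auto
  then show "\<phi> (s j p) i = (\<Sum>l\<in>I1. (if l = j then 1 else 0) * \<phi> (s l (bproj F (s j p))) i)"
   using finite_frame assms(1) sp by simp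
 qed (use sp assms in \<open>auto simp: crd_def\<close>)
 then show ?thesis by simp
qed

lemma frame_matrix_smooth:
 assumes c: "(D, \<phi>) \<in> atlas F" "D = over F V" "mopen M V" and ij: "j \<in> I1" "i \<in> idx F"
 shows "smooth_real_on M (U \<inter> V) (\<lambda>p. \<phi> (s j p) i)"
 unfolding smooth_real_on_def
proof (intro conjI ballI)
 show "mopen M (U \<inter> V)"
  by (rule manifold_mopen_Int[OF pre_gradedD(1)[OF F] coord_sysD(1)[OF cs] c(3)])
 fix x assume x: "x \<in> atlas M"
 obtain X \<eta> where X: "x = (X, \<eta>)" by (cases x)
 have "smooth_map_on M U F (s j)" using fr ij(1) by (simp add: local_frame_def)
 then have "smooth_crd (idx M) (\<eta> ` (X \<inter> U \<inter> s j -` D)) (\<lambda>z. \<phi> (s j (inv_into X \<eta> z)) i)"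
  unfolding smooth_map_on_def using x c(1) ij(2) X by blast
 moreover have "X \<inter> U \<inter> s j -` D = X \<inter> (U \<inter> V)"
  using frame_pts[OF ij(1)] by (auto simp: c(2) over_def)
 ultimately show "case x of (X, \<eta>) \<Rightarrow> smooth_crd (idx M) (\<eta> ` (X \<inter> (U \<inter> V))) (\<lambda>z. \<phi> (s j (inv_into X \<eta> z)) i)"
  by (simp add: X)
qed

text \<open>The components \<open>B\<close> of the frame in a chart form a smooth invertible matrix.  Its inverse is the matrix
  of the coframe on the coordinate vectors \<open>b k\<close> of the chart, so it is smooth as well.\<close>

lemma frame_inverse_matrix:
 assumes c: "(D, \<phi>) \<in> atlas F" "D = over F V" "mopen M V"
 obtains N where "\<And>i k. i \<in> I1 \<Longrightarrow> k \<in> I1 \<Longrightarrow> smooth_real_on M (U \<inter> V) (N i k)"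
  "\<And>v i. v \<in> D \<Longrightarrow> bproj F v \<in> U \<Longrightarrow> i \<in> I1 \<Longrightarrow> coframe F I1 s v i = (\<Sum>k\<in>I1. N i k (bproj F v) * \<phi> v k)"
proof -
 note M = pre_gradedD(1)[OF F] and fin = pre_gradedD(2)[OF F]
 note g = gcoords_atlas[OF F c(1)]
 note a = gcoordsD(1)[OF g]
 have Dp: "D \<subseteq> pts F" by (auto simp: c(2) over_def)
 have UV: "mopen M (U \<inter> V)" by (rule manifold_mopen_Int[OF M coord_sysD(1)[OF cs] c(3)])
 have bex: "\<exists>e\<in>D. bproj F e = p \<and> (\<forall>i\<in>I1. \<phi> e i = (if i = k then 1 else 0))" if p: "p \<in> U \<inter> V" and k: "k \<in> I1" for p k
 proof -
  obtain v where v: "v \<in> pts F" "bproj F v = p" using frame_U_pts p by blast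
  then have vD: "v \<in> D" using p c(2) by (auto simp: over_def)
  define z where "z = (\<lambda>i. if i \<in> I1 then (if i = k then 1 else 0) else \<phi> v i)"
  have "z \<in> crd (idx F)" using adapted_crd[OF a vD] I1 by (auto simp: z_def crd_def)
  moreover have "z i = \<phi> v i" if "i \<in> bidx F" for i using that I1 by (auto simp: z_def base_of_def)
  ultimately obtain e where "e \<in> D" "\<phi> e = z" "bproj F e = bproj F v"
   using adapted_point[OF a vD] by blast
  then show ?thesis using v(2) by (auto simp: z_def)
 qed
 define b where "b k p = (SOME e. e \<in> D \<and> bproj F e = p \<and> (\<forall>i\<in>I1. \<phi> e i = (if i = k then 1 else 0)))" for k p
 have b: "b k p \<in> D" "bproj F (b k p) = p" "\<And>i. i \<in> I1 \<Longrightarrow> \<phi> (b k p) i = (if i = k then 1 else 0)"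
  if "p \<in> U \<inter> V" "k \<in> I1" for p k
  using someI_ex[of "\<lambda>e. e \<in> D \<and> bproj F e = p \<and> (\<forall>i\<in>I1. \<phi> e i = (if i = k then 1 else 0))"] bex[OF that]
  unfolding b_def by blast+
 define N where "N i k p = coframe F I1 s (b k p) i" for i k p
 define B where "B p k j = \<phi> (s j p) k" for p k j
 have BN: "(\<Sum>j\<in>I1. B p i j * N j k p) = (if i = k then 1 else 0)" if p: "p \<in> U \<inter> V" and "i \<in> I1" "k \<in> I1" for p i k
  using frame_expand[OF _ _ g b(1)[OF p \<open>k \<in> I1\<close>] \<open>i \<in> I1\<close>] b(1,2,3)[OF p \<open>k \<in> I1\<close>] Dp p that
  by (auto simp: B_def N_def mult.commute)
 have lin: "coframe F I1 s v i = (\<Sum>k\<in>I1. N i k (bproj F v) * \<phi> v k)"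
  if v: "v \<in> D" "bproj F v \<in> U" and i: "i \<in> I1" for v i
 proof -
  let ?p = "bproj F v"
  have p: "?p \<in> U \<inter> V" using v c(2) by (auto simp: over_def)
  have "coframe F I1 s v = (\<lambda>i. if i \<in> I1 then (\<Sum>k\<in>I1. N i k ?p * \<phi> v k) else 0)"
  proof (rule coframe_unique[OF _ v(2) g v(1)])
   fix l assume l: "l \<in> I1"
   have "(\<Sum>j\<in>I1. (if j \<in> I1 then \<Sum>k\<in>I1. N j k ?p * \<phi> v k else 0) * \<phi> (s j ?p) l) =
     (\<Sum>j\<in>I1. \<Sum>k\<in>I1. N j k ?p * \<phi> v k * B ?p l j)"
    by (simp add: sum_distrib_right B_def)
   also have "\<dots> = (\<Sum>k\<in>I1. (\<Sum>j\<in>I1. B ?p l j * N j k ?p) * \<phi> v k)"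
    by (subst sum.swap) (simp add: sum_distrib_left sum_distrib_right mult_ac)
   also have "\<dots> = (\<Sum>k\<in>I1. if k = l then \<phi> v k else 0)"
    by (rule sum.cong) (auto simp: BN[OF p l])
   also have "\<dots> = \<phi> v l" using finite_frame l by simp
   finally show "\<phi> v l = (\<Sum>j\<in>I1. (if j \<in> I1 then \<Sum>k\<in>I1. N j k ?p * \<phi> v k else 0) * \<phi> (s j ?p) l)" by simp
  qed (use v(1) Dp in \<open>auto simp: crd_def\<close>)
  then show ?thesis using i by simp
 qed
 have NB: "(\<Sum>k\<in>I1. N i k p * B p k j) = (if i = j then 1 else 0)" if p: "p \<in> U \<inter> V" and ij: "i \<in> I1" "j \<in> I1" for p i j
 proof -
  have "s j p \<in> D" "bproj F (s j p) = p" using frame_pts[OF ij(2), of p] p c(2) by (auto simp: over_def)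
  then show ?thesis using lin[of "s j p" i] coframe_frame[OF ij(2), of p i] p ij by (simp add: B_def)
 qed
 have "smooth_real_on M (U \<inter> V) (N i k)" if ik: "i \<in> I1" "k \<in> I1" for i k
  unfolding smooth_real_on_def
 proof (intro conjI UV ballI, clarify)
  fix X \<eta> assume X: "(X, \<eta>) \<in> atlas M"
  have pX: "inv_into X \<eta> z \<in> U \<inter> V" if "z \<in> \<eta> ` (X \<inter> (U \<inter> V))" for z
   using that manifold_chart[OF M X] by (auto simp: inv_into_f_f)
  show "smooth_crd (idx M) (\<eta> ` (X \<inter> (U \<inter> V))) (\<lambda>z. N i k (inv_into X \<eta> z))"
  proof (rule smooth_crd_inverse_matrix[OF finite_frame manifold_finite[OF M] mopen_open[OF UV X], where B = "\<lambda>z. B (inv_into X \<eta> z)"])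
   show "smooth_crd (idx M) (\<eta> ` (X \<inter> (U \<inter> V))) (\<lambda>z. B (inv_into X \<eta> z) k j)" if "k \<in> I1" "j \<in> I1" for k j
    unfolding B_def
    by (rule smooth_real_onD[OF frame_matrix_smooth[OF c that(2)] X]) (use that I1 in simp)
  qed (use NB BN pX ik in auto)
 qed
 then show ?thesis using lin by (rule that)
qed

definition fchart :: "'f \<Rightarrow> 'i \<Rightarrow> real" where
 "fchart v i = (if i \<in> I1 then coframe F I1 s v i else if i \<in> bidx F then \<xi> (bproj F v) i else 0)"

lemma fchart_crd: "fchart v \<in> crd (idx F)"
 unfolding fchart_def crd_def by (auto simp: I1_iff base_of_def)

lemma fchart_base: "i \<in> bidx F \<Longrightarrow> fchart v i = \<xi> (bproj F v) i"
 unfolding fchart_def by (auto simp: I1_iff base_of_def)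

lemma frame_adapted: "adapted_chart M F (over F U, fchart)"
proof (rule adapted_chart_by_points[OF cs refl])
 have \<xi>c: "\<xi> p \<in> crd (bidx F)" if "p \<in> U" for p
  using coord_sysD(3)[OF cs] open_crd_subset that by blast
 show "restr (bidx F) (fchart e) = \<xi> (bproj F e)" if "e \<in> over F U" for e
  using \<xi>c[of "bproj F e"] that fchart_base by (auto simp: restr_def over_def crd_def fun_eq_iff)
 show "fchart e \<in> crd (idx F)" for e by (rule fchart_crd)
 show "v = v'" if v: "v \<in> over F U" "v' \<in> over F U" and p: "bproj F v = bproj F v'" and eq: "fchart v = fchart v'" for v v'
 proof -
  have vp: "v \<in> pts F" "bproj F v \<in> U" "v' \<in> pts F" "bproj F v' \<in> U" using v by (auto simp: over_def)
  have "coframe F I1 s v = coframe F I1 s v'"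
  proof
   fix i
   show "coframe F I1 s v i = coframe F I1 s v' i"
    using frame_coframe(1)[OF vp(1,2)] frame_coframe(1)[OF vp(3,4)] fun_cong[OF eq, of i]
    by (cases "i \<in> I1") (auto simp: fchart_def crd_def)
  qed
  then show ?thesis using frame_coframe(2)[OF vp(1,2)] frame_coframe(2)[OF vp(3,4)] p by metis
 qed
 fix p z assume p: "p \<in> U" "restr (bidx F) z = \<xi> p" and z: "z \<in> crd (idx F)"
 define v where "v = lincomb F p I1 (restr I1 z) (\<lambda>j. s j p)"
 note v = frame_lincomb(1,2)[OF p(1), where a = "restr I1 z", folded v_def]
 have vU: "v \<in> over F U" using v p(1) by (simp add: over_def)
 have co: "coframe F I1 s v = restr I1 z"
  by (rule frame_coframe(3)[OF v(1)]) (use v(2) p(1) restr_crd in \<open>auto simp: v_def\<close>)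
 have "fchart v = z"
 proof
  fix i
  have "\<xi> p i = z i" if "i \<in> bidx F" using fun_cong[OF p(2), of i] that by (simp add: restr_apply)
  moreover have "z i = 0" if "i \<notin> I1" "i \<notin> bidx F"
  proof (cases "i \<in> idx F")
   case True
   then show ?thesis using that w1[OF True] I1 by (auto simp: base_of_def)
  qed (use z in \<open>simp add: crd_def\<close>)
  ultimately show "fchart v i = z i" using co v(2) by (simp add: fchart_def restr_apply)
 qed
 then show "\<exists>v\<in>over F U. fchart v = z" using vU by blast
qed

lemma frame_gcoords: "gcoords M F (over F U, fchart)"
 unfolding gcoords_def
proof (intro conjI ballI frame_adapted)
 note M = pre_gradedD(1)[OF F] and fin = pre_gradedD(2)[OF F] and af = frame_adapted
 fix x assume x: "x \<in> atlas F"
 obtain D \<phi> where X: "x = (D, \<phi>)" by (cases x)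
 then have c: "(D, \<phi>) \<in> atlas F" using x by simp
 note g = gcoords_atlas[OF F c]
 note a = gcoordsD(1)[OF g]
 obtain V \<zeta> where "bundle_chart M F D \<phi> V \<zeta>" using bundle_chartE[OF a] by blast
 note u = bundle_chartD(1,2,4)[OF this]
 note V = coord_sysD(1)[OF u(1)]
 have sU: "saturated M F (over F U)" by (rule saturated_over[OF coord_sysD(1)[OF cs]])
 have W: "saturated M F (over F U \<inter> D)" by (rule saturated_Int[OF M sU saturated_gcoords[OF g]])
 have W0: "over F U \<inter> D \<subseteq> over F (U \<inter> V)" by (auto simp: u(2) over_def)
 have I1w: "wt F k = 1" if "k \<in> I1" for k using that I1 by simp
 have cases_idx: "i \<in> I1 \<or> i \<in> bidx F \<and> wt F i = 0" if "i \<in> idx F" for i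
  using that w1[OF that] I1 by (auto simp: base_of_def)
 show "gcompat F (over F U, fchart) x"
  unfolding gcompat_def X prod.case
 proof
  fix i assume i: "i \<in> idx F"
  show "gfun F (over F U) fchart (over F U \<inter> D) (wt F i) (\<lambda>e. \<phi> e i)"
   using cases_idx[OF i]
  proof
   assume i1: "i \<in> I1"
   have "gfun F (over F U) fchart (over F U \<inter> D) 1 (\<lambda>e. \<Sum>j\<in>I1. \<phi> (s j (bproj F e)) i * fchart e j)"
    by (rule gfun_base_times_coord[OF F af W _ W0 frame_matrix_smooth[OF c u(2) V _ i] I1w]) auto
   then have "gfun F (over F U) fchart (over F U \<inter> D) 1 (\<lambda>e. \<phi> e i)"
   proof (rule gfun_cong[OF M fin af W, rotated])
    fix e assume e: "e \<in> over F U \<inter> D"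
    then show "\<phi> e i = (\<Sum>j\<in>I1. \<phi> (s j (bproj F e)) i * fchart e j)"
     using frame_expand[OF _ _ g _ i1, of e] by (simp add: over_def fchart_def mult.commute)
   qed simp
   then show ?thesis using I1w[OF i1] by simp
  next
   assume b: "i \<in> bidx F \<and> wt F i = 0"
   have "gfun F (over F U) fchart (over F U \<inter> D) 0 (\<lambda>e. \<zeta> (bproj F e) i)"
    by (rule gfun_base[OF M fin af coord_sysD(4)[OF u(1)] W]) (use b u(2) in auto)
   then have "gfun F (over F U) fchart (over F U \<inter> D) 0 (\<lambda>e. \<phi> e i)"
   proof (rule gfun_cong[OF M fin af W, rotated])
    fix e assume e: "e \<in> over F U \<inter> D"
    then have "restr (bidx F) (\<phi> e) i = \<zeta> (bproj F e) i" using u(3) by simp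
    then show "\<phi> e i = \<zeta> (bproj F e) i" using b by (simp add: restr_apply)
   qed simp
   then show ?thesis using b by simp
  qed
 qed
 show "gcompat F x (over F U, fchart)"
  unfolding gcompat_def X prod.case
 proof
  have W': "saturated M F (D \<inter> over F U)" "D \<inter> over F U \<subseteq> over F (U \<inter> V)" using W W0 by (auto simp: Int_commute)
  fix i assume i: "i \<in> idx F"
  show "gfun F D \<phi> (D \<inter> over F U) (wt F i) (\<lambda>e. fchart e i)"
   using cases_idx[OF i]
  proof
   assume i1: "i \<in> I1"
   obtain N where N: "\<And>i k. i \<in> I1 \<Longrightarrow> k \<in> I1 \<Longrightarrow> smooth_real_on M (U \<inter> V) (N i k)"
    "\<And>v i. v \<in> D \<Longrightarrow> bproj F v \<in> U \<Longrightarrow> i \<in> I1 \<Longrightarrow> coframe F I1 s v i = (\<Sum>k\<in>I1. N i k (bproj F v) * \<phi> v k)"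
    using frame_inverse_matrix[OF c u(2) V] by blast
   have "gfun F D \<phi> (D \<inter> over F U) 1 (\<lambda>e. \<Sum>k\<in>I1. N i k (bproj F e) * \<phi> e k)"
    by (rule gfun_base_times_coord[OF F a W'(1) _ W'(2) N(1)[OF i1] I1w]) auto
   then have "gfun F D \<phi> (D \<inter> over F U) 1 (\<lambda>e. fchart e i)"
   proof (rule gfun_cong[OF M fin a W'(1), rotated])
    fix e assume e: "e \<in> D \<inter> over F U"
    then show "fchart e i = (\<Sum>k\<in>I1. N i k (bproj F e) * \<phi> e k)"
     using N(2)[of e i] i1 by (simp add: over_def fchart_def)
   qed simp
   then show ?thesis using I1w[OF i1] by simp
  next
   assume b: "i \<in> bidx F \<and> wt F i = 0"
   have "gfun F D \<phi> (D \<inter> over F U) 0 (\<lambda>e. \<xi> (bproj F e) i)"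
    by (rule gfun_base[OF M fin a coord_sysD(4)[OF cs] W'(1)]) (use b in auto)
   then have "gfun F D \<phi> (D \<inter> over F U) 0 (\<lambda>e. fchart e i)"
    by (rule gfun_cong[OF M fin a W'(1), rotated]) (use b fchart_base in auto)
   then show ?thesis using b by simp
  qed
 qed
qed

end

section \<open>Velocities of curves\<close>

lemma curve_iff:
 "curve N \<gamma> \<longleftrightarrow> \<gamma> 0 \<in> pts N \<and> (\<forall>(U, \<phi>)\<in>atlas N. \<gamma> 0 \<in> U \<longrightarrow>
   (\<exists>\<epsilon>>0. (\<forall>t\<in>{-\<epsilon><..<\<epsilon>}. \<gamma> t \<in> U) \<and> (\<forall>i\<in>idx N. smooth_curve_on {-\<epsilon><..<\<epsilon>} (\<lambda>s. \<phi> (\<gamma> s) i))))"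
 unfolding curve_def smooth_curve_on_def by (simp add: split_beta ball_conj_distrib) (meson)

lemma open_0_interval: "open S \<Longrightarrow> (0::real) \<in> S \<Longrightarrow> \<exists>\<epsilon>>0. {-\<epsilon><..<\<epsilon>} \<subseteq> S"
 unfolding open_dist by (force simp: dist_real_def)

lemma open_curve_preimage:
 assumes "open S" "finite J" "open_crd J V" "\<And>t. t \<in> S \<Longrightarrow> c t \<in> crd J"
  "\<And>j. j \<in> J \<Longrightarrow> smooth_curve_on S (\<lambda>t. c t j)"
 shows "open {t \<in> S. c t \<in> V}"
proof -
 have "open_crd (UNIV :: unit set) {z \<in> {z. z () \<in> S}. c (z ()) \<in> V}"
  by (rule open_crd_preimage[OF finite_unit _ assms(2,3)])
   (use assms in \<open>auto simp: open_crd_unit smooth_curve_on_iff[OF assms(1)]\<close>)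
 then have "open_crd (UNIV :: unit set) {z. z () \<in> {t \<in> S. c t \<in> V}}" by simp
 then show ?thesis by (simp only: open_crd_unit)
qed

lemma smooth_real_on_const: "mopen N W \<Longrightarrow> smooth_real_on N W (\<lambda>_. c)"
 unfolding smooth_real_on_def by (simp add: smooth_crd_const split_beta)

lemma funpow_one [simp]: "(f :: 'x \<Rightarrow> 'x) ^^ 1 = f"
 by (simp add: fun_eq_iff)

declare One_nat_def [simp del]

lemma jet1_iff:
 "\<delta> \<in> jet 1 N \<gamma> \<longleftrightarrow> curve N \<delta> \<and> \<delta> 0 = \<gamma> 0 \<and> (\<forall>(U, \<phi>)\<in>atlas N. \<gamma> 0 \<in> U \<longrightarrow>
   (\<forall>i\<in>idx N. deriv (\<lambda>t. \<phi> (\<delta> t) i) 0 = deriv (\<lambda>t. \<phi> (\<gamma> t) i) 0))"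
proof -
 have le1: "(\<forall>j\<le>(1::nat). P j) \<longleftrightarrow> P 0 \<and> P 1" for P
  by (auto simp: le_Suc_eq One_nat_def)
 show ?thesis unfolding jet_def le1 split_beta mem_Collect_eq
  by (intro conj_cong ball_cong imp_cong refl) simp
qed

lemma Tan1_simps:
 "pts (Tan 1 N) = jet 1 N ` {\<gamma>. curve N \<gamma>}" "idx (Tan 1 N) = idx N \<times> {..1}" "bproj (Tan 1 N) = base_pt"
 "wt (Tan 1 N) = snd"
 "atlas (Tan 1 N) = {({X \<in> pts (Tan 1 N). base_pt X \<in> U},
   \<lambda>X. restr (idx N \<times> {..1}) (\<lambda>(i, j). (deriv ^^ j) (\<lambda>t. \<phi> (repr X t) i) 0)) |U \<phi>. (U, \<phi>) \<in> atlas N}"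
 by (simp_all add: Tan_def)

lemma jet1_refl: "curve N \<gamma> \<Longrightarrow> \<gamma> \<in> jet 1 N \<gamma>"
 by (auto simp: jet1_iff)

lemma jet1_eq:
 assumes "\<delta> \<in> jet 1 N \<gamma>"
 shows "jet 1 N \<delta> = jet 1 N \<gamma>"
proof (rule set_eqI)
 fix \<beta>
 have 0: "\<delta> 0 = \<gamma> 0" using assms by (simp add: jet1_iff)
 have d: "deriv (\<lambda>t. snd x (\<delta> t) i) 0 = deriv (\<lambda>t. snd x (\<gamma> t) i) 0"
  if "x \<in> atlas N" "\<gamma> 0 \<in> fst x" "i \<in> idx N" for x i
  using assms that unfolding jet1_iff split_beta by blast
 show "\<beta> \<in> jet 1 N \<delta> \<longleftrightarrow> \<beta> \<in> jet 1 N \<gamma>"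
  unfolding jet1_iff split_beta 0
  by (intro conj_cong ball_cong imp_cong refl) (simp only: d)
qed

lemma repr_jet1: "curve N \<gamma> \<Longrightarrow> repr (jet 1 N \<gamma>) \<in> jet 1 N \<gamma>"
 unfolding repr_def using someI[of "\<lambda>\<delta>. \<delta> \<in> jet 1 N \<gamma>", OF jet1_refl] by simp

lemma tan_repr:
 assumes "X \<in> pts (Tan 1 N)"
 shows "curve N (repr X)" "jet 1 N (repr X) = X"
proof -
 obtain \<gamma> where \<gamma>: "curve N \<gamma>" "X = jet 1 N \<gamma>" using assms unfolding Tan1_simps by blast
 show "curve N (repr X)" using repr_jet1[OF \<gamma>(1)] unfolding \<gamma>(2) jet1_iff by blast
 show "jet 1 N (repr X) = X" unfolding \<gamma>(2) by (rule jet1_eq[OF repr_jet1[OF \<gamma>(1)]])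
qed

lemma tan_jet1:
 assumes "curve N \<gamma>"
 shows "jet 1 N \<gamma> \<in> pts (Tan 1 N)" "base_pt (jet 1 N \<gamma>) = \<gamma> 0"
 using assms repr_jet1[OF assms] by (auto simp: Tan1_simps base_pt_def jet1_iff)

context
 fixes N :: "('p, 'i, 'z) mfd_scheme"
 assumes N: "manifold N"
begin

lemma curve_function:
 assumes \<gamma>: "curve N \<gamma>" and f: "smooth_real_on N W f" and W: "\<gamma> 0 \<in> W"
 shows "\<exists>S. open S \<and> 0 \<in> S \<and> (\<forall>t\<in>S. \<gamma> t \<in> W) \<and> smooth_curve_on S (\<lambda>t. f (\<gamma> t))"
proof -
 have "\<gamma> 0 \<in> pts N" using \<gamma> by (simp add: curve_def)
 then obtain V \<eta> where V: "(V, \<eta>) \<in> atlas N" "\<gamma> 0 \<in> V" using manifold_cover[OF N] by blast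
 note \<eta> = manifold_chart[OF N V(1)]
 have mW: "mopen N W" using f by (simp add: smooth_real_on_def)
 have "\<exists>e>0. (\<forall>t\<in>{-e<..<e}. \<gamma> t \<in> V) \<and> (\<forall>i\<in>idx N. smooth_curve_on {-e<..<e} (\<lambda>s. \<eta> (\<gamma> s) i))"
  using bspec[OF conjunct2[OF \<gamma>[unfolded curve_iff]] V(1)] V(2) by simp
 then obtain e where e: "e > 0" "\<And>t. t \<in> {-e<..<e} \<Longrightarrow> \<gamma> t \<in> V"
  "\<And>i. i \<in> idx N \<Longrightarrow> smooth_curve_on {-e<..<e} (\<lambda>s. \<eta> (\<gamma> s) i)"
  by metis
 define S where "S = {t \<in> {-e<..<e}. \<eta> (\<gamma> t) \<in> \<eta> ` (V \<inter> W)}"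
 have oS: "open S" unfolding S_def
 proof (rule open_curve_preimage[OF _ manifold_finite[OF N] mopen_open[OF mW V(1)] _ e(3)])
  show "\<eta> (\<gamma> t) \<in> crd (idx N)" if "t \<in> {-e<..<e}" for t
   using coord_sysD(3)[OF coord_sys_atlas[OF N V(1)], THEN open_crd_subset] e(2)[OF that] by blast
 qed simp
 have S: "\<gamma> t \<in> V \<and> \<gamma> t \<in> W" if "t \<in> S" for t
  using that e(2)[of t] \<eta> by (auto simp: S_def dest: inj_onD)
 have "smooth_curve_on S (\<lambda>t. f (inv_into V \<eta> (\<eta> (\<gamma> t))))"
  by (rule smooth_curve_on_comp[OF oS manifold_finite[OF N] mopen_open[OF mW V(1)] smooth_real_onD[OF f V(1)]])
   (auto simp: S_def intro: smooth_curve_on_subset[OF e(3)])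
 then have "smooth_curve_on S (\<lambda>t. f (\<gamma> t))"
  by (rule smooth_curve_on_cong[OF oS]) (use S \<eta> in \<open>simp add: inv_into_f_f\<close>)
 moreover have "0 \<in> S" using e(1) V(2) W by (auto simp: S_def)
 ultimately show ?thesis using oS S by blast
qed

context
 fixes J :: "'j set" and U :: "'p set" and \<xi> :: "'p \<Rightarrow> 'j \<Rightarrow> real"
 assumes J: "finite J" and cs: "coord_sys N J (U, \<xi>)"
begin

lemma coord_sys_crd: "p \<in> U \<Longrightarrow> \<xi> p \<in> crd J"
 using coord_sysD(3)[OF cs] open_crd_subset by blast

lemma curve_coords:
 assumes \<gamma>: "curve N \<gamma>" and U: "\<gamma> 0 \<in> U"
 shows "\<exists>S. open S \<and> 0 \<in> S \<and> (\<forall>t\<in>S. \<gamma> t \<in> U) \<and> (\<forall>j\<in>J. smooth_curve_on S (\<lambda>t. \<xi> (\<gamma> t) j))"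
proof -
 have "\<forall>j. \<exists>S. j \<in> J \<longrightarrow> open S \<and> 0 \<in> S \<and> (\<forall>t\<in>S. \<gamma> t \<in> U) \<and> smooth_curve_on S (\<lambda>t. \<xi> (\<gamma> t) j)"
  using curve_function[OF \<gamma> coord_sysD(4)[OF cs] U] by blast
 then obtain S where S: "\<And>j. j \<in> J \<Longrightarrow> open (S j) \<and> 0 \<in> S j \<and> smooth_curve_on (S j) (\<lambda>t. \<xi> (\<gamma> t) j)"
  by metis
 obtain S0 where S0: "open S0" "0 \<in> S0" "\<forall>t\<in>S0. \<gamma> t \<in> U"
  using curve_function[OF \<gamma> smooth_real_on_const[OF coord_sysD(1)[OF cs]] U] by metis
 let ?S = "S0 \<inter> (\<Inter>j\<in>J. S j)"
 have "open (\<Inter>j\<in>J. S j)" using J S by (intro open_INT) auto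
 then have "open ?S" using S0(1) by auto
 moreover have "smooth_curve_on ?S (\<lambda>t. \<xi> (\<gamma> t) j)" if "j \<in> J" for j
  using S[OF that] smooth_curve_on_subset[of "S j" _ ?S] that by blast
 moreover have "0 \<in> ?S" using S S0 by blast
 ultimately show ?thesis using S0(3) by (intro exI[of _ ?S]) blast
qed

lemma curveI:
 assumes S: "open S" "0 \<in> S" "\<And>t. t \<in> S \<Longrightarrow> \<gamma> t \<in> U" and s: "\<And>j. j \<in> J \<Longrightarrow> smooth_curve_on S (\<lambda>t. \<xi> (\<gamma> t) j)"
 shows "curve N \<gamma>"
 unfolding curve_iff
proof (intro conjI ballI)
 show "\<gamma> 0 \<in> pts N" using S mopen_subset[OF coord_sysD(1)[OF cs]] by blast
 fix x assume x: "x \<in> atlas N"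
 obtain V \<eta> where X: "x = (V, \<eta>)" by (cases x)
 have V: "(V, \<eta>) \<in> atlas N" using x X by simp
 have "\<exists>\<epsilon>>0. (\<forall>t\<in>{-\<epsilon><..<\<epsilon>}. \<gamma> t \<in> V) \<and> (\<forall>i\<in>idx N. smooth_curve_on {-\<epsilon><..<\<epsilon>} (\<lambda>s. \<eta> (\<gamma> s) i))"
  if g0: "\<gamma> 0 \<in> V"
 proof -
  define T where "T = {t \<in> S. \<xi> (\<gamma> t) \<in> \<xi> ` (U \<inter> V)}"
  have oT: "open T" unfolding T_def
   by (rule open_curve_preimage[OF S(1) J coord_sysD(5)[OF cs V] _ s]) (use S(3) coord_sys_crd in auto)
  have T: "\<gamma> t \<in> U \<and> \<gamma> t \<in> V" if "t \<in> T" for t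
   using that S(3)[of t] coord_sysD(2)[OF cs] by (auto simp: T_def dest: inj_onD)
  have "smooth_curve_on T (\<lambda>t. \<eta> (\<gamma> t) i)" if i: "i \<in> idx N" for i
  proof -
   have "smooth_curve_on T (\<lambda>t. \<eta> (inv_into U \<xi> (\<xi> (\<gamma> t))) i)"
    by (rule smooth_curve_on_comp[OF oT J coord_sysD(5)[OF cs V] coord_sysD(6)[OF cs V i]])
     (auto simp: T_def intro: smooth_curve_on_subset[OF s])
   then show ?thesis
    by (rule smooth_curve_on_cong[OF oT]) (use T coord_sysD(2)[OF cs] in \<open>simp add: inv_into_f_f\<close>)
  qed
  moreover have "0 \<in> T" using S g0 by (auto simp: T_def)
  then obtain e where "e > 0" "{-e<..<e} \<subseteq> T" using open_0_interval[OF oT] by blast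
  ultimately show ?thesis using T smooth_curve_on_subset[of T _ "{-e<..<e}"]
   by (intro exI[of _ e]) blast
 qed
 then show "case x of (U, \<phi>) \<Rightarrow> \<gamma> 0 \<in> U \<longrightarrow>
   (\<exists>\<epsilon>>0. (\<forall>t\<in>{-\<epsilon><..<\<epsilon>}. \<gamma> t \<in> U) \<and> (\<forall>i\<in>idx N. smooth_curve_on {-\<epsilon><..<\<epsilon>} (\<lambda>s. \<phi> (\<gamma> s) i)))"
  by (simp add: X)
qed

text \<open>The velocity with respect to one coordinate system determines the derivatives of all functions along
  the curve, so that tangency classes can be compared in a single chart.\<close>

lemma deriv_along:
 assumes \<gamma>: "curve N \<gamma>" and U: "\<gamma> 0 \<in> U" and f: "smooth_real_on N W f" and W: "\<gamma> 0 \<in> W"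
 shows "deriv (\<lambda>t. f (\<gamma> t)) 0 =
  (\<Sum>j\<in>J. pdv j (\<lambda>z. f (inv_into U \<xi> z)) (\<xi> (\<gamma> 0)) * deriv (\<lambda>t. \<xi> (\<gamma> t) j) 0)"
proof -
 obtain S where S: "open S" "0 \<in> S" "\<And>t. t \<in> S \<Longrightarrow> \<gamma> t \<in> U" "\<And>j. j \<in> J \<Longrightarrow> smooth_curve_on S (\<lambda>t. \<xi> (\<gamma> t) j)"
  using curve_coords[OF \<gamma> U] by blast
 define c where "c t = (if t \<in> S then \<xi> (\<gamma> t) else (\<lambda>_. 0))" for t
 have ev: "\<forall>\<^sub>F t in nhds 0. t \<in> S" using S(1,2) by (rule eventually_nhds_in_open)
 have mW: "mopen N W" using f by (simp add: smooth_real_on_def)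
 have "((\<lambda>t. f (inv_into U \<xi> (c t))) has_field_derivative
   (\<Sum>j\<in>J. pdv j (\<lambda>z. f (inv_into U \<xi> z)) (c 0) * deriv (\<lambda>t. \<xi> (\<gamma> t) j) 0)) (at 0)"
 proof (rule chain_rule_curve[OF J coord_sys_open_image[OF N J cs mW] smooth_crdD[OF smooth_real_on_coords[OF N J cs f]]])
  show "c 0 \<in> \<xi> ` (U \<inter> W)" using S(2) U W by (simp add: c_def)
  show "c t \<in> crd J" for t
  proof (cases "t \<in> S")
   case True
   then show ?thesis using coord_sys_crd[OF S(3)] by (simp add: c_def)
  qed (simp add: c_def crd_def)
  fix j assume j: "j \<in> J"
  have "((\<lambda>t. \<xi> (\<gamma> t) j) has_field_derivative deriv (\<lambda>t. \<xi> (\<gamma> t) j) 0) (at 0)"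
   by (rule smooth_curve_on_deriv[OF S(4)[OF j] S(2)])
  moreover have "\<forall>\<^sub>F t in nhds 0. c t j = \<xi> (\<gamma> t) j" using ev by eventually_elim (simp add: c_def)
  ultimately show "((\<lambda>t. c t j) has_field_derivative deriv (\<lambda>t. \<xi> (\<gamma> t) j) 0) (at 0)"
   by (subst DERIV_cong_ev) auto
 qed
 moreover have "\<forall>\<^sub>F t in nhds 0. f (inv_into U \<xi> (c t)) = f (\<gamma> t)"
  using ev by eventually_elim (use S(3) coord_sysD(2)[OF cs] in \<open>simp add: c_def inv_into_f_f\<close>)
 ultimately have "((\<lambda>t. f (\<gamma> t)) has_field_derivative
   (\<Sum>j\<in>J. pdv j (\<lambda>z. f (inv_into U \<xi> z)) (c 0) * deriv (\<lambda>t. \<xi> (\<gamma> t) j) 0)) (at 0)"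
  by (subst (asm) DERIV_cong_ev) auto
 from DERIV_imp_deriv[OF this] show ?thesis using S(2) by (simp add: c_def)
qed

text \<open>The curve is affine in the chart.  Its values at parameters for which the line leaves the chart are
  irrelevant, since curves are considered near \<open>0\<close> only.\<close>

lemma tangent_exists:
 assumes p: "p \<in> U"
 shows "\<exists>\<gamma>. curve N \<gamma> \<and> \<gamma> 0 = p \<and> (\<forall>j\<in>J. deriv (\<lambda>t. \<xi> (\<gamma> t) j) 0 = u j)"
proof -
 define c where "c t = (\<lambda>j. if j \<in> J then \<xi> p j + u j * t else 0)" for t
 define S where "S = {t \<in> UNIV. c t \<in> \<xi> ` U}"
 have aff: "smooth_curve_on X (\<lambda>t. c t j)" if "j \<in> J" for X j
  using that smooth_curve_on_affine[of X "\<xi> p j" "u j"] by (simp add: c_def)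
 have oS: "open S" unfolding S_def
  by (rule open_curve_preimage[OF open_UNIV J coord_sysD(3)[OF cs] _ aff]) (auto simp: c_def crd_def)
 have c0: "c 0 = \<xi> p" using coord_sys_crd[OF p] by (auto simp: c_def crd_def)
 have S0: "0 \<in> S" using p c0 by (simp add: S_def)
 define \<gamma> where "\<gamma> t = inv_into U \<xi> (c t)" for t
 have \<gamma>: "\<gamma> t \<in> U \<and> \<xi> (\<gamma> t) = c t" if "t \<in> S" for t
  using that by (auto simp: S_def \<gamma>_def inv_into_into f_inv_into_f)
 have "curve N \<gamma>"
 proof (rule curveI[OF oS S0])
  show "smooth_curve_on S (\<lambda>t. \<xi> (\<gamma> t) j)" if "j \<in> J" for j
   by (rule smooth_curve_on_cong[OF oS aff[OF that]]) (simp add: \<gamma>)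
 qed (simp add: \<gamma>)
 moreover have "\<gamma> 0 = p" using c0 p coord_sysD(2)[OF cs] by (simp add: \<gamma>_def inv_into_f_f)
 moreover have "deriv (\<lambda>t. \<xi> (\<gamma> t) j) 0 = u j" if j: "j \<in> J" for j
 proof -
  have "\<forall>\<^sub>F t in nhds 0. t \<in> S" using oS S0 by (rule eventually_nhds_in_open)
  then have "\<forall>\<^sub>F t in nhds 0. \<xi> (\<gamma> t) j = \<xi> p j + u j * t"
   by eventually_elim (use \<gamma> j in \<open>simp add: c_def\<close>)
  then have "deriv (\<lambda>t. \<xi> (\<gamma> t) j) 0 = deriv (\<lambda>t. \<xi> p j + u j * t) 0"
   by (rule deriv_cong_ev) simp
  also have "\<dots> = u j" by (rule DERIV_imp_deriv) (auto intro!: derivative_eq_intros)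
  finally show ?thesis .
 qed
 ultimately show ?thesis by blast
qed

end

subsection \<open>Tangent vectors\<close>

lemma jet1_deriv:
 assumes d: "\<delta> \<in> jet 1 N \<gamma>" and \<gamma>: "curve N \<gamma>" and f: "smooth_real_on N W f" and W: "\<gamma> 0 \<in> W"
 shows "deriv (\<lambda>t. f (\<delta> t)) 0 = deriv (\<lambda>t. f (\<gamma> t)) 0"
proof -
 have "\<gamma> 0 \<in> pts N" using \<gamma> by (simp add: curve_def)
 then obtain V \<eta> where V: "(V, \<eta>) \<in> atlas N" "\<gamma> 0 \<in> V" using manifold_cover[OF N] by blast
 note cs = coord_sys_atlas[OF N V(1)]
 have \<delta>: "curve N \<delta>" "\<delta> 0 = \<gamma> 0" "\<forall>i\<in>idx N. deriv (\<lambda>t. \<eta> (\<delta> t) i) 0 = deriv (\<lambda>t. \<eta> (\<gamma> t) i) 0"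
  using d V by (auto simp: jet1_iff)
 show ?thesis
  using deriv_along[OF manifold_finite[OF N] cs \<gamma> V(2) f W]
   deriv_along[OF manifold_finite[OF N] cs \<delta>(1) _ f] \<delta>(2,3) V(2) W by simp
qed

lemma jet1_eqI:
 assumes J: "finite J" and cs: "coord_sys N J (U, \<xi>)" and \<gamma>: "curve N \<gamma>" "curve N \<delta>" "\<delta> 0 = \<gamma> 0" "\<gamma> 0 \<in> U"
  and d: "\<And>j. j \<in> J \<Longrightarrow> deriv (\<lambda>t. \<xi> (\<delta> t) j) 0 = deriv (\<lambda>t. \<xi> (\<gamma> t) j) 0"
 shows "jet 1 N \<delta> = jet 1 N \<gamma>"
proof (rule jet1_eq, unfold jet1_iff, intro conjI \<gamma> ballI)
 fix x assume x: "x \<in> atlas N"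
 obtain V \<eta> where X: "x = (V, \<eta>)" by (cases x)
 have V: "(V, \<eta>) \<in> atlas N" using x X by simp
 have "deriv (\<lambda>t. \<eta> (\<delta> t) i) 0 = deriv (\<lambda>t. \<eta> (\<gamma> t) i) 0" if "\<gamma> 0 \<in> V" "i \<in> idx N" for i
  using deriv_along[OF J cs \<gamma>(1,4) coord_sysD(4)[OF coord_sys_atlas[OF N V] that(2)] that(1)]
   deriv_along[OF J cs \<gamma>(2) _ coord_sysD(4)[OF coord_sys_atlas[OF N V] that(2)]] \<gamma>(3,4) that d by simp
 then show "case x of (U, \<phi>) \<Rightarrow> \<gamma> 0 \<in> U \<longrightarrow> (\<forall>i\<in>idx N. deriv (\<lambda>t. \<phi> (\<delta> t) i) 0 = deriv (\<lambda>t. \<phi> (\<gamma> t) i) 0)"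
  by (simp add: X)
qed

lemma tan_eqI:
 assumes J: "finite J" and cs: "coord_sys N J (U, \<xi>)" and X: "X \<in> pts (Tan 1 N)" "Y \<in> pts (Tan 1 N)"
  "base_pt Y = base_pt X" "base_pt X \<in> U"
  and d: "\<And>j. j \<in> J \<Longrightarrow> deriv (\<lambda>t. \<xi> (repr Y t) j) 0 = deriv (\<lambda>t. \<xi> (repr X t) j) 0"
 shows "Y = X"
proof -
 have "jet 1 N (repr Y) = jet 1 N (repr X)"
 proof (rule jet1_eqI[OF J cs tan_repr(1)[OF X(1)] tan_repr(1)[OF X(2)]])
  show "repr Y 0 = repr X 0" "repr X 0 \<in> U" using X(3,4) by (simp_all add: base_pt_def)
 qed (rule d)
 then show ?thesis by (simp only: tan_repr(2)[OF X(1)] tan_repr(2)[OF X(2)])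
qed

lemma repr_jet1_deriv:
 assumes \<gamma>: "curve N \<gamma>" and f: "smooth_real_on N W f" and W: "\<gamma> 0 \<in> W"
 shows "deriv (\<lambda>t. f (repr (jet 1 N \<gamma>) t)) 0 = deriv (\<lambda>t. f (\<gamma> t)) 0"
 by (rule jet1_deriv[OF repr_jet1[OF \<gamma>] \<gamma> f W])

text \<open>The action on the tangent bundle multiplies velocities.  The class of a curve with scaled velocity in
  one chart has scaled velocity in all charts by the chain rule, and the velocities determine the
  class.\<close>

lemma Tan_hact:
 assumes X: "X \<in> pts (Tan 1 N)"
 shows "hact (Tan 1 N) t X \<in> pts (Tan 1 N)" "base_pt (hact (Tan 1 N) t X) = base_pt X"
  "\<And>V \<eta> i. (V, \<eta>) \<in> atlas N \<Longrightarrow> base_pt X \<in> V \<Longrightarrow> i \<in> idx N \<Longrightarrow>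
   deriv (\<lambda>s. \<eta> (repr (hact (Tan 1 N) t X) s) i) 0 = t * deriv (\<lambda>s. \<eta> (repr X s) i) 0"
proof -
 let ?c = "\<lambda>\<phi> X. restr (idx N \<times> {..1}) (\<lambda>(i, j). (deriv ^^ j) (\<lambda>t. \<phi> (repr X t) i) 0)"
 have c0: "?c \<phi> Y (i, 0) = \<phi> (base_pt Y) i" and c1: "?c \<phi> Y (i, 1) = deriv (\<lambda>t. \<phi> (repr Y t) i) 0"
  if "i \<in> idx N" for \<phi> :: "'p \<Rightarrow> 'i \<Rightarrow> real" and Y i
  using that by (auto simp: restr_apply base_pt_def)
 note \<gamma> = tan_repr(1)[OF X]
 have "base_pt X \<in> pts N" using \<gamma> by (simp add: curve_def base_pt_def)
 then obtain V \<eta> where V: "(V, \<eta>) \<in> atlas N" "base_pt X \<in> V" using manifold_cover[OF N] by blast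
 note cs = coord_sys_atlas[OF N V(1)]
 obtain \<delta> where \<delta>: "curve N \<delta>" "\<delta> 0 = base_pt X"
  "\<And>j. j \<in> idx N \<Longrightarrow> deriv (\<lambda>s. \<eta> (\<delta> s) j) 0 = t * deriv (\<lambda>s. \<eta> (repr X s) j) 0"
  using tangent_exists[OF manifold_finite[OF N] cs V(2), of "\<lambda>j. t * deriv (\<lambda>s. \<eta> (repr X s) j) 0"] by blast
 define Y where "Y = jet 1 N \<delta>"
 have Y: "Y \<in> pts (Tan 1 N)" "base_pt Y = base_pt X" using tan_jet1[OF \<delta>(1)] \<delta>(2) by (auto simp: Y_def)
 have dY: "deriv (\<lambda>s. \<eta>' (repr Y s) i) 0 = t * deriv (\<lambda>s. \<eta>' (repr X s) i) 0"
  if V': "(V', \<eta>') \<in> atlas N" "base_pt X \<in> V'" and i: "i \<in> idx N" for V' \<eta>' i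
 proof -
  note sm = coord_sysD(4)[OF coord_sys_atlas[OF N V'(1)] i]
  have X0: "repr X 0 = base_pt X" by (simp add: base_pt_def)
  have "deriv (\<lambda>s. \<eta>' (repr Y s) i) 0 = deriv (\<lambda>s. \<eta>' (\<delta> s) i) 0"
   unfolding Y_def by (rule repr_jet1_deriv[OF \<delta>(1) sm]) (simp add: \<delta>(2) V'(2))
  also have "\<dots> = (\<Sum>j\<in>idx N. pdv j (\<lambda>z. \<eta>' (inv_into V \<eta> z) i) (\<eta> (base_pt X)) * (t * deriv (\<lambda>s. \<eta> (repr X s) j) 0))"
   using deriv_along[OF manifold_finite[OF N] cs \<delta>(1) _ sm] V(2) V'(2) \<delta>(2,3) by simp
  also have "\<dots> = t * deriv (\<lambda>s. \<eta>' (repr X s) i) 0"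
   using deriv_along[OF manifold_finite[OF N] cs \<gamma> _ sm] V(2) V'(2) X0
   by (simp add: sum_distrib_left mult_ac)
  finally show ?thesis .
 qed
 have "hact (Tan 1 N) t X = Y" unfolding hact_def
 proof (rule the_equality)
  show "Y \<in> pts (Tan 1 N) \<and> (\<forall>(D, \<phi>)\<in>atlas (Tan 1 N). X \<in> D \<longrightarrow>
    Y \<in> D \<and> (\<forall>i\<in>idx (Tan 1 N). \<phi> Y i = t ^ wt (Tan 1 N) i * \<phi> X i))"
  proof (intro conjI Y(1) ballI)
   fix x assume "x \<in> atlas (Tan 1 N)"
   then obtain V' \<eta>' where V': "(V', \<eta>') \<in> atlas N" "x = ({X \<in> pts (Tan 1 N). base_pt X \<in> V'}, ?c \<eta>')"
    unfolding Tan1_simps(5) by blast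
   have "?c \<eta>' Y ij = t ^ snd ij * ?c \<eta>' X ij" if "base_pt X \<in> V'" "ij \<in> idx N \<times> {..1}" for ij
   proof -
    obtain i j where ij: "ij = (i, j)" "i \<in> idx N" "j = 0 \<or> j = 1" using \<open>ij \<in> idx N \<times> {..1}\<close> by (auto simp: le_Suc_eq One_nat_def)
    show ?thesis using ij(3) c0[OF ij(2), of \<eta>'] c1[OF ij(2), of \<eta>'] dY[OF V'(1) that(1) ij(2)] Y(2)
     unfolding ij(1) by (elim disjE) simp_all
   qed
   then show "case x of (D, \<phi>) \<Rightarrow> X \<in> D \<longrightarrow>
    Y \<in> D \<and> (\<forall>i\<in>idx (Tan 1 N). \<phi> Y i = t ^ wt (Tan 1 N) i * \<phi> X i)"
    using Y unfolding V'(2) Tan1_simps(2,4) by auto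
  qed
  fix Z assume Z: "Z \<in> pts (Tan 1 N) \<and> (\<forall>(D, \<phi>)\<in>atlas (Tan 1 N). X \<in> D \<longrightarrow>
    Z \<in> D \<and> (\<forall>i\<in>idx (Tan 1 N). \<phi> Z i = t ^ wt (Tan 1 N) i * \<phi> X i))"
  have "({X \<in> pts (Tan 1 N). base_pt X \<in> V}, ?c \<eta>) \<in> atlas (Tan 1 N)"
   unfolding Tan1_simps(5) using V(1) by blast
  then have Z': "base_pt Z \<in> V" "\<forall>ij\<in>idx N \<times> {..1}. ?c \<eta> Z ij = t ^ snd ij * ?c \<eta> X ij"
   using Z X V(2) unfolding Tan1_simps(2,4) by auto
  have "\<eta> (base_pt Z) i = \<eta> (base_pt X) i" if "i \<in> idx N" for i
   using bspec[OF Z'(2), of "(i, 0)"] that c0[OF that, of \<eta>] by simp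
  moreover have "\<eta> (base_pt Z) i = 0" "\<eta> (base_pt X) i = 0" if "i \<notin> idx N" for i
   using coord_sys_crd[OF manifold_finite[OF N] cs Z'(1)] coord_sys_crd[OF manifold_finite[OF N] cs V(2)] that
   by (simp_all add: crd_def)
  ultimately have "\<eta> (base_pt Z) i = \<eta> (base_pt X) i" for i by (cases "i \<in> idx N") auto
  then have "\<eta> (base_pt Z) = \<eta> (base_pt X)" by (rule ext)
  then have bZ: "base_pt Z = base_pt X" using coord_sysD(2)[OF cs] Z'(1) V(2) by (auto dest: inj_onD)
  show "Z = Y"
  proof (rule tan_eqI[OF manifold_finite[OF N] cs Y(1) conjunct1[OF Z]])
   fix i assume i: "i \<in> idx N"
   show "deriv (\<lambda>s. \<eta> (repr Z s) i) 0 = deriv (\<lambda>s. \<eta> (repr Y s) i) 0"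
    using bspec[OF Z'(2), of "(i, 1)"] i c1[OF i, of \<eta>] dY[OF V i] by simp
  qed (use bZ Y V(2) in auto)
 qed
 then show "hact (Tan 1 N) t X \<in> pts (Tan 1 N)" "base_pt (hact (Tan 1 N) t X) = base_pt X"
  "\<And>V \<eta> i. (V, \<eta>) \<in> atlas N \<Longrightarrow> base_pt X \<in> V \<Longrightarrow> i \<in> idx N \<Longrightarrow>
   deriv (\<lambda>s. \<eta> (repr (hact (Tan 1 N) t X) s) i) 0 = t * deriv (\<lambda>s. \<eta> (repr X s) i) 0"
  using Y dY by auto
qed

end

section \<open>The second prolongation\<close>

lemma gcoords_coord_sys:
 assumes E: "graded_bundle k M E" and c: "gcoords M E (D, \<phi>)"
 shows "coord_sys E (idx E) (D, \<phi>)"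
proof -
 note P = graded_bundle_pre_graded[OF E]
 note M = pre_gradedD(1)[OF P] and fin = pre_gradedD(2)[OF P]
 note a = gcoordsD(1)[OF c]
 note sD = saturated_gcoords[OF c]
 have sat: "saturated M E (V \<inter> D)" if "(V, \<eta>) \<in> atlas E" for V \<eta>
  by (rule saturated_Int[OF M saturated_gcoords[OF gcoords_atlas[OF P that]] sD])
 have mD: "mopen E D"
  unfolding mopen_def
 proof (intro conjI ballI saturated_pts[OF sD], clarify)
  fix V \<eta> assume V: "(V, \<eta>) \<in> atlas E"
  show "open_crd (idx E) (\<eta> ` (V \<inter> D))"
   by (rule adapted_saturated_open[OF M fin pre_gradedD(4)[OF P V] sat[OF V]]) simp
 qed
 have "smooth_real_on E D (\<lambda>p. \<phi> p j)" if j: "j \<in> idx E" for j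
  unfolding smooth_real_on_def
 proof (intro conjI mD ballI, clarify)
  fix V \<eta> assume V: "(V, \<eta>) \<in> atlas E"
  show "smooth_crd (idx E) (\<eta> ` (V \<inter> D)) (\<lambda>z. \<phi> (inv_into V \<eta> z) j)"
   by (rule gfun_smooth[OF gcompatD[OF gcoordsD(3)[OF c V] j]])
 qed
 moreover have "open_crd (idx E) (\<phi> ` (D \<inter> V))" if V: "(V, \<eta>) \<in> atlas E" for V \<eta>
  by (rule adapted_saturated_open[OF M fin a]) (use sat[OF V] in \<open>auto simp: Int_commute\<close>)
 moreover have "smooth_crd (idx E) (\<phi> ` (D \<inter> V)) (\<lambda>z. \<eta> (inv_into D \<phi> z) i)"
  if V: "(V, \<eta>) \<in> atlas E" and i: "i \<in> idx E" for V \<eta> i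
  by (rule gfun_smooth[OF gcompatD[OF gcoordsD(2)[OF c V] i]])
 moreover have "open_crd (idx E) (\<phi> ` D)"
  by (rule adapted_saturated_open[OF M fin a sD order_refl])
 ultimately show ?thesis unfolding coord_sys_def using mD adapted_inj[OF a] by auto
qed

lemma hact_unique:
 assumes E: "pre_graded M E" and c: "gcoords M E (D, \<phi>)" and e: "e \<in> D" "e' \<in> D"
  and eq: "\<And>i. i \<in> idx E \<Longrightarrow> \<phi> e' i = t ^ wt E i * \<phi> e i"
 shows "e' = hact E t e"
proof -
 have ep: "e \<in> pts E" using e saturated_pts[OF saturated_gcoords[OF c]] by blast
 have "hact E t e \<in> D"
  by (rule saturatedD[OF saturated_gcoords[OF c] e(1) hact_coords(1,2)[OF E ep]])
 then show ?thesis
  by (rule adapted_eq[OF gcoordsD(1)[OF c] e(2)]) (simp add: eq hact_coords(3)[OF E ep c e(1)])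
qed

lemma set_comp_image: "{f x y |x y. (x, y) \<in> S} = (\<lambda>(x, y). f x y) ` S"
 by force

lemma smooth_map_onD:
 assumes "smooth_map_on N W P f" "(U, \<phi>) \<in> atlas N" "(V, \<psi>) \<in> atlas P" "i \<in> idx P"
 shows "smooth_crd (idx N) (\<phi> ` (U \<inter> W \<inter> f -` V)) (\<lambda>z. \<psi> (f (inv_into U \<phi> z)) i)"
proof -
 have "\<forall>x\<in>atlas N. \<forall>y\<in>atlas P. \<forall>i\<in>idx P. smooth_crd (idx N) (snd x ` (fst x \<inter> W \<inter> f -` fst y))
   (\<lambda>z. snd y (f (inv_into (fst x) (snd x) z)) i)"
  using assms(1) unfolding smooth_map_on_def split_beta by blast
 from bspec[OF bspec[OF bspec[OF this assms(2)] assms(3)] assms(4)] show ?thesis by simp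
qed

context
 fixes M :: "('m, 'b, 'z) mfd_scheme" and A :: "('a, 'i, 'm) gbundle" and anchor :: "'a \<Rightarrow> (real \<Rightarrow> 'm) set"
 assumes A: "graded_bundle 1 M A" and mor: "gb_morphism A (Tan 1 M) anchor" and ovr: "over_id A (Tan 1 M) anchor"
begin

lemma A_pre: "pre_graded M A"
 by (rule graded_bundle_pre_graded[OF A])

lemma A_wt: "i \<in> idx A \<Longrightarrow> wt A i \<le> 1"
 using A by (simp add: graded_bundle_def)

lemma A_mfd: "manifold A"
 using A by (simp add: graded_bundle_def)

lemmas A_M = pre_gradedD(1)[OF A_pre] and A_fin = pre_gradedD(2)[OF A_pre]

lemma anchor_Tan:
 assumes "a \<in> pts A"
 shows "anchor a \<in> pts (Tan 1 M) \<and> base_pt (anchor a) = bproj A a"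
proof
 have "anchor ` pts A \<subseteq> pts (Tan 1 M)" using mor by (simp add: gb_morphism_def smooth_map_on_def)
 then show "anchor a \<in> pts (Tan 1 M)" using assms by blast
 show "base_pt (anchor a) = bproj A a" using ovr assms by (simp add: over_id_def Tan_def)
qed

definition anch :: "('m \<Rightarrow> real) \<Rightarrow> 'a \<Rightarrow> real" where
 "anch f a = deriv (\<lambda>t. f (repr (anchor a) t)) 0"

lemma anch_along:
 assumes a: "a \<in> pts A" and cs: "coord_sys M J (U, \<xi>)" "finite J" and U: "bproj A a \<in> U"
  and f: "smooth_real_on M W f" "bproj A a \<in> W"
 shows "anch f a = (\<Sum>j\<in>J. pdv j (\<lambda>z. f (inv_into U \<xi> z)) (\<xi> (bproj A a)) * anch (\<lambda>p. \<xi> p j) a)"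
proof -
 have X: "anchor a \<in> pts (Tan 1 M)" "repr (anchor a) 0 = bproj A a"
  using anchor_Tan[OF a] by (auto simp: base_pt_def)
 show ?thesis
  using deriv_along[OF A_M cs(2,1) tan_repr(1)[OF X(1)] _ f(1)] U f(2) X(2) by (simp add: anch_def)
qed

lemma anch_coord_hact:
 assumes a: "a \<in> pts A" and V: "(V, \<eta>) \<in> atlas M" "bproj A a \<in> V" "i \<in> idx M"
 shows "anch (\<lambda>p. \<eta> p i) (hact A t a) = t * anch (\<lambda>p. \<eta> p i) a"
proof -
 have "anchor (hact A t a) = hact (Tan 1 M) t (anchor a)"
  using mor a by (simp add: gb_morphism_def)
 then show ?thesis using Tan_hact(3)[OF A_M _ V(1) _ V(3)] anchor_Tan[OF a] V(2) by (simp add: anch_def)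
qed

lemma anch_coord_gfun:
 assumes c: "(D, \<phi>) \<in> atlas A" and V: "(V, \<eta>) \<in> atlas M" and i: "i \<in> idx M"
 shows "gfun A D \<phi> (D \<inter> over A V) 1 (anch (\<lambda>p. \<eta> p i))"
proof -
 note g = gcoords_atlas[OF A_pre c]
 have W: "saturated M A (D \<inter> over A V)" "D \<inter> over A V \<subseteq> D"
  by (simp_all add: saturated_Int[OF A_M saturated_gcoords[OF g] saturated_over[OF mopen_chart[OF A_M V]]])
 let ?D' = "{X \<in> pts (Tan 1 M). base_pt X \<in> V}"
 let ?c = "\<lambda>X. restr (idx M \<times> {..1}) (\<lambda>(i, j). (deriv ^^ j) (\<lambda>t. \<eta> (repr X t) i) 0)"
 have t: "(?D', ?c) \<in> atlas (Tan 1 M)" unfolding Tan1_simps(5) using V by blast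
 have "smooth_map A (Tan 1 M) anchor" using mor by (simp add: gb_morphism_def)
 moreover have i1: "(i, 1) \<in> idx (Tan 1 M)" using i by (simp add: Tan1_simps)
 ultimately have "smooth_crd (idx A) (\<phi> ` (D \<inter> pts A \<inter> anchor -` ?D')) (\<lambda>z. ?c (anchor (inv_into D \<phi> z)) (i, 1))"
  using smooth_map_onD[OF _ c t] by blast
 moreover have "D \<inter> pts A \<inter> anchor -` ?D' = D \<inter> over A V"
  using anchor_Tan by (auto simp: over_def)
 ultimately have "smooth_crd (idx A) (\<phi> ` (D \<inter> over A V)) (\<lambda>z. ?c (anchor (inv_into D \<phi> z)) (i, 1))"
  by simp
 then have sm: "smooth_crd (idx A) (\<phi> ` (D \<inter> over A V)) (\<lambda>z. anch (\<lambda>p. \<eta> p i) (inv_into D \<phi> z))"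
  using i by (simp add: restr_apply anch_def)
 show ?thesis
 proof (rule gfunI[OF A_M A_fin gcoordsD(1)[OF g] W sm])
  fix e e' t assume e: "e \<in> D \<inter> over A V" "e' \<in> D \<inter> over A V" "\<phi> e' = scl (wt A) t (\<phi> e)"
  have "e' = hact A t e" by (rule hact_unique[OF A_pre g]) (use e in \<open>auto simp: scl_def\<close>)
  then show "anch (\<lambda>p. \<eta> p i) e' = t ^ 1 * anch (\<lambda>p. \<eta> p i) e"
   using anch_coord_hact[OF _ V _ i] e(1) by (simp add: over_def)
 qed
qed

lemma pdv_base_smooth:
 assumes V: "(V, \<eta>) \<in> atlas M" and f: "smooth_real_on M W f" and i: "i \<in> idx M"
 shows "smooth_real_on M (V \<inter> W) (\<lambda>p. pdv i (\<lambda>z. f (inv_into V \<eta> z)) (\<eta> p))"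
proof -
 note cs = coord_sys_atlas[OF A_M V]
 have W: "mopen M W" using f by (simp add: smooth_real_on_def)
 have VW: "mopen M (V \<inter> W)" by (rule manifold_mopen_Int[OF A_M mopen_chart[OF A_M V] W])
 show ?thesis
 proof (rule smooth_real_on_from_coords[OF A_M manifold_finite[OF A_M] cs VW])
  have "smooth_crd (idx M) (\<eta> ` (V \<inter> W)) (pdv i (\<lambda>z. f (inv_into V \<eta> z)))"
   by (rule smooth_crd_pdv[OF smooth_real_onD[OF f V] i])
  then show "smooth_crd (idx M) (\<eta> ` (V \<inter> W)) (\<lambda>z. pdv i (\<lambda>z. f (inv_into V \<eta> z)) (\<eta> (inv_into V \<eta> z)))"
  proof (rule smooth_crd_cong_imp[OF manifold_finite[OF A_M] mopen_open[OF W V]])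
   fix y assume "y \<in> \<eta> ` (V \<inter> W)"
   then have "\<eta> (inv_into V \<eta> y) = y" by (auto intro: f_inv_into_f)
   then show "pdv i (\<lambda>z. f (inv_into V \<eta> z)) (\<eta> (inv_into V \<eta> y)) = pdv i (\<lambda>z. f (inv_into V \<eta> z)) y" by simp
  qed
 qed simp
qed

text \<open>Because the anchor commutes with the actions, its components are linear on the fibres of \<open>A\<close>.\<close>

lemma anch_gfun:
 assumes c: "gcoords M A (D, \<phi>)" and f: "smooth_real_on M W0 f"
  and W: "saturated M A W" "W \<subseteq> D" "W \<subseteq> over A W0"
 shows "gfun A D \<phi> W 1 (anch f)"
proof (rule gfun_cover[OF A_pre gcoordsD(1)[OF c] W(1,2)])
 fix D' \<psi> assume c': "(D', \<psi>) \<in> atlas A"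
 note g = gcoords_atlas[OF A_pre c']
 have WD': "saturated M A (W \<inter> D')" by (rule saturated_Int[OF A_M W(1) saturated_gcoords[OF g]])
 have loc: "saturated M A (W \<inter> D' \<inter> over A V) \<and> W \<inter> D' \<inter> over A V \<subseteq> D' \<and> gfun A D' \<psi> (W \<inter> D' \<inter> over A V) 1 (anch f)"
  if V: "(V, \<eta>) \<in> atlas M" for V \<eta>
 proof -
  have S: "saturated M A (W \<inter> D' \<inter> over A V)" "W \<inter> D' \<inter> over A V \<subseteq> D'"
   using saturated_Int[OF A_M WD' saturated_over[OF mopen_chart[OF A_M V]]] by auto
  have s2: "W \<inter> D' \<inter> over A V \<subseteq> over A (V \<inter> W0)" using W(3) by (auto simp: over_def)
  have "gfun A D' \<psi> (W \<inter> D' \<inter> over A V) (0 + 1)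
    (\<lambda>a. pdv i (\<lambda>z. f (inv_into V \<eta> z)) (\<eta> (bproj A a)) * anch (\<lambda>p. \<eta> p i) a)" if i: "i \<in> idx M" for i
  proof (rule gfun_mult[OF A_M A_fin gcoordsD(1)[OF g] S])
   show "gfun A D' \<psi> (W \<inter> D' \<inter> over A V) 0 (\<lambda>a. pdv i (\<lambda>z. f (inv_into V \<eta> z)) (\<eta> (bproj A a)))"
    by (rule gfun_base[OF A_M A_fin gcoordsD(1)[OF g] pdv_base_smooth[OF V f i] S s2])
   show "gfun A D' \<psi> (W \<inter> D' \<inter> over A V) 1 (anch (\<lambda>p. \<eta> p i))"
    by (rule gfun_mono[OF anch_coord_gfun[OF c' V i]]) auto
  qed
  then have "gfun A D' \<psi> (W \<inter> D' \<inter> over A V) 1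
    (\<lambda>a. \<Sum>i\<in>idx M. pdv i (\<lambda>z. f (inv_into V \<eta> z)) (\<eta> (bproj A a)) * anch (\<lambda>p. \<eta> p i) a)"
   by (intro gfun_sum[OF A_M A_fin gcoordsD(1)[OF g] S]) simp
  then have "gfun A D' \<psi> (W \<inter> D' \<inter> over A V) 1 (anch f)"
   by (rule gfun_cong[OF A_M A_fin gcoordsD(1)[OF g] S])
    (rule anch_along[OF _ coord_sys_atlas[OF A_M V] manifold_finite[OF A_M] _ f], use s2 in \<open>auto simp: over_def\<close>)
  then show ?thesis using S by blast
 qed
 have "gfun A D' \<psi> (\<Union>((\<lambda>(V, \<eta>). W \<inter> D' \<inter> over A V) ` atlas M)) 1 (anch f)"
  by (rule gfun_Union[OF A_M A_fin gcoordsD(1)[OF g]]) (use loc in auto)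
 moreover have "\<Union>((\<lambda>(V, \<eta>). W \<inter> D' \<inter> over A V) ` atlas M) = W \<inter> D'"
 proof -
  have "\<exists>x\<in>atlas M. a \<in> over A (fst x)" if "a \<in> W" for a
  proof -
   have a: "a \<in> pts A" "bproj A a \<in> pts M" using saturated_pts[OF W(1)] that W(3) f mopen_subset[of M W0]
    by (auto simp: over_def smooth_real_on_def)
   obtain V \<eta> where "(V, \<eta>) \<in> atlas M" "bproj A a \<in> V" using manifold_cover[OF A_M a(2)] by blast
   then show ?thesis using a(1) by (force simp: over_def)
  qed
  then show ?thesis by (auto simp: split_beta)
 qed
 ultimately have "gfun A D' \<psi> (W \<inter> D') 1 (anch f)" by simp
 then show "gfun A D \<phi> (W \<inter> D') 1 (anch f)"
  by (rule gfun_change_gcoords[OF A_pre c g WD', rotated 2]) (use W(2) in auto)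
qed

abbreviation (input) A2 where "A2 \<equiv> second_prolongation M A anchor"

lemma A2_simps:
 "pts A2 = {X\<in>pts (Tan 1 A). Tmap 1 M (bproj A) X = anchor (base_pt X)}"
 "idx A2 = {(i, j). i \<in> idx A \<and> (j = 0 \<or> j = 1 \<and> wt A i = 1)}"
 "bproj A2 = bproj A \<circ> base_pt" "wt A2 = (\<lambda>(i, j). wt A i + j)"
 "atlas A2 = {(D \<inter> pts A2, \<lambda>X. restr (idx A2) (\<phi> X)) |D \<phi>. (D, \<phi>) \<in> atlas (Tan 1 A)}"
 by (simp_all add: second_prolongation_def Let_def)

definition lift_dom :: "'a set \<Rightarrow> (real \<Rightarrow> 'a) set set" where
 "lift_dom D = {X \<in> pts A2. base_pt X \<in> D}"

text \<open>The chart \<open>\<phi>\<close> of \<open>A\<close> induces on the second prolongation the values and, for linear coordinates, the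
  velocities of \<open>\<phi>\<close>.\<close>

definition lift :: "('a \<Rightarrow> 'i \<Rightarrow> real) \<Rightarrow> (real \<Rightarrow> 'a) set \<Rightarrow> 'i \<times> nat \<Rightarrow> real" where
 "lift \<phi> X = restr (idx A2) (\<lambda>(i, j). (deriv ^^ j) (\<lambda>t. \<phi> (repr X t) i) 0)"

lemma lift_0: "i \<in> idx A \<Longrightarrow> lift \<phi> X (i, 0) = \<phi> (base_pt X) i"
 by (simp add: lift_def restr_apply A2_simps base_pt_def)

lemma lift_1: "i \<in> idx A \<Longrightarrow> wt A i = 1 \<Longrightarrow> lift \<phi> X (i, 1) = deriv (\<lambda>t. \<phi> (repr X t) i) 0"
 by (simp add: lift_def restr_apply A2_simps)

lemma finite_idx_A2: "finite (idx A2)"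
 by (rule finite_subset[of _ "idx A \<times> {0, 1}"]) (use A_fin in \<open>auto simp: A2_simps\<close>)

lemma bidx_A2: "bidx A2 = (\<lambda>i. (i, 0)) ` bidx A"
 by (auto simp: base_of_def A2_simps)

lemma atlas_A2: "atlas A2 = (\<lambda>(D, \<phi>). (lift_dom D, lift \<phi>)) ` atlas A"
proof -
 have r: "restr (idx A2) (restr (idx A \<times> {..1}) z) = restr (idx A2) z" for z :: "'i \<times> nat \<Rightarrow> real"
  by (auto simp: restr_def fun_eq_iff A2_simps)
 have d: "{X \<in> pts (Tan 1 A). base_pt X \<in> U} \<inter> pts A2 = lift_dom U" for U
  by (auto simp: lift_dom_def A2_simps)
 have "atlas A2 = (\<lambda>(U, \<phi>). ({X \<in> pts (Tan 1 A). base_pt X \<in> U} \<inter> pts A2,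
   \<lambda>X. restr (idx A2) (restr (idx A \<times> {..1}) (\<lambda>(i, j). (deriv ^^ j) (\<lambda>t. \<phi> (repr X t) i) 0)))) ` atlas A"
  unfolding A2_simps(5) Tan1_simps(5) set_comp_image by (simp add: image_image split_beta)
 then show ?thesis unfolding r d lift_def [abs_def] .
qed

lemma A2_pt:
 assumes "X \<in> pts A2"
 shows "curve A (repr X)" "jet 1 A (repr X) = X" "X \<in> pts (Tan 1 A)" "base_pt X \<in> pts A"
  "jet 1 M (\<lambda>t. bproj A (repr X t)) = anchor (base_pt X)"
proof -
 show X: "X \<in> pts (Tan 1 A)" "jet 1 M (\<lambda>t. bproj A (repr X t)) = anchor (base_pt X)"
  using assms by (auto simp: A2_simps Tmap_def)
 show "curve A (repr X)" "jet 1 A (repr X) = X" using tan_repr[OF X(1)] by auto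
 then show "base_pt X \<in> pts A" by (simp add: base_pt_def curve_def)
qed

lemma base_coord:
 assumes c: "gcoords M A (D, \<phi>)" and cs: "\<And>e. e \<in> D \<Longrightarrow> restr (bidx A) (\<phi> e) = \<xi> (bproj A e)" and i: "i \<in> bidx A" and e: "e \<in> D"
 shows "\<phi> e i = \<xi> (bproj A e) i"
 using fun_cong[OF cs[OF e], of i] i by (simp add: restr_apply)

lemma proj_curve:
 assumes c: "gcoords M A (D, \<phi>)" and cs: "coord_sys M (bidx A) (U, \<xi>)" "D = over A U"
   "\<And>e. e \<in> D \<Longrightarrow> restr (bidx A) (\<phi> e) = \<xi> (bproj A e)"
  and \<gamma>: "curve A \<gamma>" "\<gamma> 0 \<in> D"
 shows "curve M (\<lambda>t. bproj A (\<gamma> t))"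
  "i \<in> bidx A \<Longrightarrow> deriv (\<lambda>t. \<xi> (bproj A (\<gamma> t)) i) 0 = deriv (\<lambda>t. \<phi> (\<gamma> t) i) 0"
proof -
 obtain S where S: "open S" "0 \<in> S" "\<And>t. t \<in> S \<Longrightarrow> \<gamma> t \<in> D" "\<And>j. j \<in> idx A \<Longrightarrow> smooth_curve_on S (\<lambda>t. \<phi> (\<gamma> t) j)"
  using curve_coords[OF A_mfd A_fin gcoords_coord_sys[OF A c] \<gamma>] by blast
 have eq: "\<xi> (bproj A (\<gamma> t)) i = \<phi> (\<gamma> t) i" if "t \<in> S" "i \<in> bidx A" for t i
  using base_coord[OF c cs(3) that(2) S(3)[OF that(1)]] by simp
 show "curve M (\<lambda>t. bproj A (\<gamma> t))"
 proof (rule curveI[OF A_M finite_bidx[OF A_fin] cs(1) S(1,2)])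
  show "bproj A (\<gamma> t) \<in> U" if "t \<in> S" for t using S(3)[OF that] cs(2) by (simp add: over_def)
  show "smooth_curve_on S (\<lambda>t. \<xi> (bproj A (\<gamma> t)) j)" if j: "j \<in> bidx A" for j
  proof (rule smooth_curve_on_cong[OF S(1) S(4) eq[OF _ j]])
   show "j \<in> idx A" using j by (simp add: base_of_def)
  qed
 qed
 show "deriv (\<lambda>t. \<xi> (bproj A (\<gamma> t)) i) 0 = deriv (\<lambda>t. \<phi> (\<gamma> t) i) 0" if i: "i \<in> bidx A"
 proof (rule deriv_cong_ev)
  have "\<forall>\<^sub>F t in nhds 0. t \<in> S" using S(1,2) by (rule eventually_nhds_in_open)
  then show "\<forall>\<^sub>F t in nhds 0. \<xi> (bproj A (\<gamma> t)) i = \<phi> (\<gamma> t) i"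
   by eventually_elim (rule eq[OF _ i])
 qed simp
qed

lemma A2_base_velocity:
 assumes c: "gcoords M A (D, \<phi>)" and cs: "coord_sys M (bidx A) (U, \<xi>)" "D = over A U"
   "\<And>e. e \<in> D \<Longrightarrow> restr (bidx A) (\<phi> e) = \<xi> (bproj A e)"
  and X: "X \<in> lift_dom D" and i: "i \<in> bidx A"
 shows "deriv (\<lambda>t. \<phi> (repr X t) i) 0 = anch (\<lambda>p. \<xi> p i) (base_pt X)"
proof -
 have X': "X \<in> pts A2" "repr X 0 \<in> D" using X by (auto simp: lift_dom_def base_pt_def)
 note p = A2_pt[OF X'(1)]
 note pc = proj_curve[OF c cs p(1) X'(2)]
 have "deriv (\<lambda>t. \<xi> (repr (jet 1 M (\<lambda>t. bproj A (repr X t))) t) i) 0 = deriv (\<lambda>t. \<xi> (bproj A (repr X t)) i) 0"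
  by (rule repr_jet1_deriv[OF A_M pc(1) coord_sysD(4)[OF cs(1) i]]) (use X'(2) in \<open>simp_all add: cs(2) over_def\<close>)
 then show ?thesis using pc(2)[OF _ i] unfolding p(5) by (simp add: anch_def)
qed

lemma A2_memberI:
 assumes c: "gcoords M A (D, \<phi>)" and cs: "coord_sys M (bidx A) (U, \<xi>)" "D = over A U"
   "\<And>e. e \<in> D \<Longrightarrow> restr (bidx A) (\<phi> e) = \<xi> (bproj A e)"
  and \<gamma>: "curve A \<gamma>" "\<gamma> 0 \<in> D" and v: "\<And>i. i \<in> bidx A \<Longrightarrow> deriv (\<lambda>t. \<phi> (\<gamma> t) i) 0 = anch (\<lambda>p. \<xi> p i) (\<gamma> 0)"
 shows "jet 1 A \<gamma> \<in> lift_dom D"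
  "i \<in> idx A \<Longrightarrow> lift \<phi> (jet 1 A \<gamma>) (i, 0) = \<phi> (\<gamma> 0) i"
  "i \<in> idx A \<Longrightarrow> wt A i = 1 \<Longrightarrow> lift \<phi> (jet 1 A \<gamma>) (i, 1) = deriv (\<lambda>t. \<phi> (\<gamma> t) i) 0"
proof -
 let ?X = "jet 1 A \<gamma>"
 note X = tan_jet1[OF \<gamma>(1)]
 have \<gamma>0: "\<gamma> 0 \<in> pts A" using \<gamma>(1) by (simp add: curve_def)
 have dv: "deriv (\<lambda>t. \<phi> (repr ?X t) i) 0 = deriv (\<lambda>t. \<phi> (\<gamma> t) i) 0" if "i \<in> idx A" for i
  by (rule repr_jet1_deriv[OF A_mfd \<gamma>(1) coord_sysD(4)[OF gcoords_coord_sys[OF A c] that] \<gamma>(2)])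
 note r = tan_repr[OF X(1)]
 have r0: "repr ?X 0 = \<gamma> 0" using X(2) by (simp add: base_pt_def)
 note pc = proj_curve[OF c cs r(1)]
 have "jet 1 M (\<lambda>t. bproj A (repr ?X t)) = jet 1 M (repr (anchor (\<gamma> 0)))"
 proof (rule jet1_eqI[OF A_M finite_bidx[OF A_fin] cs(1)])
  show "curve M (repr (anchor (\<gamma> 0)))" using tan_repr(1) anchor_Tan[OF \<gamma>0] by blast
  show "curve M (\<lambda>t. bproj A (repr ?X t))" by (rule pc(1)) (simp_all add: r0 \<gamma>(2))
  have a0: "repr (anchor (\<gamma> 0)) 0 = bproj A (\<gamma> 0)" using anchor_Tan[OF \<gamma>0] by (simp add: base_pt_def)
  then show "bproj A (repr ?X 0) = repr (anchor (\<gamma> 0)) 0" by (simp add: r0)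
  show "repr (anchor (\<gamma> 0)) 0 \<in> U" using a0 \<gamma>(2) cs(2) by (simp add: over_def)
  fix i assume i: "i \<in> bidx A"
  then have iA: "i \<in> idx A" by (simp add: base_of_def)
  have "deriv (\<lambda>t. \<xi> (bproj A (repr ?X t)) i) 0 = deriv (\<lambda>t. \<phi> (\<gamma> t) i) 0"
   using pc(2)[OF _ _ i] dv[OF iA] r0 \<gamma>(2) by simp
  then show "deriv (\<lambda>t. \<xi> (bproj A (repr ?X t)) i) 0 = deriv (\<lambda>t. \<xi> (repr (anchor (\<gamma> 0)) t) i) 0"
   using v[OF i] by (simp add: anch_def)
 qed
 also have "\<dots> = anchor (\<gamma> 0)" using tan_repr(2) anchor_Tan[OF \<gamma>0] by blast
 finally have "?X \<in> pts A2" using X by (simp add: A2_simps Tmap_def)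
 then show "?X \<in> lift_dom D" using X(2) \<gamma>(2) by (simp add: lift_dom_def)
 show "i \<in> idx A \<Longrightarrow> lift \<phi> ?X (i, 0) = \<phi> (\<gamma> 0) i" using lift_0[of i \<phi> ?X] X(2) by simp
 show "i \<in> idx A \<Longrightarrow> wt A i = 1 \<Longrightarrow> lift \<phi> ?X (i, 1) = deriv (\<lambda>t. \<phi> (\<gamma> t) i) 0"
  using lift_1[of i \<phi> ?X] dv by simp
qed

text \<open>The velocities of the base coordinates are prescribed by the anchor, and those of the linear
  coordinates are free.  This gives injectivity, and for any prescribed coordinates an admissible curve.\<close>

lemma lift_adapted:
 assumes c: "gcoords M A (D, \<phi>)"
 shows "adapted_chart M A2 (lift_dom D, lift \<phi>)"
proof -
 note a = gcoordsD(1)[OF c]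
 obtain U \<xi> where "bundle_chart M A D \<phi> U \<xi>" using bundle_chartE[OF a] by blast
 note u = bundle_chartD[OF this]
 note acs = gcoords_coord_sys[OF A c]
 define \<zeta> :: "'m \<Rightarrow> 'i \<times> nat \<Rightarrow> real" where "\<zeta> p k = (if k \<in> bidx A2 then \<xi> p (fst k) else 0)" for p k
 have "bij_betw fst (bidx A2) (bidx A)"
  unfolding bidx_A2 by (auto simp: bij_betw_def inj_on_def image_image)
 from coord_sys_relabel[OF A_M finite_bidx[OF A_fin] u(1) this]
 have cs: "coord_sys M (bidx A2) (U, \<zeta>)" by (simp add: \<zeta>_def [abs_def])
 have dom: "lift_dom D = over A2 U"
  using A2_pt(4) by (auto simp: lift_dom_def over_def u(2) A2_simps(3))
 have bc: "restr (bidx A2) (lift \<phi> X) = \<zeta> (bproj A2 X)" if X: "X \<in> lift_dom D" for X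
 proof
  fix k
  show "restr (bidx A2) (lift \<phi> X) k = \<zeta> (bproj A2 X) k"
  proof (cases "k \<in> bidx A2")
   case True
   then obtain i where i: "k = (i, 0)" "i \<in> bidx A" unfolding bidx_A2 by blast
   then have iA: "i \<in> idx A" by (simp add: base_of_def)
   have "base_pt X \<in> D" using X by (simp add: lift_dom_def)
   then show ?thesis using True lift_0[OF iA, of \<phi> X] base_coord[OF c u(4) i(2)] i(1)
    by (simp add: restr_apply \<zeta>_def A2_simps(3))
  qed (simp add: restr_apply \<zeta>_def)
 qed
 show ?thesis
 proof (rule adapted_chart_by_points[OF cs dom bc])
  show "lift \<phi> X \<in> crd (idx A2)" for X by (simp add: lift_def restr_crd)
  show "X = Y" if X: "X \<in> lift_dom D" and Y: "Y \<in> lift_dom D" and eq: "lift \<phi> X = lift \<phi> Y" for X Y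
  proof -
   have D: "base_pt X \<in> D" "base_pt Y \<in> D" "X \<in> pts A2" "Y \<in> pts A2" using X Y by (auto simp: lift_dom_def)
   have b: "base_pt X = base_pt Y"
    by (rule adapted_eq[OF a D(1,2)]) (metis eq lift_0)
   show ?thesis
   proof (rule tan_eqI[OF A_mfd A_fin acs A2_pt(3)[OF D(4)] A2_pt(3)[OF D(3)] b D(2)])
    fix i assume i: "i \<in> idx A"
    show "deriv (\<lambda>t. \<phi> (repr X t) i) 0 = deriv (\<lambda>t. \<phi> (repr Y t) i) 0"
    proof (cases "wt A i = 0")
     case True
     then have "i \<in> bidx A" using i by (simp add: base_of_def)
     then show ?thesis using A2_base_velocity[OF c u(1,2,4) X] A2_base_velocity[OF c u(1,2,4) Y] b by simp
    next
     case False
     then have "wt A i = 1" using A_wt[OF i] by simp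
     then show ?thesis using lift_1[OF i] eq by metis
    qed
   qed
  qed
  fix p z assume p: "restr (bidx A2) z = \<zeta> p" "p \<in> U" and z: "z \<in> crd (idx A2)"
  define y where "y = (\<lambda>i. z (i, 0))"
  have "y \<in> crd (idx A)" using z by (auto simp: y_def crd_def A2_simps)
  moreover have "restr (bidx A) y = \<xi> p"
  proof
   fix i
   have "\<xi> p \<in> crd (bidx A)" by (rule coord_sys_crd[OF A_M finite_bidx[OF A_fin] u(1) p(2)])
   then show "restr (bidx A) y i = \<xi> p i"
    using fun_cong[OF p(1), of "(i, 0)"] unfolding bidx_A2 \<zeta>_def
    by (auto simp: restr_apply y_def crd_def)
  qed
  ultimately have "y \<in> \<phi> ` D" using u(5) p(2) by (simp add: cyl_def)
  then obtain e where e: "e \<in> D" "\<phi> e = y" by auto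
  obtain \<gamma> where \<gamma>: "curve A \<gamma>" "\<gamma> 0 = e"
   "\<And>i. i \<in> idx A \<Longrightarrow> deriv (\<lambda>t. \<phi> (\<gamma> t) i) 0 = (if i \<in> bidx A then anch (\<lambda>p. \<xi> p i) e else z (i, 1))"
   using tangent_exists[OF A_mfd A_fin acs e(1), of "\<lambda>i. if i \<in> bidx A then anch (\<lambda>p. \<xi> p i) e else z (i, 1)"] by blast
  note X = A2_memberI[OF c u(1,2,4) \<gamma>(1)]
  have \<gamma>D: "\<gamma> 0 \<in> D" using \<gamma>(2) e(1) by simp
  have v: "deriv (\<lambda>t. \<phi> (\<gamma> t) i) 0 = anch (\<lambda>p. \<xi> p i) (\<gamma> 0)" if "i \<in> bidx A" for i
   using \<gamma>(2) \<gamma>(3)[of i] that by (simp add: base_of_def)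
  have "lift \<phi> (jet 1 A \<gamma>) = z"
  proof
   fix k :: "'i \<times> nat"
   obtain i j where k: "k = (i, j)" by (cases k)
   show "lift \<phi> (jet 1 A \<gamma>) k = z k"
   proof (cases "k \<in> idx A2")
    case True
    then have i: "i \<in> idx A" "j = 0 \<or> j = 1 \<and> wt A i = 1" using k by (auto simp: A2_simps)
    from i(2) show ?thesis
    proof
     assume "j = 0"
     then show ?thesis using X(2)[OF _ \<gamma>D v i(1)] \<gamma>(2) e(2) k by (simp add: y_def)
    next
     assume j: "j = 1 \<and> wt A i = 1"
     then have "i \<notin> bidx A" by (simp add: base_of_def)
     then show ?thesis using X(3)[OF _ \<gamma>D v i(1)] j \<gamma>(3)[OF i(1)] k by simp
    qed
   next
    case False
    then have "z k = 0" using z unfolding crd_def by blast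
    then show ?thesis using False by (simp add: lift_def restr_apply)
   qed
  qed
  then show "\<exists>X\<in>lift_dom D. lift \<phi> X = z" using X(1)[OF _ \<gamma>D v] by blast
 qed
qed

lemma lift_gfun_base:
 assumes c: "gcoords M A (D, \<phi>)" and W: "saturated M A W" "W \<subseteq> D" and h: "gfun A D \<phi> W d h"
  and V: "saturated M A2 V" "V \<subseteq> lift_dom D" "base_pt ` V \<subseteq> W"
 shows "gfun A2 (lift_dom D) (lift \<phi>) V d (\<lambda>X. h (base_pt X))"
proof (rule gfun_pullback[OF A_M finite_idx_A2 lift_adapted[OF c] A_fin gcoordsD(1)[OF c] A_M V(1,2) W _ _ h])
 show "base_pt X \<in> W" if "X \<in> V" for X using that V(3) by blast
 fix i assume i: "i \<in> idx A"
 have "gfun A2 (lift_dom D) (lift \<phi>) V (wt A2 (i, 0)) (\<lambda>X. lift \<phi> X (i, 0))"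
  by (rule gfun_coord[OF A_M finite_idx_A2 lift_adapted[OF c] V(1,2)])
 then show "gfun A2 (lift_dom D) (lift \<phi>) V (wt A i) (\<lambda>X. \<phi> (base_pt X) i)"
  by (simp add: lift_0[OF i] A2_simps(4))
qed

text \<open>Differentiation along admissible curves raises the degree by one: by the chain rule the derivative is
  \<open>\<Sum>\<^sub>l \<partial>\<^sub>l h \<cdot> dl/dt\<close>, where \<open>\<partial>\<^sub>l h\<close> has degree \<open>d - wt l\<close> and the velocity of the coordinate \<open>l\<close> has degree
  \<open>wt l + 1\<close>.  For base coordinates the latter holds since the velocity is the anchor.\<close>

lemma lift_gfun_velocity:
 assumes c: "gcoords M A (D, \<phi>)" and W: "saturated M A W" "W \<subseteq> D" and h: "gfun A D \<phi> W d h"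
  and hs: "smooth_real_on A W h"
  and V: "saturated M A2 V" "V \<subseteq> lift_dom D" "base_pt ` V \<subseteq> W"
 shows "gfun A2 (lift_dom D) (lift \<phi>) V (d + 1) (\<lambda>X. deriv (\<lambda>t. h (repr X t)) 0)"
proof -
 note a = gcoordsD(1)[OF c] and la = lift_adapted[OF c]
 note acs = gcoords_coord_sys[OF A c]
 obtain U \<xi> where "bundle_chart M A D \<phi> U \<xi>" using bundle_chartE[OF a] by blast
 note u = bundle_chartD(1,2,4)[OF this]
 let ?f = "\<lambda>z. h (inv_into D \<phi> z)"
 have "gfun A2 (lift_dom D) (lift \<phi>) V (d + 1) (\<lambda>X. \<Sum>l\<in>idx A. pdv l ?f (\<phi> (base_pt X)) * deriv (\<lambda>t. \<phi> (repr X t) l) 0)"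
 proof (rule gfun_sum[OF A_M finite_idx_A2 la V(1,2)])
  fix l assume l: "l \<in> idx A"
  have pd: "gfun A2 (lift_dom D) (lift \<phi>) V (d - wt A l) (\<lambda>X. pdv l ?f (\<phi> (base_pt X)))" if "wt A l \<le> d"
   by (rule lift_gfun_base[OF c W gfun_pdv(1)[OF A_M A_fin a W h l that] V])
  have vel: "gfun A2 (lift_dom D) (lift \<phi>) V (wt A l + 1) (\<lambda>X. deriv (\<lambda>t. \<phi> (repr X t) l) 0)"
  proof (cases "wt A l = 0")
   case True
   then have b: "l \<in> bidx A" using l by (simp add: base_of_def)
   have "gfun A D \<phi> D 1 (anch (\<lambda>p. \<xi> p l))"
    by (rule anch_gfun[OF c coord_sysD(4)[OF u(1) b] saturated_gcoords[OF c]]) (auto simp: u(2))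
   then have "gfun A2 (lift_dom D) (lift \<phi>) V 1 (\<lambda>X. anch (\<lambda>p. \<xi> p l) (base_pt X))"
    by (rule lift_gfun_base[OF c saturated_gcoords[OF c] order_refl _ V(1,2)]) (use V(3) W(2) in blast)
   then have "gfun A2 (lift_dom D) (lift \<phi>) V 1 (\<lambda>X. deriv (\<lambda>t. \<phi> (repr X t) l) 0)"
    by (rule gfun_cong[OF A_M finite_idx_A2 la V(1,2)]) (rule A2_base_velocity[OF c u subsetD[OF V(2)] b])
   then show ?thesis using True by simp
  next
   case False
   then have w: "wt A l = 1" using A_wt[OF l] by simp
   have "gfun A2 (lift_dom D) (lift \<phi>) V (wt A2 (l, 1)) (\<lambda>X. lift \<phi> X (l, 1))"
    by (rule gfun_coord[OF A_M finite_idx_A2 la V(1,2)])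
   then show ?thesis by (simp add: lift_1[OF l w] A2_simps(4))
  qed
  show "gfun A2 (lift_dom D) (lift \<phi>) V (d + 1) (\<lambda>X. pdv l ?f (\<phi> (base_pt X)) * deriv (\<lambda>t. \<phi> (repr X t) l) 0)"
  proof (cases "wt A l \<le> d")
   case True
   from gfun_mult[OF A_M finite_idx_A2 la V(1,2) pd[OF True] vel] True show ?thesis by simp
  next
   case False
   show ?thesis
    by (rule gfun_cong[OF A_M finite_idx_A2 la V(1,2) gfun_zero[OF A_M finite_idx_A2 la V(1,2)]])
     (use gfun_pdv(2)[OF A_M A_fin a W h l] False V(3) in auto)
  qed
 qed
 then show ?thesis
 proof (rule gfun_cong[OF A_M finite_idx_A2 la V(1,2)])
  fix X assume X: "X \<in> V"
  then have "X \<in> pts A2" "repr X 0 \<in> D" "repr X 0 \<in> W" using V(2,3) by (auto simp: lift_dom_def base_pt_def)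
  then show "deriv (\<lambda>t. h (repr X t)) 0 = (\<Sum>l\<in>idx A. pdv l ?f (\<phi> (base_pt X)) * deriv (\<lambda>t. \<phi> (repr X t) l) 0)"
   using deriv_along[OF A_mfd A_fin acs A2_pt(1) _ hs] by (simp add: base_pt_def)
 qed
qed

lemma lift_gcompat:
 assumes c: "gcoords M A (D, \<phi>)" and c': "gcoords M A (D', \<psi>)"
 shows "gcompat A2 (lift_dom D, lift \<phi>) (lift_dom D', lift \<psi>)"
 unfolding gcompat_def prod.case
proof
 let ?V = "lift_dom D \<inter> lift_dom D'"
 note la = lift_adapted[OF c] and la' = lift_adapted[OF c']
 have V: "saturated M A2 ?V" "?V \<subseteq> lift_dom D" "base_pt ` ?V \<subseteq> D \<inter> D'"
  using saturated_Int[OF A_M adapted_saturated[OF la] adapted_saturated[OF la']] by (auto simp: lift_dom_def)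
 have W: "saturated M A (D \<inter> D')" "D \<inter> D' \<subseteq> D"
  by (simp_all add: saturated_Int[OF A_M saturated_gcoords[OF c] saturated_gcoords[OF c']])
 fix k assume k: "k \<in> idx A2"
 obtain i j where ij: "k = (i, j)" by (cases k)
 then have i: "i \<in> idx A" "j = 0 \<or> j = 1 \<and> wt A i = 1" using k by (auto simp: A2_simps)
 note g = gcompatD[OF gcoords_compat[OF A_pre c c'] i(1)]
 from i(2) show "gfun A2 (lift_dom D) (lift \<phi>) ?V (wt A2 k) (\<lambda>X. lift \<psi> X k)"
 proof
  assume "j = 0"
  then show ?thesis using lift_gfun_base[OF c W g V] ij by (simp add: lift_0[OF i(1)] A2_simps(4))
 next
  assume j: "j = 1 \<and> wt A i = 1"
  have "smooth_real_on A (D \<inter> D') (\<lambda>e. \<psi> e i)"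
  proof (rule smooth_real_on_from_coords[OF A_mfd A_fin gcoords_coord_sys[OF A c] _ _ gfun_smooth[OF g]])
   show "mopen A (D \<inter> D')"
    using manifold_mopen_Int[OF A_mfd] coord_sysD(1) gcoords_coord_sys[OF A] c c' by blast
  qed simp
  from lift_gfun_velocity[OF c W g this V] show ?thesis
   using ij j by (simp add: lift_1[OF i(1)] A2_simps(4))
 qed
qed

lemma pre_graded_A2: "pre_graded M A2"
proof (rule pre_gradedI[OF A_M finite_idx_A2])
 show "(\<Union>(D, \<phi>)\<in>atlas A2. D) = pts A2"
 proof (intro subset_antisym subsetI)
  fix X assume X: "X \<in> pts A2"
  obtain D \<phi> where "(D, \<phi>) \<in> atlas A" "base_pt X \<in> D" using pre_graded_cover[OF A_pre A2_pt(4)[OF X]] by blast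
  then have "(lift_dom D, lift \<phi>) \<in> atlas A2" "X \<in> lift_dom D" using X by (auto simp: atlas_A2 lift_dom_def)
  then show "X \<in> (\<Union>(D, \<phi>)\<in>atlas A2. D)" by blast
 qed (auto simp: atlas_A2 lift_dom_def)
 show "adapted_chart M A2 (D, \<phi>)" if "(D, \<phi>) \<in> atlas A2" for D \<phi>
  using that lift_adapted[OF gcoords_atlas[OF A_pre]] unfolding atlas_A2 by auto
 show "gcompat A2 (D, \<phi>) (D', \<psi>)" if "(D, \<phi>) \<in> atlas A2" "(D', \<psi>) \<in> atlas A2" for D \<phi> D' \<psi>
  using that lift_gcompat[OF gcoords_atlas[OF A_pre] gcoords_atlas[OF A_pre]] unfolding atlas_A2 by auto
qed

lemma lift_gcoords:
 assumes c: "gcoords M A (D, \<phi>)"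
 shows "gcoords M A2 (lift_dom D, lift \<phi>)"
 unfolding gcoords_def
proof (intro conjI ballI lift_adapted[OF c])
 fix x assume "x \<in> atlas A2"
 then obtain D' \<psi> where x: "x = (lift_dom D', lift \<psi>)" "(D', \<psi>) \<in> atlas A" unfolding atlas_A2 by auto
 note g = gcoords_atlas[OF A_pre x(2)]
 show "gcompat A2 (lift_dom D, lift \<phi>) x" "gcompat A2 x (lift_dom D, lift \<phi>)"
  unfolding x(1) by (rule lift_gcompat[OF c g], rule lift_gcompat[OF g c])
qed

text \<open>The curve \<open>t \<mapsto> t v\<close> stays in one fibre and is admissible because the anchor vanishes at the zero vector
  through which it passes.  Its velocity is \<open>v\<close>, so \<open>vlift\<close> identifies \<open>A\<close> with the core.\<close>

lemma vlift_A2: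
 assumes v: "v \<in> pts A"
 shows "vlift A v \<in> pts A2" "base_pt (vlift A v) = hact A 0 v" "bproj A2 (vlift A v) = bproj A v"
  "\<And>D \<phi> i. gcoords M A (D, \<phi>) \<Longrightarrow> v \<in> D \<Longrightarrow> i \<in> idx A \<Longrightarrow> wt A i = 1 \<Longrightarrow> lift \<phi> (vlift A v) (i, 1) = \<phi> v i"
  "\<And>D \<phi> i. gcoords M A (D, \<phi>) \<Longrightarrow> v \<in> D \<Longrightarrow> i \<in> idx A \<Longrightarrow> wt A i = 1 \<Longrightarrow> lift \<phi> (vlift A v) (i, 0) = 0"
proof -
 define \<gamma> where "\<gamma> = (\<lambda>t. hact A t v)"
 have vl: "vlift A v = jet 1 A \<gamma>" by (simp add: vlift_def \<gamma>_def)
 note hv = hact_coords[OF A_pre v]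
 have main: "curve A \<gamma> \<and> jet 1 A \<gamma> \<in> lift_dom D \<and> (\<forall>i\<in>idx A. wt A i = 1 \<longrightarrow> lift \<phi> (jet 1 A \<gamma>) (i, 1) = \<phi> v i \<and>
   lift \<phi> (jet 1 A \<gamma>) (i, 0) = 0)"
  if c: "gcoords M A (D, \<phi>)" and vD: "v \<in> D" for D \<phi>
 proof -
  obtain U \<xi> where "bundle_chart M A D \<phi> U \<xi>" using bundle_chartE[OF gcoordsD(1)[OF c]] by blast
  note u = bundle_chartD(1,2,4)[OF this]
  have \<gamma>D: "\<gamma> t \<in> D" for t
   unfolding \<gamma>_def by (rule saturatedD[OF saturated_gcoords[OF c] vD hv(1,2)])
  have wt01: "wt A i = 0 \<or> wt A i = 1" if "i \<in> idx A" for i using A_wt[OF that] by linarith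
  have co: "\<phi> (\<gamma> t) i = (if wt A i = 0 then \<phi> v i else 0) + (if wt A i = 0 then 0 else \<phi> v i) * t" if "i \<in> idx A" for t i
   using hv(3)[OF c vD that] wt01[OF that] unfolding \<gamma>_def by auto
  have cur: "curve A \<gamma>"
  proof (rule curveI[OF A_mfd A_fin gcoords_coord_sys[OF A c] open_UNIV])
   show "smooth_curve_on UNIV (\<lambda>t. \<phi> (\<gamma> t) j)" if "j \<in> idx A" for j
    unfolding co[OF that] by (rule smooth_curve_on_affine)
  qed (simp_all add: \<gamma>D)
  have dv: "deriv (\<lambda>t. \<phi> (\<gamma> t) i) 0 = (if wt A i = 0 then 0 else \<phi> v i)" if "i \<in> idx A" for i
   unfolding co[OF that] by (rule DERIV_imp_deriv) (auto intro!: derivative_eq_intros)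
  have b: "deriv (\<lambda>t. \<phi> (\<gamma> t) i) 0 = anch (\<lambda>p. \<xi> p i) (\<gamma> 0)" if i: "i \<in> bidx A" for i
  proof -
   have iA: "i \<in> idx A" "wt A i = 0" using i by (auto simp: base_of_def)
   have "gfun A D \<phi> D 1 (anch (\<lambda>p. \<xi> p i))"
    by (rule anch_gfun[OF c coord_sysD(4)[OF u(1) i] saturated_gcoords[OF c]]) (auto simp: u(2))
   then have "anch (\<lambda>p. \<xi> p i) (\<gamma> 0) = 0 ^ 1 * anch (\<lambda>p. \<xi> p i) v"
    by (rule gfun_eval[OF A_M A_fin gcoordsD(1)[OF c] _ order_refl vD \<gamma>D])
     (simp add: \<gamma>_def hv(3)[OF c vD])
   then show ?thesis using dv[OF iA(1)] iA(2) by simp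
  qed
  note m = A2_memberI[OF c u cur \<gamma>D b]
  show ?thesis
  proof (intro conjI cur m(1) ballI impI)
   fix i assume i: "i \<in> idx A" "wt A i = 1"
   show "lift \<phi> (jet 1 A \<gamma>) (i, 1) = \<phi> v i" using m(3)[OF _ _ i] dv[OF i(1)] i(2) by simp
   show "lift \<phi> (jet 1 A \<gamma>) (i, 0) = 0" using m(2)[OF _ _ i(1)] co[OF i(1), of 0] i(2) by simp
  qed
 qed
 obtain D \<phi> where c0: "(D, \<phi>) \<in> atlas A" "v \<in> D" using pre_graded_cover[OF A_pre v] by blast
 note m0 = main[OF gcoords_atlas[OF A_pre c0(1)] c0(2)]
 show "vlift A v \<in> pts A2" using m0 by (simp add: vl lift_dom_def)
 show b: "base_pt (vlift A v) = hact A 0 v" using tan_jet1(2)[OF conjunct1[OF m0]] by (simp add: vl \<gamma>_def)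
 show "bproj A2 (vlift A v) = bproj A v" using hv(2) by (simp add: A2_simps(3) b)
 show "lift \<phi> (vlift A v) (i, 1) = \<phi> v i" "lift \<phi> (vlift A v) (i, 0) = 0"
  if "gcoords M A (D, \<phi>)" "v \<in> D" "i \<in> idx A" "wt A i = 1" for D \<phi> i
  using main[OF that(1,2)] that(3,4) by (auto simp: vl)
qed

end

section \<open>Quotients of graded bundles\<close>

context
 fixes M :: "('m, 'b, 'z) mfd_scheme" and F :: "('f, 'k, 'm) gbundle" and R :: "('f \<times> 'f) set"
  and J :: "'j set" and lab :: "'j \<Rightarrow> 'k"
 assumes F: "pre_graded M F" and R: "equiv (pts F) R" and Rb0: "\<forall>f f'. (f, f') \<in> R \<longrightarrow> bproj F f' = bproj F f"
  and J: "finite J" and lab: "inj_on lab J" "lab ` J \<subseteq> idx F" "bidx F \<subseteq> lab ` J"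
begin

lemma Rb: "(f, f') \<in> R \<Longrightarrow> bproj F f' = bproj F f"
 using Rb0 by blast

abbreviation (input) Q where "Q \<equiv> quotient_bundle M F R J lab"

definition qdom :: "'f set \<Rightarrow> 'f set set" where
 "qdom D = (\<lambda>f. R `` {f}) ` D"

definition qchart :: "('f \<Rightarrow> 'k \<Rightarrow> real) \<Rightarrow> 'f set \<Rightarrow> 'j \<Rightarrow> real" where
 "qchart \<phi> X = restr J (\<lambda>j. \<phi> (SOME f. f \<in> X) (lab j))"

text \<open>Charts in which the relation is the equality of the coordinates labelled by \<open>lab ` J\<close>; they induce the
  charts of the quotient.\<close>

definition rchart :: "'f set \<Rightarrow> ('f \<Rightarrow> 'k \<Rightarrow> real) \<Rightarrow> bool" where
 "rchart D \<phi> \<longleftrightarrow> gcoords M F (D, \<phi>) \<and>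
   (\<forall>f\<in>D. \<forall>f'\<in>D. (f, f') \<in> R \<longleftrightarrow> (\<forall>j\<in>J. \<phi> f (lab j) = \<phi> f' (lab j)))"

lemma quotient_simps:
 "pts Q = pts F // R" "idx Q = J" "wt Q = wt F \<circ> lab" "bproj Q = (\<lambda>X. bproj F (SOME f. f \<in> X))"
 "atlas Q = {(qdom D, qchart \<phi>) |D \<phi>. rchart D \<phi>}"
 unfolding quotient_bundle_def qdom_def qchart_def [abs_def] rchart_def gcoords_iff_graded_coords[OF F]
 by simp_all

lemma rchartD: "rchart D \<phi> \<Longrightarrow> gcoords M F (D, \<phi>)"
 "rchart D \<phi> \<Longrightarrow> f \<in> D \<Longrightarrow> f' \<in> D \<Longrightarrow> (f, f') \<in> R \<longleftrightarrow> (\<forall>j\<in>J. \<phi> f (lab j) = \<phi> f' (lab j))"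
 by (auto simp: rchart_def)

lemma R_pts: "(f, f') \<in> R \<Longrightarrow> f \<in> pts F \<and> f' \<in> pts F"
 using R by (auto simp: equiv_def refl_on_def)

lemma some_class:
 assumes "f \<in> pts F"
 shows "(f, SOME g. g \<in> R `` {f}) \<in> R"
proof -
 have "f \<in> R `` {f}" using equiv_class_self[OF R assms] .
 then have "(SOME g. g \<in> R `` {f}) \<in> R `` {f}" by (rule someI)
 then show ?thesis by simp
qed

lemma bproj_class: "f \<in> pts F \<Longrightarrow> bproj Q (R `` {f}) = bproj F f"
 using Rb[OF some_class] by (simp add: quotient_simps)

lemma qchart_class:
 assumes c: "rchart D \<phi>" and f: "f \<in> D"
 shows "qchart \<phi> (R `` {f}) = restr J (\<lambda>j. \<phi> f (lab j))"
proof -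
 have fp: "f \<in> pts F" using f saturated_pts[OF saturated_gcoords[OF rchartD(1)[OF c]]] by blast
 let ?g = "SOME g. g \<in> R `` {f}"
 note g = some_class[OF fp]
 have gD: "?g \<in> D"
  by (rule saturatedD[OF saturated_gcoords[OF rchartD(1)[OF c]] f conjunct2[OF R_pts[OF g]] Rb[OF g]])
 have "\<forall>j\<in>J. \<phi> f (lab j) = \<phi> ?g (lab j)" using rchartD(2)[OF c f gD] g by simp
 then show ?thesis by (auto simp: qchart_def restr_def)
qed

lemma bidx_Q: "bij_betw lab (bidx Q) (bidx F)"
 unfolding bij_betw_def
proof
 have s: "bidx Q \<subseteq> J" by (auto simp: base_of_def quotient_simps)
 show "inj_on lab (bidx Q)" using lab(1) s by (rule inj_on_subset)
 show "lab ` bidx Q = bidx F" using lab(2,3) by (force simp: base_of_def quotient_simps)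
qed

text \<open>A section of the projection to the quotient over the domain of a chart, obtained by setting the
  remaining coordinates to zero.\<close>

definition qsec :: "'f set \<Rightarrow> ('f \<Rightarrow> 'k \<Rightarrow> real) \<Rightarrow> 'f set \<Rightarrow> 'f" where
 "qsec D \<phi> X = inv_into D \<phi> (\<lambda>k. if k \<in> lab ` J then qchart \<phi> X (inv_into J lab k) else 0)"

lemma fill_point:
 assumes c: "rchart D \<phi>" and cs: "coord_sys M (bidx F) (U, \<xi>)" and u: "\<phi> ` D = cyl (idx F) (wt F) (\<xi> ` U)"
  and p: "p \<in> U" and z: "\<And>j. j \<in> bidx Q \<Longrightarrow> z j = \<xi> p (lab j)"
 shows "\<exists>f\<in>D. \<phi> f = (\<lambda>k. if k \<in> lab ` J then z (inv_into J lab k) else 0)"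
proof -
 let ?y = "\<lambda>k. if k \<in> lab ` J then z (inv_into J lab k) else 0"
 have "?y \<in> crd (idx F)" using lab(2) by (auto simp: crd_def)
 moreover have "restr (bidx F) ?y = \<xi> p"
 proof
  fix k
  have crd: "\<xi> p \<in> crd (bidx F)"
   by (rule coord_sys_crd[OF pre_gradedD(1)[OF F] finite_bidx[OF pre_gradedD(2)[OF F]] cs p])
  show "restr (bidx F) ?y k = \<xi> p k"
  proof (cases "k \<in> bidx F")
   case True
   then obtain j where j: "j \<in> bidx Q" "k = lab j" using bidx_Q by (auto simp: bij_betw_def)
   then have jJ: "j \<in> J" by (simp add: base_of_def quotient_simps)
   show ?thesis using True z[OF j(1)] j(2) jJ lab(1) by (simp add: restr_apply)
  next
   case False
   then show ?thesis using crd by (simp add: restr_apply crd_def)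
  qed
 qed
 ultimately have "?y \<in> \<phi> ` D" using u p by (simp add: cyl_def)
 then show ?thesis by auto
qed

lemma q_adapted:
 assumes c: "rchart D \<phi>"
 shows "adapted_chart M Q (qdom D, qchart \<phi>)"
  and "\<And>X. X \<in> qdom D \<Longrightarrow> qsec D \<phi> X \<in> D \<and> R `` {qsec D \<phi> X} = X \<and>
   \<phi> (qsec D \<phi> X) = (\<lambda>k. if k \<in> lab ` J then qchart \<phi> X (inv_into J lab k) else 0)"
proof -
 note M = pre_gradedD(1)[OF F] and fin = pre_gradedD(2)[OF F]
 note g = rchartD(1)[OF c]
 note a = gcoordsD(1)[OF g]
 obtain U \<xi> where "bundle_chart M F D \<phi> U \<xi>" using bundle_chartE[OF a] by blast
 note u = bundle_chartD[OF this]
 have Dp: "D \<subseteq> pts F" by (rule saturated_pts[OF saturated_gcoords[OF g]])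
 have bc: "\<phi> e k = \<xi> (bproj F e) k" if "e \<in> D" "k \<in> bidx F" for e k
  using fun_cong[OF u(4)[OF that(1)], of k] that(2) by (simp add: restr_apply)
 show sec: "qsec D \<phi> X \<in> D \<and> R `` {qsec D \<phi> X} = X \<and>
   \<phi> (qsec D \<phi> X) = (\<lambda>k. if k \<in> lab ` J then qchart \<phi> X (inv_into J lab k) else 0)" if X: "X \<in> qdom D" for X
 proof -
  obtain f where f: "f \<in> D" "X = R `` {f}" using X by (auto simp: qdom_def)
  have q: "qchart \<phi> X j = \<phi> f (lab j)" if "j \<in> J" for j
   using qchart_class[OF c f(1)] f(2) that by (simp add: restr_apply)
  have pU: "bproj F f \<in> U" using f(1) u(2) by (simp add: over_def)
  have "\<exists>f'\<in>D. \<phi> f' = (\<lambda>k. if k \<in> lab ` J then qchart \<phi> X (inv_into J lab k) else 0)"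
  proof (rule fill_point[OF c u(1,5) pU])
   fix j assume j: "j \<in> bidx Q"
   then have "j \<in> J" "lab j \<in> bidx F" using bidx_Q by (auto simp: base_of_def quotient_simps bij_betw_def)
   then show "qchart \<phi> X j = \<xi> (bproj F f) (lab j)" using q bc[OF f(1)] by simp
  qed
  then have "(\<lambda>k. if k \<in> lab ` J then qchart \<phi> X (inv_into J lab k) else 0) \<in> \<phi> ` D" by (metis imageI)
  then have s: "qsec D \<phi> X \<in> D" "\<phi> (qsec D \<phi> X) = (\<lambda>k. if k \<in> lab ` J then qchart \<phi> X (inv_into J lab k) else 0)"
   unfolding qsec_def by (rule inv_into_into, rule f_inv_into_f)
  have "(f, qsec D \<phi> X) \<in> R"
   unfolding rchartD(2)[OF c f(1) s(1)] s(2) using q lab(1) by simp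
  then have "R `` {qsec D \<phi> X} = X" using equiv_class_eq[OF R] f(2) by blast
  then show ?thesis using s by blast
 qed
 define \<zeta> where "\<zeta> p j = (if j \<in> bidx Q then \<xi> p (lab j) else 0)" for p j
 have cs: "coord_sys M (bidx Q) (U, \<zeta>)"
  using coord_sys_relabel[OF M finite_bidx[OF fin] u(1) bidx_Q] by (simp add: \<zeta>_def [abs_def])
 have bQ: "bproj Q (R `` {f}) = bproj F f" if "f \<in> D" for f
  using bproj_class that Dp by blast
 show "adapted_chart M Q (qdom D, qchart \<phi>)"
 proof (rule adapted_chart_by_points[OF cs])
  show "qdom D = over Q U"
  proof (intro subset_antisym subsetI)
   fix X assume "X \<in> qdom D"
   then obtain f where f: "f \<in> D" "X = R `` {f}" by (auto simp: qdom_def)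
   have fp: "f \<in> pts F" using f(1) Dp by blast
   have "X \<in> pts Q" unfolding f(2) quotient_simps(1) using fp by (rule quotientI)
   moreover have "bproj Q X \<in> U" unfolding f(2) bQ[OF f(1)] using f(1) u(2) by (simp add: over_def)
   ultimately show "X \<in> over Q U" by (simp add: over_def)
  next
   fix X assume "X \<in> over Q U"
   then have X: "X \<in> pts F // R" "bproj Q X \<in> U" unfolding over_def quotient_simps(1) by auto
   then obtain f where f: "f \<in> pts F" "X = R `` {f}" by (auto elim: quotientE)
   have "bproj F f \<in> U" using X(2) unfolding f(2) bproj_class[OF f(1)] .
   then show "X \<in> qdom D" using f u(2) by (auto simp: qdom_def over_def)
  qed
  show "qchart \<phi> X \<in> crd (idx Q)" for X by (simp add: qchart_def restr_crd quotient_simps(2))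
  show "X = Y" if X: "X \<in> qdom D" and Y: "Y \<in> qdom D" and eq: "qchart \<phi> X = qchart \<phi> Y" for X Y
  proof -
   have "qsec D \<phi> X = qsec D \<phi> Y" unfolding qsec_def eq ..
   then show ?thesis using sec[OF X] sec[OF Y] by metis
  qed
  show "restr (bidx Q) (qchart \<phi> X) = \<zeta> (bproj Q X)" if X: "X \<in> qdom D" for X
  proof
   fix j
   obtain f where f: "f \<in> D" "X = R `` {f}" using X by (auto simp: qdom_def)
   show "restr (bidx Q) (qchart \<phi> X) j = \<zeta> (bproj Q X) j"
   proof (cases "j \<in> bidx Q")
    case True
    then have "j \<in> J" "lab j \<in> bidx F" using bidx_Q by (auto simp: base_of_def quotient_simps bij_betw_def)
    then show ?thesis using True qchart_class[OF c f(1)] bc[OF f(1)] bQ[OF f(1)]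
     unfolding f(2) by (simp add: restr_apply \<zeta>_def)
   qed (simp add: restr_apply \<zeta>_def)
  qed
  fix p z assume p: "p \<in> U" "restr (bidx Q) z = \<zeta> p" and z1: "z \<in> crd (idx Q)"
  have z: "z \<in> crd J" using z1 by (simp add: quotient_simps(2))
  have "\<exists>f\<in>D. \<phi> f = (\<lambda>k. if k \<in> lab ` J then z (inv_into J lab k) else 0)"
  proof (rule fill_point[OF c u(1,5) p(1)])
   fix j assume "j \<in> bidx Q"
   then show "z j = \<xi> p (lab j)" using fun_cong[OF p(2), of j] by (simp add: restr_apply \<zeta>_def)
  qed
  then obtain f where f: "f \<in> D" "\<phi> f = (\<lambda>k. if k \<in> lab ` J then z (inv_into J lab k) else 0)" by blast
  have "qchart \<phi> (R `` {f}) = z"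
  proof
   fix j
   show "qchart \<phi> (R `` {f}) j = z j"
    using qchart_class[OF c f(1)] f(2) lab(1) z by (cases "j \<in> J") (auto simp: restr_apply crd_def)
  qed
  then show "\<exists>X\<in>qdom D. qchart \<phi> X = z" using f(1) by (auto simp: qdom_def)
 qed
qed

text \<open>A coordinate of the second chart, composed with the section \<open>qsec\<close> of the first, is homogeneous because
  the section has homogeneous coordinates; the choice of representative does not matter.\<close>

lemma q_gcompat:
 assumes c: "rchart D \<phi>" and c': "rchart D' \<psi>"
 shows "gcompat Q (qdom D, qchart \<phi>) (qdom D', qchart \<psi>)"
 unfolding gcompat_def prod.case
proof
 note M = pre_gradedD(1)[OF F] and fin = pre_gradedD(2)[OF F]
 note g = rchartD(1)[OF c] and g' = rchartD(1)[OF c']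
 note aQ = q_adapted(1)[OF c] and aQ' = q_adapted(1)[OF c']
 have finQ: "finite (idx Q)" using J by (simp add: quotient_simps)
 let ?V = "qdom D \<inter> qdom D'"
 have V: "saturated M Q ?V" "?V \<subseteq> qdom D"
  using saturated_Int[OF M adapted_saturated[OF aQ] adapted_saturated[OF aQ']] by auto
 have W: "saturated M F (D \<inter> D')" "D \<inter> D' \<subseteq> D"
  using saturated_Int[OF M saturated_gcoords[OF g] saturated_gcoords[OF g']] by auto
 fix j assume "j \<in> idx Q"
 then have j: "j \<in> J" "lab j \<in> idx F" using lab(2) by (auto simp: quotient_simps)
 have sec: "qsec D \<phi> X \<in> D \<inter> D' \<and> R `` {qsec D \<phi> X} = X" if X: "X \<in> ?V" for X
 proof -
  note s = q_adapted(2)[OF c, of X]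
  have sD: "qsec D \<phi> X \<in> D" "R `` {qsec D \<phi> X} = X" using s X by auto
  obtain f where f: "f \<in> D'" "X = R `` {f}" using X by (auto simp: qdom_def)
  have sp: "qsec D \<phi> X \<in> pts F" using sD(1) saturated_pts[OF saturated_gcoords[OF g]] by blast
  have "qsec D \<phi> X \<in> R `` {f}" using equiv_class_self[OF R sp] by (simp only: sD(2) f(2) [symmetric])
  then have "(f, qsec D \<phi> X) \<in> R" by simp
  then have "qsec D \<phi> X \<in> D'"
   using saturatedD[OF saturated_gcoords[OF g'] f(1) sp] Rb by blast
  then show ?thesis using sD by blast
 qed
 have "gfun Q (qdom D) (qchart \<phi>) ?V (wt F (lab j)) (\<lambda>X. \<psi> (qsec D \<phi> X) (lab j))"
 proof (rule gfun_pullback[OF M finQ aQ fin gcoordsD(1)[OF g] M V W _ _ gcompatD[OF gcoords_compat[OF F g g'] j(2)]])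
  show "qsec D \<phi> X \<in> D \<inter> D'" if "X \<in> ?V" for X using sec[OF that] by blast
  fix k assume k: "k \<in> idx F"
  show "gfun Q (qdom D) (qchart \<phi>) ?V (wt F k) (\<lambda>X. \<phi> (qsec D \<phi> X) k)"
  proof (cases "k \<in> lab ` J")
   case True
   then obtain l where l: "l \<in> J" "k = lab l" by blast
   have "gfun Q (qdom D) (qchart \<phi>) ?V (wt Q l) (\<lambda>X. qchart \<phi> X l)" by (rule gfun_coord[OF M finQ aQ V])
   then have "gfun Q (qdom D) (qchart \<phi>) ?V (wt F k) (\<lambda>X. qchart \<phi> X l)"
    using l(2) by (simp add: quotient_simps)
   then show ?thesis
    by (rule gfun_cong[OF M finQ aQ V]) (use q_adapted(2)[OF c] l lab(1) in auto)
  next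
   case False
   show ?thesis
    by (rule gfun_cong[OF M finQ aQ V gfun_zero[OF M finQ aQ V]]) (use q_adapted(2)[OF c] False in auto)
  qed
 qed
 then have "gfun Q (qdom D) (qchart \<phi>) ?V (wt F (lab j)) (\<lambda>X. qchart \<psi> X j)"
 proof (rule gfun_cong[OF M finQ aQ V])
  fix X assume X: "X \<in> ?V"
  have "qchart \<psi> (R `` {qsec D \<phi> X}) = restr J (\<lambda>j. \<psi> (qsec D \<phi> X) (lab j))"
   by (rule qchart_class[OF c']) (use sec[OF X] in blast)
  then show "qchart \<psi> X j = \<psi> (qsec D \<phi> X) (lab j)" using sec[OF X] j(1) by (simp add: restr_apply)
 qed
 then show "gfun Q (qdom D) (qchart \<phi>) ?V (wt Q j) (\<lambda>X. qchart \<psi> X j)" by (simp add: quotient_simps)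
qed

lemma pre_graded_quotient:
 assumes cover: "\<And>f. f \<in> pts F \<Longrightarrow> \<exists>D \<phi>. rchart D \<phi> \<and> f \<in> D"
 shows "pre_graded M Q"
proof (rule pre_gradedI[OF pre_gradedD(1)[OF F]])
 show "finite (idx Q)" using J by (simp add: quotient_simps)
 show "(\<Union>(D, \<phi>)\<in>atlas Q. D) = pts Q"
 proof (intro subset_antisym subsetI)
  fix X assume "X \<in> (\<Union>(D, \<phi>)\<in>atlas Q. D)"
  then obtain D \<phi> f where "rchart D \<phi>" "f \<in> D" "X = R `` {f}" by (auto simp: quotient_simps(5) qdom_def)
  then show "X \<in> pts Q" using saturated_pts[OF saturated_gcoords[OF rchartD(1)]]
   by (auto simp: quotient_simps(1) intro: quotientI)
 next
  fix X assume "X \<in> pts Q"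
  then obtain f where f: "f \<in> pts F" "X = R `` {f}" by (auto simp: quotient_simps(1) elim: quotientE)
  then obtain D \<phi> where "rchart D \<phi>" "f \<in> D" using cover by blast
  then have "(qdom D, qchart \<phi>) \<in> atlas Q" "X \<in> qdom D" using f(2) by (auto simp: quotient_simps(5) qdom_def)
  then show "X \<in> (\<Union>(D, \<phi>)\<in>atlas Q. D)" by blast
 qed
 show "adapted_chart M Q (D, \<phi>)" if "(D, \<phi>) \<in> atlas Q" for D \<phi>
  using that q_adapted(1) by (auto simp: quotient_simps(5))
 show "gcompat Q (D, \<phi>) (D', \<psi>)" if "(D, \<phi>) \<in> atlas Q" "(D', \<psi>) \<in> atlas Q" for D \<phi> D' \<psi>
  using that q_gcompat by (auto simp: quotient_simps(5))
qed

end

section \<open>Transport along a bijection\<close>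

lemma adapted_scl_image:
 assumes "manifold M" "finite (idx E)" "adapted_chart M E (D, \<phi>)" "saturated M E W" "W \<subseteq> D" "z \<in> \<phi> ` W"
 shows "scl (wt E) t z \<in> \<phi> ` W"
proof -
 obtain e where e: "e \<in> W" "z = \<phi> e" using assms(6) by blast
 obtain e' where "e' \<in> W" "\<phi> e' = scl (wt E) t (\<phi> e)" using adapted_scl[OF assms(1-5) e(1)] by blast
 then show ?thesis using e(2) by (metis imageI)
qed

lemma topology_mopen:
 assumes "\<And>U \<phi>. (U, \<phi>) \<in> atlas N \<Longrightarrow> inj_on \<phi> U" "mopen N (pts N)"
 shows "openin (topology (mopen N)) = mopen N" "topspace (topology (mopen N)) = pts N"
proof -
 show o: "openin (topology (mopen N)) = mopen N"
  using topology_inverse'[OF istopology_mopen[OF assms(1)]] by blast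
 show "topspace (topology (mopen N)) = pts N"
  unfolding topspace_def o using assms(2) mopen_subset by auto
qed

context
 fixes M :: "('m, 'b, 'z) mfd_scheme" and E :: "('e, 'i, 'm) gbundle" and P :: "('q, 'i, 'm) gbundle"
  and \<Psi> :: "'q \<Rightarrow> 'e" and k :: nat
 assumes E: "graded_bundle k M E" and P: "pre_graded M P" and same: "idx P = idx E" "wt P = wt E"
  and bij: "bij_betw \<Psi> (pts P) (pts E)" and ov: "\<And>Z. Z \<in> pts P \<Longrightarrow> bproj E (\<Psi> Z) = bproj P Z"
  and at: "\<And>D \<phi>. (D, \<phi>) \<in> atlas E \<Longrightarrow> \<exists>\<psi>. ({Z \<in> pts P. \<Psi> Z \<in> D}, \<psi>) \<in> atlas P \<and> (\<forall>Z\<in>pts P. \<Psi> Z \<in> D \<longrightarrow> \<psi> Z = \<phi> (\<Psi> Z))"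
begin

abbreviation (input) \<Psi>i where "\<Psi>i \<equiv> inv_into (pts P) \<Psi>"

lemma \<Psi>i: "V \<in> pts E \<Longrightarrow> \<Psi>i V \<in> pts P \<and> \<Psi> (\<Psi>i V) = V" "Z \<in> pts P \<Longrightarrow> \<Psi>i (\<Psi> Z) = Z"
 "Z \<in> pts P \<Longrightarrow> \<Psi> Z \<in> pts E"
 using bij by (auto simp: bij_betw_def inv_into_into f_inv_into_f)

lemma E_pre: "pre_graded M E"
 by (rule graded_bundle_pre_graded[OF E])

lemma transported_chart_inv:
 assumes c: "gcoords M P (D, \<phi>)" and z: "z \<in> \<phi> ` D"
 shows "inv_into (\<Psi> ` D) (\<lambda>V. \<phi> (\<Psi>i V)) z = \<Psi> (inv_into D \<phi> z)"
proof -
 have Dp: "D \<subseteq> pts P" by (rule saturated_pts[OF saturated_gcoords[OF c]])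
 have "inj_on (\<lambda>V. \<phi> (\<Psi>i V)) (\<Psi> ` D)"
 proof (rule inj_onI, clarify)
  fix Z Z' assume Z: "Z \<in> D" "Z' \<in> D" "\<phi> (\<Psi>i (\<Psi> Z)) = \<phi> (\<Psi>i (\<Psi> Z'))"
  have "\<phi> Z = \<phi> Z'" using Z Dp \<Psi>i(2) by (metis subsetD)
  then show "\<Psi> Z = \<Psi> Z'" using adapted_inj[OF gcoordsD(1)[OF c]] Z by (auto dest: inj_onD)
 qed
 moreover obtain Z where Z: "Z \<in> D" "z = \<phi> Z" using z by auto
 ultimately have "inv_into (\<Psi> ` D) (\<lambda>V. \<phi> (\<Psi>i V)) (\<phi> (\<Psi>i (\<Psi> Z))) = \<Psi> Z"
  by (intro inv_into_f_f[where f = "\<lambda>V. \<phi> (\<Psi>i V)"]) auto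
 then show ?thesis using Z Dp \<Psi>i(2) adapted_inv[OF gcoordsD(1)[OF c] Z(1)] by (metis subsetD)
qed

lemma transported_adapted:
 assumes c: "gcoords M P (D, \<phi>)"
 shows "adapted_chart M E (\<Psi> ` D, \<lambda>V. \<phi> (\<Psi>i V))"
proof -
 have Dp: "D \<subseteq> pts P" by (rule saturated_pts[OF saturated_gcoords[OF c]])
 obtain U \<xi> where "bundle_chart M P D \<phi> U \<xi>" using bundle_chartE[OF gcoordsD(1)[OF c]] by blast
 note u = bundle_chartD[OF this]
 have inv: "\<Psi>i (\<Psi> Z) = Z" if "Z \<in> D" for Z using \<Psi>i(2) that Dp by blast
 show ?thesis
 proof (rule adapted_chartI)
  show "coord_sys M (bidx E) (U, \<xi>)" using u(1) same by simp
  show "\<Psi> ` D = over E U"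
  proof (intro subset_antisym subsetI)
   fix V assume "V \<in> over E U"
   then have V: "V \<in> pts E" "bproj E V \<in> U" by (auto simp: over_def)
   then have "\<Psi>i V \<in> D" using \<Psi>i(1)[OF V(1)] ov[of "\<Psi>i V"] by (simp add: u(2) over_def)
   then show "V \<in> \<Psi> ` D" using \<Psi>i(1)[OF V(1)] by (metis imageI)
  qed (use \<Psi>i(3) ov in \<open>auto simp: over_def u(2)\<close>)
  show "inj_on (\<lambda>V. \<phi> (\<Psi>i V)) (\<Psi> ` D)"
  proof (rule inj_onI, clarify)
   fix Z Z' assume Z: "Z \<in> D" "Z' \<in> D" "\<phi> (\<Psi>i (\<Psi> Z)) = \<phi> (\<Psi>i (\<Psi> Z'))"
   then show "\<Psi> Z = \<Psi> Z'" using u(3) inv[OF Z(1)] inv[OF Z(2)] by (auto dest: inj_onD)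
  qed
  show "restr (bidx E) (\<phi> (\<Psi>i e)) = \<xi> (bproj E e)" if "e \<in> \<Psi> ` D" for e
   using that u(4) inv ov Dp same by auto
  have "(\<lambda>V. \<phi> (\<Psi>i V)) ` (\<Psi> ` D) = \<phi> ` D" using inv by force
  then show "(\<lambda>V. \<phi> (\<Psi>i V)) ` (\<Psi> ` D) = cyl (idx E) (wt E) (\<xi> ` U)" using u(5) same by simp
 qed
qed

definition pullback_chart :: "'e set \<Rightarrow> ('e \<Rightarrow> 'i \<Rightarrow> real) \<Rightarrow> ('q \<Rightarrow> 'i \<Rightarrow> real) \<Rightarrow> bool" where
 "pullback_chart D \<phi> \<psi> \<longleftrightarrow> ({Z \<in> pts P. \<Psi> Z \<in> D}, \<psi>) \<in> atlas P \<and>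
   (\<forall>Z\<in>pts P. \<Psi> Z \<in> D \<longrightarrow> \<psi> Z = \<phi> (\<Psi> Z)) \<and> \<Psi> ` {Z \<in> pts P. \<Psi> Z \<in> D} = D"

lemma pullback_chartD:
 assumes "pullback_chart D \<phi> \<psi>"
 shows "({Z \<in> pts P. \<Psi> Z \<in> D}, \<psi>) \<in> atlas P" "\<And>Z. Z \<in> pts P \<Longrightarrow> \<Psi> Z \<in> D \<Longrightarrow> \<psi> Z = \<phi> (\<Psi> Z)"
  "\<Psi> ` {Z \<in> pts P. \<Psi> Z \<in> D} = D"
 using assms by (auto simp: pullback_chart_def)

lemma atlas_pullback:
 assumes "(D, \<phi>) \<in> atlas E"
 shows "\<exists>\<psi>. pullback_chart D \<phi> \<psi>"
proof -
 have "D \<subseteq> pts E" by (rule saturated_pts[OF saturated_gcoords[OF gcoords_atlas[OF E_pre assms]]])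
 then have "\<Psi> ` {Z \<in> pts P. \<Psi> Z \<in> D} = D" using \<Psi>i(1) by (force simp: image_iff)
 then show ?thesis using at[OF assms] unfolding pullback_chart_def by blast
qed

lemma pullback_inv:
 assumes c: "(D, \<phi>) \<in> atlas E" and q: "({Z \<in> pts P. \<Psi> Z \<in> D}, \<psi>) \<in> atlas P"
  and eq: "\<And>Z. Z \<in> pts P \<Longrightarrow> \<Psi> Z \<in> D \<Longrightarrow> \<psi> Z = \<phi> (\<Psi> Z)" and Z: "Z \<in> pts P" "\<Psi> Z \<in> D"
 shows "inv_into D \<phi> (\<phi> (\<Psi> Z)) = \<Psi> Z" "inv_into {Z \<in> pts P. \<Psi> Z \<in> D} \<psi> (\<phi> (\<Psi> Z)) = Z"
 using adapted_inv[OF pre_gradedD(4)[OF E_pre c] Z(2)] adapted_inv[OF pre_gradedD(4)[OF P q], of Z] Z eq[OF Z]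
 by auto

text \<open>Compatibility with a chart of \<open>E\<close> is compatibility in \<open>P\<close> with its pull-back, which belongs to the atlas
  of \<open>P\<close>.\<close>

lemma transported_gcoords:
 assumes c: "gcoords M P (D, \<phi>)"
 shows "gcoords M E (\<Psi> ` D, \<lambda>V. \<phi> (\<Psi>i V))"
 unfolding gcoords_def
proof (intro conjI ballI transported_adapted[OF c])
 note M = pre_gradedD(1)[OF P] and fin = pre_gradedD(2)[OF P]
 note a = gcoordsD(1)[OF c]
 have Dp: "D \<subseteq> pts P" by (rule saturated_pts[OF saturated_gcoords[OF c]])
 fix x assume "x \<in> atlas E"
 then obtain D1 \<phi>1 where x: "x = (D1, \<phi>1)" and c1: "(D1, \<phi>1) \<in> atlas E" by (cases x) auto
 obtain \<psi> where q0: "pullback_chart D1 \<phi>1 \<psi>"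
  using atlas_pullback[OF c1] by blast
 note q = pullback_chartD[OF q0]
 let ?D1 = "{Z \<in> pts P. \<Psi> Z \<in> D1}"
 have W: "saturated M P (D \<inter> ?D1)"
  by (rule saturated_Int[OF M saturated_gcoords[OF c] saturated_gcoords[OF gcoords_atlas[OF P q(1)]]])
 have inv: "\<Psi>i (\<Psi> Z) = Z" if "Z \<in> D" for Z using \<Psi>i(2) that Dp by blast
 have im: "(\<lambda>V. \<phi> (\<Psi>i V)) ` (\<Psi> ` D \<inter> D1) = \<phi> ` (D \<inter> ?D1)"
  using inv Dp by (force simp: image_iff)
 have im1: "\<phi>1 ` (D1 \<inter> \<Psi> ` D) = \<psi> ` (?D1 \<inter> D)"
 proof -
  have "D1 \<inter> \<Psi> ` D = \<Psi> ` (?D1 \<inter> D)" using Dp by auto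
  then show ?thesis using q(2) by (force simp: image_iff)
 qed
 show "gcompat E (\<Psi> ` D, \<lambda>V. \<phi> (\<Psi>i V)) x"
  unfolding x gcompat_def prod.case
 proof
  fix i assume i: "i \<in> idx E"
  have g: "gfun P D \<phi> (D \<inter> ?D1) (wt E i) (\<lambda>e. \<psi> e i)"
   using gcompatD[OF gcoordsD(2)[OF c q(1)]] i same by simp
  have eq: "\<phi>1 (inv_into (\<Psi> ` D) (\<lambda>V. \<phi> (\<Psi>i V)) z) i = \<psi> (inv_into D \<phi> z) i" if "z \<in> \<phi> ` (D \<inter> ?D1)" for z
   using that transported_chart_inv[OF c, of z] adapted_inv[OF a] q(2) by auto
  show "gfun E (\<Psi> ` D) (\<lambda>V. \<phi> (\<Psi>i V)) (\<Psi> ` D \<inter> D1) (wt E i) (\<lambda>e. \<phi>1 e i)"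
   unfolding gfun_def im
  proof
   show "smooth_crd (idx E) (\<phi> ` (D \<inter> ?D1)) (\<lambda>z. \<phi>1 (inv_into (\<Psi> ` D) (\<lambda>V. \<phi> (\<Psi>i V)) z) i)"
    using smooth_crd_cong_imp[OF fin adapted_saturated_open[OF M fin a W Int_lower1] gfun_smooth[OF g] eq] same by simp
   have "scl (wt P) t z \<in> \<phi> ` (D \<inter> ?D1)" if "z \<in> \<phi> ` (D \<inter> ?D1)" for z t
    by (rule adapted_scl_image[OF M fin a W Int_lower1 that])
   then show "homog_on (wt E) (wt E i) (\<phi> ` (D \<inter> ?D1)) (\<lambda>z. \<phi>1 (inv_into (\<Psi> ` D) (\<lambda>V. \<phi> (\<Psi>i V)) z) i)"
    using gfun_homog[OF g] unfolding homog_on_def by (simp add: eq same)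
  qed
 qed
 show "gcompat E x (\<Psi> ` D, \<lambda>V. \<phi> (\<Psi>i V))"
  unfolding x gcompat_def prod.case
 proof
  note a1 = pre_gradedD(4)[OF P q(1)]
  have W1: "saturated M P (?D1 \<inter> D)" using W by (simp add: Int_commute)
  fix i assume i: "i \<in> idx E"
  have g: "gfun P ?D1 \<psi> (?D1 \<inter> D) (wt E i) (\<lambda>e. \<phi> e i)"
   using gcompatD[OF gcoordsD(3)[OF c q(1)]] i same by simp
  have eq: "\<phi> (\<Psi>i (inv_into D1 \<phi>1 z)) i = \<phi> (inv_into ?D1 \<psi> z) i" if z: "z \<in> \<psi> ` (?D1 \<inter> D)" for z
  proof -
   obtain Z where Z: "Z \<in> pts P" "\<Psi> Z \<in> D1" "Z \<in> D" "z = \<psi> Z" using z by auto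
   then show ?thesis using pullback_inv[OF c1 q(1,2) Z(1,2)] q(2)[OF Z(1,2)] inv[OF Z(3)] by simp
  qed
  show "gfun E D1 \<phi>1 (D1 \<inter> \<Psi> ` D) (wt E i) (\<lambda>e. \<phi> (\<Psi>i e) i)"
   unfolding gfun_def im1
  proof
   show "smooth_crd (idx E) (\<psi> ` (?D1 \<inter> D)) (\<lambda>z. \<phi> (\<Psi>i (inv_into D1 \<phi>1 z)) i)"
    using smooth_crd_cong_imp[OF fin adapted_saturated_open[OF M fin a1 W1 Int_lower1] gfun_smooth[OF g] eq] same by simp
   have "scl (wt P) t z \<in> \<psi> ` (?D1 \<inter> D)" if "z \<in> \<psi> ` (?D1 \<inter> D)" for z t
    by (rule adapted_scl_image[OF M fin a1 W1 Int_lower1 that])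
   then show "homog_on (wt E) (wt E i) (\<psi> ` (?D1 \<inter> D)) (\<lambda>z. \<phi> (\<Psi>i (inv_into D1 \<phi>1 z)) i)"
    using gfun_homog[OF g] unfolding homog_on_def by (simp add: eq same)
  qed
 qed
qed

text \<open>The topologies are determined by the atlases.  The atlas of \<open>P\<close> may be larger than the pulled-back one,
  but openness can be tested locally in pulled-back charts.\<close>

lemma mopen_transport:
 "mopen P W \<longleftrightarrow> W \<subseteq> pts P \<and> mopen E (\<Psi> ` W)"
proof
 note M = pre_gradedD(1)[OF P] and fin = pre_gradedD(2)[OF P]
 assume W: "mopen P W"
 have Wp: "W \<subseteq> pts P" by (rule mopen_subset[OF W])
 have "open_crd (idx E) (\<phi> ` (D \<inter> \<Psi> ` W))" if c: "(D, \<phi>) \<in> atlas E" for D \<phi>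
 proof -
  obtain \<psi> where q0: "pullback_chart D \<phi> \<psi>"
   using atlas_pullback[OF c] by blast
  note q = pullback_chartD[OF q0]
  have "D \<inter> \<Psi> ` W = \<Psi> ` ({Z \<in> pts P. \<Psi> Z \<in> D} \<inter> W)" using Wp by auto
  then have "\<phi> ` (D \<inter> \<Psi> ` W) = \<psi> ` ({Z \<in> pts P. \<Psi> Z \<in> D} \<inter> W)"
   using q(2) by (force simp: image_iff)
  then show ?thesis using mopen_open[OF W q(1)] same by simp
 qed
 moreover have "\<Psi> ` W \<subseteq> pts E" using Wp \<Psi>i(3) by blast
 ultimately show "W \<subseteq> pts P \<and> mopen E (\<Psi> ` W)" using Wp unfolding mopen_def by blast
next
 note M = pre_gradedD(1)[OF P] and fin = pre_gradedD(2)[OF P]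
 assume W: "W \<subseteq> pts P \<and> mopen E (\<Psi> ` W)"
 have "open_crd (idx P) (\<phi> ` (D \<inter> W))" if c: "(D, \<phi>) \<in> atlas P" for D \<phi>
 proof (rule open_crd_local)
  note g = gcoords_atlas[OF P c]
  note a = gcoordsD(1)[OF g]
  fix z assume "z \<in> \<phi> ` (D \<inter> W)"
  then obtain Z where Z: "Z \<in> D" "Z \<in> W" "z = \<phi> Z" by auto
  have Zp: "Z \<in> pts P" using Z(2) W by blast
  obtain D1 \<phi>1 where c1: "(D1, \<phi>1) \<in> atlas E" "\<Psi> Z \<in> D1" using pre_graded_cover[OF E_pre \<Psi>i(3)[OF Zp]] by blast
  obtain \<psi> where q0: "pullback_chart D1 \<phi>1 \<psi>"
   using atlas_pullback[OF c1(1)] by blast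
  note q = pullback_chartD[OF q0]
  let ?D1 = "{Z \<in> pts P. \<Psi> Z \<in> D1}"
  have sat: "saturated M P (D \<inter> ?D1)"
   by (rule saturated_Int[OF M saturated_gcoords[OF g] saturated_gcoords[OF gcoords_atlas[OF P q(1)]]])
  have O: "open_crd (idx P) (\<phi> ` (D \<inter> ?D1))" by (rule adapted_saturated_open[OF M fin a sat Int_lower1])
  let ?\<tau> = "\<lambda>z. \<psi> (inv_into D \<phi> z)"
  have O1: "open_crd (idx P) (\<phi>1 ` (D1 \<inter> \<Psi> ` W))" using mopen_open[OF conjunct2[OF W] c1(1)] same by simp
  have op: "open_crd (idx P) {z \<in> \<phi> ` (D \<inter> ?D1). ?\<tau> z \<in> \<phi>1 ` (D1 \<inter> \<Psi> ` W)}"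
  proof (rule open_crd_preimage[OF fin O fin O1])
   fix z assume "z \<in> \<phi> ` (D \<inter> ?D1)"
   then obtain Z' where Z': "Z' \<in> D" "Z' \<in> ?D1" "z = \<phi> Z'" by auto
   then show "?\<tau> z \<in> crd (idx P)"
    using adapted_inv[OF a Z'(1)] adapted_crd[OF pre_gradedD(4)[OF P q(1)] Z'(2)] by simp
  next
   fix j assume "j \<in> idx P"
   then show "smooth_crd (idx P) (\<phi> ` (D \<inter> ?D1)) (\<lambda>z. \<psi> (inv_into D \<phi> z) j)"
    by (rule gfun_smooth[OF gcompatD[OF pre_gradedD(5)[OF P c q(1)]]])
  qed
  have "z \<in> {z \<in> \<phi> ` (D \<inter> ?D1). ?\<tau> z \<in> \<phi>1 ` (D1 \<inter> \<Psi> ` W)}"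
   using Z Zp c1(2) adapted_inv[OF a Z(1)] q(2)[OF Zp c1(2)] by auto
  moreover have "{z \<in> \<phi> ` (D \<inter> ?D1). ?\<tau> z \<in> \<phi>1 ` (D1 \<inter> \<Psi> ` W)} \<subseteq> \<phi> ` (D \<inter> W)"
  proof
   fix y assume y: "y \<in> {z \<in> \<phi> ` (D \<inter> ?D1). ?\<tau> z \<in> \<phi>1 ` (D1 \<inter> \<Psi> ` W)}"
   then obtain Y where Y: "Y \<in> D" "Y \<in> pts P" "\<Psi> Y \<in> D1" "y = \<phi> Y" by auto
   have "\<phi>1 (\<Psi> Y) \<in> \<phi>1 ` (D1 \<inter> \<Psi> ` W)" using y Y adapted_inv[OF a Y(1)] q(2)[OF Y(2,3)] by simp
   then obtain Y' where Y': "Y' \<in> W" "\<Psi> Y' \<in> D1" "\<phi>1 (\<Psi> Y) = \<phi>1 (\<Psi> Y')" by auto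
   have "\<Psi> Y = \<Psi> Y'" using adapted_inj[OF pre_gradedD(4)[OF E_pre c1(1)]] Y(3) Y'(2,3) by (auto dest: inj_onD)
   then have "Y = Y'" using \<Psi>i(2)[OF Y(2)] \<Psi>i(2)[of Y'] Y'(1) W by (metis subsetD)
   then show "y \<in> \<phi> ` (D \<inter> W)" using Y Y'(1) by blast
  qed
  ultimately show "\<exists>V. open_crd (idx P) V \<and> z \<in> V \<and> V \<subseteq> \<phi> ` (D \<inter> W)" using op by blast
 qed
 then show "mopen P W" using W unfolding mopen_def by blast
qed

text \<open>The Hausdorff and countability axioms pass through the homeomorphism; the local axioms hold by
  assumption.\<close>

lemma graded_bundle_transport: "graded_bundle k M P"
proof -
 note M = pre_gradedD(1)[OF P] and fin = pre_gradedD(2)[OF P]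
 have EM: "manifold E" using E by (simp add: graded_bundle_def)
 have inj: "inj_on \<phi> D" if "(D, \<phi>) \<in> atlas P" for D \<phi> by (rule adapted_inj[OF pre_gradedD(4)[OF P that]])
 have injE: "inj_on \<phi> D" if "(D, \<phi>) \<in> atlas E" for D \<phi> by (rule adapted_inj[OF pre_gradedD(4)[OF E_pre that]])
 have im: "\<Psi> ` pts P = pts E" using bij by (simp add: bij_betw_def)
 have Pp: "mopen P (pts P)" using mopen_transport im mopen_pts[OF EM] by simp
 have tP: "openin (topology (mopen P)) = mopen P" "topspace (topology (mopen P)) = pts P"
  by (rule topology_mopen, erule inj, rule Pp)+
 have tE: "openin (topology (mopen E)) = mopen E" "topspace (topology (mopen E)) = pts E"
  by (rule topology_mopen, erule injE, rule mopen_pts[OF EM])+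
 have hom: "homeomorphic_map (topology (mopen P)) (topology (mopen E)) \<Psi>"
 proof (rule bijective_open_imp_homeomorphic_map)
  show "continuous_map (topology (mopen P)) (topology (mopen E)) \<Psi>"
   unfolding continuous_map_def tP tE
  proof (intro conjI allI impI)
   show "\<Psi> \<in> pts P \<rightarrow> pts E" using \<Psi>i(3) by blast
   fix V assume V: "mopen E V"
   have "\<Psi> ` {x \<in> pts P. \<Psi> x \<in> V} = V" using mopen_subset[OF V] \<Psi>i(1) by (force simp: image_iff)
   then show "mopen P {x \<in> pts P. \<Psi> x \<in> V}" using mopen_transport V by simp
  qed
  show "open_map (topology (mopen P)) (topology (mopen E)) \<Psi>"
   unfolding open_map_def tP tE using mopen_transport by blast
  show "\<Psi> ` topspace (topology (mopen P)) = topspace (topology (mopen E))" unfolding tP tE by (rule im)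
  show "inj_on \<Psi> (topspace (topology (mopen P)))" unfolding tP using bij by (simp add: bij_betw_def)
 qed
 have hs: "topology (mopen E) homeomorphic_space topology (mopen P)"
  using homeomorphic_map_imp_homeomorphic_space[OF hom] homeomorphic_space_sym by blast
 have "manifold P" unfolding manifold_def
 proof (intro conjI ballI)
  show "finite (idx P)" by (rule fin)
  show "(\<Union>(U, \<phi>)\<in>atlas P. U) = pts P" by (rule pre_gradedD(3)[OF P])
  fix x assume "x \<in> atlas P"
  then obtain D \<phi> where x: "x = (D, \<phi>)" and c: "(D, \<phi>) \<in> atlas P" by (cases x) auto
  note a = pre_gradedD(4)[OF P c]
  have "open_crd (idx P) (\<phi> ` D)" by (rule adapted_saturated_open[OF M fin a adapted_saturated[OF a] order_refl])
  then show "case x of (U, \<phi>) \<Rightarrow> inj_on \<phi> U \<and> open_crd (idx P) (\<phi> ` U)" using inj[OF c] x by simp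
  have "open_crd (idx P) (\<phi> ` (D \<inter> D')) \<and> (\<forall>i\<in>idx P. smooth_crd (idx P) (\<phi> ` (D \<inter> D')) (\<lambda>z. \<psi> (inv_into D \<phi> z) i))"
   if c': "(D', \<psi>) \<in> atlas P" for D' \<psi>
   using adapted_saturated_open[OF M fin a saturated_Int[OF M adapted_saturated[OF a] adapted_saturated[OF pre_gradedD(4)[OF P c']]] Int_lower1]
    gfun_smooth[OF gcompatD[OF pre_gradedD(5)[OF P c c']]] by blast
  then show "case x of (U, \<phi>) \<Rightarrow> \<forall>(V, \<psi>)\<in>atlas P. open_crd (idx P) (\<phi> ` (U \<inter> V)) \<and>
    (\<forall>i\<in>idx P. smooth_crd (idx P) (\<phi> ` (U \<inter> V)) (\<lambda>z. \<psi> (inv_into U \<phi> z) i))"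
   using x by auto
 next
  have "Hausdorff_space (topology (mopen E))" "second_countable (topology (mopen E))"
   using EM by (simp_all add: manifold_def)
  then show "Hausdorff_space (topology (mopen P))" "second_countable (topology (mopen P))"
   using homeomorphic_Hausdorff_space[OF hs] homeomorphic_space_second_countability[OF hs] by simp_all
 qed
 moreover have "bproj P ` pts P = pts M"
 proof -
  have "bproj P ` pts P = bproj E ` \<Psi> ` pts P" using ov by (force simp: image_iff)
  then show ?thesis using im E by (simp add: graded_bundle_def)
 qed
 moreover have "\<forall>i\<in>idx P. wt P i \<le> k" using E same by (simp add: graded_bundle_def)
 moreover have "polynomial_transition M P c c'" if "c \<in> atlas P" "c' \<in> atlas P" for c c'
  using gcoords_atlas[OF P that(1)] that(2) gcoords_iff_graded_coords[OF P] unfolding graded_coords_def by blast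
 ultimately show ?thesis unfolding graded_bundle_def using M pre_gradedD(4)[OF P] by blast
qed

lemma \<Psi>_hact:
 assumes Z: "Z \<in> pts P"
 shows "\<Psi> (hact P t Z) = hact E t (\<Psi> Z)"
proof -
 obtain D \<phi> where c: "(D, \<phi>) \<in> atlas E" "\<Psi> Z \<in> D" using pre_graded_cover[OF E_pre \<Psi>i(3)[OF Z]] by blast
 obtain \<psi> where q0: "pullback_chart D \<phi> \<psi>"
  using atlas_pullback[OF c(1)] by blast
 note q = pullback_chartD[OF q0]
 note h = hact_coords[OF P Z, where t = t]
 note g = gcoords_atlas[OF E_pre c(1)]
 have hD: "\<Psi> (hact P t Z) \<in> D"
  by (rule saturatedD[OF saturated_gcoords[OF g] c(2) \<Psi>i(3)[OF h(1)]]) (simp add: ov h(1,2) Z)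
 show ?thesis
 proof (rule hact_unique[OF E_pre g c(2) hD])
  fix i assume i: "i \<in> idx E"
  have "\<psi> (hact P t Z) i = t ^ wt P i * \<psi> Z i"
   by (rule h(3)[OF gcoords_atlas[OF P q(1)]]) (use Z c(2) i same in auto)
  then show "\<phi> (\<Psi> (hact P t Z)) i = t ^ wt E i * \<phi> (\<Psi> Z) i"
   using q(2)[OF Z c(2)] q(2)[OF h(1) hD] same by simp
 qed
qed

lemma isomorphism_transport: "gb_isomorphism P E \<Psi>"
proof -
 note M = pre_gradedD(1)[OF P] and fin = pre_gradedD(2)[OF P]
 have EM: "manifold E" using E by (simp add: graded_bundle_def)
 have im: "\<Psi> ` pts P = pts E" using bij by (simp add: bij_betw_def)
 have Pp: "mopen P (pts P)" using mopen_transport im mopen_pts[OF EM] by simp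
 have both: "open_crd (idx P) (\<phi> ` (D \<inter> pts P \<inter> \<Psi> -` D1)) \<and>
   (\<forall>i\<in>idx E. smooth_crd (idx P) (\<phi> ` (D \<inter> pts P \<inter> \<Psi> -` D1)) (\<lambda>z. \<phi>1 (\<Psi> (inv_into D \<phi> z)) i)) \<and>
   open_crd (idx E) (\<phi>1 ` (D1 \<inter> pts E \<inter> \<Psi>i -` D)) \<and>
   (\<forall>i\<in>idx P. smooth_crd (idx E) (\<phi>1 ` (D1 \<inter> pts E \<inter> \<Psi>i -` D)) (\<lambda>z. \<phi> (\<Psi>i (inv_into D1 \<phi>1 z)) i))"
  if c: "(D, \<phi>) \<in> atlas P" and c1: "(D1, \<phi>1) \<in> atlas E" for D \<phi> D1 \<phi>1
 proof -
  obtain \<psi> where q0: "pullback_chart D1 \<phi>1 \<psi>"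
   using atlas_pullback[OF c1] by blast
  note q = pullback_chartD[OF q0]
  let ?D1 = "{Z \<in> pts P. \<Psi> Z \<in> D1}"
  note a = pre_gradedD(4)[OF P c] and a1 = pre_gradedD(4)[OF P q(1)]
  have Dp: "D \<subseteq> pts P" by (rule saturated_pts[OF adapted_saturated[OF a]])
  have sat: "saturated M P (D \<inter> ?D1)" by (rule saturated_Int[OF M adapted_saturated[OF a] adapted_saturated[OF a1]])
  have e: "D \<inter> pts P \<inter> \<Psi> -` D1 = D \<inter> ?D1" by auto
  have O: "open_crd (idx P) (\<phi> ` (D \<inter> ?D1))" by (rule adapted_saturated_open[OF M fin a sat Int_lower1])
  have O1: "open_crd (idx P) (\<psi> ` (?D1 \<inter> D))"
   by (rule adapted_saturated_open[OF M fin a1 _ Int_lower1]) (use sat in \<open>simp add: Int_commute\<close>)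
  have "D1 \<subseteq> pts E" by (rule saturated_pts[OF saturated_gcoords[OF gcoords_atlas[OF E_pre c1]]])
  then have "D1 \<inter> pts E \<inter> \<Psi>i -` D = \<Psi> ` (?D1 \<inter> D)"
   using \<Psi>i Dp by (force simp: image_iff)
  then have e1: "\<phi>1 ` (D1 \<inter> pts E \<inter> \<Psi>i -` D) = \<psi> ` (?D1 \<inter> D)" using q(2) by (force simp: image_iff)
  have "smooth_crd (idx P) (\<phi> ` (D \<inter> ?D1)) (\<lambda>z. \<phi>1 (\<Psi> (inv_into D \<phi> z)) i)" if i: "i \<in> idx E" for i
  proof (rule smooth_crd_cong_imp[OF fin O gfun_smooth[OF gcompatD[OF pre_gradedD(5)[OF P c q(1)]]]])
   show "i \<in> idx P" using i same by simp
   fix y assume "y \<in> \<phi> ` (D \<inter> ?D1)"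
   then show "\<phi>1 (\<Psi> (inv_into D \<phi> y)) i = \<psi> (inv_into D \<phi> y) i" using adapted_inv[OF a] q(2) by auto
  qed
  moreover have "smooth_crd (idx P) (\<psi> ` (?D1 \<inter> D)) (\<lambda>z. \<phi> (\<Psi>i (inv_into D1 \<phi>1 z)) i)" if i: "i \<in> idx P" for i
  proof (rule smooth_crd_cong_imp[OF fin O1 gfun_smooth[OF gcompatD[OF pre_gradedD(5)[OF P q(1) c] i]]])
   fix y assume "y \<in> \<psi> ` (?D1 \<inter> D)"
   then obtain Z where Z: "Z \<in> pts P" "\<Psi> Z \<in> D1" "Z \<in> D" "y = \<psi> Z" by auto
   then show "\<phi> (\<Psi>i (inv_into D1 \<phi>1 y)) i = \<phi> (inv_into ?D1 \<psi> y) i"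
    using pullback_inv[OF c1 q(1,2) Z(1,2)] q(2)[OF Z(1,2)] \<Psi>i(2)[OF Z(1)] by simp
  qed
  ultimately show ?thesis unfolding e e1 using O O1 same by simp
 qed
 have "smooth_map P E \<Psi>"
  unfolding smooth_map_on_def using Pp im both by (auto simp: split_beta)
 moreover have "smooth_map E P \<Psi>i"
  unfolding smooth_map_on_def using mopen_pts[OF EM] \<Psi>i(1) both by (auto simp: split_beta)
 moreover have "\<Psi>i (hact E t V) = hact P t (\<Psi>i V)" if V: "V \<in> pts E" for t V
  using \<Psi>_hact[of "\<Psi>i V" t] \<Psi>i(1)[OF V] \<Psi>i(2)[OF hact_coords(1)[OF P, of "\<Psi>i V"]] by metis
 ultimately show ?thesis unfolding gb_isomorphism_def gb_morphism_def using bij \<Psi>_hact by blast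
qed

end

section \<open>Graded morphisms and smooth functions in coordinates\<close>

lemma gb_morphism_gfun:
 assumes G: "pre_graded M G" and H: "pre_graded M H" and f: "gb_morphism G H f" "over_id G H f"
  and c: "(D, \<phi>) \<in> atlas G" and c': "(D', \<psi>) \<in> atlas H" and i: "i \<in> idx H"
 shows "gfun G D \<phi> {e\<in>D. f e \<in> D'} (wt H i) (\<lambda>e. \<psi> (f e) i)"
proof -
 note M = pre_gradedD(1)[OF G] and fin = pre_gradedD(2)[OF G]
 note g = gcoords_atlas[OF G c] and g' = gcoords_atlas[OF H c']
 have sm: "smooth_map G H f" using f(1) by (simp add: gb_morphism_def)
 have D: "D \<subseteq> pts G" by (rule saturated_pts[OF saturated_gcoords[OF g]])
 have fp: "f e \<in> pts H" if "e \<in> pts G" for e using sm that by (auto simp: smooth_map_on_def)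
 have fb: "bproj H (f e) = bproj G e" if "e \<in> pts G" for e using f(2) that by (simp add: over_id_def)
 obtain U' where U': "mopen M U'" "D' = over H U'"
  using saturated_gcoords[OF g'] by (auto simp: saturated_def)
 let ?V = "{e\<in>D. f e \<in> D'}"
 have V: "?V = D \<inter> over G U'" using D fp fb by (auto simp: U'(2) over_def)
 have sat: "saturated M G ?V" "?V \<subseteq> D"
  unfolding V by (simp_all add: saturated_Int[OF M saturated_gcoords[OF g] saturated_over[OF U'(1)]])
 show ?thesis
 proof (rule gfunI[OF M fin gcoordsD(1)[OF g] sat])
  have "D \<inter> pts G \<inter> f -` D' = ?V" using D by auto
  then show "smooth_crd (idx G) (\<phi> ` ?V) (\<lambda>z. \<psi> (f (inv_into D \<phi> z)) i)"
   using smooth_map_onD[OF sm c c' i] by simp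
  fix e e' t assume e: "e \<in> ?V" "e' \<in> ?V" "\<phi> e' = scl (wt G) t (\<phi> e)"
  have "e' = hact G t e" by (rule hact_unique[OF G g]) (use e in \<open>auto simp: scl_def\<close>)
  moreover have ep: "e \<in> pts G" using e(1) D by blast
  ultimately have "f e' = hact H t (f e)" using f(1) by (simp add: gb_morphism_def)
  then show "\<psi> (f e') i = t ^ wt H i * \<psi> (f e) i"
   using hact_coords(3)[OF H fp[OF ep] g' _ i] e(1) by simp
 qed
qed

lemma gfun_additive:
 assumes M: "manifold M" and fin: "finite (idx E)" and a: "adapted_chart M E (D, \<phi>)"
  and W: "saturated M E W" "W \<subseteq> D" and h: "gfun E D \<phi> W k h" and k: "0 < k"
  and V: "V \<in> W" "v \<in> W" "V' \<in> W" "bproj E v = bproj E V" "bproj E V' = bproj E V"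
  and add: "\<And>i. i \<in> idx E \<Longrightarrow> \<phi> V' i = \<phi> V i + (if wt E i = k then \<phi> v i else 0)"
  and v: "\<And>i. i \<in> idx E \<Longrightarrow> wt E i \<noteq> 0 \<Longrightarrow> wt E i \<noteq> k \<Longrightarrow> \<phi> v i = 0"
 shows "h V' = h V + h v"
proof (rule gfun_top_linear[OF M fin a W h k], goal_cases)
 case (1 g)
 have "h V' = h V + (\<Sum>i\<in>{i\<in>idx E. wt E i = k}. g i (bproj E V) * \<phi> v i)"
  by (rule 1(1)[OF V add])
 moreover have "h v = (\<Sum>i\<in>{i\<in>idx E. wt E i = k}. g i (bproj E v) * \<phi> v i)"
  by (rule 1(2)[OF V(2) v])
 ultimately show ?case using V(4) by simp
qed

lemma smooth_real_on_local:
 assumes U: "mopen N U" and loc: "\<And>p. p \<in> U \<Longrightarrow> \<exists>V. p \<in> V \<and> smooth_real_on N (U \<inter> V) f"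
 shows "smooth_real_on N U f"
 unfolding smooth_real_on_def
proof (intro conjI U ballI, clarify)
 fix X \<eta> assume X: "(X, \<eta>) \<in> atlas N"
 show "smooth_crd (idx N) (\<eta> ` (X \<inter> U)) (\<lambda>z. f (inv_into X \<eta> z))"
 proof (rule smooth_crd_local)
  fix z assume "z \<in> \<eta> ` (X \<inter> U)"
  then obtain p where p: "p \<in> X" "p \<in> U" "z = \<eta> p" by auto
  obtain V where V: "p \<in> V" "smooth_real_on N (U \<inter> V) f" using loc[OF p(2)] by blast
  then have "mopen N (U \<inter> V)" by (simp add: smooth_real_on_def)
  then have "open_crd (idx N) (\<eta> ` (X \<inter> (U \<inter> V)))" by (rule mopen_open[OF _ X])
  moreover have "z \<in> \<eta> ` (X \<inter> (U \<inter> V))" "\<eta> ` (X \<inter> (U \<inter> V)) \<subseteq> \<eta> ` (X \<inter> U)" using p V(1) by auto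
  ultimately show "\<exists>V. open_crd (idx N) V \<and> z \<in> V \<and> V \<subseteq> \<eta> ` (X \<inter> U) \<and> smooth_crd (idx N) V (\<lambda>z. f (inv_into X \<eta> z))"
   using smooth_real_onD[OF V(2) X] by blast
 qed
qed

lemma smooth_real_on_sum_mult:
 assumes N: "manifold N" and W: "mopen N W" and f: "\<And>k. k \<in> K \<Longrightarrow> smooth_real_on N W (f k)"
  and g: "\<And>k. k \<in> K \<Longrightarrow> smooth_real_on N W (g k)"
 shows "smooth_real_on N W (\<lambda>p. \<Sum>k\<in>K. f k p * g k p)"
 unfolding smooth_real_on_def
proof (intro conjI W ballI, clarify)
 fix X \<eta> assume X: "(X, \<eta>) \<in> atlas N"
 show "smooth_crd (idx N) (\<eta> ` (X \<inter> W)) (\<lambda>z. \<Sum>k\<in>K. f k (inv_into X \<eta> z) * g k (inv_into X \<eta> z))"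
  by (intro smooth_crd_sum smooth_crd_mult manifold_finite[OF N] mopen_open[OF W X]
    smooth_real_onD[OF f X] smooth_real_onD[OF g X])
qed

lemma smooth_real_on_cong:
 assumes N: "manifold N" and f: "smooth_real_on N W f" and eq: "\<And>p. p \<in> W \<Longrightarrow> g p = f p"
 shows "smooth_real_on N W g"
proof -
 have W: "mopen N W" using f by (simp add: smooth_real_on_def)
 show ?thesis unfolding smooth_real_on_def
 proof (intro conjI W ballI, clarify)
 fix X \<eta> assume X: "(X, \<eta>) \<in> atlas N"
 show "smooth_crd (idx N) (\<eta> ` (X \<inter> W)) (\<lambda>z. g (inv_into X \<eta> z))"
  by (rule smooth_crd_cong_imp[OF manifold_finite[OF N] mopen_open[OF W X] smooth_real_onD[OF f X]])
   (use manifold_chart[OF N X] eq in \<open>auto simp: inv_into_f_f\<close>)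
 qed
qed

lemma smooth_real_on_comp_section:
 assumes E: "pre_graded M E" and c: "adapted_chart M E (D, \<phi>)" and W: "mopen M W"
  and s: "\<And>p. p \<in> W \<Longrightarrow> s p \<in> D" "\<And>i. i \<in> idx E \<Longrightarrow> smooth_real_on M W (\<lambda>p. \<phi> (s p) i)"
  and h: "smooth_crd (idx E) (\<phi> ` D) (\<lambda>z. h (inv_into D \<phi> z))"
 shows "smooth_real_on M W (\<lambda>p. h (s p))"
 unfolding smooth_real_on_def
proof (intro conjI W ballI, clarify)
 note M = pre_gradedD(1)[OF E] and fin = pre_gradedD(2)[OF E]
 fix X \<eta> assume X: "(X, \<eta>) \<in> atlas M"
 note O = mopen_open[OF W X]
 have p: "inv_into X \<eta> z \<in> W" if "z \<in> \<eta> ` (X \<inter> W)" for z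
  using that manifold_chart[OF M X] by (auto simp: inv_into_f_f)
 have "smooth_crd (idx M) (\<eta> ` (X \<inter> W)) (\<lambda>z. h (inv_into D \<phi> (\<phi> (s (inv_into X \<eta> z)))))"
  by (rule smooth_crd_comp[OF manifold_finite[OF M] O fin
     adapted_saturated_open[OF M fin c adapted_saturated[OF c] order_refl] _ smooth_real_onD[OF s(2) X] h])
   (use p s(1) in blast)
 then show "smooth_crd (idx M) (\<eta> ` (X \<inter> W)) (\<lambda>z. h (s (inv_into X \<eta> z)))"
  by (rule smooth_crd_cong_imp[OF manifold_finite[OF M] O]) (use p s(1) adapted_inv[OF c] in simp)
qed

section \<open>The quotient presentation\<close>

lemma reduct_simps:
 "pts (reduct 1 E) = red 1 E ` pts E" "idx (reduct 1 E) = {i\<in>idx E. wt E i \<le> 1}"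
 "bproj (reduct 1 E) = (\<lambda>a. bproj E (SOME e. e \<in> a))" "wt (reduct 1 E) = wt E"
 "atlas (reduct 1 E) = {(red 1 E ` D, \<lambda>a. restr {i\<in>idx E. wt E i \<le> 1} (\<phi> (SOME e. e \<in> a))) |D \<phi>. (D, \<phi>) \<in> atlas E}"
 by (simp_all add: reduct_def)

context
 fixes M :: "('m, 'b, 'z) mfd_scheme" and E :: "('e, 'i, 'm) gbundle"
  and an :: "'e set \<Rightarrow> (real \<Rightarrow> 'm) set" and \<Theta> :: "(real \<Rightarrow> 'e set) set \<Rightarrow> 'e"
 assumes E: "graded_bundle 2 M E" and A1: "graded_bundle 1 M (reduct 1 E)"
  and an: "gb_morphism (reduct 1 E) (Tan 1 M) an" "over_id (reduct 1 E) (Tan 1 M) an"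
  and \<Theta>: "gb_morphism (second_prolongation M (reduct 1 E) an) E \<Theta>"
   "over_id (second_prolongation M (reduct 1 E) an) E \<Theta>"
   "\<And>X. X \<in> pts (second_prolongation M (reduct 1 E) an) \<Longrightarrow> red 1 E (\<Theta> X) = base_pt X"
begin

abbreviation (input) A where "A \<equiv> reduct 1 E"
abbreviation (input) C where "C \<equiv> core 2 E"
abbreviation (input) AA where "AA \<equiv> second_prolongation M A an"
abbreviation (input) CC where "CC \<equiv> reweight 2 C"
abbreviation (input) FF where "FF \<equiv> fibre_prod AA CC"
abbreviation (input) bd where "bd \<equiv> \<lambda>v. \<Theta> (vlift A v)"
abbreviation (input) RR where "RR \<equiv> graph_rel A AA C bd"
abbreviation (input) lab :: "'i \<Rightarrow> 'i \<times> nat + 'i" where "lab \<equiv> \<lambda>i. if wt E i = 2 then Inr i else Inl (i, 0)"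
abbreviation (input) QQ where "QQ \<equiv> quotient_bundle M FF RR (idx E) lab"
abbreviation (input) I0 where "I0 \<equiv> {i\<in>idx E. wt E i = 0}"
abbreviation (input) I1 where "I1 \<equiv> {i\<in>idx E. wt E i = 1}"
abbreviation (input) I2 where "I2 \<equiv> {i\<in>idx E. wt E i = 2}"
abbreviation (input) ldom where "ldom \<equiv> lift_dom M A an"
abbreviation (input) lft where "lft \<equiv> lift M A an"

lemma EP: "pre_graded M E" by (rule graded_bundle_pre_graded[OF E])
lemma AP: "pre_graded M A" by (rule graded_bundle_pre_graded[OF A1])
lemma AAP: "pre_graded M AA" by (rule pre_graded_A2[OF A1 an])
lemma wt2: "i \<in> idx E \<Longrightarrow> wt E i \<le> 2" using E by (simp add: graded_bundle_def)
lemma wt_le1: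
 assumes "i \<in> idx E" "wt E i \<noteq> 2"
 shows "i \<in> idx A" "wt A i \<le> 1"
proof -
 have "wt E i \<le> 1" using wt2[OF assms(1)] assms(2) by linarith
 then show "i \<in> idx A" "wt A i \<le> 1" using assms(1) by (simp_all add: reduct_simps)
qed

lemma CP: "pre_graded M C" by (rule pre_graded_core[OF EP _ wt2]) simp_all
lemma CCP: "pre_graded M CC" by (rule pre_graded_reweight[OF _ CP]) simp
lemma FP: "pre_graded M FF" by (rule pre_graded_fibre_prod[OF AAP CCP])

lemmas MM = pre_gradedD(1)[OF EP]

text \<open>Transition functions of weight at most one do not involve coordinates of weight two, so the fibre of
  \<open>E \<rightarrow> E\<^sup>1\<close> is described by any chart.\<close>

lemma red_iff:
 assumes c: "(D, \<phi>) \<in> atlas E" and e: "e \<in> D"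
 shows "e' \<in> red 1 E e \<longleftrightarrow> e' \<in> D \<and> (\<forall>i\<in>idx E. wt E i \<le> 1 \<longrightarrow> \<phi> e' i = \<phi> e i)"
proof
 assume "e' \<in> red 1 E e"
 then obtain D1 \<phi>1 where c1: "(D1, \<phi>1) \<in> atlas E" "e \<in> D1" "e' \<in> D1"
  and eq: "\<forall>i\<in>idx E. wt E i \<le> 1 \<longrightarrow> \<phi>1 e' i = \<phi>1 e i"
  unfolding red_def by auto
 note g = gcoords_atlas[OF EP c] and g1 = gcoords_atlas[OF EP c1(1)]
 note a1 = gcoordsD(1)[OF g1]
 have "bproj E e' = bproj E e"
  unfolding adapted_base_eq[OF a1 c1(3,2)] using eq by (auto simp: base_of_def)
 moreover have "e' \<in> pts E" using c1(3) saturated_pts[OF saturated_gcoords[OF g1]] by blast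
 ultimately have e'D: "e' \<in> D" using saturatedD[OF saturated_gcoords[OF g] e] by blast
 have W: "saturated M E (D1 \<inter> D)" by (rule saturated_Int[OF MM saturated_gcoords[OF g1] saturated_gcoords[OF g]])
 have "\<phi> e' i = \<phi> e i" if i: "i \<in> idx E" "wt E i \<le> 1" for i
 proof (rule gfun_below_top[OF MM pre_gradedD(2)[OF EP] a1 W Int_lower1 gcompatD[OF gcoords_compat[OF EP g1 g] i(1)]])
  show "wt E i < 2" using i(2) by simp
  show "e \<in> D1 \<inter> D" "e' \<in> D1 \<inter> D" using c1 e e'D by auto
  show "\<phi>1 e' j = \<phi>1 e j" if "j \<in> idx E" "wt E j \<noteq> 2" for j
   using eq wt2[OF that(1)] that by (auto simp: le_Suc_eq One_nat_def numeral_2_eq_2)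
 qed
 then show "e' \<in> D \<and> (\<forall>i\<in>idx E. wt E i \<le> 1 \<longrightarrow> \<phi> e' i = \<phi> e i)" using e'D by blast
next
 assume "e' \<in> D \<and> (\<forall>i\<in>idx E. wt E i \<le> 1 \<longrightarrow> \<phi> e' i = \<phi> e i)"
 then show "e' \<in> red 1 E e" unfolding red_def using c e by auto
qed

lemma red_self: "e \<in> pts E \<Longrightarrow> e \<in> red 1 E e"
 using pre_graded_cover[OF EP] red_iff by metis

definition rA :: "('e \<Rightarrow> 'i \<Rightarrow> real) \<Rightarrow> 'e set \<Rightarrow> 'i \<Rightarrow> real" where
 "rA \<phi> a = restr {i\<in>idx E. wt E i \<le> 1} (\<phi> (SOME e. e \<in> a))"

lemma rA_atlas: "(D, \<phi>) \<in> atlas E \<Longrightarrow> (red 1 E ` D, rA \<phi>) \<in> atlas A"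
 unfolding reduct_simps(5) rA_def [abs_def] by blast

lemma rA_gcoords: "(D, \<phi>) \<in> atlas E \<Longrightarrow> gcoords M A (red 1 E ` D, rA \<phi>)"
 by (rule gcoords_atlas[OF AP rA_atlas])

lemma red_some:
 assumes "e \<in> pts E"
 shows "(SOME x. x \<in> red 1 E e) \<in> red 1 E e"
 using red_self[OF assms] by (rule someI)

lemma rA_red:
 assumes c: "(D, \<phi>) \<in> atlas E" and e: "e \<in> D" and i: "i \<in> idx A"
 shows "rA \<phi> (red 1 E e) i = \<phi> e i"
proof -
 have "e \<in> pts E" using e saturated_pts[OF saturated_gcoords[OF gcoords_atlas[OF EP c]]] by blast
 from iffD1[OF red_iff[OF c e] red_some[OF this]] show ?thesis
  using i by (simp add: rA_def restr_apply reduct_simps)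
qed

lemma bproj_red:
 assumes "e \<in> pts E"
 shows "bproj A (red 1 E e) = bproj E e"
proof -
 obtain D \<phi> where c: "(D, \<phi>) \<in> atlas E" "e \<in> D" using pre_graded_cover[OF EP assms] by blast
 let ?x = "SOME x. x \<in> red 1 E e"
 have x: "?x \<in> D" "\<forall>i\<in>idx E. wt E i \<le> 1 \<longrightarrow> \<phi> ?x i = \<phi> e i"
  using iffD1[OF red_iff[OF c] red_some[OF assms]] by auto
 have "bproj E ?x = bproj E e"
  unfolding adapted_base_eq[OF pre_gradedD(4)[OF EP c(1)] x(1) c(2)] using x(2) by (auto simp: base_of_def)
 then show ?thesis by (simp add: reduct_simps)
qed

lemma red_dom:
 assumes c: "(D, \<phi>) \<in> atlas E" and e: "e \<in> pts E"
 shows "red 1 E e \<in> red 1 E ` D \<longleftrightarrow> e \<in> D"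
proof
 assume "red 1 E e \<in> red 1 E ` D"
 then obtain e1 where e1: "e1 \<in> D" "red 1 E e = red 1 E e1" by auto
 have "e \<in> red 1 E e1" using red_self[OF e] e1(2) by simp
 then show "e \<in> D" unfolding red_iff[OF c e1(1)] by blast
qed simp

lemma \<Theta>_pts: "X \<in> pts AA \<Longrightarrow> \<Theta> X \<in> pts E \<and> bproj E (\<Theta> X) = bproj AA X"
 using \<Theta>(1,2) by (auto simp: gb_morphism_def smooth_map_on_def over_id_def)

lemma \<Theta>_dom:
 assumes c: "(D, \<phi>) \<in> atlas E" and X: "X \<in> ldom (red 1 E ` D)"
 shows "\<Theta> X \<in> D" "\<And>i. i \<in> idx A \<Longrightarrow> \<phi> (\<Theta> X) i = rA \<phi> (base_pt X) i"
proof -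
 have X': "X \<in> pts AA" "base_pt X \<in> red 1 E ` D" using X by (auto simp: lift_dom_def[OF A1 an])
 show D: "\<Theta> X \<in> D" using red_dom[OF c conjunct1[OF \<Theta>_pts[OF X'(1)]]] X'(2) \<Theta>(3)[OF X'(1)] by simp
 show "\<phi> (\<Theta> X) i = rA \<phi> (base_pt X) i" if "i \<in> idx A" for i
  using rA_red[OF c D that] \<Theta>(3)[OF X'(1)] by simp
qed

lemma \<Theta>_gfun:
 assumes c: "(D, \<phi>) \<in> atlas E" and i: "i \<in> idx E"
 shows "gfun AA (ldom (red 1 E ` D)) (lft (rA \<phi>)) (ldom (red 1 E ` D)) (wt E i) (\<lambda>X. \<phi> (\<Theta> X) i)"
proof -
 have "(ldom (red 1 E ` D), lft (rA \<phi>)) \<in> atlas AA"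
  unfolding atlas_A2[OF A1 an] using rA_atlas[OF c] by force
 from gb_morphism_gfun[OF AAP EP \<Theta>(1,2) this c i]
 have "gfun AA (ldom (red 1 E ` D)) (lft (rA \<phi>)) {X \<in> ldom (red 1 E ` D). \<Theta> X \<in> D} (wt E i) (\<lambda>X. \<phi> (\<Theta> X) i)" .
 moreover have "{X \<in> ldom (red 1 E ` D). \<Theta> X \<in> D} = ldom (red 1 E ` D)"
  using \<Theta>_dom(1)[OF c] by blast
 ultimately show ?thesis by simp
qed

lemma bd_coords:
 assumes b: "b \<in> pts A"
 shows "bd b \<in> pts C" "bproj C (bd b) = bproj A b"
  "\<And>D \<phi>. (D, \<phi>) \<in> atlas E \<Longrightarrow> b \<in> red 1 E ` D \<Longrightarrow> vlift A b \<in> ldom (red 1 E ` D) \<and> bd b \<in> D"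
  "\<And>D \<phi> i. (D, \<phi>) \<in> atlas E \<Longrightarrow> b \<in> red 1 E ` D \<Longrightarrow> i \<in> idx E \<Longrightarrow> wt E i = 1 \<Longrightarrow> \<phi> (bd b) i = 0"
proof -
 note v = vlift_A2[OF A1 an b]
 have ldom: "vlift A b \<in> ldom D" if "gcoords M A (D, \<phi>)" "b \<in> D" for D \<phi>
 proof -
  have "hact A 0 b \<in> D" by (rule saturatedD[OF saturated_gcoords[OF that(1)] that(2) hact_coords(1,2)[OF AP b]])
  then show ?thesis using v(1,2) by (simp add: lift_dom_def[OF A1 an])
 qed
 show d: "vlift A b \<in> ldom (red 1 E ` D) \<and> bd b \<in> D" if c: "(D, \<phi>) \<in> atlas E" "b \<in> red 1 E ` D" for D \<phi>
  using ldom[OF rA_gcoords[OF c(1)] c(2)] \<Theta>_dom(1)[OF c(1)] by blast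
 show z: "\<phi> (bd b) i = 0" if c: "(D, \<phi>) \<in> atlas E" "b \<in> red 1 E ` D" and i: "i \<in> idx E" "wt E i = 1" for D \<phi> i
 proof -
  have iA: "i \<in> idx A" "wt A i = 1" using i by (auto simp: reduct_simps)
  have "\<phi> (bd b) i = rA \<phi> (base_pt (vlift A b)) i"
   by (rule \<Theta>_dom(2)[OF c(1) conjunct1[OF d[OF c]] iA(1)])
  also have "\<dots> = lft (rA \<phi>) (vlift A b) (i, 0)" by (rule lift_0[OF A1 an iA(1), symmetric])
  also have "\<dots> = 0" by (rule v(5)[OF rA_gcoords[OF c(1)] c(2) iA])
  finally show ?thesis .
 qed
 have "b \<in> red 1 E ` pts E" using b by (simp add: reduct_simps)
 then obtain e where e: "e \<in> pts E" "b = red 1 E e" by blast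
 obtain D \<phi> where c: "(D, \<phi>) \<in> atlas E" "e \<in> D" using pre_graded_cover[OF EP e(1)] by blast
 then have bD: "b \<in> red 1 E ` D" using e(2) by blast
 have "\<forall>i\<in>idx E. 0 < wt E i \<and> wt E i < 2 \<longrightarrow> \<phi> (bd b) i = 0"
 proof (intro ballI impI)
  fix i assume i: "i \<in> idx E" "0 < wt E i \<and> wt E i < 2"
  then have "wt E i = 1" by linarith
  then show "\<phi> (bd b) i = 0" by (rule z[OF c(1) bD i(1)])
 qed
 then show "bd b \<in> pts C"
  using core_iff[OF EP _ wt2 gcoords_atlas[OF EP c(1)] conjunct2[OF d[OF c(1) bD]]] by simp
 show "bproj C (bd b) = bproj A b" using \<Theta>_pts[OF v(1)] v(3) by (simp add: core_simps)
qed

lemma idx_AA_cases: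
 assumes "k \<in> idx AA"
 obtains i where "k = (i, 0)" "i \<in> idx A" "wt AA k = wt A i" "wt A i \<le> 1"
  | i where "k = (i, 1)" "i \<in> idx A" "wt A i = 1" "wt AA k = 2"
proof -
 obtain i j where k: "k = (i, j)" by (cases k)
 then have i: "i \<in> idx A" "j = 0 \<or> j = 1 \<and> wt A i = 1" using assms by (auto simp: A2_simps[OF A1 an])
 from i(2) show ?thesis
 proof
  assume "j = 0"
  then show ?thesis using that(1)[of i] i k by (simp add: A2_simps[OF A1 an] reduct_simps)
 next
  assume "j = 1 \<and> wt A i = 1"
  then show ?thesis using that(2)[of i] i k by (simp add: A2_simps[OF A1 an])
 qed
qed

lemma vlift_core:
 assumes c: "gcoords M A (D, \<phi>)" and b: "b \<in> pts A" "b \<in> D" and k: "k \<in> idx AA" "wt AA k \<noteq> 0" "wt AA k \<noteq> 2"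
 shows "lft \<phi> (vlift A b) k = 0"
proof (rule idx_AA_cases[OF k(1)])
 fix i assume i: "k = (i, 0)" "i \<in> idx A" "wt AA k = wt A i" "wt A i \<le> 1"
 then have "wt A i = 1" using k by simp
 then show ?thesis using vlift_A2(5)[OF A1 an b(1) c b(2) i(2)] i(1) by simp
qed (use k in simp)

lemma vlift_dom:
 assumes c: "gcoords M A (D, \<phi>)" and b: "b \<in> pts A" "b \<in> D"
 shows "vlift A b \<in> ldom D"
proof -
 have "hact A 0 b \<in> D" by (rule saturatedD[OF saturated_gcoords[OF c] b(2) hact_coords(1,2)[OF AP b(1)]])
 then show ?thesis using vlift_A2(1,2)[OF A1 an b(1)] by (simp add: lift_dom_def[OF A1 an])
qed

lemma AA_dotplus:
 assumes X: "X \<in> pts AA" and b: "b \<in> pts A" "bproj A b = bproj AA X"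
 shows "dotplus 2 AA X (vlift A b) \<in> pts AA" "bproj AA (dotplus 2 AA X (vlift A b)) = bproj AA X"
  "\<And>D \<phi> k. gcoords M A (D, \<phi>) \<Longrightarrow> X \<in> ldom D \<Longrightarrow> k \<in> idx AA \<Longrightarrow>
   lft \<phi> (dotplus 2 AA X (vlift A b)) k = lft \<phi> X k + (if wt AA k = 2 then lft \<phi> (vlift A b) k else 0)"
proof -
 obtain D \<phi> where c: "(D, \<phi>) \<in> atlas A" "b \<in> D" using pre_graded_cover[OF AP b(1)] by blast
 note g = gcoords_atlas[OF AP c(1)]
 have w: "wt AA k \<le> 2" if "k \<in> idx AA" for k
  by (rule idx_AA_cases[OF that]) simp_all
 have bv: "bproj AA (vlift A b) = bproj AA X" using vlift_A2(3)[OF A1 an b(1)] b(2) by simp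
 have z: "lft \<phi> (vlift A b) k = 0" if "k \<in> idx AA" "0 < wt AA k" "wt AA k < 2" for k
  by (rule vlift_core[OF g b(1) c(2) that(1)]) (use that in simp_all)
 note dp = dotplus_coords[OF AAP _ w X vlift_A2(1)[OF A1 an b(1)] bv lift_gcoords[OF A1 an g] vlift_dom[OF g b(1) c(2)] z]
 show "dotplus 2 AA X (vlift A b) \<in> pts AA" "bproj AA (dotplus 2 AA X (vlift A b)) = bproj AA X"
  using dp(1,2) by simp_all
 show "lft \<phi> (dotplus 2 AA X (vlift A b)) k = lft \<phi> X k + (if wt AA k = 2 then lft \<phi> (vlift A b) k else 0)"
  if "gcoords M A (D, \<phi>)" "X \<in> ldom D" "k \<in> idx AA" for D \<phi> k
  using dp(3)[OF _ _ _ _ _ lift_gcoords[OF A1 an that(1)] that(2,3)] by simp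
qed

text \<open>The coordinate \<open>i\<close> of \<open>\<Theta>\<close> has degree two and \<open>b\<close> lies in the core, so this is the additivity of
  functions of top degree; the linear part is the value on the core, that is, \<open>\<partial>\<close>.\<close>

lemma \<Theta>_additive:
 assumes c: "(D, \<phi>) \<in> atlas E" and X: "X \<in> ldom (red 1 E ` D)" and b: "b \<in> pts A" "bproj A b = bproj AA X"
  and i: "i \<in> I2"
 shows "\<phi> (\<Theta> (dotplus 2 AA X (vlift A b))) i = \<phi> (\<Theta> X) i + \<phi> (bd b) i"
proof -
 let ?D = "red 1 E ` D"
 note g = rA_gcoords[OF c]
 note l = lift_gcoords[OF A1 an g]
 have X': "X \<in> pts AA" "base_pt X \<in> ?D" using X by (auto simp: lift_dom_def[OF A1 an])
 have bD: "b \<in> ?D"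
  using saturatedD[OF saturated_gcoords[OF g] X'(2) b(1)] b(2) by (simp add: A2_simps[OF A1 an])
 note dp = AA_dotplus[OF X'(1) b]
 have dD: "dotplus 2 AA X (vlift A b) \<in> ldom ?D"
  by (rule saturatedD[OF saturated_gcoords[OF l] X dp(1,2)])
 show ?thesis
 proof (rule gfun_additive[OF MM pre_gradedD(2)[OF AAP] gcoordsD(1)[OF l] saturated_gcoords[OF l] order_refl _ _ X
    vlift_dom[OF g b(1) bD] dD _ dp(2)])
  show "gfun AA (ldom ?D) (lft (rA \<phi>)) (ldom ?D) 2 (\<lambda>X. \<phi> (\<Theta> X) i)"
   using \<Theta>_gfun[OF c, of i] i by simp
  show "bproj AA (vlift A b) = bproj AA X" using vlift_A2(3)[OF A1 an b(1)] b(2) by simp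
  show "lft (rA \<phi>) (dotplus 2 AA X (vlift A b)) k = lft (rA \<phi>) X k + (if wt AA k = 2 then lft (rA \<phi>) (vlift A b) k else 0)"
   if "k \<in> idx AA" for k by (rule dp(3)[OF g X that])
  show "lft (rA \<phi>) (vlift A b) k = 0" if "k \<in> idx AA" "wt AA k \<noteq> 0" "wt AA k \<noteq> 2" for k
   by (rule vlift_core[OF g b(1) bD that])
 qed simp
qed

lemma C_wt: "i \<in> idx C \<Longrightarrow> wt C i \<le> 1"
 by (simp add: core_simps)

lemma C_dotplus:
 assumes v: "v \<in> pts C" and d: "d \<in> pts C" "bproj C d = bproj C v"
 shows "dotplus 1 C v (hact C t d) \<in> pts C" "bproj C (dotplus 1 C v (hact C t d)) = bproj C v"
  "\<And>D \<psi> i. gcoords M C (D, \<psi>) \<Longrightarrow> v \<in> D \<Longrightarrow> i \<in> I2 \<Longrightarrow>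
   \<psi> (dotplus 1 C v (hact C t d)) i = \<psi> v i + t * \<psi> d i"
proof -
 note h = hact_coords[OF CP d(1), where t = t]
 obtain D \<phi> where c: "(D, \<phi>) \<in> atlas C" "hact C t d \<in> D" using pre_graded_cover[OF CP h(1)] by blast
 have hb: "bproj C (hact C t d) = bproj C v" using h(2) d(2) by simp
 note dp = dotplus_coords[OF CP _ C_wt v h(1) hb gcoords_atlas[OF CP c(1)] c(2)]
 show "dotplus 1 C v (hact C t d) \<in> pts C" "bproj C (dotplus 1 C v (hact C t d)) = bproj C v"
  using dp(1,2) by simp_all
 fix D \<psi> i assume g: "gcoords M C (D, \<psi>)" and vD: "v \<in> D" and i: "i \<in> I2"
 have iC: "i \<in> idx C" "wt C i = 1" using i by (simp_all add: core_simps)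
 have dD: "d \<in> D" by (rule saturatedD[OF saturated_gcoords[OF g] vD d])
 show "\<psi> (dotplus 1 C v (hact C t d)) i = \<psi> v i + t * \<psi> d i"
  using dp(3)[OF _ _ _ g vD iC(1)] h(3)[OF g dD iC(1)] iC(2) by simp
qed

lemma RR_iff:
 "((X, v), (X', v')) \<in> RR \<longleftrightarrow> (\<exists>b. X \<in> pts AA \<and> v \<in> pts C \<and> b \<in> pts A \<and> bproj AA X = bproj C v \<and>
   bproj A b = bproj C v \<and> X' = dotplus 2 AA X (vlift A b) \<and> v' = dotplus 1 C v (hact C (-1) (bd b)))"
 unfolding graph_rel_def by auto

lemma FF_pts: "(X, v) \<in> pts FF \<longleftrightarrow> X \<in> pts AA \<and> v \<in> pts C \<and> bproj AA X = bproj C v"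
 by (simp add: fibre_prod_simps)

lemma FF_bproj: "bproj FF (X, v) = bproj AA X"
 by (simp add: fibre_prod_simps)

lemma RR_pts:
 assumes "(f, f') \<in> RR"
 shows "f \<in> pts FF" "f' \<in> pts FF" "bproj FF f' = bproj FF f"
proof -
 obtain X v X' v' where f: "f = (X, v)" "f' = (X', v')" by (cases f; cases f')
 then obtain b where b: "X \<in> pts AA" "v \<in> pts C" "b \<in> pts A" "bproj AA X = bproj C v"
  "bproj A b = bproj C v" "X' = dotplus 2 AA X (vlift A b)" "v' = dotplus 1 C v (hact C (-1) (bd b))"
  using assms unfolding f RR_iff by blast
 have bX: "bproj A b = bproj AA X" using b by simp
 have bdv: "bproj C (bd b) = bproj C v" using bd_coords(2)[OF b(3)] b(5) by simp
 note X' = AA_dotplus(1,2)[OF b(1,3) bX, folded b(6)]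
 note v' = C_dotplus(1,2)[OF b(2) bd_coords(1)[OF b(3)] bdv, of "-1", folded b(7)]
 show "f \<in> pts FF" "f' \<in> pts FF" "bproj FF f' = bproj FF f"
  unfolding f FF_pts FF_bproj using b(1,2,4) X' v' by simp_all
qed

abbreviation (input) sdom where "sdom \<equiv> shear_dom AA CC"
abbreviation (input) shr where "shr \<equiv> shear AA CC"

lemma sdom_iff: "(X, v) \<in> sdom (ldom D) D' \<longleftrightarrow> (X, v) \<in> pts FF \<and> base_pt X \<in> D \<and> v \<in> D'"
 unfolding shear_dom_def[OF AAP CCP] by (auto simp: FF_pts lift_dom_def[OF A1 an])

lemma shr_lab:
 assumes i: "i \<in> idx E"
 shows "shr (lft \<phi>) \<psi> S (X, v) (lab i) = (if wt E i = 2 then \<psi> v i + S X i else \<phi> (base_pt X) i)"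
proof (cases "wt E i = 2")
 case True
 then have "i \<in> idx CC" "0 < wt CC i" using i by (simp_all add: core_simps)
 then show ?thesis using shear_apply(2)[OF AAP CCP] True by simp
next
 case False
 then have iA: "i \<in> idx A" by (rule wt_le1(1)[OF i])
 then have "(i, 0) \<in> idx AA" by (simp add: A2_simps[OF A1 an])
 then show ?thesis using shear_apply(1)[OF AAP CCP] lift_0[OF A1 an iA] False by simp
qed

text \<open>If the sheared coordinates agree, then \<open>X\<close> and \<open>X'\<close> have the same base point, and the difference of their
  velocities is an element \<open>b\<close> with \<open>X' = X \<oplus> b\<close>.  As \<open>S X' = S X + \<partial> b\<close>, the equality \<open>v + S X = v' + S X'\<close>
  then means \<open>v' = v - \<partial> b\<close>.\<close>

lemma RR_shear:
 assumes cA: "gcoords M A (DA, \<phi>)" and cC: "gcoords M C (DC, \<psi>)"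
  and S: "\<And>X b \<mu>. X \<in> ldom DA \<Longrightarrow> b \<in> pts A \<Longrightarrow> bproj A b = bproj AA X \<Longrightarrow> \<mu> \<in> I2 \<Longrightarrow>
   S (dotplus 2 AA X (vlift A b)) \<mu> = S X \<mu> + \<psi> (bd b) \<mu>"
  and f: "f \<in> sdom (ldom DA) DC" "f' \<in> sdom (ldom DA) DC"
 shows "(f, f') \<in> RR \<longleftrightarrow> (\<forall>i\<in>idx E. shr (lft \<phi>) \<psi> S f (lab i) = shr (lft \<phi>) \<psi> S f' (lab i))"
proof -
 obtain X v X' v' where ff: "f = (X, v)" "f' = (X', v')" by (cases f; cases f')
 note l = lift_gcoords[OF A1 an cA]
 have X: "X \<in> pts AA" "v \<in> pts C" "bproj AA X = bproj C v" "base_pt X \<in> DA" "v \<in> DC" "X \<in> ldom DA"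
  and X': "X' \<in> pts AA" "v' \<in> pts C" "bproj AA X' = bproj C v'" "base_pt X' \<in> DA" "v' \<in> DC" "X' \<in> ldom DA"
  using f unfolding ff sdom_iff FF_pts by (auto simp: lift_dom_def[OF A1 an])
 show ?thesis
 proof
  assume "(f, f') \<in> RR"
  then obtain b where b: "b \<in> pts A" "bproj A b = bproj C v" "X' = dotplus 2 AA X (vlift A b)"
   "v' = dotplus 1 C v (hact C (-1) (bd b))" unfolding ff RR_iff by blast
  have bX: "bproj A b = bproj AA X" using b X by simp
  have bdv: "bproj C (bd b) = bproj C v" using bd_coords(2)[OF b(1)] b(2) by simp
  show "\<forall>i\<in>idx E. shr (lft \<phi>) \<psi> S f (lab i) = shr (lft \<phi>) \<psi> S f' (lab i)"
  proof
   fix i assume i: "i \<in> idx E"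
   show "shr (lft \<phi>) \<psi> S f (lab i) = shr (lft \<phi>) \<psi> S f' (lab i)"
   proof (cases "wt E i = 2")
    case True
    then have "i \<in> I2" using i by simp
    then show ?thesis unfolding ff shr_lab[OF i]
     using C_dotplus(3)[OF X(2) bd_coords(1)[OF b(1)] bdv cC X(5), of i "-1"] S[OF X(6) b(1) bX, of i] b(3,4) True
     by simp
   next
    case False
    note iA = wt_le1[OF i False]
    then have "(i, 0) \<in> idx AA" "wt AA (i, 0) \<noteq> 2" by (simp_all add: A2_simps[OF A1 an])
    then have "lft \<phi> X' (i, 0) = lft \<phi> X (i, 0)"
     using AA_dotplus(3)[OF X(1) b(1) bX cA X(6)] b(3) by simp
    then show ?thesis unfolding ff shr_lab[OF i] lift_0[OF A1 an iA(1)] using False by simp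
   qed
  qed
 next
  assume eq: "\<forall>i\<in>idx E. shr (lft \<phi>) \<psi> S f (lab i) = shr (lft \<phi>) \<psi> S f' (lab i)"
  have eqA: "\<phi> (base_pt X) i = \<phi> (base_pt X') i" if "i \<in> idx A" for i
  proof -
   have i: "i \<in> idx E" "wt E i \<noteq> 2" using that by (auto simp: reduct_simps)
   show ?thesis using bspec[OF eq i(1)] i(2) unfolding ff shr_lab[OF i(1)] by simp
  qed
  have eqC: "\<psi> v i + S X i = \<psi> v' i + S X' i" if "i \<in> I2" for i
  proof -
   have i: "i \<in> idx E" "wt E i = 2" using that by auto
   show ?thesis using bspec[OF eq i(1)] i(2) unfolding ff shr_lab[OF i(1)] by simp
  qed
  \<comment> \<open>The element \<open>b\<close> has as components the differences of the velocities of \<open>X\<close> and of its translate.\<close>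
  define z where "z = (\<lambda>i. if i \<in> idx A \<and> wt A i = 1 then lft \<phi> X' (i, 1) - lft \<phi> X (i, 1) else \<phi> (base_pt X) i)"
  note aA = gcoordsD(1)[OF cA]
  have "z \<in> crd (idx A)" using adapted_crd[OF aA X(4)] by (auto simp: z_def crd_def)
  moreover have "z i = \<phi> (base_pt X) i" if "i \<in> bidx A" for i using that by (simp add: z_def base_of_def)
  ultimately obtain b where b: "b \<in> DA" "\<phi> b = z" "bproj A b = bproj A (base_pt X)"
   using adapted_point[OF aA X(4)] by blast
  have bp: "b \<in> pts A" using b(1) saturated_pts[OF saturated_gcoords[OF cA]] by blast
  have bX: "bproj A b = bproj AA X" using b(3) by (simp add: A2_simps[OF A1 an])
  have bv: "bproj A b = bproj C v" using bX X(3) by simp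
  have bdv: "bproj C (bd b) = bproj C v" using bd_coords(2)[OF bp] bv by simp
  note dX = AA_dotplus[OF X(1) bp bX]
  have dXD: "dotplus 2 AA X (vlift A b) \<in> ldom DA"
   by (rule saturatedD[OF saturated_gcoords[OF l] X(6) dX(1,2)])
  have X'eq: "X' = dotplus 2 AA X (vlift A b)"
  proof (rule adapted_eq[OF gcoordsD(1)[OF l] X'(6) dXD])
   fix k assume k: "k \<in> idx AA"
   show "lft \<phi> X' k = lft \<phi> (dotplus 2 AA X (vlift A b)) k"
    unfolding dX(3)[OF cA X(6) k]
   proof (rule idx_AA_cases[OF k])
    fix i assume i: "k = (i, 0)" "i \<in> idx A" "wt AA k = wt A i" "wt A i \<le> 1"
    then show "lft \<phi> X' k = lft \<phi> X k + (if wt AA k = 2 then lft \<phi> (vlift A b) k else 0)"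
     using eqA[OF i(2)] lift_0[OF A1 an i(2)] by simp
   next
    fix i assume i: "k = (i, 1)" "i \<in> idx A" "wt A i = 1" "wt AA k = 2"
    then show "lft \<phi> X' k = lft \<phi> X k + (if wt AA k = 2 then lft \<phi> (vlift A b) k else 0)"
     using vlift_A2(4)[OF A1 an bp cA b(1) i(2,3)] b(2) by (simp add: z_def)
   qed
  qed
  note dv = C_dotplus[OF X(2) bd_coords(1)[OF bp] bdv, where t = "-1"]
  have dvD: "dotplus 1 C v (hact C (-1) (bd b)) \<in> DC"
   by (rule saturatedD[OF saturated_gcoords[OF cC] X(5) dv(1,2)])
  have "v' = dotplus 1 C v (hact C (-1) (bd b))"
  proof (rule adapted_eq[OF gcoordsD(1)[OF cC] X'(5) dvD])
   fix i assume i: "i \<in> idx C"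
   show "\<psi> v' i = \<psi> (dotplus 1 C v (hact C (-1) (bd b))) i"
   proof (cases "wt E i = 0")
    case True
    then have "i \<in> bidx C" using i by (simp add: base_of_def core_simps)
    moreover have "bproj C v' = bproj C (dotplus 1 C v (hact C (-1) (bd b)))"
     using dv(2) X'(3) X(3) dX(2) X'eq by simp
    ultimately show ?thesis using adapted_base_eq[OF gcoordsD(1)[OF cC] X'(5) dvD] by simp
   next
    case False
    then have i2: "i \<in> I2" using i by (simp add: core_simps)
    show ?thesis using dv(3)[OF cC X(5) i2] eqC[OF i2] S[OF X(6) bp bX i2] X'eq by simp
   qed
  qed
  then show "(f, f') \<in> RR" unfolding ff RR_iff using X bp bv X'eq by blast
 qed
qed

lemma cchart_coord: "i \<in> I2 \<Longrightarrow> cchart E 2 \<phi> v i = \<phi> v i"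
 by (simp add: cchart_def[OF EP _ wt2] restr_apply)

definition SE :: "('e \<Rightarrow> 'i \<Rightarrow> real) \<Rightarrow> (real \<Rightarrow> 'e set) set \<Rightarrow> 'i \<Rightarrow> real" where
 "SE \<phi> X \<mu> = \<phi> (\<Theta> X) \<mu>"

definition domE :: "'e set \<Rightarrow> ((real \<Rightarrow> 'e set) set \<times> 'e) set" where
 "domE D = sdom (ldom (red 1 E ` D)) (D \<inter> pts C)"

definition chE :: "('e \<Rightarrow> 'i \<Rightarrow> real) \<Rightarrow> (real \<Rightarrow> 'e set) set \<times> 'e \<Rightarrow> ('i \<times> nat) + 'i \<Rightarrow> real" where
 "chE \<phi> = shr (lft (rA \<phi>)) (cchart E 2 \<phi>) (SE \<phi>)"

lemma core_gc: "(D, \<phi>) \<in> atlas E \<Longrightarrow> gcoords M C (D \<inter> pts C, cchart E 2 \<phi>)"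
 by (rule core_gcoords[OF EP _ wt2 gcoords_atlas[OF EP]]) simp_all

lemma CC_pos: "\<mu> \<in> idx CC \<Longrightarrow> 0 < wt CC \<mu> \<Longrightarrow> \<mu> \<in> I2 \<and> wt CC \<mu> = 2"
 by (auto simp: core_simps)

lemma chE_gcoords:
 assumes c: "(D, \<phi>) \<in> atlas E"
 shows "gcoords M FF (domE D, chE \<phi>)"
 unfolding domE_def chE_def
proof (rule shear_gcoords[OF AAP CCP lift_gcoords[OF A1 an rA_gcoords[OF c]] gcoords_reweight[OF _ core_gc[OF c]]])
 fix \<mu> assume "\<mu> \<in> idx CC" "0 < wt CC \<mu>"
 from CC_pos[OF this] have \<mu>: "\<mu> \<in> idx E" "wt E \<mu> = 2" "wt CC \<mu> = 2" by auto
 show "gfun AA (ldom (red 1 E ` D)) (lft (rA \<phi>)) (ldom (red 1 E ` D)) (wt CC \<mu>) (\<lambda>e. SE \<phi> e \<mu>)"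
  using \<Theta>_gfun[OF c \<mu>(1)] \<mu>(2,3) by (simp add: SE_def)
qed simp

lemma domE_iff: "(D, \<phi>) \<in> atlas E \<Longrightarrow> (X, v) \<in> domE D \<longleftrightarrow> (X, v) \<in> pts FF \<and> base_pt X \<in> red 1 E ` D \<and> v \<in> D"
 unfolding domE_def sdom_iff FF_pts by blast

text \<open>By \<open>\<Theta>_additive\<close> the coordinates of weight two of \<open>\<Theta>\<close> may serve as the shearing function.\<close>

lemma RR_chE:
 assumes c: "(D, \<phi>) \<in> atlas E" and f: "f \<in> domE D" "f' \<in> domE D"
 shows "(f, f') \<in> RR \<longleftrightarrow> (\<forall>i\<in>idx E. chE \<phi> f (lab i) = chE \<phi> f' (lab i))"
 unfolding chE_def
proof (rule RR_shear[OF rA_gcoords[OF c] core_gc[OF c] _ f[unfolded domE_def]])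
 fix X b \<mu> assume "X \<in> ldom (red 1 E ` D)" "b \<in> pts A" "bproj A b = bproj AA X" "\<mu> \<in> I2"
 then show "SE \<phi> (dotplus 2 AA X (vlift A b)) \<mu> = SE \<phi> X \<mu> + cchart E 2 \<phi> (bd b) \<mu>"
  using \<Theta>_additive[OF c] cchart_coord by (simp add: SE_def)
qed

definition \<Psi>0 :: "(real \<Rightarrow> 'e set) set \<times> 'e \<Rightarrow> 'e" where
 "\<Psi>0 f = dotplus 2 E (\<Theta> (fst f)) (snd f)"

lemma C_pts: "v \<in> pts C \<Longrightarrow> v \<in> pts E"
 by (simp add: core_simps)

lemma \<Psi>0_pts:
 assumes f: "f \<in> pts FF"
 shows "\<Psi>0 f \<in> pts E" "bproj E (\<Psi>0 f) = bproj FF f"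
  "\<And>D \<phi> i. (D, \<phi>) \<in> atlas E \<Longrightarrow> f \<in> domE D \<Longrightarrow> i \<in> idx E \<Longrightarrow> \<phi> (\<Psi>0 f) i = chE \<phi> f (lab i)"
proof -
 obtain X v where ff: "f = (X, v)" by (cases f)
 have X: "X \<in> pts AA" "v \<in> pts C" "bproj AA X = bproj C v" using f unfolding ff FF_pts by auto
 have v: "v \<in> pts E" "bproj E v = bproj E (\<Theta> X)" using C_pts[OF X(2)] X \<Theta>_pts[OF X(1)] by (simp_all add: core_simps)
 obtain D \<phi> where c: "(D, \<phi>) \<in> atlas E" "v \<in> D" using pre_graded_cover[OF EP v(1)] by blast
 have z: "\<phi> v i = 0" if "i \<in> idx E" "0 < wt E i" "wt E i < 2" for i
  using core_iff[OF EP _ wt2 gcoords_atlas[OF EP c(1)] c(2)] X(2) that by simp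
 note dp = dotplus_coords[OF EP _ wt2 conjunct1[OF \<Theta>_pts[OF X(1)]] v gcoords_atlas[OF EP c(1)] c(2) z]
 show "\<Psi>0 f \<in> pts E" "bproj E (\<Psi>0 f) = bproj FF f"
  unfolding \<Psi>0_def ff fst_conv snd_conv FF_bproj using dp(1,2) \<Theta>_pts[OF X(1)] by simp_all
 fix D \<phi> i assume c': "(D, \<phi>) \<in> atlas E" and fD: "f \<in> domE D" and i: "i \<in> idx E"
 have XD: "X \<in> ldom (red 1 E ` D)" using fD unfolding ff domE_iff[OF c'] using X(1) by (simp add: lift_dom_def[OF A1 an])
 have "\<phi> (\<Psi>0 f) i = \<phi> (\<Theta> X) i + (if wt E i = 2 then \<phi> v i else 0)"
  unfolding \<Psi>0_def ff fst_conv snd_conv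
  using dp(3)[OF _ _ _ _ _ gcoords_atlas[OF EP c'] \<Theta>_dom(1)[OF c' XD] i] by simp
 also have "\<dots> = chE \<phi> f (lab i)"
  unfolding chE_def ff shr_lab[OF i]
  using \<Theta>_dom(2)[OF c' XD, of i] cchart_coord[of i] i wt_le1(1)[OF i] by (simp add: SE_def)
 finally show "\<phi> (\<Psi>0 f) i = chE \<phi> f (lab i)" .
qed

lemma domE_saturated: "(D, \<phi>) \<in> atlas E \<Longrightarrow> f \<in> pts FF \<Longrightarrow> f \<in> domE D \<longleftrightarrow> \<Psi>0 f \<in> D"
proof -
 assume c: "(D, \<phi>) \<in> atlas E" and f: "f \<in> pts FF"
 obtain X v where ff: "f = (X, v)" by (cases f)
 have X: "X \<in> pts AA" "v \<in> pts C" "bproj AA X = bproj C v" using f unfolding ff FF_pts by auto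
 note s = saturated_gcoords[OF gcoords_atlas[OF EP c]]
 have b: "bproj E (\<Psi>0 f) = bproj AA X" using \<Psi>0_pts(2)[OF f] ff FF_bproj by simp
 have t: "\<Theta> X \<in> pts E" "bproj E (\<Theta> X) = bproj AA X" using \<Theta>_pts[OF X(1)] by auto
 have v: "v \<in> pts E" "bproj E v = bproj AA X" using C_pts[OF X(2)] X(3) by (simp_all add: core_simps)
 have "f \<in> domE D \<longleftrightarrow> \<Theta> X \<in> D \<and> v \<in> D"
  unfolding ff domE_iff[OF c] using red_dom[OF c t(1)] \<Theta>(3)[OF X(1)] f ff by simp
 also have "\<dots> \<longleftrightarrow> \<Psi>0 f \<in> D"
 proof
  assume "\<Theta> X \<in> D \<and> v \<in> D"
  then have tD: "\<Theta> X \<in> D" by simp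
  show "\<Psi>0 f \<in> D" by (rule saturatedD[OF s tD \<Psi>0_pts(1)[OF f]]) (simp add: b t(2))
 next
  assume pD: "\<Psi>0 f \<in> D"
  have "\<Theta> X \<in> D" by (rule saturatedD[OF s pD t(1)]) (simp add: b t(2))
  moreover have "v \<in> D" by (rule saturatedD[OF s pD v(1)]) (simp add: b v(2))
  ultimately show "\<Theta> X \<in> D \<and> v \<in> D" by simp
 qed
 finally show ?thesis .
qed

lemma domE_cover:
 assumes f: "f \<in> pts FF"
 obtains D \<phi> where "(D, \<phi>) \<in> atlas E" "f \<in> domE D"
proof -
 obtain D \<phi> where c: "(D, \<phi>) \<in> atlas E" "\<Psi>0 f \<in> D" using pre_graded_cover[OF EP \<Psi>0_pts(1)[OF f]] by blast
 show ?thesis by (rule that[OF c(1)]) (simp add: domE_saturated[OF c(1) f] c(2))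
qed

text \<open>The sheared coordinates that describe the relation are the coordinates of the image point in \<open>E\<close>.\<close>

lemma RR_iff_\<Psi>0:
 assumes f: "f \<in> pts FF" "f' \<in> pts FF"
 shows "(f, f') \<in> RR \<longleftrightarrow> \<Psi>0 f = \<Psi>0 f'"
proof -
 obtain D \<phi> where c: "(D, \<phi>) \<in> atlas E" "f \<in> domE D" using domE_cover[OF f(1)] by blast
 have D: "\<Psi>0 f \<in> D" using domE_saturated[OF c(1) f(1)] c(2) by simp
 note s = saturated_gcoords[OF gcoords_atlas[OF EP c(1)]]
 show ?thesis
 proof
  assume r: "(f, f') \<in> RR"
  have D': "\<Psi>0 f' \<in> D"
   by (rule saturatedD[OF s D \<Psi>0_pts(1)[OF f(2)]]) (simp add: \<Psi>0_pts(2)[OF f(1)] \<Psi>0_pts(2)[OF f(2)] RR_pts(3)[OF r])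
  then have f'D: "f' \<in> domE D" using domE_saturated[OF c(1) f(2)] by simp
  show "\<Psi>0 f = \<Psi>0 f'"
  proof (rule adapted_eq[OF pre_gradedD(4)[OF EP c(1)] D D'])
   fix i assume i: "i \<in> idx E"
   show "\<phi> (\<Psi>0 f) i = \<phi> (\<Psi>0 f') i"
    unfolding \<Psi>0_pts(3)[OF f(1) c i] \<Psi>0_pts(3)[OF f(2) c(1) f'D i] using RR_chE[OF c f'D] r i by blast
  qed
 next
  assume eq: "\<Psi>0 f = \<Psi>0 f'"
  then have f'D: "f' \<in> domE D" using domE_saturated[OF c(1) f(2)] D by simp
  have "chE \<phi> f (lab i) = chE \<phi> f' (lab i)" if i: "i \<in> idx E" for i
   using \<Psi>0_pts(3)[OF f(1) c i] \<Psi>0_pts(3)[OF f(2) c(1) f'D i] eq by simp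
  then show "(f, f') \<in> RR" using RR_chE[OF c f'D] by blast
 qed
qed

lemma RR_equiv: "equiv (pts FF) RR"
proof (rule equivI)
 show "RR \<subseteq> pts FF \<times> pts FF" using RR_pts(1,2) by fast
 show "refl_on (pts FF) RR" unfolding refl_on_def using RR_iff_\<Psi>0 by simp
 show "sym RR" unfolding sym_def using RR_iff_\<Psi>0 RR_pts by metis
 show "trans RR" unfolding trans_def using RR_iff_\<Psi>0 RR_pts by metis
qed

lemma lab_inj: "inj_on lab (idx E)"
 by (rule inj_onI) (auto split: if_splits)

lemma lab_idx: "lab ` idx E \<subseteq> idx FF"
proof
 fix k assume "k \<in> lab ` idx E"
 then obtain i where i: "i \<in> idx E" "k = lab i" by blast
 show "k \<in> idx FF"
 proof (cases "wt E i = 2")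
  case True
  then show ?thesis using i by (auto simp: fibre_prod_simps core_simps intro!: InrI)
 next
  case False
  then show ?thesis using i wt_le1[OF i(1) False] by (auto simp: fibre_prod_simps A2_simps[OF A1 an] intro!: InlI)
 qed
qed

lemma lab_base: "bidx FF \<subseteq> lab ` idx E"
proof
 fix k assume "k \<in> bidx FF"
 then obtain i where i: "k = Inl (i, 0)" "i \<in> bidx A"
  unfolding bidx_fibre_prod[OF AAP CCP] bidx_A2[OF A1 an] by blast
 then have "i \<in> idx E" "wt E i = 0" by (auto simp: base_of_def reduct_simps)
 then have "k = lab i" using i(1) by simp
 then show "k \<in> lab ` idx E" using \<open>i \<in> idx E\<close> by blast
qed

lemma RR_base: "\<forall>f f'. (f, f') \<in> RR \<longrightarrow> bproj FF f' = bproj FF f"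
 using RR_pts(3) by blast

lemmas quot_args = FP RR_equiv RR_base pre_gradedD(2)[OF EP] lab_inj lab_idx lab_base

abbreviation (input) rch where "rch \<equiv> rchart M FF RR (idx E) lab"

lemma rch_E: "(D, \<phi>) \<in> atlas E \<Longrightarrow> rch (domE D) (chE \<phi>)"
 unfolding rchart_def[OF quot_args] using chE_gcoords RR_chE by simp

lemma QP: "pre_graded M QQ"
proof (rule pre_graded_quotient[OF quot_args])
 fix f assume "f \<in> pts FF"
 then obtain D \<phi> where "(D, \<phi>) \<in> atlas E" "f \<in> domE D" by (rule domE_cover)
 then show "\<exists>D \<phi>. rch D \<phi> \<and> f \<in> D" using rch_E by blast
qed

lemmas q_simps = quotient_simps[OF quot_args]

lemma q_pts: "f \<in> pts FF \<Longrightarrow> RR `` {f} \<in> pts QQ"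
 unfolding q_simps(1) by (rule quotientI)

lemma q_ptsE:
 assumes "Z \<in> pts QQ"
 obtains f where "f \<in> pts FF" "Z = RR `` {f}"
proof -
 have "Z \<in> pts FF // RR" using assms unfolding q_simps(1) .
 then show ?thesis by (rule quotientE) (rule that)
qed

definition \<Psi> :: "((real \<Rightarrow> 'e set) set \<times> 'e) set \<Rightarrow> 'e" where
 "\<Psi> Z = \<Psi>0 (SOME f. f \<in> Z)"

lemma \<Psi>_class:
 assumes f: "f \<in> pts FF"
 shows "\<Psi> (RR `` {f}) = \<Psi>0 f"
proof -
 note g = some_class[OF quot_args f]
 show ?thesis unfolding \<Psi>_def using RR_iff_\<Psi>0[OF f RR_pts(2)[OF g]] g by simp
qed

lemma \<Psi>_over:
 assumes Z: "Z \<in> pts QQ"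
 shows "\<Psi> Z \<in> pts E" "bproj E (\<Psi> Z) = bproj QQ Z"
proof -
 obtain f where f: "f \<in> pts FF" "Z = RR `` {f}" using Z by (rule q_ptsE)
 show "\<Psi> Z \<in> pts E" unfolding f(2) \<Psi>_class[OF f(1)] by (rule \<Psi>0_pts(1)[OF f(1)])
 show "bproj E (\<Psi> Z) = bproj QQ Z"
  unfolding f(2) \<Psi>_class[OF f(1)] bproj_class[OF quot_args f(1)] by (rule \<Psi>0_pts(2)[OF f(1)])
qed

text \<open>Some point of the product lies over the base point of \<open>V\<close>, namely the one given by the class of \<open>V\<close> in
  \<open>A\<close>; its sheared coordinates can be changed into those of \<open>V\<close>.\<close>

lemma \<Psi>0_surj:
 assumes V: "V \<in> pts E"
 shows "\<exists>f\<in>pts FF. \<Psi>0 f = V"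
proof -
 obtain D \<phi> where c: "(D, \<phi>) \<in> atlas E" "V \<in> D" using pre_graded_cover[OF EP V] by blast
 note aE = pre_gradedD(4)[OF EP c(1)]
 note aF = gcoordsD(1)[OF chE_gcoords[OF c(1)]]
 define a where "a = red 1 E V"
 have a: "a \<in> pts A" "bproj A a = bproj E V" using V bproj_red[OF V] by (simp_all add: a_def reduct_simps)
 define f0 where "f0 = (vlift A a, bd a)"
 have f0: "f0 \<in> pts FF"
  unfolding f0_def FF_pts using vlift_A2(1,3)[OF A1 an a(1)] bd_coords(1,2)[OF a(1)] by simp
 have b0: "bproj E (\<Psi>0 f0) = bproj E V"
  unfolding \<Psi>0_pts(2)[OF f0] unfolding f0_def FF_bproj using vlift_A2(3)[OF A1 an a(1)] a(2) by simp
 have D0: "\<Psi>0 f0 \<in> D" by (rule saturatedD[OF saturated_gcoords[OF gcoords_atlas[OF EP c(1)]] c(2) \<Psi>0_pts(1)[OF f0] b0])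
 then have f0D: "f0 \<in> domE D" using domE_saturated[OF c(1) f0] by simp
 define z where "z = (\<lambda>k. if k \<in> lab ` idx E then \<phi> V (inv_into (idx E) lab k) else 0)"
 have zl: "z (lab i) = \<phi> V i" if "i \<in> idx E" for i
  unfolding z_def using inv_into_f_f[OF lab_inj that] that by simp
 have "\<exists>f\<in>domE D. chE \<phi> f = z \<and> bproj FF f = bproj FF f0"
 proof (rule adapted_point[OF aF f0D])
  show "z \<in> crd (idx FF)" using lab_idx by (auto simp: z_def crd_def)
  fix k assume k: "k \<in> bidx FF"
  then obtain i where i: "i \<in> idx E" "k = lab i" using lab_base by blast
  have "wt FF k = 0" using k by (simp add: base_of_def)
  then have "wt E i = 0" unfolding i(2) by (simp add: fibre_prod_simps A2_simps[OF A1 an] reduct_simps core_simps split: if_splits)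
  then have "i \<in> bidx E" using i(1) by (simp add: base_of_def)
  then have "\<phi> (\<Psi>0 f0) i = \<phi> V i" using adapted_base_eq[OF aE D0 c(2)] b0 by simp
  then show "z k = chE \<phi> f0 k" unfolding i(2) zl[OF i(1)] using \<Psi>0_pts(3)[OF f0 c(1) f0D i(1)] by simp
 qed
 then obtain f where f: "f \<in> domE D" "chE \<phi> f = z" by blast
 have fp: "f \<in> pts FF" using f(1) saturated_pts[OF saturated_gcoords[OF chE_gcoords[OF c(1)]]] by blast
 have "\<Psi>0 f = V"
 proof (rule adapted_eq[OF aE _ c(2)])
  show "\<Psi>0 f \<in> D" using domE_saturated[OF c(1) fp] f(1) by simp
  show "\<phi> (\<Psi>0 f) i = \<phi> V i" if "i \<in> idx E" for i
   unfolding \<Psi>0_pts(3)[OF fp c(1) f(1) that] f(2) by (rule zl[OF that])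
 qed
 then show ?thesis using fp by blast
qed

lemma \<Psi>_bij: "bij_betw \<Psi> (pts QQ) (pts E)"
 unfolding bij_betw_def
proof
 show "inj_on \<Psi> (pts QQ)"
 proof (rule inj_onI)
  fix Z Z' assume Z: "Z \<in> pts QQ" and Z': "Z' \<in> pts QQ" and eq: "\<Psi> Z = \<Psi> Z'"
  obtain f where f: "f \<in> pts FF" "Z = RR `` {f}" using Z by (rule q_ptsE)
  obtain f' where f': "f' \<in> pts FF" "Z' = RR `` {f'}" using Z' by (rule q_ptsE)
  have "(f, f') \<in> RR" unfolding RR_iff_\<Psi>0[OF f(1) f'(1)]
   using eq unfolding f(2) f'(2) \<Psi>_class[OF f(1)] \<Psi>_class[OF f'(1)] .
  then show "Z = Z'" unfolding f(2) f'(2) by (rule equiv_class_eq[OF RR_equiv])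
 qed
 show "\<Psi> ` pts QQ = pts E"
 proof (intro subset_antisym subsetI)
  fix V assume "V \<in> pts E"
  then obtain f where f: "f \<in> pts FF" "\<Psi>0 f = V" using \<Psi>0_surj by blast
  have "\<Psi> (RR `` {f}) = V" unfolding \<Psi>_class[OF f(1)] by (rule f(2))
  then show "V \<in> \<Psi> ` pts QQ" using q_pts[OF f(1)] by blast
 qed (use \<Psi>_over(1) in blast)
qed

lemma QQ_labels: "idx QQ = idx E" "wt QQ = wt E"
proof -
 show "idx QQ = idx E" by (rule q_simps(2))
 have "wt FF (lab i) = wt E i" for i
  by (simp add: fibre_prod_simps A2_simps[OF A1 an] reduct_simps core_simps)
 then show "wt QQ = wt E" unfolding q_simps(3) by (simp add: fun_eq_iff)
qed

abbreviation (input) qcrd where "qcrd \<equiv> qchart (idx E) lab"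

lemma \<Psi>_atlas:
 assumes c: "(D, \<phi>) \<in> atlas E"
 shows "\<exists>\<psi>. ({Z \<in> pts QQ. \<Psi> Z \<in> D}, \<psi>) \<in> atlas QQ \<and> (\<forall>Z\<in>pts QQ. \<Psi> Z \<in> D \<longrightarrow> \<psi> Z = \<phi> (\<Psi> Z))"
proof (intro exI conjI ballI impI)
 have DF: "domE D \<subseteq> pts FF" by (rule saturated_pts[OF saturated_gcoords[OF chE_gcoords[OF c]]])
 have "{Z \<in> pts QQ. \<Psi> Z \<in> D} = qdom RR (domE D)"
 proof (intro subset_antisym subsetI)
  fix Z assume "Z \<in> {Z \<in> pts QQ. \<Psi> Z \<in> D}"
  then have Z: "Z \<in> pts QQ" "\<Psi> Z \<in> D" by auto
  obtain f where f: "f \<in> pts FF" "Z = RR `` {f}" using Z(1) by (rule q_ptsE)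
  have "f \<in> domE D" using Z(2) unfolding f(2) \<Psi>_class[OF f(1)] domE_saturated[OF c f(1)] .
  then show "Z \<in> qdom RR (domE D)" unfolding f(2) qdom_def[OF quot_args] by (rule imageI)
 next
  fix Z assume "Z \<in> qdom RR (domE D)"
  then obtain f where f: "f \<in> domE D" "Z = RR `` {f}" unfolding qdom_def[OF quot_args] by blast
  have fp: "f \<in> pts FF" using f(1) DF by blast
  have "\<Psi> Z \<in> D" using f(1) unfolding f(2) \<Psi>_class[OF fp] domE_saturated[OF c fp] .
  then show "Z \<in> {Z \<in> pts QQ. \<Psi> Z \<in> D}" using q_pts[OF fp] f(2) by simp
 qed
 then show "({Z \<in> pts QQ. \<Psi> Z \<in> D}, qcrd (chE \<phi>)) \<in> atlas QQ"
  unfolding q_simps(5) using rch_E[OF c] by blast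
 fix Z assume Z: "Z \<in> pts QQ" "\<Psi> Z \<in> D"
 obtain f where f: "f \<in> pts FF" "Z = RR `` {f}" using Z(1) by (rule q_ptsE)
 have fD: "f \<in> domE D" "\<Psi>0 f \<in> D" using Z(2) unfolding f(2) \<Psi>_class[OF f(1)] domE_saturated[OF c f(1)] by auto
 show "qcrd (chE \<phi>) Z = \<phi> (\<Psi> Z)"
 proof
  fix i
  show "qcrd (chE \<phi>) Z i = \<phi> (\<Psi> Z) i"
   unfolding f(2) \<Psi>_class[OF f(1)] qchart_class[OF quot_args rch_E[OF c] fD(1)]
   using \<Psi>0_pts(3)[OF f(1) c fD(1), of i] adapted_crd[OF pre_gradedD(4)[OF EP c] fD(2)]
   by (simp add: restr_apply crd_def)
 qed
qed

lemmas transport_args = E QP QQ_labels \<Psi>_bij \<Psi>_over(2) \<Psi>_atlas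

lemma Q_graded: "graded_bundle 2 M QQ"
 by (rule graded_bundle_transport[OF transport_args])

lemma \<Psi>_iso: "gb_isomorphism QQ E \<Psi>"
 by (rule isomorphism_transport[OF transport_args])

lemma zero_C:
 assumes v: "v \<in> pts C"
 shows "zero_vec C (bproj C v) \<in> pts C" "bproj C (zero_vec C (bproj C v)) = bproj C v"
  "\<And>D \<psi> i. gcoords M C (D, \<psi>) \<Longrightarrow> v \<in> D \<Longrightarrow> i \<in> I2 \<Longrightarrow> zero_vec C (bproj C v) \<in> D \<and> \<psi> (zero_vec C (bproj C v)) i = 0"
proof -
 note h = hact_coords[OF CP v, where t = 0]
 have "zero_vec C (bproj C v) = hact C 0 v"
  unfolding zero_vec_def
 proof (rule the_equality)
  obtain D \<psi> where c: "(D, \<psi>) \<in> atlas C" "v \<in> D" using pre_graded_cover[OF CP v] by blast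
  note g = gcoords_atlas[OF CP c(1)]
  have D: "hact C 0 v \<in> D" by (rule saturatedD[OF saturated_gcoords[OF g] c(2) h(1,2)])
  have "hact C 0 v = hact C 0 (hact C 0 v)"
   by (rule hact_unique[OF CP g D D]) (simp add: h(3)[OF g c(2)] power_0_left)
  then show "hact C 0 v \<in> pts C \<and> bproj C (hact C 0 v) = bproj C v \<and> hact C 0 (hact C 0 v) = hact C 0 v"
   using h(1,2) by simp
  fix w assume w: "w \<in> pts C \<and> bproj C w = bproj C v \<and> hact C 0 w = w"
  have wp: "w \<in> pts C" "bproj C w = bproj C v" and w0: "hact C 0 w = w" using w by auto
  have wD: "w \<in> D" by (rule saturatedD[OF saturated_gcoords[OF g] c(2) wp])
  show "w = hact C 0 v"
  proof (rule hact_unique[OF CP g c(2) wD])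
   fix i assume i: "i \<in> idx C"
   have "\<psi> w i = 0 ^ wt C i * \<psi> w i" using hact_coords(3)[OF CP wp(1) g wD i, of 0] w0 by simp
   moreover have "\<psi> w i = \<psi> v i" if "wt C i = 0"
    using adapted_base_eq[OF gcoordsD(1)[OF g] wD c(2)] wp(2) i that by (simp add: base_of_def)
   ultimately show "\<psi> w i = 0 ^ wt C i * \<psi> v i" by (cases "wt C i = 0") (simp_all add: power_0_left)
  qed
 qed
 note eq = this
 show "zero_vec C (bproj C v) \<in> pts C" "bproj C (zero_vec C (bproj C v)) = bproj C v"
  unfolding eq using h(1,2) by simp_all
 fix D \<psi> i assume g: "gcoords M C (D, \<psi>)" "v \<in> D" and i: "i \<in> I2"
 have iC: "i \<in> idx C" "wt C i = 1" using i by (simp_all add: core_simps)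
 have "hact C 0 v \<in> D" by (rule saturatedD[OF saturated_gcoords[OF g(1)] g(2) h(1,2)])
 then show "zero_vec C (bproj C v) \<in> D \<and> \<psi> (zero_vec C (bproj C v)) i = 0"
  unfolding eq using h(3)[OF g iC(1)] iC(2) by simp
qed

lemma zero_over:
 assumes X: "X \<in> pts AA"
 shows "(X, zero_vec C (bproj AA X)) \<in> pts FF"
  "\<And>D \<psi> i. gcoords M C (D, \<psi>) \<Longrightarrow> bd (base_pt X) \<in> D \<Longrightarrow> i \<in> I2 \<Longrightarrow>
   zero_vec C (bproj AA X) \<in> D \<and> \<psi> (zero_vec C (bproj AA X)) i = 0"
proof -
 note a = A2_pt(4)[OF A1 an X]
 have b: "bproj AA X = bproj C (bd (base_pt X))" using bd_coords(2)[OF a] by (simp add: A2_simps[OF A1 an])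
 note z = zero_C[OF bd_coords(1)[OF a], folded b]
 show "(X, zero_vec C (bproj AA X)) \<in> pts FF" unfolding FF_pts using X z(1,2) by simp
 show "\<And>D \<psi> i. gcoords M C (D, \<psi>) \<Longrightarrow> bd (base_pt X) \<in> D \<Longrightarrow> i \<in> I2 \<Longrightarrow>
   zero_vec C (bproj AA X) \<in> D \<and> \<psi> (zero_vec C (bproj AA X)) i = 0" by (rule z(3))
qed

lemma \<Psi>0_zero:
 assumes X: "X \<in> pts AA"
 shows "\<Psi>0 (X, zero_vec C (bproj AA X)) = \<Theta> X"
proof -
 let ?f = "(X, zero_vec C (bproj AA X))"
 note f = zero_over(1)[OF X]
 obtain D \<phi> where c: "(D, \<phi>) \<in> atlas E" "?f \<in> domE D" using f by (rule domE_cover)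
 have fD: "\<Psi>0 ?f \<in> D" using domE_saturated[OF c(1) f] c(2) by simp
 have D: "base_pt X \<in> red 1 E ` D" using c(2) unfolding domE_iff[OF c(1)] by blast
 have XD: "X \<in> ldom (red 1 E ` D)" using D X by (simp add: lift_dom_def[OF A1 an])
 note a = A2_pt(4)[OF A1 an X]
 have bdD: "bd (base_pt X) \<in> D \<inter> pts C" using bd_coords(1)[OF a] bd_coords(3)[OF a c(1) D] by blast
 show ?thesis
 proof (rule adapted_eq[OF pre_gradedD(4)[OF EP c(1)] fD \<Theta>_dom(1)[OF c(1) XD]])
  fix i assume i: "i \<in> idx E"
  show "\<phi> (\<Psi>0 ?f) i = \<phi> (\<Theta> X) i"
   unfolding \<Psi>0_pts(3)[OF f c i] chE_def shr_lab[OF i]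
   using \<Theta>_dom(2)[OF c(1) XD, of i] zero_over(2)[OF X core_gc[OF c(1)] bdD, of i] i wt_le1(1)[OF i]
   by (simp add: SE_def)
 qed
qed

context
 fixes U :: "'m set" and \<xi> :: "'m \<Rightarrow> 'i \<Rightarrow> real" and e :: "'i \<Rightarrow> 'm \<Rightarrow> 'e set" and c :: "'i \<Rightarrow> 'm \<Rightarrow> 'e"
 assumes cs: "coord_sys M I0 (U, \<xi>)" and fe: "local_frame M A I1 U e" and fc: "local_frame M C I2 U c"
begin

lemma onto_A: "bproj A ` pts A = pts M" using A1 by (simp add: graded_bundle_def)
lemma wt_A: "i \<in> idx A \<Longrightarrow> wt A i \<le> 1" using A1 by (simp add: graded_bundle_def)

lemma onto_C: "bproj C ` pts C = pts M"
proof (intro subset_antisym subsetI)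
 fix p assume "p \<in> bproj C ` pts C"
 then obtain v where "v \<in> pts C" "p = bproj C v" by (rule imageE)
 then have v: "v \<in> pts E" "p = bproj E v" using C_pts[of v] by (simp_all only: core_simps(3))
 have "p \<in> bproj E ` pts E" using v(2,1) by (rule image_eqI)
 then show "p \<in> pts M" using E by (simp add: graded_bundle_def)
next
 fix p assume "p \<in> pts M"
 then obtain b where b: "b \<in> pts A" "p = bproj A b" using onto_A by blast
 have "p = bproj C (bd b)" using bd_coords(2)[OF b(1)] b(2) by simp
 then show "p \<in> bproj C ` pts C" using bd_coords(1)[OF b(1)] by (rule image_eqI)
qed

lemma I1_A: "I1 = {i\<in>idx A. wt A i = 1}" by (auto simp: reduct_simps)
lemma I2_C: "I2 = {i\<in>idx C. wt C i = 1}" by (auto simp: core_simps)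
lemma cs_A: "coord_sys M (bidx A) (U, \<xi>)"
proof -
 have "bidx A = I0" by (auto simp: base_of_def reduct_simps)
 then show ?thesis using cs by simp
qed
lemma cs_C: "coord_sys M (bidx C) (U, \<xi>)"
proof -
 have "bidx C = I0" by (auto simp: base_of_def core_simps)
 then show ?thesis using cs by simp
qed

lemmas frame_A = AP wt_A onto_A I1_A cs_A fe
lemmas frame_C = CP C_wt onto_C I2_C cs_C fc

abbreviation (input) Qm where "Qm \<equiv> \<lambda>\<mu> i p. coframe C I2 c (bd (e i p)) \<mu>"
abbreviation (input) chA where "chA \<equiv> fchart A \<xi> e I1"
abbreviation (input) chC where "chC \<equiv> fchart C \<xi> c I2"

lemma chA_gcoords: "gcoords M A (over A U, chA)"
 by (rule frame_gcoords[OF frame_A])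

lemma chC_gcoords: "gcoords M C (over C U, chC)"
 by (rule frame_gcoords[OF frame_C])

lemma chA_apply:
 "i \<in> I1 \<Longrightarrow> chA v i = coframe A I1 e v i"
 "i \<in> I0 \<Longrightarrow> chA v i = \<xi> (bproj A v) i"
proof -
 show "i \<in> I1 \<Longrightarrow> chA v i = coframe A I1 e v i" by (simp add: fchart_def[OF frame_A])
 assume "i \<in> I0"
 then have "i \<in> bidx A" by (simp add: base_of_def reduct_simps)
 then show "chA v i = \<xi> (bproj A v) i" by (simp add: fchart_base[OF frame_A])
qed

lemma chC_apply: "i \<in> I2 \<Longrightarrow> chC v i = coframe C I2 c v i"
 by (simp add: fchart_def[OF frame_C])

lemma e_pts: "i \<in> I1 \<Longrightarrow> p \<in> U \<Longrightarrow> e i p \<in> pts A" "i \<in> I1 \<Longrightarrow> p \<in> U \<Longrightarrow> bproj A (e i p) = p"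
 using frame_pts[OF frame_A] by auto

text \<open>The core map is linear on fibres, being homogeneous of degree two on the core of \<open>A\<^bsup>[2]\<^esup>\<close> whose coordinates all
  have weight two.\<close>

lemma bd_linear:
 assumes ch: "(D, \<phi>) \<in> atlas E" and k: "k \<in> I2"
 shows "\<exists>g. \<forall>b\<in>red 1 E ` D. \<phi> (bd b) k = (\<Sum>j\<in>I1. g j (bproj A b) * rA \<phi> b j)"
proof -
 let ?D = "red 1 E ` D"
 note g = rA_gcoords[OF ch]
 note l = lift_gcoords[OF A1 an g]
 have gf: "gfun AA (ldom ?D) (lft (rA \<phi>)) (ldom ?D) 2 (\<lambda>X. \<phi> (\<Theta> X) k)"
  using \<Theta>_gfun[OF ch, of k] k by simp
 have "\<exists>g. \<forall>v\<in>ldom ?D. (\<forall>i\<in>idx AA. wt AA i \<noteq> 0 \<longrightarrow> wt AA i \<noteq> 2 \<longrightarrow> lft (rA \<phi>) v i = 0) \<longrightarrow>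
   \<phi> (\<Theta> v) k = (\<Sum>i\<in>{i\<in>idx AA. wt AA i = 2}. g i (bproj AA v) * lft (rA \<phi>) v i)"
  by (rule gfun_core_linear[OF MM pre_gradedD(2)[OF AAP] gcoordsD(1)[OF l] saturated_gcoords[OF l] order_refl gf]) simp
 then obtain h where h: "\<And>v. v \<in> ldom ?D \<Longrightarrow> (\<And>i. i \<in> idx AA \<Longrightarrow> wt AA i \<noteq> 0 \<Longrightarrow> wt AA i \<noteq> 2 \<Longrightarrow> lft (rA \<phi>) v i = 0) \<Longrightarrow>
   \<phi> (\<Theta> v) k = (\<Sum>i\<in>{i\<in>idx AA. wt AA i = 2}. h i (bproj AA v) * lft (rA \<phi>) v i)" by blast
 \<comment> \<open>On the core of the second prolongation only the velocities remain.\<close>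
 have idx2: "{i\<in>idx AA. wt AA i = 2} = (\<lambda>i. (i, 1)) ` I1"
  by (auto simp: A2_simps[OF A1 an] reduct_simps)
 show ?thesis
 proof (intro exI ballI)
  fix b assume b: "b \<in> ?D"
  have bp: "b \<in> pts A" using b saturated_pts[OF saturated_gcoords[OF g]] by blast
  have "\<phi> (bd b) k = (\<Sum>i\<in>{i\<in>idx AA. wt AA i = 2}. h i (bproj AA (vlift A b)) * lft (rA \<phi>) (vlift A b) i)"
   by (rule h[OF vlift_dom[OF g bp b] vlift_core[OF g bp b]])
  also have "\<dots> = (\<Sum>j\<in>I1. h (j, 1) (bproj AA (vlift A b)) * lft (rA \<phi>) (vlift A b) (j, 1))"
   unfolding idx2 by (subst sum.reindex) (auto simp: inj_on_def)
  also have "\<dots> = (\<Sum>j\<in>I1. h (j, 1) (bproj A b) * rA \<phi> b j)"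
   by (rule sum.cong[OF refl]) (use vlift_A2(3)[OF A1 an bp] vlift_A2(4)[OF A1 an bp g b] in \<open>auto simp: reduct_simps\<close>)
  finally show "\<phi> (bd b) k = (\<Sum>j\<in>I1. (\<lambda>j. h (j, 1)) j (bproj A b) * rA \<phi> b j)" .
 qed
qed

lemma bd_coframe:
 assumes b: "b \<in> pts A" "bproj A b \<in> U" and \<mu>: "\<mu> \<in> I2"
 shows "coframe C I2 c (bd b) \<mu> = (\<Sum>i\<in>I1. coframe A I1 e b i * Qm \<mu> i (bproj A b))"
proof -
 let ?p = "bproj A b" and ?a = "coframe A I1 e b"
 have "b \<in> red 1 E ` pts E" using b(1) by (simp add: reduct_simps)
 then obtain x where x: "x \<in> pts E" "b = red 1 E x" by blast
 obtain D \<phi> where ch: "(D, \<phi>) \<in> atlas E" "x \<in> D" using pre_graded_cover[OF EP x(1)] by blast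
 let ?D = "red 1 E ` D" and ?\<phi> = "cchart E 2 \<phi>"
 have bD: "b \<in> ?D" unfolding x(2) using ch(2) by (rule imageI)
 note g = rA_gcoords[OF ch(1)] and gC = core_gc[OF ch(1)]
 have eD: "e i ?p \<in> ?D" if "i \<in> I1" for i
  by (rule saturatedD[OF saturated_gcoords[OF g] bD e_pts(1)[OF that b(2)]]) (rule e_pts(2)[OF that b(2)])
 have bdC: "bd v \<in> D \<inter> pts C" if "v \<in> ?D" for v
 proof -
  have "v \<in> pts A" using that saturated_pts[OF saturated_gcoords[OF g]] by blast
  then show ?thesis using bd_coords(1) bd_coords(3)[OF _ ch(1) that] by blast
 qed
 have bp: "bproj C (bd b) = ?p" by (rule bd_coords(2)[OF b(1)])
 have ep: "bproj C (bd (e i ?p)) = ?p" if "i \<in> I1" for i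
  using bd_coords(2)[OF e_pts(1)[OF that b(2)]] e_pts(2)[OF that b(2)] by simp
 define a where "a = restr I2 (\<lambda>\<mu>. \<Sum>i\<in>I1. ?a i * Qm \<mu> i ?p)"
 have "coframe C I2 c (bd b) = a"
 proof (rule coframe_unique[OF frame_C bd_coords(1)[OF b(1)] _ gC bdC[OF bD]])
  show "bproj C (bd b) \<in> U" using bp b(2) by simp
  show "a \<in> crd I2" by (simp add: a_def restr_crd)
  fix k assume k: "k \<in> I2"
  obtain h where h: "\<And>v. v \<in> ?D \<Longrightarrow> \<phi> (bd v) k = (\<Sum>j\<in>I1. h j (bproj A v) * rA \<phi> v j)"
   using bd_linear[OF ch(1) k] by blast
  have "?\<phi> (bd b) k = (\<Sum>j\<in>I1. h j ?p * (\<Sum>i\<in>I1. ?a i * rA \<phi> (e i ?p) j))"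
   unfolding cchart_coord[OF k] h[OF bD]
   by (rule sum.cong[OF refl]) (simp add: frame_expand[OF frame_A b g bD])
  also have "\<dots> = (\<Sum>i\<in>I1. ?a i * (\<Sum>j\<in>I1. h j ?p * rA \<phi> (e i ?p) j))"
   unfolding sum_distrib_left by (subst sum.swap) (simp add: mult.left_commute)
  also have "\<dots> = (\<Sum>i\<in>I1. ?a i * ?\<phi> (bd (e i ?p)) k)"
   by (rule sum.cong[OF refl]) (simp add: cchart_coord[OF k] h[OF eD] e_pts(2)[OF _ b(2)])
  also have "\<dots> = (\<Sum>i\<in>I1. ?a i * (\<Sum>\<mu>\<in>I2. Qm \<mu> i ?p * ?\<phi> (c \<mu> ?p) k))"
  proof (rule sum.cong[OF refl])
   fix i assume i: "i \<in> I1"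
   have "bproj C (bd (e i ?p)) \<in> U" using ep[OF i] b(2) by simp
   from frame_expand[OF frame_C bd_coords(1)[OF e_pts(1)[OF i b(2)]] this gC bdC[OF eD[OF i]] k]
   show "?a i * ?\<phi> (bd (e i ?p)) k = ?a i * (\<Sum>\<mu>\<in>I2. Qm \<mu> i ?p * ?\<phi> (c \<mu> ?p) k)"
    unfolding ep[OF i] by simp
  qed
  also have "\<dots> = (\<Sum>\<mu>\<in>I2. (\<Sum>i\<in>I1. ?a i * Qm \<mu> i ?p) * ?\<phi> (c \<mu> ?p) k)"
   unfolding sum_distrib_left sum_distrib_right by (subst sum.swap) (simp add: mult.assoc)
  also have "\<dots> = (\<Sum>\<mu>\<in>I2. a \<mu> * ?\<phi> (c \<mu> ?p) k)"
   by (rule sum.cong[OF refl]) (simp add: a_def restr_apply)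
  finally show "?\<phi> (bd b) k = (\<Sum>\<mu>\<in>I2. a \<mu> * ?\<phi> (c \<mu> (bproj C (bd b))) k)" unfolding bp .
 qed
 then show ?thesis using \<mu> by (simp add: a_def restr_apply)
qed

text \<open>Near a point the coefficients are the product of the smooth coframe matrix and the coordinates of
  \<open>\<partial>(e\<^sub>i)\<close>; the latter are smooth since they are \<open>\<Theta>\<close> evaluated along the smooth section \<open>vlift \<circ> e\<^sub>i\<close>.\<close>

lemma Qm_smooth:
 assumes \<mu>: "\<mu> \<in> I2" and i: "i \<in> I1"
 shows "smooth_real_on M U (Qm \<mu> i)"
proof (rule smooth_real_on_local[OF coord_sysD(1)[OF cs]])
 fix p assume p: "p \<in> U"
 have "p \<in> bproj E ` pts E" using p mopen_subset[OF coord_sysD(1)[OF cs]] E by (auto simp: graded_bundle_def)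
 then obtain x where x: "x \<in> pts E" "p = bproj E x" by blast
 obtain D \<phi> where ch: "(D, \<phi>) \<in> atlas E" "x \<in> D" using pre_graded_cover[OF EP x(1)] by blast
 let ?D = "red 1 E ` D" and ?\<phi> = "cchart E 2 \<phi>"
 note g = rA_gcoords[OF ch(1)] and gC = core_gc[OF ch(1)]
 note l = lift_gcoords[OF A1 an g]
 obtain V where V: "mopen M V" "?D = over A V"
  using saturated_gcoords[OF g] by (auto simp: saturated_def)
 obtain V' where V': "mopen M V'" "D = over E V'"
  using saturated_gcoords[OF gcoords_atlas[OF EP ch(1)]] by (auto simp: saturated_def)
 \<comment> \<open>The induced charts of \<open>A\<close> and of the core have the same base domain.\<close>
 have VV: "V = V'"
 proof -
  have "V \<subseteq> pts M" "V' \<subseteq> pts M" using V(1) V'(1) by (auto dest: mopen_subset)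
  moreover have "q \<in> V \<longleftrightarrow> q \<in> V'" if "q \<in> pts M" for q
  proof -
   have "q \<in> bproj E ` pts E" using that E by (simp add: graded_bundle_def)
   then obtain y where y: "y \<in> pts E" "q = bproj E y" by blast
   have "q \<in> V \<longleftrightarrow> red 1 E y \<in> ?D"
    unfolding V(2) over_def using y bproj_red[OF y(1)] by (simp add: reduct_simps(1))
   also have "\<dots> \<longleftrightarrow> y \<in> D" by (rule red_dom[OF ch(1) y(1)])
   also have "\<dots> \<longleftrightarrow> q \<in> V'" unfolding V'(2) over_def using y by simp
   finally show ?thesis .
  qed
  ultimately show ?thesis by blast
 qed
 have DC: "D \<inter> pts C = over C V" using C_pts by (auto simp: V'(2) VV over_def core_simps(3))
 have pV: "p \<in> V" using ch(2) x(2) by (simp add: V'(2) VV over_def)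
 have cC: "(D \<inter> pts C, ?\<phi>) \<in> atlas C"
  unfolding atlas_core[OF EP _ wt2, simplified] using ch(1) by force
 have UV: "mopen M (U \<inter> V)" by (rule manifold_mopen_Int[OF MM coord_sysD(1)[OF cs] V(1)])
 have "\<exists>N. (\<forall>i\<in>I2. \<forall>k\<in>I2. smooth_real_on M (U \<inter> V) (N i k)) \<and>
  (\<forall>v\<in>D \<inter> pts C. bproj C v \<in> U \<longrightarrow> (\<forall>i\<in>I2. coframe C I2 c v i = (\<Sum>k\<in>I2. N i k (bproj C v) * ?\<phi> v k)))"
 proof (rule frame_inverse_matrix[OF frame_C cC DC V(1)])
  fix N assume N: "\<And>i k. i \<in> I2 \<Longrightarrow> k \<in> I2 \<Longrightarrow> smooth_real_on M (U \<inter> V) (N i k)"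
   "\<And>v i. v \<in> D \<inter> pts C \<Longrightarrow> bproj C v \<in> U \<Longrightarrow> i \<in> I2 \<Longrightarrow> coframe C I2 c v i = (\<Sum>k\<in>I2. N i k (bproj C v) * ?\<phi> v k)"
  show ?thesis by (rule exI[of _ N], intro conjI ballI impI) (erule (1) N(1), erule (2) N(2))
 qed
 then obtain N where "\<forall>i\<in>I2. \<forall>k\<in>I2. smooth_real_on M (U \<inter> V) (N i k)"
  and N2: "\<forall>v\<in>D \<inter> pts C. bproj C v \<in> U \<longrightarrow> (\<forall>i\<in>I2. coframe C I2 c v i = (\<Sum>k\<in>I2. N i k (bproj C v) * ?\<phi> v k))"
  by (elim exE conjE)
 then have N1: "smooth_real_on M (U \<inter> V) (N \<mu> k)" if "k \<in> I2" for k using \<mu> that by simp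
 have eD: "e i q \<in> ?D" if "q \<in> U \<inter> V" for q
  using e_pts[OF i, of q] that unfolding V(2) over_def by simp
 have sm: "smooth_real_on M (U \<inter> V) (\<lambda>q. \<phi> (bd (e i q)) k)" if k: "k \<in> I2" for k
 proof (rule smooth_real_on_comp_section[OF AAP gcoordsD(1)[OF l] UV])
  show "vlift A (e i q) \<in> ldom ?D" if "q \<in> U \<inter> V" for q
   by (rule vlift_dom[OF g e_pts(1)[OF i] eD[OF that]]) (use that in blast)
  show "smooth_crd (idx AA) (lft (rA \<phi>) ` ldom ?D) (\<lambda>z. \<phi> (\<Theta> (inv_into (ldom ?D) (lft (rA \<phi>)) z)) k)"
   using gfun_smooth[OF \<Theta>_gfun[OF ch(1), of k]] k by simp
  fix m assume m: "m \<in> idx AA"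
  have sA: "smooth_real_on M (U \<inter> V) (\<lambda>q. rA \<phi> (e i q) j)" if "j \<in> idx A" for j
   by (rule frame_matrix_smooth[OF frame_A rA_atlas[OF ch(1)] V(2,1) i that])
  show "smooth_real_on M (U \<inter> V) (\<lambda>q. lft (rA \<phi>) (vlift A (e i q)) m)"
  proof (rule idx_AA_cases[OF m])
   fix j assume j: "m = (j, 0)" "j \<in> idx A" "wt AA m = wt A j" "wt A j \<le> 1"
   show ?thesis
   proof (rule smooth_real_on_cong[OF MM smooth_real_on_sum_mult[OF MM UV]])
    show "smooth_real_on M (U \<inter> V) (\<lambda>q. (0::real) ^ wt A j)" if "x \<in> {()}" for x
     by (rule smooth_real_on_const[OF UV])
    show "smooth_real_on M (U \<inter> V) (\<lambda>q. rA \<phi> (e i q) j)" if "x \<in> {()}" for x by (rule sA[OF j(2)])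
    fix q assume q: "q \<in> U \<inter> V"
    then have ep: "e i q \<in> pts A" using e_pts(1)[OF i] by blast
    show "lft (rA \<phi>) (vlift A (e i q)) m = (\<Sum>x\<in>{()}. 0 ^ wt A j * rA \<phi> (e i q) j)"
     unfolding j(1) lift_0[OF A1 an j(2)] vlift_A2(2)[OF A1 an ep] hact_coords(3)[OF AP ep g eD[OF q] j(2)] by simp
   qed
  next
   fix j assume j: "m = (j, 1)" "j \<in> idx A" "wt A j = 1" "wt AA m = 2"
   show ?thesis
   proof (rule smooth_real_on_cong[OF MM sA[OF j(2)]])
    fix q assume q: "q \<in> U \<inter> V"
    show "lft (rA \<phi>) (vlift A (e i q)) m = rA \<phi> (e i q) j"
     unfolding j(1) by (rule vlift_A2(4)[OF A1 an e_pts(1)[OF i] g eD[OF q] j(2,3)]) (use q in blast)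
   qed
  qed
 qed
 have "smooth_real_on M (U \<inter> V) (\<lambda>q. \<Sum>k\<in>I2. N \<mu> k q * \<phi> (bd (e i q)) k)"
  by (rule smooth_real_on_sum_mult[OF MM UV N1 sm])
 then have "smooth_real_on M (U \<inter> V) (Qm \<mu> i)"
 proof (rule smooth_real_on_cong[OF MM])
  fix q assume q: "q \<in> U \<inter> V"
  then have qU: "q \<in> U" by blast
  note ep = e_pts[OF i qU]
  have b: "bproj C (bd (e i q)) = q" using bd_coords(2)[OF ep(1)] ep(2) by simp
  have bdD: "bd (e i q) \<in> D \<inter> pts C" using bd_coords(1)[OF ep(1)] bd_coords(3)[OF ep(1) ch(1) eD[OF q]] by blast
  show "Qm \<mu> i q = (\<Sum>k\<in>I2. N \<mu> k q * \<phi> (bd (e i q)) k)"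
   using bspec[OF mp[OF bspec[OF N2 bdD]] \<mu>] qU unfolding b by (simp add: cchart_coord)
 qed
 then show "\<exists>V. p \<in> V \<and> smooth_real_on M (U \<inter> V) (Qm \<mu> i)" using pV by blast
qed

definition SQ :: "(real \<Rightarrow> 'e set) set \<Rightarrow> 'i \<Rightarrow> real" where
 "SQ X \<mu> = (\<Sum>i\<in>I1. Qm \<mu> i (bproj AA X) * lft chA X (i, 1))"

abbreviation (input) domQ where "domQ \<equiv> sdom (ldom (over A U)) (over C U)"
abbreviation (input) chQ where "chQ \<equiv> shr (lft chA) chC SQ"
abbreviation (input) \<psi> where "\<psi> \<equiv> qcrd chQ"

lemma AA_velocity: "i \<in> I1 \<Longrightarrow> (i, 1) \<in> idx AA \<and> wt AA (i, 1) = 2"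
 by (simp add: A2_simps[OF A1 an] reduct_simps)

lemma lft_dot: "i \<in> I1 \<Longrightarrow> lft chA X (i, 1) = coframe_dot A I1 e X i"
proof -
 assume i: "i \<in> I1"
 then have "i \<in> idx A" "wt A i = 1" by (simp_all add: reduct_simps)
 then have "lft chA X (i, 1) = deriv (\<lambda>t. chA (repr X t) i) 0" by (rule lift_1[OF A1 an])
 then show ?thesis unfolding coframe_dot_def chA_apply(1)[OF i] .
qed

lemma SQ_gfun:
 assumes \<mu>: "\<mu> \<in> I2"
 shows "gfun AA (ldom (over A U)) (lft chA) (ldom (over A U)) 2 (\<lambda>X. SQ X \<mu>)"
proof -
 note l = lift_gcoords[OF A1 an chA_gcoords]
 note D = saturated_gcoords[OF l]
 have U: "ldom (over A U) \<subseteq> over AA U"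
  by (auto simp: lift_dom_def[OF A1 an] over_def A2_simps(3)[OF A1 an])
 show ?thesis unfolding SQ_def
 proof (rule gfun_sum[OF MM pre_gradedD(2)[OF AAP] gcoordsD(1)[OF l] D order_refl])
  fix i assume i: "i \<in> I1"
  note b = gfun_base[OF MM pre_gradedD(2)[OF AAP] gcoordsD(1)[OF l] Qm_smooth[OF \<mu> i] D order_refl U]
  note v = gfun_coord[OF MM pre_gradedD(2)[OF AAP] gcoordsD(1)[OF l] D order_refl, of "(i, 1)"]
  show "gfun AA (ldom (over A U)) (lft chA) (ldom (over A U)) 2 (\<lambda>X. Qm \<mu> i (bproj AA X) * lft chA X (i, 1))"
   using gfun_mult[OF MM pre_gradedD(2)[OF AAP] gcoordsD(1)[OF l] D order_refl b v]
   unfolding conjunct2[OF AA_velocity[OF i]] add_0_left .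
 qed
qed

text \<open>Adding \<open>b\<close> changes the velocities by the components of \<open>b\<close>, and \<open>Q\<close> is the matrix of \<open>\<partial>\<close>.\<close>

lemma SQ_additive:
 assumes X: "X \<in> ldom (over A U)" and b: "b \<in> pts A" "bproj A b = bproj AA X" and \<mu>: "\<mu> \<in> I2"
 shows "SQ (dotplus 2 AA X (vlift A b)) \<mu> = SQ X \<mu> + chC (bd b) \<mu>"
proof -
 have Xp: "X \<in> pts AA" using X by (simp add: lift_dom_def[OF A1 an])
 have XU: "bproj AA X \<in> U" using X by (simp add: lift_dom_def[OF A1 an] over_def A2_simps(3)[OF A1 an])
 have bU: "bproj A b \<in> U" "b \<in> over A U" using b XU by (simp_all add: over_def)
 note dp = AA_dotplus[OF Xp b]
 have "lft chA (dotplus 2 AA X (vlift A b)) (i, 1) = lft chA X (i, 1) + coframe A I1 e b i" if i: "i \<in> I1" for i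
 proof -
  have iA: "i \<in> idx A" "wt A i = 1" using i by (simp_all add: reduct_simps)
  show ?thesis
   using dp(3)[OF chA_gcoords X conjunct1[OF AA_velocity[OF i]]] AA_velocity[OF i]
    vlift_A2(4)[OF A1 an b(1) chA_gcoords bU(2) iA] chA_apply(1)[OF i] by simp
 qed
 then have "SQ (dotplus 2 AA X (vlift A b)) \<mu> =
   (\<Sum>i\<in>I1. Qm \<mu> i (bproj AA X) * lft chA X (i, 1) + coframe A I1 e b i * Qm \<mu> i (bproj A b))"
  unfolding SQ_def dp(2) b(2) by (intro sum.cong[OF refl]) (simp add: algebra_simps)
 then show ?thesis
  unfolding SQ_def chC_apply[OF \<mu>] bd_coframe[OF b(1) bU(1) \<mu>] by (simp add: sum.distrib)
qed

lemma chQ_gcoords: "gcoords M FF (domQ, chQ)"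
proof (rule shear_gcoords[OF AAP CCP lift_gcoords[OF A1 an chA_gcoords] gcoords_reweight[OF _ chC_gcoords]])
 fix \<mu> assume "\<mu> \<in> idx CC" "0 < wt CC \<mu>"
 from CC_pos[OF this] have \<mu>: "\<mu> \<in> I2" "wt CC \<mu> = 2" by auto
 show "gfun AA (ldom (over A U)) (lft chA) (ldom (over A U)) (wt CC \<mu>) (\<lambda>X. SQ X \<mu>)"
  unfolding \<mu>(2) by (rule SQ_gfun[OF \<mu>(1)])
qed simp

lemma rch_Q: "rch domQ chQ"
proof -
 have "(f, f') \<in> RR \<longleftrightarrow> (\<forall>i\<in>idx E. chQ f (lab i) = chQ f' (lab i))" if "f \<in> domQ" "f' \<in> domQ" for f f'
  by (rule RR_shear[OF chA_gcoords chC_gcoords SQ_additive that])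
 then show ?thesis unfolding rchart_def[OF quot_args] using chQ_gcoords by simp
qed

lemma domQ_iff: "f \<in> domQ \<longleftrightarrow> f \<in> pts FF \<and> bproj FF f \<in> U"
proof -
 obtain X v where f: "f = (X, v)" by (cases f)
 show ?thesis unfolding f sdom_iff FF_bproj FF_pts over_def
  using A2_pt(4)[OF A1 an, of X] by (auto simp: A2_simps(3)[OF A1 an])
qed

lemma qdomQ: "qdom RR domQ = {Z \<in> pts QQ. bproj QQ Z \<in> U}"
proof (intro subset_antisym subsetI)
 fix Z assume "Z \<in> qdom RR domQ"
 then obtain f where f: "f \<in> domQ" "Z = RR `` {f}" unfolding qdom_def[OF quot_args] by blast
 have fp: "f \<in> pts FF" "bproj FF f \<in> U" using f(1) unfolding domQ_iff by auto
 show "Z \<in> {Z \<in> pts QQ. bproj QQ Z \<in> U}"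
  unfolding f(2) using q_pts[OF fp(1)] bproj_class[OF quot_args fp(1)] fp(2) by simp
next
 fix Z assume "Z \<in> {Z \<in> pts QQ. bproj QQ Z \<in> U}"
 then have Z: "Z \<in> pts QQ" "bproj QQ Z \<in> U" by auto
 obtain f where f: "f \<in> pts FF" "Z = RR `` {f}" using Z(1) by (rule q_ptsE)
 have "f \<in> domQ" unfolding domQ_iff using f(1) Z(2) unfolding f(2) bproj_class[OF quot_args f(1)] by simp
 then show "Z \<in> qdom RR domQ" unfolding f(2) qdom_def[OF quot_args] by (rule imageI)
qed

lemma \<psi>_gcoords: "gcoords M QQ ({Z \<in> pts QQ. bproj QQ Z \<in> U}, \<psi>)"
proof -
 have "({Z \<in> pts QQ. bproj QQ Z \<in> U}, \<psi>) \<in> atlas QQ"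
  unfolding qdomQ[symmetric] q_simps(5) using rch_Q by blast
 then show ?thesis by (rule gcoords_atlas[OF QP])
qed

lemma \<psi>_apply:
 assumes f: "(X, v) \<in> pts FF" "bproj AA X \<in> U"
 shows "a \<in> I0 \<Longrightarrow> \<psi> (RR `` {(X, v)}) a = \<xi> (bproj AA X) a"
  "i \<in> I1 \<Longrightarrow> \<psi> (RR `` {(X, v)}) i = coframe A I1 e (base_pt X) i"
  "\<mu> \<in> I2 \<Longrightarrow> \<psi> (RR `` {(X, v)}) \<mu> =
   coframe C I2 c v \<mu> + (\<Sum>i\<in>I1. Qm \<mu> i (bproj AA X) * coframe_dot A I1 e X i)"
proof -
 have fD: "(X, v) \<in> domQ" unfolding domQ_iff FF_bproj using f by simp
 have q: "\<psi> (RR `` {(X, v)}) i = (if wt E i = 2 then chC v i + SQ X i else chA (base_pt X) i)" if "i \<in> idx E" for i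
  unfolding qchart_class[OF quot_args rch_Q fD] using shr_lab[OF that, of chA chC SQ X v] that by (simp add: restr_apply)
 show "\<psi> (RR `` {(X, v)}) a = \<xi> (bproj AA X) a" if "a \<in> I0"
  using q[of a] chA_apply(2)[OF that] that by (simp add: A2_simps(3)[OF A1 an])
 show "\<psi> (RR `` {(X, v)}) i = coframe A I1 e (base_pt X) i" if "i \<in> I1"
  using q[of i] chA_apply(1)[OF that] that by simp
 show "\<psi> (RR `` {(X, v)}) \<mu> = coframe C I2 c v \<mu> + (\<Sum>i\<in>I1. Qm \<mu> i (bproj AA X) * coframe_dot A I1 e X i)"
  if "\<mu> \<in> I2"
  using q[of \<mu>] chC_apply[OF that] that by (simp add: SQ_def lft_dot)
qed

lemma \<psi>E_gcoords:
 "gcoords M E ({V \<in> pts E. bproj E V \<in> U}, \<lambda>V. \<psi> (inv_into (pts QQ) \<Psi> V))"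
proof -
 have "\<Psi> ` {Z \<in> pts QQ. bproj QQ Z \<in> U} = {V \<in> pts E. bproj E V \<in> U}"
 proof (intro subset_antisym subsetI)
  fix V assume "V \<in> \<Psi> ` {Z \<in> pts QQ. bproj QQ Z \<in> U}"
  then obtain Z where Z: "Z \<in> pts QQ" "bproj QQ Z \<in> U" "V = \<Psi> Z" by blast
  show "V \<in> {V \<in> pts E. bproj E V \<in> U}" unfolding Z(3) using \<Psi>_over[OF Z(1)] Z(2) by simp
 next
  fix V assume "V \<in> {V \<in> pts E. bproj E V \<in> U}"
  then have V: "V \<in> pts E" "bproj E V \<in> U" by auto
  then obtain Z where Z: "Z \<in> pts QQ" "V = \<Psi> Z" using \<Psi>_bij unfolding bij_betw_def by blast
  then show "V \<in> \<Psi> ` {Z \<in> pts QQ. bproj QQ Z \<in> U}" using V(2) \<Psi>_over(2)[OF Z(1)] by auto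
 qed
 moreover have "gcoords M E (\<Psi> ` {Z \<in> pts QQ. bproj QQ Z \<in> U}, \<lambda>V. \<psi> (inv_into (pts QQ) \<Psi> V))"
  by (rule transported_gcoords[OF transport_args \<psi>_gcoords])
 ultimately show ?thesis by simp
qed

lemma \<psi>E_\<Theta>:
 assumes X: "X \<in> pts AA" "bproj AA X \<in> U"
 shows "a \<in> I0 \<Longrightarrow> \<psi> (inv_into (pts QQ) \<Psi> (\<Theta> X)) a = \<xi> (bproj AA X) a"
  "i \<in> I1 \<Longrightarrow> \<psi> (inv_into (pts QQ) \<Psi> (\<Theta> X)) i = coframe A I1 e (base_pt X) i"
  "\<mu> \<in> I2 \<Longrightarrow> \<psi> (inv_into (pts QQ) \<Psi> (\<Theta> X)) \<mu> = (\<Sum>i\<in>I1. Qm \<mu> i (bproj AA X) * coframe_dot A I1 e X i)"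
proof -
 let ?z = "zero_vec C (bproj AA X)"
 note f = zero_over(1)[OF X(1)]
 have i: "inv_into (pts QQ) \<Psi> (\<Theta> X) = RR `` {(X, ?z)}"
  using inv_into_f_f[OF bij_betw_imp_inj_on[OF \<Psi>_bij] q_pts[OF f]]
  unfolding \<Psi>_class[OF f] \<Psi>0_zero[OF X(1)] .
 have z: "?z \<in> pts C" "bproj C ?z \<in> U" using f X(2) unfolding FF_pts by auto
 have bdU: "bd (base_pt X) \<in> over C U"
  using bd_coords(1,2)[OF A2_pt(4)[OF A1 an X(1)]] X(2) by (simp add: over_def A2_simps(3)[OF A1 an])
 have z0: "coframe C I2 c ?z \<mu> = 0" if "\<mu> \<in> I2" for \<mu>
  using zero_over(2)[OF X(1) chC_gcoords bdU that] chC_apply[OF that] by simp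
 note p = \<psi>_apply[OF f X(2), folded i]
 show "\<psi> (inv_into (pts QQ) \<Psi> (\<Theta> X)) a = \<xi> (bproj AA X) a" if "a \<in> I0" by (rule p(1)[OF that])
 show "\<psi> (inv_into (pts QQ) \<Psi> (\<Theta> X)) i = coframe A I1 e (base_pt X) i" if "i \<in> I1" by (rule p(2)[OF that])
 show "\<psi> (inv_into (pts QQ) \<Psi> (\<Theta> X)) \<mu> = (\<Sum>i\<in>I1. Qm \<mu> i (bproj AA X) * coframe_dot A I1 e X i)" if "\<mu> \<in> I2"
  using p(3)[OF that] z0[OF that] by simp
qed

lemma frame_coordinates:
 "\<exists>\<psi>. graded_coords M QQ ({Z\<in>pts QQ. bproj QQ Z \<in> U}, \<psi>) \<and>
   (\<forall>(X, v)\<in>pts FF. bproj AA X \<in> U \<longrightarrow>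
    (\<forall>a\<in>I0. \<psi> (RR `` {(X, v)}) a = \<xi> (bproj AA X) a) \<and>
    (\<forall>i\<in>I1. \<psi> (RR `` {(X, v)}) i = coframe A I1 e (base_pt X) i) \<and>
    (\<forall>\<mu>\<in>I2. \<psi> (RR `` {(X, v)}) \<mu> =
     coframe C I2 c v \<mu> + (\<Sum>i\<in>I1. Qm \<mu> i (bproj AA X) * coframe_dot A I1 e X i))) \<and>
   graded_coords M E ({V\<in>pts E. bproj E V \<in> U}, \<lambda>V. \<psi> (inv_into (pts QQ) \<Psi> V)) \<and>
   (\<forall>X\<in>pts AA. bproj AA X \<in> U \<longrightarrow>
    (\<forall>a\<in>I0. \<psi> (inv_into (pts QQ) \<Psi> (\<Theta> X)) a = \<xi> (bproj AA X) a) \<and>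
    (\<forall>i\<in>I1. \<psi> (inv_into (pts QQ) \<Psi> (\<Theta> X)) i = coframe A I1 e (base_pt X) i) \<and>
    (\<forall>\<mu>\<in>I2. \<psi> (inv_into (pts QQ) \<Psi> (\<Theta> X)) \<mu> =
     (\<Sum>i\<in>I1. Qm \<mu> i (bproj AA X) * coframe_dot A I1 e X i)))"
proof (rule exI[of _ \<psi>], intro conjI ballI impI)
 show "graded_coords M QQ ({Z\<in>pts QQ. bproj QQ Z \<in> U}, \<psi>)"
  using \<psi>_gcoords gcoords_iff_graded_coords[OF QP] by simp
 show "graded_coords M E ({V\<in>pts E. bproj E V \<in> U}, \<lambda>V. \<psi> (inv_into (pts QQ) \<Psi> V))"
  using \<psi>E_gcoords gcoords_iff_graded_coords[OF EP] by simp
 fix f assume fp: "f \<in> pts FF"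
 obtain X v where f: "f = (X, v)" by (cases f)
 show "case f of (X, v) \<Rightarrow> bproj AA X \<in> U \<longrightarrow>
   (\<forall>a\<in>I0. \<psi> (RR `` {(X, v)}) a = \<xi> (bproj AA X) a) \<and>
   (\<forall>i\<in>I1. \<psi> (RR `` {(X, v)}) i = coframe A I1 e (base_pt X) i) \<and>
   (\<forall>\<mu>\<in>I2. \<psi> (RR `` {(X, v)}) \<mu> =
    coframe C I2 c v \<mu> + (\<Sum>i\<in>I1. Qm \<mu> i (bproj AA X) * coframe_dot A I1 e X i))"
  unfolding f prod.case using \<psi>_apply[OF fp[unfolded f]] by (intro impI conjI ballI)
qed (rule \<psi>E_\<Theta>; assumption)+

end

end

theorem lemma3p6:
 fixes M :: "('m, 'b) mfd"
  and E :: "('e, 'i, 'm) gbundle"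
  and \<kappa> :: "((real \<Rightarrow> 'e set) set \<times> (real \<Rightarrow> 'e) set) set"
  and sharp :: "'e \<Rightarrow> (real \<Rightarrow> 'm) set"
  and \<Theta> :: "(real \<Rightarrow> 'e set) set \<Rightarrow> 'e"
 assumes "skew_higher_algebroid 2 M E \<kappa> sharp"
  and "canonical_Theta M E \<kappa> sharp \<Theta>"
 shows "let A = reduct 1 E;
       C = core 2 E;
       A2 = second_prolongation M A (reduced_anchor M sharp);
       bd = (\<lambda>v. \<Theta> (vlift A v));
       F = fibre_prod A2 (reweight 2 C);
       R = graph_rel A A2 C bd;
       q = (\<lambda>f. R `` {f});
       Q = quotient_bundle M F R (idx E) (\<lambda>i. if wt E i = 2 then Inr i else Inl (i, 0));
       I0 = {i\<in>idx E. wt E i = 0};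
       I1 = {i\<in>idx E. wt E i = 1};
       I2 = {i\<in>idx E. wt E i = 2}
     in equiv (pts F) R \<and> graded_bundle 2 M Q \<and>
      (\<exists>\<Psi>.
       gb_isomorphism Q E \<Psi> \<and> over_id Q E \<Psi> \<and>
       (\<forall>(X, c)\<in>pts F. \<Psi> (q (X, c)) = dotplus 2 E (\<Theta> X) c) \<and>
       (\<forall>X\<in>pts A2. \<Psi> (q (X, zero_vec C (bproj A2 X))) = \<Theta> X) \<and>
       (\<forall>U \<xi> e c.
         coord_sys M I0 (U, \<xi>) \<longrightarrow> local_frame M A I1 U e \<longrightarrow> local_frame M C I2 U c \<longrightarrow>
         (\<exists>\<psi>.
          let Qm = (\<lambda>\<mu> i p. coframe C I2 c (bd (e i p)) \<mu>);
            \<psi>E = (\<lambda>V. \<psi> (inv_into (pts Q) \<Psi> V))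
          in graded_coords M Q ({Z\<in>pts Q. bproj Q Z \<in> U}, \<psi>) \<and>
            (\<forall>(X, v)\<in>pts F. bproj A2 X \<in> U \<longrightarrow>
             (\<forall>a\<in>I0. \<psi> (q (X, v)) a = \<xi> (bproj A2 X) a) \<and>
             (\<forall>i\<in>I1. \<psi> (q (X, v)) i = coframe A I1 e (base_pt X) i) \<and>
             (\<forall>\<mu>\<in>I2. \<psi> (q (X, v)) \<mu> =
               coframe C I2 c v \<mu> + (\<Sum>i\<in>I1. Qm \<mu> i (bproj A2 X) * coframe_dot A I1 e X i))) \<and>
            graded_coords M E ({V\<in>pts E. bproj E V \<in> U}, \<psi>E) \<and>
            (\<forall>X\<in>pts A2. bproj A2 X \<in> U \<longrightarrow>
             (\<forall>a\<in>I0. \<psi>E (\<Theta> X) a = \<xi> (bproj A2 X) a) \<and>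
             (\<forall>i\<in>I1. \<psi>E (\<Theta> X) i = coframe A I1 e (base_pt X) i) \<and>
             (\<forall>\<mu>\<in>I2. \<psi>E (\<Theta> X) \<mu> =
               (\<Sum>i\<in>I1. Qm \<mu> i (bproj A2 X) * coframe_dot A I1 e X i))))))"
proof -
 let ?A = "reduct 1 E" and ?an = "reduced_anchor M sharp" and ?C = "core 2 E"
 let ?A2 = "second_prolongation M ?A ?an" and ?lab = "\<lambda>i. if wt E i = 2 then Inr i else Inl (i, 0 :: nat)"
 let ?R = "graph_rel ?A ?A2 ?C (\<lambda>v. \<Theta> (vlift ?A v))"
 have h: "graded_bundle 2 M E" "algebroid M ?A (reduced_kappa E \<kappa>) ?an"
  using assms(1) by (simp_all add: skew_higher_algebroid_def higher_algebroid_def)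
 have A: "graded_bundle 1 M ?A" "gb_morphism ?A (Tan 1 M) ?an" "over_id ?A (Tan 1 M) ?an"
  using h(2) by (simp_all add: algebroid_def graded_comorphism_def)
 have T: "gb_morphism (second_prolongation M ?A ?an) E \<Theta>" "over_id (second_prolongation M ?A ?an) E \<Theta>"
  "\<And>X. X \<in> pts (second_prolongation M ?A ?an) \<Longrightarrow> red 1 E (\<Theta> X) = base_pt X"
  using assms(2) unfolding canonical_Theta_def Let_def by simp_all
 note pres = h(1) A T
 show ?thesis
  unfolding Let_def
 proof (intro conjI exI[of _ "\<Psi> E \<Theta>"] allI impI)
  show "over_id (quotient_bundle M (fibre_prod ?A2 (reweight 2 ?C)) ?R (idx E) ?lab) E (\<Psi> E \<Theta>)"
   using \<Psi>_over(2)[OF pres] by (simp add: over_id_def)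
  show "\<forall>(X, c)\<in>pts (fibre_prod ?A2 (reweight 2 ?C)). \<Psi> E \<Theta> (?R `` {(X, c)}) = dotplus 2 E (\<Theta> X) c"
   using \<Psi>_class[OF pres] by (auto simp: \<Psi>0_def[OF pres])
  show "\<forall>X\<in>pts ?A2. \<Psi> E \<Theta> (?R `` {(X, zero_vec ?C (bproj ?A2 X))}) = \<Theta> X"
   using \<Psi>_class[OF pres zero_over(1)[OF pres]] \<Psi>0_zero[OF pres] by simp
 qed (rule RR_equiv[OF pres] Q_graded[OF pres] \<Psi>_iso[OF pres] frame_coordinates[OF pres]; assumption)+
qed

end
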